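(* Let $\mathcal{A}$ be an essentially small additive category and $K$ an algebraically closed field. Let $F$ be a functor of finite length in $\mathcal{F}^{\mathrm{df}}(\mathcal{A};K)$. Then there exists a bifunctor $B$ in $\mathcal{F}^{\mathrm{df}}(\mathcal{A}\times\mathcal{A};K)$, unique up to isomorphism, which is polynomial with respect to the first variable and antipolynomial with respect to the second variable, such that $F$ is isomorphic to the composite of $B$ with the diagonal functor $\mathcal{A}\to\mathcal{A}\times\mathcal{A}$.
   Context: For an essentially small category $\mathcal{C}$, $\mathcal{F}(\mathcal{C};K)$ is the abelian category of all functors from $\mathcal{C}$ to $K$-vector spaces (morphisms are natural transformations), and $\mathcal{F}^{\mathrm{df}}(\mathcal{C};K)$ is its full subcategory of functors all of whose values are finite-dimensional over $K$. Polynomial functions: for abelian groups $U,V$ and a map $f:U\to V$, the $d$-th deviation is $\delta_d(f)(u_1,\dots,u_d)=\sum_{I\subset\{1,\dots,d\}}(-1)^{d-|I|}f(\sum_{i\in I}u_i)$; $f$ is polynomial of degree at most $d$ if $\delta_{d+1}(f)=0$. A functor $F$ in $\mathcal{F}(\mathcal{A};K)$ is polynomial if there is an integer $d\ge 0$ such that for all objects $x,y$ the map $\mathcal{A}(x,y)\to\mathrm{Hom}_K(F(x),F(y))$ induced by $F$ is polynomial of degree at most $d$. An essentially small additive category $\mathcal{B}$ is $K$-trivial if for all objects $x,y$ the abelian group $\mathcal{B}(x,y)$ is finite and $K\otimes_{\mathbb{Z}}\mathcal{B}(x,y)=0$. A functor in $\mathcal{F}(\mathcal{A};K)$ is antipolynomial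 if it is isomorphic to $G\circ\pi$ for some additive functor $\pi:\mathcal{A}\to\mathcal{B}$ with $\mathcal{B}$ a $K$-trivial category and some $G$ in $\mathcal{F}(\mathcal{B};K)$. A bifunctor $B$ is polynomial (resp. antipolynomial) with respect to a variable if for every value of the other variable the resulting functor in that variable is polynomial (resp. antipolynomial). *)

theory Defs
  imports
    "HOL-Algebra.Algebraic_Closure"
    "HOL-Algebra.Free_Abelian_Groups"
    "HOL-Algebra.Elementary_Groups"
    "Jordan_Normal_Form.Missing_VectorSpace"
begin

section \<open>Categories and additive categories\<close>

text \<open>Hom-sets, identities and composites are indexed by objects, so hom-sets of different pairs
  of objects need not be disjoint. \<open>Comp C x y z g f\<close> is the composite of \<open>f : x \<rightarrow> y\<close> and
  \<open>g : y \<rightarrow> z\<close>. Objects and morphisms live in HOL types, so every category here is small.\<close>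

record ('o, 'm) category_data =
  Obj :: "'o set"
  Hom :: "'o \<Rightarrow> 'o \<Rightarrow> 'm set"
  Id :: "'o \<Rightarrow> 'm"
  Comp :: "'o \<Rightarrow> 'o \<Rightarrow> 'o \<Rightarrow> 'm \<Rightarrow> 'm \<Rightarrow> 'm"

locale category =
  fixes C :: "('o, 'm, 'e) category_data_scheme"
  assumes Id_closed: "x \<in> Obj C \<Longrightarrow> Id C x \<in> Hom C x x"
    and Comp_closed:
      "\<lbrakk>x \<in> Obj C; y \<in> Obj C; z \<in> Obj C; f \<in> Hom C x y; g \<in> Hom C y z\<rbrakk>
        \<Longrightarrow> Comp C x y z g f \<in> Hom C x z"
    and Comp_Id_left:
      "\<lbrakk>x \<in> Obj C; y \<in> Obj C; f \<in> Hom C x y\<rbrakk> \<Longrightarrow> Comp C x y y (Id C y) f = f"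
    and Comp_Id_right:
      "\<lbrakk>x \<in> Obj C; y \<in> Obj C; f \<in> Hom C x y\<rbrakk> \<Longrightarrow> Comp C x x y f (Id C x) = f"
    and Comp_assoc:
      "\<lbrakk>w \<in> Obj C; x \<in> Obj C; y \<in> Obj C; z \<in> Obj C;
        f \<in> Hom C w x; g \<in> Hom C x y; h \<in> Hom C y z\<rbrakk>
        \<Longrightarrow> Comp C w y z h (Comp C w x y g f) = Comp C w x z (Comp C x y z h g) f"

record ('o, 'm) preadditive_data = "('o, 'm) category_data" +
  hom_add :: "'o \<Rightarrow> 'o \<Rightarrow> 'm \<Rightarrow> 'm \<Rightarrow> 'm"
  hom_zero :: "'o \<Rightarrow> 'o \<Rightarrow> 'm"

text \<open>Abelian groups are commutative groups in the sense of HOL-Algebra, hence written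
  multiplicatively.\<close>

definition hom_group :: "('o, 'm, 'e) preadditive_data_scheme \<Rightarrow> 'o \<Rightarrow> 'o \<Rightarrow> 'm monoid" where
  "hom_group C x y = \<lparr>carrier = Hom C x y, monoid.mult = hom_add C x y, one = hom_zero C x y\<rparr>"

locale preadditive_category = category C
  for C :: "('o, 'm, 'e) preadditive_data_scheme" +
  assumes hom_comm_group: "\<lbrakk>x \<in> Obj C; y \<in> Obj C\<rbrakk> \<Longrightarrow> comm_group (hom_group C x y)"
    and Comp_add_left:
      "\<lbrakk>x \<in> Obj C; y \<in> Obj C; z \<in> Obj C; f \<in> Hom C x y; g \<in> Hom C y z; h \<in> Hom C y z\<rbrakk>
        \<Longrightarrow> Comp C x y z (hom_add C y z g h) f
          = hom_add C x z (Comp C x y z g f) (Comp C x y z h f)"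
    and Comp_add_right:
      "\<lbrakk>x \<in> Obj C; y \<in> Obj C; z \<in> Obj C; f \<in> Hom C x y; g \<in> Hom C x y; h \<in> Hom C y z\<rbrakk>
        \<Longrightarrow> Comp C x y z h (hom_add C x y f g)
          = hom_add C x z (Comp C x y z h f) (Comp C x y z h g)"

definition zero_object :: "('o, 'm, 'e) category_data_scheme \<Rightarrow> 'o \<Rightarrow> bool" where
  "zero_object C z \<longleftrightarrow>
    z \<in> Obj C \<and> (\<forall>x\<in>Obj C. (\<exists>!f. f \<in> Hom C x z) \<and> (\<exists>!f. f \<in> Hom C z x))"

definition biproduct ::
    "('o, 'm, 'e) preadditive_data_scheme \<Rightarrow> 'o \<Rightarrow> 'o \<Rightarrow> 'o \<Rightarrow> 'm \<Rightarrow> 'm \<Rightarrow> 'm \<Rightarrow> 'm \<Rightarrow> bool" where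
  "biproduct C x y s i j p q \<longleftrightarrow>
    s \<in> Obj C \<and> i \<in> Hom C x s \<and> j \<in> Hom C y s \<and> p \<in> Hom C s x \<and> q \<in> Hom C s y \<and>
    Comp C x s x p i = Id C x \<and> Comp C y s y q j = Id C y \<and>
    Comp C y s x p j = hom_zero C y x \<and> Comp C x s y q i = hom_zero C x y \<and>
    hom_add C s s (Comp C s x s i p) (Comp C s y s j q) = Id C s"

locale additive_category = preadditive_category C
  for C :: "('o, 'm, 'e) preadditive_data_scheme" +
  assumes ex_zero_object: "\<exists>z. zero_object C z"
    and ex_biproduct: "\<lbrakk>x \<in> Obj C; y \<in> Obj C\<rbrakk> \<Longrightarrow> \<exists>s i j p q. biproduct C x y s i j p q"

definition prod_category ::
    "('o, 'm, 'e) category_data_scheme \<Rightarrow> ('p, 'n, 'f) category_data_scheme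
      \<Rightarrow> ('o \<times> 'p, 'm \<times> 'n) category_data" where
  "prod_category C D = \<lparr>
    Obj = Obj C \<times> Obj D,
    Hom = (\<lambda>x y. Hom C (fst x) (fst y) \<times> Hom D (snd x) (snd y)),
    Id = (\<lambda>x. (Id C (fst x), Id D (snd x))),
    Comp = (\<lambda>x y z g f. (Comp C (fst x) (fst y) (fst z) (fst g) (fst f),
                         Comp D (snd x) (snd y) (snd z) (snd g) (snd f)))\<rparr>"


section \<open>Functors\<close>

record ('o, 'm, 'p, 'n) functor_data =
  fobj :: "'o \<Rightarrow> 'p"
  farr :: "'o \<Rightarrow> 'o \<Rightarrow> 'm \<Rightarrow> 'n"

locale functor_between = C: category C + D: category D
  for C :: "('o, 'm, 'e) category_data_scheme"
    and D :: "('p, 'n, 'f) category_data_scheme" +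
  fixes F :: "('o, 'm, 'p, 'n) functor_data"
  assumes fobj_closed: "x \<in> Obj C \<Longrightarrow> fobj F x \<in> Obj D"
    and farr_closed:
      "\<lbrakk>x \<in> Obj C; y \<in> Obj C; f \<in> Hom C x y\<rbrakk> \<Longrightarrow> farr F x y f \<in> Hom D (fobj F x) (fobj F y)"
    and farr_Id: "x \<in> Obj C \<Longrightarrow> farr F x x (Id C x) = Id D (fobj F x)"
    and farr_Comp:
      "\<lbrakk>x \<in> Obj C; y \<in> Obj C; z \<in> Obj C; f \<in> Hom C x y; g \<in> Hom C y z\<rbrakk>
        \<Longrightarrow> farr F x z (Comp C x y z g f)
          = Comp D (fobj F x) (fobj F y) (fobj F z) (farr F y z g) (farr F x y f)"

locale additive_functor = functor_between C D F
  for C :: "('o, 'm, 'e) preadditive_data_scheme"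
    and D :: "('p, 'n, 'f) preadditive_data_scheme"
    and F :: "('o, 'm, 'p, 'n) functor_data" +
  assumes farr_hom:
    "\<lbrakk>x \<in> Obj C; y \<in> Obj C\<rbrakk>
      \<Longrightarrow> farr F x y \<in> hom (hom_group C x y) (hom_group D (fobj F x) (fobj F y))"

definition comp_functor ::
    "('p, 'n, 'q, 'l) functor_data \<Rightarrow> ('o, 'm, 'p, 'n) functor_data
      \<Rightarrow> ('o, 'm, 'q, 'l) functor_data" where
  "comp_functor G F = \<lparr>
    fobj = (\<lambda>x. fobj G (fobj F x)),
    farr = (\<lambda>x y f. farr G (fobj F x) (fobj F y) (farr F x y f))\<rparr>"

definition diagonal_functor :: "('o, 'm, 'o \<times> 'o, 'm \<times> 'm) functor_data" where
  "diagonal_functor = \<lparr>fobj = (\<lambda>x. (x, x)), farr = (\<lambda>x y f. (f, f))\<rparr>"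

text \<open>The functors \<open>B(-, y)\<close> and \<open>B(x, -)\<close> obtained from a bifunctor \<open>B\<close> on \<open>C \<times> D\<close>.\<close>

definition fix_second ::
    "('p, 'n, 'f) category_data_scheme \<Rightarrow> ('o \<times> 'p, 'm \<times> 'n, 'q, 'l) functor_data \<Rightarrow> 'p
      \<Rightarrow> ('o, 'm, 'q, 'l) functor_data" where
  "fix_second D B y = \<lparr>
    fobj = (\<lambda>x. fobj B (x, y)),
    farr = (\<lambda>x x' f. farr B (x, y) (x', y) (f, Id D y))\<rparr>"

definition fix_first ::
    "('o, 'm, 'e) category_data_scheme \<Rightarrow> ('o \<times> 'p, 'm \<times> 'n, 'q, 'l) functor_data \<Rightarrow> 'o
      \<Rightarrow> ('p, 'n, 'q, 'l) functor_data" where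
  "fix_first C B x = \<lparr>
    fobj = (\<lambda>y. fobj B (x, y)),
    farr = (\<lambda>y y' g. farr B (x, y) (x, y') (Id C x, g))\<rparr>"

definition natural_transformation ::
    "('o, 'm, 'e) category_data_scheme \<Rightarrow> ('p, 'n, 'f) category_data_scheme
      \<Rightarrow> ('o, 'm, 'p, 'n) functor_data \<Rightarrow> ('o, 'm, 'p, 'n) functor_data \<Rightarrow> ('o \<Rightarrow> 'n) \<Rightarrow> bool" where
  "natural_transformation C D F G \<eta> \<longleftrightarrow>
    (\<forall>x\<in>Obj C. \<eta> x \<in> Hom D (fobj F x) (fobj G x)) \<and>
    (\<forall>x\<in>Obj C. \<forall>y\<in>Obj C. \<forall>f\<in>Hom C x y.
      Comp D (fobj F x) (fobj F y) (fobj G y) (\<eta> y) (farr F x y f)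
      = Comp D (fobj F x) (fobj G x) (fobj G y) (farr G x y f) (\<eta> x))"

definition isomorphic_functors ::
    "('o, 'm, 'e) category_data_scheme \<Rightarrow> ('p, 'n, 'f) category_data_scheme
      \<Rightarrow> ('o, 'm, 'p, 'n) functor_data \<Rightarrow> ('o, 'm, 'p, 'n) functor_data \<Rightarrow> bool" where
  "isomorphic_functors C D F G \<longleftrightarrow>
    (\<exists>\<eta> \<theta>. natural_transformation C D F G \<eta> \<and> natural_transformation C D G F \<theta> \<and>
      (\<forall>x\<in>Obj C.
        Comp D (fobj F x) (fobj G x) (fobj F x) (\<theta> x) (\<eta> x) = Id D (fobj F x) \<and>
        Comp D (fobj G x) (fobj F x) (fobj G x) (\<eta> x) (\<theta> x) = Id D (fobj G x)))"


section \<open>Functors with values in vector spaces\<close>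

text \<open>\<open>Vect K\<close> is the category of the \<open>K\<close>-vector spaces with carrier in a type \<open>'v\<close>, which
  plays the role of the universe. A bifunctor \<open>B\<close> with \<open>B \<circ> \<Delta>\<close> isomorphic to \<open>F\<close> needs no larger
  universe than \<open>F\<close>, since \<open>B(x, y)\<close> is a direct summand of \<open>B(x \<oplus> y, x \<oplus> y)\<close>. Linear maps are made extensional (\<open>undefined\<close> outside the domain),
  so that equality of morphisms is equality of linear maps.\<close>

definition Vect :: "'k ring \<Rightarrow> (('k, 'v) module, 'v \<Rightarrow> 'v) preadditive_data" where
  "Vect K = \<lparr>
    Obj = {V. vectorspace K V},
    Hom = (\<lambda>V W. module_hom K V W \<inter> extensional (carrier V)),
    Id = (\<lambda>V. \<lambda>v\<in>carrier V. v),
    Comp = (\<lambda>U V W g f. compose (carrier U) g f),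
    hom_add = (\<lambda>V W f g. \<lambda>v\<in>carrier V. f v \<oplus>\<^bsub>W\<^esub> g v),
    hom_zero = (\<lambda>V W. \<lambda>v\<in>carrier V. \<zero>\<^bsub>W\<^esub>)\<rparr>"

type_synonym ('o, 'm, 'k, 'v) vfunctor = "('o, 'm, ('k, 'v) module, 'v \<Rightarrow> 'v) functor_data"

definition df_functor ::
    "'k ring \<Rightarrow> ('o, 'm, 'e) category_data_scheme \<Rightarrow> ('o, 'm, 'k, 'v) vfunctor \<Rightarrow> bool" where
  "df_functor K C F \<longleftrightarrow>
    functor_between C (Vect K) F \<and> (\<forall>x\<in>Obj C. vectorspace.fin_dim K (fobj F x))"


section \<open>Functors of finite length\<close>

definition subfunctor ::
    "'k ring \<Rightarrow> ('o, 'm, 'e) category_data_scheme \<Rightarrow> ('o, 'm, 'k, 'v) vfunctor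
      \<Rightarrow> ('o \<Rightarrow> 'v set) \<Rightarrow> bool" where
  "subfunctor K C F S \<longleftrightarrow>
    (\<forall>x\<in>Obj C. subspace K (S x) (fobj F x)) \<and>
    (\<forall>x\<in>Obj C. \<forall>y\<in>Obj C. \<forall>f\<in>Hom C x y. farr F x y f ` S x \<subseteq> S y)"

definition restrict_functor ::
    "('o, 'm, 'k, 'v) vfunctor \<Rightarrow> ('o \<Rightarrow> 'v set) \<Rightarrow> ('o, 'm, 'k, 'v) vfunctor" where
  "restrict_functor F S = \<lparr>
    fobj = (\<lambda>x. (fobj F x)\<lparr>carrier := S x\<rparr>),
    farr = (\<lambda>x y f. restrict (farr F x y f) (S x))\<rparr>"

text \<open>The fields \<open>mult\<close> and \<open>one\<close> of a module record are irrelevant.\<close>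

definition quotient_space :: "('k, 'v) module \<Rightarrow> 'v set \<Rightarrow> ('k, 'v set) module" where
  "quotient_space V W = \<lparr>
    carrier = a_rcosets\<^bsub>V\<^esub> W,
    monoid.mult = (\<lambda>P Q. W),
    one = W,
    ring.zero = W,
    ring.add = (\<lambda>P Q. P <+>\<^bsub>V\<^esub> Q),
    smult = (\<lambda>a P. \<Union>v\<in>P. W +>\<^bsub>V\<^esub> (a \<odot>\<^bsub>V\<^esub> v))\<rparr>"

definition quotient_functor ::
    "('o, 'm, 'k, 'v) vfunctor \<Rightarrow> ('o \<Rightarrow> 'v set) \<Rightarrow> ('o, 'm, 'k, 'v set) vfunctor" where
  "quotient_functor F S = \<lparr>
    fobj = (\<lambda>x. quotient_space (fobj F x) (S x)),
    farr = (\<lambda>x y f. \<lambda>P\<in>a_rcosets\<^bsub>fobj F x\<^esub> (S x).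
      \<Union>v\<in>P. S y +>\<^bsub>fobj F y\<^esub> farr F x y f v)\<rparr>"

definition simple_functor ::
    "'k ring \<Rightarrow> ('o, 'm, 'e) category_data_scheme \<Rightarrow> ('o, 'm, 'k, 'v) vfunctor \<Rightarrow> bool" where
  "simple_functor K C F \<longleftrightarrow>
    functor_between C (Vect K) F \<and>
    (\<exists>x\<in>Obj C. carrier (fobj F x) \<noteq> {\<zero>\<^bsub>fobj F x\<^esub>}) \<and>
    (\<forall>S. subfunctor K C F S \<longrightarrow>
      (\<forall>x\<in>Obj C. S x = {\<zero>\<^bsub>fobj F x\<^esub>}) \<or> (\<forall>x\<in>Obj C. S x = carrier (fobj F x)))"

definition finite_length ::
    "'k ring \<Rightarrow> ('o, 'm, 'e) category_data_scheme \<Rightarrow> ('o, 'm, 'k, 'v) vfunctor \<Rightarrow> bool" where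
  "finite_length K C F \<longleftrightarrow>
    functor_between C (Vect K) F \<and>
    (\<exists>(n::nat) S.
      (\<forall>i\<le>n. subfunctor K C F (S i)) \<and>
      (\<forall>x\<in>Obj C. S 0 x = {\<zero>\<^bsub>fobj F x\<^esub>}) \<and>
      (\<forall>x\<in>Obj C. S n x = carrier (fobj F x)) \<and>
      (\<forall>i<n. (\<forall>x\<in>Obj C. S i x \<subseteq> S (Suc i) x) \<and>
        simple_functor K C (quotient_functor (restrict_functor F (S (Suc i))) (S i))))"


section \<open>Polynomial functors\<close>

definition deviation ::
    "('a, 'e) monoid_scheme \<Rightarrow> ('b, 'f) monoid_scheme \<Rightarrow> nat \<Rightarrow> ('a \<Rightarrow> 'b) \<Rightarrow> (nat \<Rightarrow> 'a) \<Rightarrow> 'b" where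
  "deviation U V d f u =
    (\<Otimes>\<^bsub>V\<^esub>I\<in>Pow {1..d}. f (\<Otimes>\<^bsub>U\<^esub>i\<in>I. u i) [^]\<^bsub>V\<^esub> ((- 1 :: int) ^ (d - card I)))"

definition polynomial_map ::
    "('a, 'e) monoid_scheme \<Rightarrow> ('b, 'f) monoid_scheme \<Rightarrow> nat \<Rightarrow> ('a \<Rightarrow> 'b) \<Rightarrow> bool" where
  "polynomial_map U V d f \<longleftrightarrow>
    (\<forall>u\<in>{1..d + 1} \<rightarrow> carrier U. deviation U V (d + 1) f u = \<one>\<^bsub>V\<^esub>)"

definition polynomial_functor ::
    "'k ring \<Rightarrow> ('o, 'm, 'e) preadditive_data_scheme \<Rightarrow> ('o, 'm, 'k, 'v) vfunctor \<Rightarrow> bool" where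
  "polynomial_functor K A F \<longleftrightarrow>
    functor_between A (Vect K) F \<and>
    (\<exists>d. \<forall>x\<in>Obj A. \<forall>y\<in>Obj A.
      polynomial_map (hom_group A x y) (hom_group (Vect K) (fobj F x) (fobj F y)) d (farr F x y))"


section \<open>Antipolynomial functors\<close>

text \<open>The tensor product over the integers of two (multiplicatively written) abelian groups.\<close>

definition tensor_relations ::
    "('a, 'e) monoid_scheme \<Rightarrow> ('b, 'f) monoid_scheme \<Rightarrow> (('a \<times> 'b) \<Rightarrow>\<^sub>0 int) set" where
  "tensor_relations G H =
    {frag_of (a \<otimes>\<^bsub>G\<^esub> a', b) - (frag_of (a, b) + frag_of (a', b)) | a a' b.
      a \<in> carrier G \<and> a' \<in> carrier G \<and> b \<in> carrier H} \<union>
    {frag_of (a, b \<otimes>\<^bsub>H\<^esub> b') - (frag_of (a, b) + frag_of (a, b')) | a b b'.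
      a \<in> carrier G \<and> b \<in> carrier H \<and> b' \<in> carrier H}"

definition tensor_group ::
    "('a, 'e) monoid_scheme \<Rightarrow> ('b, 'f) monoid_scheme \<Rightarrow> (('a \<times> 'b) \<Rightarrow>\<^sub>0 int) set monoid" where
  "tensor_group G H =
    free_Abelian_group (carrier G \<times> carrier H) Mod
      generate (free_Abelian_group (carrier G \<times> carrier H)) (tensor_relations G H)"

definition K_trivial :: "'k ring \<Rightarrow> ('p, 'n, 'f) preadditive_data_scheme \<Rightarrow> bool" where
  "K_trivial K B \<longleftrightarrow>
    additive_category B \<and>
    (\<forall>x\<in>Obj B. \<forall>y\<in>Obj B.
      finite (Hom B x y) \<and> trivial_group (tensor_group (add_monoid K) (hom_group B x y)))"

text \<open>A quantifier inside a HOL definition ranges over fixed types, here \<open>'o\<close> for the objects and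
  \<open>nat\<close> for the morphisms of the \<open>K\<close>-trivial category. This is no restriction: replace an arbitrary
  \<open>B\<close> by the full image of \<open>\<pi>\<close>, whose objects are those of \<open>A\<close> and whose hom-sets are finite.
  The lemma \<open>antipolynomial_functorI\<close> below proves this.\<close>

definition antipolynomial_functor ::
    "'k ring \<Rightarrow> ('o, 'm, 'e) preadditive_data_scheme \<Rightarrow> ('o, 'm, 'k, 'v) vfunctor \<Rightarrow> bool" where
  "antipolynomial_functor K A F \<longleftrightarrow>
    functor_between A (Vect K) F \<and>
    (\<exists>(B :: ('o, nat) preadditive_data) \<pi> (G :: ('o, nat, 'k, 'v) vfunctor).
      K_trivial K B \<and> additive_functor A B \<pi> \<and> functor_between B (Vect K) G \<and>
      isomorphic_functors A (Vect K) F (comp_functor G \<pi>))"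


definition bifunctor_decomposition ::
    "'k ring \<Rightarrow> ('o, 'm, 'e) preadditive_data_scheme \<Rightarrow> ('o, 'm, 'k, 'v) vfunctor
      \<Rightarrow> ('o \<times> 'o, 'm \<times> 'm, 'k, 'v) vfunctor \<Rightarrow> bool" where
  "bifunctor_decomposition K A F B \<longleftrightarrow>
    df_functor K (prod_category A A) B \<and>
    (\<forall>y\<in>Obj A. polynomial_functor K A (fix_second A B y)) \<and>
    (\<forall>x\<in>Obj A. antipolynomial_functor K A (fix_first A B x)) \<and>
    isomorphic_functors A (Vect K) F (comp_functor B diagonal_functor)"


section \<open>Antipolynomiality does not depend on the types chosen in its definition\<close>

lemma trivial_tensor_group_iff:
  assumes "group G" "group H"
  shows "trivial_group (tensor_group G H) \<longleftrightarrow>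
    carrier (free_Abelian_group (carrier G \<times> carrier H))
      \<subseteq> generate (free_Abelian_group (carrier G \<times> carrier H)) (tensor_relations G H)"
proof -
  interpret G: group G by fact
  interpret H: group H by fact
  define M where "M = free_Abelian_group (carrier G \<times> carrier H)"
  define N where "N = generate M (tensor_relations G H)"
  interpret M: comm_group M unfolding M_def by (rule abelian_free_Abelian_group)
  have rels: "tensor_relations G H \<subseteq> carrier M"
    unfolding tensor_relations_def M_def
    by (auto dest!: subsetD[OF keys_diff] subsetD[OF keys_add] split: if_splits)
  have sub: "subgroup N M" unfolding N_def by (rule M.generate_is_subgroup[OF rels])
  then have "N \<lhd> M" by (rule M.subgroup_imp_normal)
  then have grp: "group (M Mod N)" by (rule normal.factorgroup_is_group)
  have "carrier (M Mod N) \<subseteq> {N} \<longleftrightarrow> carrier M \<subseteq> N"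
  proof
    assume *: "carrier (M Mod N) \<subseteq> {N}"
    show "carrier M \<subseteq> N"
    proof
      fix x assume x: "x \<in> carrier M"
      then have "N #>\<^bsub>M\<^esub> x = N" using * by (auto simp: FactGroup_def RCOSETS_def)
      then show "x \<in> N" using M.rcos_self[OF x sub] by simp
    qed
  next
    assume "carrier M \<subseteq> N"
    then show "carrier (M Mod N) \<subseteq> {N}"
      using M.coset_join2[OF _ sub] by (auto simp: FactGroup_def RCOSETS_def)
  qed
  then show ?thesis
    using group.trivial_group_subset[OF grp] by (simp add: tensor_group_def M_def N_def FactGroup_def)
qed

lemma trivial_tensor_group_iso:
  assumes G: "group G" and H: "group H" and H': "group H'" and h: "h \<in> iso H H'"
    and triv: "trivial_group (tensor_group G H)"
  shows "trivial_group (tensor_group G H')"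
proof -
  interpret G: group G by fact
  interpret H: group H by fact
  interpret H': group H' by fact
  let ?M = "free_Abelian_group (carrier G \<times> carrier H)"
  let ?M' = "free_Abelian_group (carrier G \<times> carrier H')"
  let ?N = "generate ?M (tensor_relations G H)"
  let ?N' = "generate ?M' (tensor_relations G H')"
  interpret M': comm_group ?M' by (rule abelian_free_Abelian_group)
  have hc: "h b \<in> carrier H'" if "b \<in> carrier H" for b
    using h that by (auto simp: iso_def hom_def)
  have hm: "h (b \<otimes>\<^bsub>H\<^esub> b') = h b \<otimes>\<^bsub>H'\<^esub> h b'" if "b \<in> carrier H" "b' \<in> carrier H" for b b'
    using h that by (auto simp: iso_def hom_def)
  have rels: "tensor_relations G H' \<subseteq> carrier ?M'"
    unfolding tensor_relations_def
    by (auto dest!: subsetD[OF keys_diff] subsetD[OF keys_add] split: if_splits)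
  have sub: "subgroup ?N' ?M'" by (rule M'.generate_is_subgroup[OF rels])
  have diff: "x - y \<in> ?N'" if "x \<in> ?N'" "y \<in> ?N'" for x y
  proof -
    have "Poly_Mapping.keys y \<subseteq> carrier G \<times> carrier H'"
      using subgroup.mem_carrier[OF sub that(2)] by simp
    then show ?thesis
      using subgroup.m_closed[OF sub that(1) subgroup.m_inv_closed[OF sub that(2)]] by simp
  qed
  have zero: "0 \<in> ?N'" using subgroup.one_closed[OF sub] by simp
  define \<phi> where "\<phi> = frag_extend (\<lambda>(a, b). frag_of (a, h b) :: ('a \<times> 'e) \<Rightarrow>\<^sub>0 int)"
  have [simp]: "\<phi> (frag_of (a, b)) = frag_of (a, h b)" for a b by (simp add: \<phi>_def)
  have [simp]: "\<phi> (x - y) = \<phi> x - \<phi> y" "\<phi> (x + y) = \<phi> x + \<phi> y" for x y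
    by (simp_all add: \<phi>_def frag_extend_diff frag_extend_add)
  have [simp]: "\<phi> 0 = 0" "\<phi> (- x) = - \<phi> x" for x by (simp_all add: \<phi>_def frag_extend_minus)
  have \<phi>rel: "\<phi> x \<in> tensor_relations G H'" if "x \<in> tensor_relations G H" for x
  proof -
    consider (l) a a' b where "a \<in> carrier G" "a' \<in> carrier G" "b \<in> carrier H"
        "x = frag_of (a \<otimes>\<^bsub>G\<^esub> a', b) - (frag_of (a, b) + frag_of (a', b))"
      | (r) a b b' where "a \<in> carrier G" "b \<in> carrier H" "b' \<in> carrier H"
        "x = frag_of (a, b \<otimes>\<^bsub>H\<^esub> b') - (frag_of (a, b) + frag_of (a, b'))"
      using \<open>x \<in> tensor_relations G H\<close> unfolding tensor_relations_def by blast
    then show ?thesis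
    proof cases
      case l
      then have "\<phi> x = frag_of (a \<otimes>\<^bsub>G\<^esub> a', h b) - (frag_of (a, h b) + frag_of (a', h b))"
        by simp
      then show ?thesis using l hc unfolding tensor_relations_def by blast
    next
      case r
      then have "\<phi> x = frag_of (a, h b \<otimes>\<^bsub>H'\<^esub> h b') - (frag_of (a, h b) + frag_of (a, h b'))"
        by (simp add: hm)
      then show ?thesis using r hc unfolding tensor_relations_def by blast
    qed
  qed
  have relsH: "tensor_relations G H \<subseteq> carrier ?M"
    unfolding tensor_relations_def
    by (auto dest!: subsetD[OF keys_diff] subsetD[OF keys_add] split: if_splits)
  have \<phi>N: "\<phi> x \<in> ?N'" if "x \<in> ?N" for x
    using that
  proof induction
    case one then show ?case using zero by simp
  next
    case (incl x) then show ?case by (intro generate.incl \<phi>rel)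
  next
    case (inv x)
    then have "x \<in> carrier ?M" using relsH by blast
    then have "Poly_Mapping.keys x \<subseteq> carrier G \<times> carrier H" by simp
    moreover have "\<phi> x \<in> ?N'" using inv by (intro generate.incl \<phi>rel)
    ultimately show ?case using diff[OF zero] by simp
  next
    case (eng x y) then show ?case using subgroup.m_closed[OF sub, of "\<phi> x" "\<phi> y"] by simp
  qed
  have "carrier ?M' \<subseteq> ?N'"
  proof
    fix x assume "x \<in> carrier ?M'"
    then have "Poly_Mapping.keys x \<subseteq> carrier G \<times> carrier H'" by simp
    then show "x \<in> ?N'"
    proof (rule free_Abelian_group_induct[where P = "\<lambda>x. x \<in> ?N'"])
      fix p assume "p \<in> carrier G \<times> carrier H'"
      then obtain a b' where p: "p = (a, b')" "a \<in> carrier G" "b' \<in> carrier H'" by auto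
      then obtain b where b: "b \<in> carrier H" "b' = h b"
        using h by (auto simp: iso_def bij_betw_def)
      have "frag_of (a, b) \<in> carrier ?M" using p b by simp
      then have "frag_of (a, b) \<in> ?N"
        using trivial_tensor_group_iff[OF G H] triv by blast
      from \<phi>N[OF this] show "frag_of p \<in> ?N'" using p b by simp
    qed (use zero diff in auto)
  qed
  then show ?thesis using trivial_tensor_group_iff[OF G H'] by blast
qed

lemma isomorphic_functors_cong:
  assumes "isomorphic_functors C D F G" "category C"
    and "\<And>x. x \<in> Obj C \<Longrightarrow> fobj G x = fobj G' x"
    and "\<And>x y f. \<lbrakk>x \<in> Obj C; y \<in> Obj C; f \<in> Hom C x y\<rbrakk> \<Longrightarrow> farr G x y f = farr G' x y f"
  shows "isomorphic_functors C D F G'"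
  using assms(1,3,4) unfolding isomorphic_functors_def natural_transformation_def
  by simp

lemma antipolynomial_functorI:
  fixes A :: "('o, 'm, 'e) preadditive_data_scheme"
    and B :: "('p, 'n) preadditive_data"
    and K :: "'k ring"
    and F :: "('o, 'm, 'k, 'v) vfunctor"
  assumes A: "additive_category A" and K: "field K"
    and F: "functor_between A (Vect K) F"
    and B: "K_trivial K B" and \<pi>: "additive_functor A B \<pi>"
    and G: "functor_between B (Vect K) G"
    and iso: "isomorphic_functors A (Vect K) F (comp_functor G \<pi>)"
  shows "antipolynomial_functor K A F"
proof -
  interpret A: additive_category A by fact
  interpret B: additive_category B using B by (simp add: K_trivial_def)
  interpret \<pi>: additive_functor A B \<pi> by fact
  interpret G: functor_between B "Vect K" G by fact
  interpret K: field K by fact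
  define H where "H x y = Hom B (fobj \<pi> x) (fobj \<pi> y)" for x y
  note ob = \<pi>.fobj_closed
  have fin: "finite (H x y)" if "x \<in> Obj A" "y \<in> Obj A" for x y
    using B that ob by (simp add: K_trivial_def H_def)
  define e where "e x y = (SOME e :: 'n \<Rightarrow> nat. inj_on e (H x y))" for x y
  have inj: "inj_on (e x y) (H x y)" if "x \<in> Obj A" "y \<in> Obj A" for x y
  proof -
    have "\<exists>e :: 'n \<Rightarrow> nat. inj_on e (H x y)"
      using finite_imp_inj_to_nat_seg[OF fin[OF that]] by blast
    then show ?thesis unfolding e_def by (rule someI_ex)
  qed
  define d where "d x y = inv_into (H x y) (e x y)" for x y
  have de: "d x y (e x y f) = f" if "x \<in> Obj A" "y \<in> Obj A" "f \<in> H x y" for x y f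
    using that inj by (simp add: d_def)
  define B' :: "('o, nat) preadditive_data" where "B' = \<lparr>
    Obj = Obj A, Hom = (\<lambda>x y. e x y ` H x y), Id = (\<lambda>x. e x x (Id B (fobj \<pi> x))),
    Comp = (\<lambda>x y z g f. e x z (Comp B (fobj \<pi> x) (fobj \<pi> y) (fobj \<pi> z) (d y z g) (d x y f))),
    hom_add = (\<lambda>x y f g. e x y (hom_add B (fobj \<pi> x) (fobj \<pi> y) (d x y f) (d x y g))),
    hom_zero = (\<lambda>x y. e x y (hom_zero B (fobj \<pi> x) (fobj \<pi> y)))\<rparr>"
  define \<pi>' :: "('o, 'm, 'o, nat) functor_data" where
    "\<pi>' = \<lparr>fobj = (\<lambda>x. x), farr = (\<lambda>x y f. e x y (farr \<pi> x y f))\<rparr>"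
  define G' :: "('o, nat, 'k, 'v) vfunctor" where
    "G' = \<lparr>fobj = (\<lambda>x. fobj G (fobj \<pi> x)),
      farr = (\<lambda>x y f. farr G (fobj \<pi> x) (fobj \<pi> y) (d x y f))\<rparr>"
  have hg: "comm_group (hom_group B (fobj \<pi> x) (fobj \<pi> y))" if "x \<in> Obj A" "y \<in> Obj A" for x y
    using that ob by (intro B.hom_comm_group)
  have H_add: "hom_add B (fobj \<pi> x) (fobj \<pi> y) f g \<in> H x y"
    if "x \<in> Obj A" "y \<in> Obj A" "f \<in> H x y" "g \<in> H x y" for x y f g
    using monoid.m_closed[OF comm_group.axioms(2)[OF hg, THEN group.is_monoid], of x y f g] that
    by (simp add: H_def hom_group_def)
  have H_zero: "hom_zero B (fobj \<pi> x) (fobj \<pi> y) \<in> H x y" if "x \<in> Obj A" "y \<in> Obj A" for x y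
    using monoid.one_closed[OF comm_group.axioms(2)[OF hg, THEN group.is_monoid], of x y] that
    by (simp add: H_def hom_group_def)
  have H_Id: "Id B (fobj \<pi> x) \<in> H x x" if "x \<in> Obj A" for x
    using that ob B.Id_closed by (simp add: H_def)
  have H_Comp: "Comp B (fobj \<pi> x) (fobj \<pi> y) (fobj \<pi> z) g f \<in> H x z"
    if "x \<in> Obj A" "y \<in> Obj A" "z \<in> Obj A" "f \<in> H x y" "g \<in> H y z" for x y z f g
    using that ob B.Comp_closed by (simp add: H_def)
  have H_\<pi>: "farr \<pi> x y f \<in> H x y" if "x \<in> Obj A" "y \<in> Obj A" "f \<in> Hom A x y" for x y f
    using that \<pi>.farr_closed by (simp add: H_def)
  have cat: "category B'"
    by standard
      (use ob in \<open>auto simp: B'_def de H_Id H_Comp, auto simp: H_def B.Comp_Id_left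
        B.Comp_Id_right B.Comp_assoc\<close>)
  have iso_e: "e x y \<in> iso (hom_group B (fobj \<pi> x) (fobj \<pi> y)) (hom_group B' x y)"
    if "x \<in> Obj A" "y \<in> Obj A" for x y
    using that inj by (auto simp: iso_def hom_def bij_betw_def hom_group_def B'_def H_def[symmetric] de)
  have hg': "comm_group (hom_group B' x y)" if "x \<in> Obj A" "y \<in> Obj A" for x y
  proof -
    interpret comm_group "hom_group B (fobj \<pi> x) (fobj \<pi> y)" by (rule hg) fact+
    have "comm_group (hom_group B' x y\<lparr>one := e x y \<one>\<^bsub>hom_group B (fobj \<pi> x) (fobj \<pi> y)\<^esub>\<rparr>)"
      by (rule iso_imp_img_comm_group[OF iso_e]) fact+
    then show ?thesis by (simp add: hom_group_def B'_def)
  qed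
  have preadd: "preadditive_category B'"
    by (intro preadditive_category.intro cat preadditive_category_axioms.intro)
      (use ob hg' in \<open>auto simp: B'_def de H_add H_Comp\<close>,
       use ob in \<open>auto simp: H_def B.Comp_add_left B.Comp_add_right\<close>)
  have \<pi>_zero: "farr \<pi> x y (hom_zero A x y) = hom_zero B (fobj \<pi> x) (fobj \<pi> y)"
    if "x \<in> Obj A" "y \<in> Obj A" for x y
    using hom_one[OF \<pi>.farr_hom comm_group.axioms(2)[OF A.hom_comm_group]
        comm_group.axioms(2)[OF hg]] that by (simp add: hom_group_def)
  have \<pi>_add: "farr \<pi> x y (hom_add A x y f g)
      = hom_add B (fobj \<pi> x) (fobj \<pi> y) (farr \<pi> x y f) (farr \<pi> x y g)"
    if "x \<in> Obj A" "y \<in> Obj A" "f \<in> Hom A x y" "g \<in> Hom A x y" for x y f g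
    using hom_mult[OF \<pi>.farr_hom, of x y f g] that by (simp add: hom_group_def)
  have cat_\<pi>': "functor_between A B' \<pi>'"
    by (intro functor_between.intro A.category_axioms cat functor_between_axioms.intro)
      (auto simp: \<pi>'_def B'_def H_\<pi> de \<pi>.farr_Id \<pi>.farr_Comp)
  have add_\<pi>': "additive_functor A B' \<pi>'"
    by (intro additive_functor.intro cat_\<pi>' additive_functor_axioms.intro)
      (auto simp: hom_def hom_group_def \<pi>'_def B'_def H_\<pi> de \<pi>_add)
  interpret B': preadditive_category B' by fact
  interpret \<pi>': additive_functor A B' \<pi>' by fact
  have \<pi>'_zero: "farr \<pi>' x y (hom_zero A x y) = hom_zero B' x y"
    if "x \<in> Obj A" "y \<in> Obj A" for x y
    using that \<pi>_zero by (simp add: \<pi>'_def B'_def)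
  have \<pi>'_add: "farr \<pi>' x y (hom_add A x y f g) = hom_add B' x y (farr \<pi>' x y f) (farr \<pi>' x y g)"
    if "x \<in> Obj A" "y \<in> Obj A" "f \<in> Hom A x y" "g \<in> Hom A x y" for x y f g
    using hom_mult[OF \<pi>'.farr_hom, of x y f g] that by (simp add: hom_group_def \<pi>'_def)
  have [simp]: "fobj \<pi>' x = x" "Obj B' = Obj A" for x by (simp_all add: \<pi>'_def B'_def)
  have add: "additive_category B'"
  proof (intro additive_category.intro preadd additive_category_axioms.intro)
    obtain z where z: "zero_object A z" using A.ex_zero_object by blast
    then have zA: "z \<in> Obj A" by (simp add: zero_object_def)
    have "hom_zero A z z \<in> Hom A z z"
      using monoid.one_closed[OF comm_group.axioms(2)[OF A.hom_comm_group, THEN group.is_monoid], of z z] zA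
      by (simp add: hom_group_def)
    then have "Id A z = hom_zero A z z"
      using z zA A.Id_closed[OF zA] unfolding zero_object_def by blast
    then have Idz: "Id B' z = hom_zero B' z z"
      using \<pi>'.farr_Id[OF zA] \<pi>'_zero[OF zA zA] by simp
    have zcl: "hom_zero B' x y \<in> Hom B' x y" if "x \<in> Obj A" "y \<in> Obj A" for x y
      using that H_zero by (simp add: B'_def)
    have grp: "group (hom_group B' x y)" if "x \<in> Obj A" "y \<in> Obj A" for x y
      using that B'.hom_comm_group by (simp add: comm_group_def)
    have idem: "f = hom_zero B' x y"
      if "x \<in> Obj A" "y \<in> Obj A" "f \<in> Hom B' x y" "hom_add B' x y f f = f" for x y f
      using group.l_cancel_one[OF grp[OF that(1,2)], of f f] that(3,4)
      by (simp add: hom_group_def)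
    have zz: "hom_add B' z z (hom_zero B' z z) (hom_zero B' z z) = hom_zero B' z z"
      using monoid.l_one[OF grp[THEN group.is_monoid], of z z "hom_zero B' z z"] zA zcl
      by (simp add: hom_group_def)
    have into: "f = hom_zero B' x z" if x: "x \<in> Obj A" and f: "f \<in> Hom B' x z" for x f
    proof (rule idem[OF x zA f])
      have "hom_add B' x z f f = Comp B' x z z (hom_add B' z z (Id B' z) (Id B' z)) f"
        using x f zA B'.Comp_add_left[of x z z f "Id B' z" "Id B' z"] B'.Id_closed
        by (simp add: B'.Comp_Id_left)
      also have "\<dots> = f" using zz Idz B'.Comp_Id_left[of x z f] x f zA by simp
      finally show "hom_add B' x z f f = f" .
    qed
    have out: "f = hom_zero B' z x" if x: "x \<in> Obj A" and f: "f \<in> Hom B' z x" for x f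
    proof (rule idem[OF zA x f])
      have "hom_add B' z x f f = Comp B' z z x f (hom_add B' z z (Id B' z) (Id B' z))"
        using x f zA B'.Comp_add_right[of z z x "Id B' z" "Id B' z" f] B'.Id_closed
        by (simp add: B'.Comp_Id_right)
      also have "\<dots> = f" using zz Idz B'.Comp_Id_right[of z x f] x f zA by simp
      finally show "hom_add B' z x f f = f" .
    qed
    have "zero_object B' z"
      unfolding zero_object_def
    proof (intro conjI ballI)
      fix x assume "x \<in> Obj B'"
      then have x: "x \<in> Obj A" by simp
      show "\<exists>!f. f \<in> Hom B' x z" by (rule ex1I, rule zcl[OF x zA], rule into[OF x])
      show "\<exists>!f. f \<in> Hom B' z x" by (rule ex1I, rule zcl[OF zA x], rule out[OF x])
    qed (use zA in simp)
    then show "\<exists>z. zero_object B' z" ..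
  next
    fix x y assume "x \<in> Obj B'" "y \<in> Obj B'"
    then have xy: "x \<in> Obj A" "y \<in> Obj A" by simp_all
    then obtain s i j p q where bi: "biproduct A x y s i j p q" using A.ex_biproduct by blast
    have s: "s \<in> Obj A" "i \<in> Hom A x s" "j \<in> Hom A y s" "p \<in> Hom A s x" "q \<in> Hom A s y"
      using bi by (simp_all add: biproduct_def)
    have "biproduct B' x y s (farr \<pi>' x s i) (farr \<pi>' y s j) (farr \<pi>' s x p) (farr \<pi>' s y q)"
      using bi xy s \<pi>'.farr_closed[of _ _] \<pi>'.farr_Comp[symmetric, simplified] \<pi>'.farr_Id[simplified]
        \<pi>'_zero \<pi>'_add[symmetric] A.Comp_closed
      unfolding biproduct_def by simp
    then show "\<exists>s i j p q. biproduct B' x y s i j p q" by blast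
  qed
  have triv: "K_trivial K B'"
    unfolding K_trivial_def
  proof (intro conjI ballI add)
    fix x y assume "x \<in> Obj B'" "y \<in> Obj B'"
    then have xy: "x \<in> Obj A" "y \<in> Obj A" by simp_all
    show "finite (Hom B' x y)" using fin[OF xy] by (simp add: B'_def)
    have "trivial_group (tensor_group (add_monoid K) (hom_group B (fobj \<pi> x) (fobj \<pi> y)))"
      using B xy ob by (simp add: K_trivial_def)
    then show "trivial_group (tensor_group (add_monoid K) (hom_group B' x y))"
      using trivial_tensor_group_iso[OF K.a_group comm_group.axioms(2)[OF hg]
          comm_group.axioms(2)[OF hg'] iso_e] xy by blast
  qed
  have G': "functor_between B' (Vect K) G'"
    by (intro functor_between.intro cat G.D.category_axioms functor_between_axioms.intro)
      (use ob in \<open>auto simp: G'_def B'_def de H_Id H_Comp\<close>,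
       use ob in \<open>auto simp: H_def G.fobj_closed G.farr_closed G.farr_Id
        G.farr_Comp\<close>)
  have "isomorphic_functors A (Vect K) F (comp_functor G' \<pi>')"
    using iso A.category_axioms
    by (rule isomorphic_functors_cong) (auto simp: comp_functor_def G'_def \<pi>'_def de H_\<pi>)
  with triv add_\<pi>' G' F show ?thesis
    unfolding antipolynomial_functor_def by blast
qed


section \<open>Well-definedness of the constructions\<close>

lemma Vect_simps [simp]:
  "Obj (Vect K) = {V. vectorspace K V}"
  "Hom (Vect K) V W = module_hom K V W \<inter> extensional (carrier V)"
  "Id (Vect K) V = (\<lambda>v\<in>carrier V. v)"
  "Comp (Vect K) U V W g f = compose (carrier U) g f"
  "hom_add (Vect K) V W f g = (\<lambda>v\<in>carrier V. f v \<oplus>\<^bsub>W\<^esub> g v)"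
  "hom_zero (Vect K) V W = (\<lambda>v\<in>carrier V. \<zero>\<^bsub>W\<^esub>)"
  by (simp_all add: Vect_def)

lemma vectorspace_closed:
  assumes "vectorspace K V"
  shows "\<lbrakk>v \<in> carrier V; w \<in> carrier V\<rbrakk> \<Longrightarrow> v \<oplus>\<^bsub>V\<^esub> w \<in> carrier V"
    and "\<lbrakk>a \<in> carrier K; v \<in> carrier V\<rbrakk> \<Longrightarrow> a \<odot>\<^bsub>V\<^esub> v \<in> carrier V"
    and "\<zero>\<^bsub>V\<^esub> \<in> carrier V"
proof -
  interpret V: vectorspace K V by fact
  show "\<lbrakk>v \<in> carrier V; w \<in> carrier V\<rbrakk> \<Longrightarrow> v \<oplus>\<^bsub>V\<^esub> w \<in> carrier V"
    and "\<lbrakk>a \<in> carrier K; v \<in> carrier V\<rbrakk> \<Longrightarrow> a \<odot>\<^bsub>V\<^esub> v \<in> carrier V"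
    and "\<zero>\<^bsub>V\<^esub> \<in> carrier V"
    by simp_all
qed

lemma category_Vect:
  fixes K :: "'k ring"
  shows "category (Vect K :: (('k, 'v) module, 'v \<Rightarrow> 'v) preadditive_data)"
proof
  fix V :: "('k, 'v) module" assume "V \<in> Obj (Vect K)"
  then show "Id (Vect K) V \<in> Hom (Vect K) V V"
    by (auto simp: module_hom_def vectorspace_closed)
next
  fix U V W :: "('k, 'v) module" and f g
  assume "U \<in> Obj (Vect K)" "V \<in> Obj (Vect K)" "W \<in> Obj (Vect K)"
    "f \<in> Hom (Vect K) U V" "g \<in> Hom (Vect K) V W"
  then show "Comp (Vect K) U V W g f \<in> Hom (Vect K) U W"
    by (auto simp: module_hom_def vectorspace_closed compose_def Pi_iff)
next
  fix V W :: "('k, 'v) module" and f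
  assume *: "V \<in> Obj (Vect K)" "W \<in> Obj (Vect K)" "f \<in> Hom (Vect K) V W"
  from * show "Comp (Vect K) V W W (Id (Vect K) W) f = f"
    by (auto simp: module_hom_def compose_def extensional_def fun_eq_iff)
  from * show "Comp (Vect K) V V W f (Id (Vect K) V) = f"
    by (auto simp: module_hom_def compose_def extensional_def fun_eq_iff)
next
  fix U V W T :: "('k, 'v) module" and f g h
  assume "U \<in> Obj (Vect K)" "V \<in> Obj (Vect K)" "W \<in> Obj (Vect K)" "T \<in> Obj (Vect K)"
    "f \<in> Hom (Vect K) U V" "g \<in> Hom (Vect K) V W" "h \<in> Hom (Vect K) W T"
  then show "Comp (Vect K) U W T h (Comp (Vect K) U V W g f)
      = Comp (Vect K) U V T (Comp (Vect K) V W T h g) f"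
    by (auto simp: module_hom_def compose_def extensional_def fun_eq_iff)
qed

lemma preadditive_category_Vect:
  fixes K :: "'k ring"
  shows "preadditive_category (Vect K :: (('k, 'v) module, 'v \<Rightarrow> 'v) preadditive_data)"
proof (intro preadditive_category.intro category_Vect preadditive_category_axioms.intro)
  fix V W :: "('k, 'v) module"
  assume VW: "V \<in> Obj (Vect K)" "W \<in> Obj (Vect K)"
  interpret V: vectorspace K V using VW by simp
  interpret W: vectorspace K W using VW by simp
  show "comm_group (hom_group (Vect K) V W)"
  proof (rule comm_groupI)
    fix f assume f: "f \<in> carrier (hom_group (Vect K) V W)"
    show "\<exists>g\<in>carrier (hom_group (Vect K) V W).
        g \<otimes>\<^bsub>hom_group (Vect K) V W\<^esub> f = \<one>\<^bsub>hom_group (Vect K) V W\<^esub>"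
    proof (rule bexI[of _ "\<lambda>v\<in>carrier V. \<ominus>\<^bsub>W\<^esub> f v"])
      show "(\<lambda>v\<in>carrier V. \<ominus>\<^bsub>W\<^esub> f v) \<otimes>\<^bsub>hom_group (Vect K) V W\<^esub> f = \<one>\<^bsub>hom_group (Vect K) V W\<^esub>"
        using f by (auto simp: hom_group_def module_hom_def Pi_iff W.module.M.l_neg)
      show "(\<lambda>v\<in>carrier V. \<ominus>\<^bsub>W\<^esub> f v) \<in> carrier (hom_group (Vect K) V W)"
        using f by (auto simp: hom_group_def module_hom_def Pi_iff W.module.M.minus_add
            W.module.smult_r_minus)
    qed
  qed (auto simp: hom_group_def module_hom_def Pi_iff extensional_def fun_eq_iff
      W.module.M.a_ac W.module.smult_r_distr)
next
  fix U V W :: "('k, 'v) module" and f g h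
  assume "U \<in> Obj (Vect K)" "V \<in> Obj (Vect K)" "W \<in> Obj (Vect K)"
    "f \<in> Hom (Vect K) U V" "g \<in> Hom (Vect K) V W" "h \<in> Hom (Vect K) V W"
  then show "Comp (Vect K) U V W (hom_add (Vect K) V W g h) f
      = hom_add (Vect K) U W (Comp (Vect K) U V W g f) (Comp (Vect K) U V W h f)"
    by (auto simp: module_hom_def compose_def fun_eq_iff Pi_iff)
next
  fix U V W :: "('k, 'v) module" and f g h
  assume "U \<in> Obj (Vect K)" "V \<in> Obj (Vect K)" "W \<in> Obj (Vect K)"
    "f \<in> Hom (Vect K) U V" "g \<in> Hom (Vect K) U V" "h \<in> Hom (Vect K) V W"
  then show "Comp (Vect K) U V W h (hom_add (Vect K) U V f g)
      = hom_add (Vect K) U W (Comp (Vect K) U V W h f) (Comp (Vect K) U V W h g)"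
    by (auto simp: module_hom_def compose_def fun_eq_iff Pi_iff)
qed

lemma category_prod_category:
  assumes "category C" "category D"
  shows "category (prod_category C D)"
proof -
  interpret C: category C by fact
  interpret D: category D by fact
  show ?thesis
    by standard
      (auto simp: prod_category_def C.Id_closed D.Id_closed C.Comp_closed D.Comp_closed
        C.Comp_Id_left D.Comp_Id_left C.Comp_Id_right D.Comp_Id_right C.Comp_assoc D.Comp_assoc)
qed

lemma functor_restrict_functor:
  assumes "functor_between C (Vect K) F" "subfunctor K C F S"
  shows "functor_between C (Vect K) (restrict_functor F S)"
proof -
  interpret F: functor_between C "Vect K" F by fact
  have sub: "subspace K (S x) (fobj F x)" if "x \<in> Obj C" for x
    using assms(2) that by (auto simp: subfunctor_def)
  have S: "S x \<subseteq> carrier (fobj F x)" if "x \<in> Obj C" for x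
    using sub[OF that] by (auto simp: subspace_def submodule_def)
  have im: "farr F x y f v \<in> S y" if "x \<in> Obj C" "y \<in> Obj C" "f \<in> Hom C x y" "v \<in> S x" for x y f v
    using assms(2) that unfolding subfunctor_def by blast
  show ?thesis
  proof
    fix x assume x: "x \<in> Obj C"
    interpret V: vectorspace K "fobj F x" using F.fobj_closed[OF x] by simp
    show "fobj (restrict_functor F S) x \<in> Obj (Vect K)"
      using V.subspace_is_vs[OF sub[OF x]] by (simp add: restrict_functor_def)
    show "farr (restrict_functor F S) x x (Id C x) = Id (Vect K) (fobj (restrict_functor F S) x)"
      using S[OF x] F.farr_Id[OF x] by (auto simp: restrict_functor_def fun_eq_iff restrict_def)
  next
    fix x y f assume *: "x \<in> Obj C" "y \<in> Obj C" "f \<in> Hom C x y"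
    show "farr (restrict_functor F S) x y f
        \<in> Hom (Vect K) (fobj (restrict_functor F S) x) (fobj (restrict_functor F S) y)"
      using F.farr_closed[OF *] im[OF *] S[OF *(1)] sub[OF *(1)]
      by (auto simp: restrict_functor_def module_hom_def subspace_def submodule_def subset_iff)
  next
    fix x y z f g assume *: "x \<in> Obj C" "y \<in> Obj C" "z \<in> Obj C" "f \<in> Hom C x y" "g \<in> Hom C y z"
    show "farr (restrict_functor F S) x z (Comp C x y z g f)
        = Comp (Vect K) (fobj (restrict_functor F S) x) (fobj (restrict_functor F S) y)
          (fobj (restrict_functor F S) z)
          (farr (restrict_functor F S) y z g) (farr (restrict_functor F S) x y f)"
      using F.farr_Comp[OF *] im[OF *(1,2,4)] S[OF *(1)]
      by (auto simp: restrict_functor_def compose_def fun_eq_iff restrict_def)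
  qed
qed

lemma quotient_space_simps [simp]:
  "carrier (quotient_space V W) = a_rcosets\<^bsub>V\<^esub> W"
  "\<zero>\<^bsub>quotient_space V W\<^esub> = W"
  "P \<oplus>\<^bsub>quotient_space V W\<^esub> Q = P <+>\<^bsub>V\<^esub> Q"
  "a \<odot>\<^bsub>quotient_space V W\<^esub> P = (\<Union>v\<in>P. W +>\<^bsub>V\<^esub> (a \<odot>\<^bsub>V\<^esub> v))"
  by (simp_all add: quotient_space_def)

lemma subspace_abelian_subgroup:
  assumes "subspace K W V"
  shows "abelian_subgroup W V"
proof -
  interpret W: subspace K W V by fact
  interpret V: vectorspace K V by (rule W.vs)
  interpret W: submodule K W V by (rule W.submod)
  show ?thesis
  proof (rule abelian_subgroupI3)
    show "abelian_group V" by (rule V.module.M.abelian_group_axioms)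
    show "additive_subgroup W V"
    proof (rule additive_subgroupI, rule V.module.M.add.subgroupI)
      show "W \<subseteq> carrier V" by (rule W.subset)
      show "W \<noteq> {}" using W.zero_closed by blast
    next
      fix a assume a: "a \<in> W"
      then have aV: "a \<in> carrier V" using W.subset by auto
      have "(\<ominus>\<^bsub>K\<^esub> \<one>\<^bsub>K\<^esub>) \<odot>\<^bsub>V\<^esub> a \<in> W" using a by (intro W.smult_closed) auto
      moreover have "(\<ominus>\<^bsub>K\<^esub> \<one>\<^bsub>K\<^esub>) \<odot>\<^bsub>V\<^esub> a = \<ominus>\<^bsub>V\<^esub> a"
        using aV by (simp add: V.module.smult_l_minus)
      ultimately show "\<ominus>\<^bsub>V\<^esub> a \<in> W" by simp
    qed (use W.m_closed in auto)
  qed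
qed

lemma rcosetE:
  assumes "P \<in> a_rcosets\<^bsub>V\<^esub> W"
  obtains v where "v \<in> carrier V" "P = W +>\<^bsub>V\<^esub> v"
  using assms by (auto simp: A_RCOSETS_def')

lemma rcoset_map:
  assumes "subspace K W V" "subspace K W' V'"
    and f: "\<And>u. u \<in> carrier V \<Longrightarrow> f u \<in> carrier V'"
      "\<And>u v. \<lbrakk>u \<in> carrier V; v \<in> carrier V\<rbrakk> \<Longrightarrow> f (u \<oplus>\<^bsub>V\<^esub> v) = f u \<oplus>\<^bsub>V'\<^esub> f v"
      "f ` W \<subseteq> W'"
    and v: "v \<in> carrier V"
  shows "(\<Union>u\<in>W +>\<^bsub>V\<^esub> v. W' +>\<^bsub>V'\<^esub> f u) = W' +>\<^bsub>V'\<^esub> f v"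
proof -
  interpret W: abelian_subgroup W V by (rule subspace_abelian_subgroup) fact
  interpret W': abelian_subgroup W' V' by (rule subspace_abelian_subgroup) fact
  have "W' +>\<^bsub>V'\<^esub> f u = W' +>\<^bsub>V'\<^esub> f v" if u: "u \<in> W +>\<^bsub>V\<^esub> v" for u
  proof -
    obtain w where w: "w \<in> W" "u = w \<oplus>\<^bsub>V\<^esub> v" using u by (auto simp: a_r_coset_def')
    have "w \<in> carrier V" using w(1) W.a_subset by auto
    then have "f u = f w \<oplus>\<^bsub>V'\<^esub> f v" using w(2) v f(2) by simp
    then have "f u \<in> W' +>\<^bsub>V'\<^esub> f v" using w(1) f(3) by (auto simp: a_r_coset_def')
    then show ?thesis using W'.a_repr_independence f(1)[OF v] W'.a_subgroup by metis
  qed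
  moreover have "v \<in> W +>\<^bsub>V\<^esub> v" using v by (rule W.a_rcos_self)
  ultimately show ?thesis by blast
qed

lemma quotient_space_smult:
  assumes "subspace K W V" "a \<in> carrier K" "v \<in> carrier V"
  shows "(\<Union>u\<in>W +>\<^bsub>V\<^esub> v. W +>\<^bsub>V\<^esub> (a \<odot>\<^bsub>V\<^esub> u)) = W +>\<^bsub>V\<^esub> (a \<odot>\<^bsub>V\<^esub> v)"
proof -
  interpret W: subspace K W V by fact
  interpret V: vectorspace K V by (rule W.vs)
  interpret W: submodule K W V by (rule W.submod)
  show ?thesis
    using assms W.smult_closed
    by (intro rcoset_map[OF assms(1,1)]) (auto simp: V.module.smult_r_distr)
qed

lemma vectorspace_quotient_space:
  assumes "subspace K W V"
  shows "vectorspace K (quotient_space V W)"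
proof -
  interpret W: subspace K W V by fact
  interpret V: vectorspace K V by (rule W.vs)
  interpret Wa: abelian_subgroup W V by (rule subspace_abelian_subgroup) fact
  have closed: "W +>\<^bsub>V\<^esub> v \<in> a_rcosets\<^bsub>V\<^esub> W" if "v \<in> carrier V" for v
    using that by (auto simp: A_RCOSETS_def')
  have sm: "a \<odot>\<^bsub>quotient_space V W\<^esub> (W +>\<^bsub>V\<^esub> v) = W +>\<^bsub>V\<^esub> (a \<odot>\<^bsub>V\<^esub> v)"
    if "a \<in> carrier K" "v \<in> carrier V" for a v
    using quotient_space_smult[OF assms that] by simp
  have W0: "W = W +>\<^bsub>V\<^esub> \<zero>\<^bsub>V\<^esub>"
    using V.module.M.a_coset_add_zero[OF Wa.a_subset] by simp
  have Wc: "W \<in> a_rcosets\<^bsub>V\<^esub> W"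
    using W0 closed[OF V.module.M.zero_closed] by simp
  have "abelian_group (quotient_space V W)"
  proof (rule abelian_groupI)
    fix P assume "P \<in> carrier (quotient_space V W)"
    then obtain v where v: "v \<in> carrier V" "P = W +>\<^bsub>V\<^esub> v" by (auto elim: rcosetE)
    show "\<exists>Q\<in>carrier (quotient_space V W). Q \<oplus>\<^bsub>quotient_space V W\<^esub> P = \<zero>\<^bsub>quotient_space V W\<^esub>"
      using v W0 by (intro bexI[of _ "W +>\<^bsub>V\<^esub> (\<ominus>\<^bsub>V\<^esub> v)"])
        (simp_all add: closed Wa.a_rcos_sum V.module.M.l_neg)
    show "\<zero>\<^bsub>quotient_space V W\<^esub> \<oplus>\<^bsub>quotient_space V W\<^esub> P = P"
      using v Wa.rcosets_add_eq closed by simp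
  qed (auto elim!: rcosetE simp: closed Wc Wa.a_rcos_sum V.module.M.a_ac W0[symmetric]
      intro: Wa.rcosets_add_eq)
  then have "module K (quotient_space V W)"
    by (intro moduleI V.R.is_cring)
      (auto elim!: rcosetE simp del: quotient_space_simps(4) simp: closed Wa.a_rcos_sum sm
        V.module.smult_l_distr V.module.smult_r_distr V.module.smult_assoc1)
  then show ?thesis
    by (intro vectorspace.intro V.field_axioms)
qed

lemma functor_quotient_functor:
  fixes F :: "('o, 'm, 'k, 'v) vfunctor"
  assumes "functor_between C (Vect K) F" "subfunctor K C F S"
  shows "functor_between C (Vect K) (quotient_functor F S)"
proof -
  interpret F: functor_between C "Vect K" F by fact
  have sub: "subspace K (S x) (fobj F x)" if "x \<in> Obj C" for x
    using assms(2) that by (auto simp: subfunctor_def)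
  have vs: "vectorspace K (fobj F x)" if "x \<in> Obj C" for x
    using F.fobj_closed[OF that] by simp
  have hom: "farr F x y f v \<in> carrier (fobj F y)"
    "farr F x y f (v \<oplus>\<^bsub>fobj F x\<^esub> w) = farr F x y f v \<oplus>\<^bsub>fobj F y\<^esub> farr F x y f w"
    "a \<in> carrier K \<Longrightarrow> farr F x y f (a \<odot>\<^bsub>fobj F x\<^esub> v) = a \<odot>\<^bsub>fobj F y\<^esub> farr F x y f v"
    if "x \<in> Obj C" "y \<in> Obj C" "f \<in> Hom C x y" "v \<in> carrier (fobj F x)" "w \<in> carrier (fobj F x)"
    for x y f v w a
    using F.farr_closed[OF that(1-3)] that(4,5) by (auto simp: module_hom_def)
  have closed: "S x +>\<^bsub>fobj F x\<^esub> v \<in> a_rcosets\<^bsub>fobj F x\<^esub> S x"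
    if "x \<in> Obj C" "v \<in> carrier (fobj F x)" for x v
    using that(2) by (auto simp: A_RCOSETS_def')
  have qmap: "farr (quotient_functor F S) x y f (S x +>\<^bsub>fobj F x\<^esub> v)
      = S y +>\<^bsub>fobj F y\<^esub> farr F x y f v"
    if *: "x \<in> Obj C" "y \<in> Obj C" "f \<in> Hom C x y" and v: "v \<in> carrier (fobj F x)" for x y f v
  proof -
    have "farr F x y f ` S x \<subseteq> S y" using * assms(2) by (auto simp: subfunctor_def)
    then have "(\<Union>u\<in>S x +>\<^bsub>fobj F x\<^esub> v. S y +>\<^bsub>fobj F y\<^esub> farr F x y f u)
        = S y +>\<^bsub>fobj F y\<^esub> farr F x y f v"
      using v hom[OF *] by (intro rcoset_map[OF sub[OF *(1)] sub[OF *(2)]]) auto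
    then show ?thesis using closed[OF *(1) v] by (simp add: quotient_functor_def)
  qed
  have ob: "fobj (quotient_functor F S) x = quotient_space (fobj F x) (S x)" for x
    by (simp add: quotient_functor_def)
  have ext: "farr (quotient_functor F S) x y f \<in> extensional (a_rcosets\<^bsub>fobj F x\<^esub> S x)" for x y f
    by (simp add: quotient_functor_def)
  have qsm: "a \<odot>\<^bsub>quotient_space (fobj F x) (S x)\<^esub> (S x +>\<^bsub>fobj F x\<^esub> v)
      = S x +>\<^bsub>fobj F x\<^esub> (a \<odot>\<^bsub>fobj F x\<^esub> v)"
    if "x \<in> Obj C" "a \<in> carrier K" "v \<in> carrier (fobj F x)" for x a v
    using quotient_space_smult[OF sub] that by simp
  have sum: "(S x +>\<^bsub>fobj F x\<^esub> v) <+>\<^bsub>fobj F x\<^esub> (S x +>\<^bsub>fobj F x\<^esub> w)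
      = S x +>\<^bsub>fobj F x\<^esub> (v \<oplus>\<^bsub>fobj F x\<^esub> w)"
    if "x \<in> Obj C" "v \<in> carrier (fobj F x)" "w \<in> carrier (fobj F x)" for x v w
    using abelian_subgroup.a_rcos_sum[OF subspace_abelian_subgroup[OF sub]] that by blast
  interpret Q: category "Vect K :: (('k, 'v set) module, 'v set \<Rightarrow> 'v set) preadditive_data"
    by (rule category_Vect)
  show ?thesis
  proof
    fix x assume x: "x \<in> Obj C"
    show "fobj (quotient_functor F S) x \<in> Obj (Vect K)"
      using vectorspace_quotient_space[OF sub[OF x]] by (simp add: ob)
    show "farr (quotient_functor F S) x x (Id C x) = Id (Vect K) (fobj (quotient_functor F S) x)"
    proof (rule extensionalityI[OF ext])
      fix P assume P: "P \<in> a_rcosets\<^bsub>fobj F x\<^esub> S x"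
      then obtain v where "v \<in> carrier (fobj F x)" "P = S x +>\<^bsub>fobj F x\<^esub> v" by (rule rcosetE)
      then show "farr (quotient_functor F S) x x (Id C x) P
          = Id (Vect K) (fobj (quotient_functor F S) x) P"
        using P x by (simp add: ob qmap F.C.Id_closed F.farr_Id)
    qed (simp add: ob)
  next
    fix x y f assume *: "x \<in> Obj C" "y \<in> Obj C" "f \<in> Hom C x y"
    show "farr (quotient_functor F S) x y f
        \<in> Hom (Vect K) (fobj (quotient_functor F S) x) (fobj (quotient_functor F S) y)"
      using ext * vectorspace_closed[OF vs[OF *(1)]]
      by (auto simp del: quotient_space_simps(4)
          simp: module_hom_def ob qmap closed hom sum qsm elim!: rcosetE)
  next
    fix x y z f g assume *: "x \<in> Obj C" "y \<in> Obj C" "z \<in> Obj C" "f \<in> Hom C x y" "g \<in> Hom C y z"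
    show "farr (quotient_functor F S) x z (Comp C x y z g f)
        = Comp (Vect K) (fobj (quotient_functor F S) x) (fobj (quotient_functor F S) y)
          (fobj (quotient_functor F S) z)
          (farr (quotient_functor F S) y z g) (farr (quotient_functor F S) x y f)"
    proof (rule extensionalityI[OF ext])
      fix P assume P: "P \<in> a_rcosets\<^bsub>fobj F x\<^esub> S x"
      then obtain v where v: "v \<in> carrier (fobj F x)" "P = S x +>\<^bsub>fobj F x\<^esub> v" by (rule rcosetE)
      show "farr (quotient_functor F S) x z (Comp C x y z g f) P
        = Comp (Vect K) (fobj (quotient_functor F S) x) (fobj (quotient_functor F S) y)
          (fobj (quotient_functor F S) z)
          (farr (quotient_functor F S) y z g) (farr (quotient_functor F S) x y f) P"
        using P v * F.C.Comp_closed[OF *]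
        by (simp add: ob qmap F.farr_Comp hom compose_def)
    qed (simp add: ob)
  qed
qed

end

theory Submission
  imports Defs
begin

text \<open>
  The proof constructs, for all objects \<open>x\<close> and \<open>y\<close>, a function \<open>ext x y f g\<close> of two morphisms
  \<open>f, g : x \<rightarrow> y\<close> with values in the linear maps from \<open>F x\<close> to \<open>F y\<close>, which is polynomial in \<open>f\<close>, is
  periodic in \<open>g\<close> under a subgroup whose quotient is finite and killed by an integer that is
  invertible in \<open>K\<close>, and satisfies \<open>ext x y f f = F f\<close>. There is only one such function: a
  polynomial map that vanishes on a coset of such a subgroup is zero, since it is then periodic, hence
  constant (\<open>poly_periodic_unique\<close>). Uniqueness implies that \<open>ext\<close> is compatible with composition of
  pairs (\<open>ext_comp\<close>). In particular \<open>ext (i p) (j q)\<close> is an idempotent of \<open>F (x \<oplus> y)\<close>, where \<open>i p\<close> and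
  \<open>j q\<close> are the projectors onto the two summands, and \<open>B(x, y)\<close> is its image; on it, a pair \<open>(f, g)\<close>
  acts by \<open>ext (i' f p) (j' g q)\<close>.

  Such an extension exists as soon as \<open>F\<close> is polynomial on the cosets of a subgroup of the same kind
  (\<open>bi_ext\<close>): a polynomial map on \<open>H\<close> extends to \<open>G\<close> if an integer \<open>N\<close> invertible in \<open>K\<close> sends
  \<open>G\<close> into \<open>H\<close>, because it is a combination of its dilates by powers of \<open>N\<close>. That \<open>F\<close> is polynomial on
  cosets is where finite dimension and algebraic closedness enter. The shears of \<open>x \<oplus> x \<oplus> y\<close> form a
  Heisenberg group, acting on the finite-dimensional space \<open>F (x \<oplus> x \<oplus> y)\<close>. On a common eigenvector,
  its centre \<open>Hom(x, y)\<close> acts by a character \<open>\<chi>\<close>, and the commutation relation shows that the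
  eigenvalues of one fixed shear are permuted by multiplication with the values of \<open>\<chi>\<close>. So \<open>\<chi>\<close> has
  a finite image, and on the common kernel of finitely many such characters the centre acts by
  unipotent operators (\<open>unipotent_on_finite_index_subgroup\<close>), which means that \<open>F\<close> is polynomial
  (\<open>polynomial_on_cosets\<close>).

  Polynomiality of \<open>B\<close> requires a bound on the degree that is uniform in the objects, and
  antipolynomiality requires a single ideal of periods. Both come from finite length: some object
  \<open>z\<close> generates and cogenerates \<open>F\<close> (\<open>ex_separating_object\<close>), so a linear map \<open>F x \<rightarrow> F y\<close> is determined by
  its compressions to \<open>F z\<close>, and everything reduces to \<open>Hom(z, z)\<close>. The morphisms all of whose
  compressions are periods form an ideal \<open>I\<close>, the category \<open>A / I\<close> is \<open>K\<close>-trivial, and \<open>B(x, -)\<close> factors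
  through it.

  Conversely, let \<open>B'\<close> be any decomposition of \<open>F\<close>. Under the isomorphism between \<open>F\<close> and the diagonal
  of \<open>B'\<close>, the maps \<open>B'(f, g)\<close> between diagonal objects have the properties that characterize \<open>ext\<close>
  (\<open>ext_eq\<close>). As \<open>B'(x, y)\<close> is the image of \<open>B'(i p, j q)\<close> in \<open>B'(x \<oplus> y, x \<oplus> y)\<close>, it is isomorphic to \<open>B(x, y)\<close>.
\<close>

section \<open>Polynomial maps from an abelian group to a vector space\<close>

text \<open>The degree is defined by iterated differences. Bounding it strictly lets the bound \<open>0\<close> single out
  the zero map, so that inductions on the degree start trivially.\<close>

primrec degree_less ::
    "('a, 'e) monoid_scheme \<Rightarrow> ('k, 'v, 'f) module_scheme \<Rightarrow> nat \<Rightarrow> ('a \<Rightarrow> 'v) \<Rightarrow> bool" where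
  "degree_less G M 0 q \<longleftrightarrow> (\<forall>v\<in>carrier G. q v = \<zero>\<^bsub>M\<^esub>)"
| "degree_less G M (Suc d) q \<longleftrightarrow>
    (\<forall>u\<in>carrier G. degree_less G M d (\<lambda>v. q (u \<otimes>\<^bsub>G\<^esub> v) \<ominus>\<^bsub>M\<^esub> q v))"

lemma degree_less_cong:
  assumes "group G" "\<And>v. v \<in> carrier G \<Longrightarrow> q v = q' v"
  shows "degree_less G M d q \<longleftrightarrow> degree_less G M d q'"
  using assms(2)
proof (induction d arbitrary: q q')
  case (Suc d)
  interpret group G by fact
  have "degree_less G M d (\<lambda>v. q (u \<otimes>\<^bsub>G\<^esub> v) \<ominus>\<^bsub>M\<^esub> q v)
      \<longleftrightarrow> degree_less G M d (\<lambda>v. q' (u \<otimes>\<^bsub>G\<^esub> v) \<ominus>\<^bsub>M\<^esub> q' v)" if "u \<in> carrier G" for u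
    using that Suc.prems by (intro Suc.IH) simp
  then show ?case by simp
qed simp

lemma degree_less_hom:
  assumes "group G" "group G'" "\<phi> \<in> hom G' G" "degree_less G M d q"
  shows "degree_less G' M d (\<lambda>v. q (\<phi> v))"
  using assms(4)
proof (induction d arbitrary: q)
  case 0
  then show ?case using assms(3) by (auto simp: hom_def)
next
  case (Suc d)
  show ?case
    unfolding degree_less.simps
  proof
    fix u assume u: "u \<in> carrier G'"
    then have "\<phi> u \<in> carrier G" using assms(3) by (auto simp: hom_def)
    then have "degree_less G' M d (\<lambda>v. q (\<phi> u \<otimes>\<^bsub>G\<^esub> \<phi> v) \<ominus>\<^bsub>M\<^esub> q (\<phi> v))"
      using Suc.prems by (intro Suc.IH[of "\<lambda>v. q (\<phi> u \<otimes>\<^bsub>G\<^esub> v) \<ominus>\<^bsub>M\<^esub> q v"]) simp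
    then show "degree_less G' M d (\<lambda>v. q (\<phi> (u \<otimes>\<^bsub>G'\<^esub> v)) \<ominus>\<^bsub>M\<^esub> q (\<phi> v))"
      using u assms(3) by (subst degree_less_cong[OF assms(2)]) (auto simp: hom_def)
  qed
qed

locale poly_maps = G: comm_group G + M: vectorspace K M
  for G :: "('a, 'e) monoid_scheme" and K :: "('k, 'l) ring_scheme" and M :: "('k, 'v, 'f) module_scheme"
begin

abbreviation maps where "maps \<equiv> carrier G \<rightarrow> carrier M"
abbreviation deg where "deg \<equiv> degree_less G M"

lemma minus_add_minus:
  assumes "a \<in> carrier M" "b \<in> carrier M" "c \<in> carrier M" "d \<in> carrier M"
  shows "(a \<oplus>\<^bsub>M\<^esub> b) \<ominus>\<^bsub>M\<^esub> (c \<oplus>\<^bsub>M\<^esub> d) = (a \<ominus>\<^bsub>M\<^esub> c) \<oplus>\<^bsub>M\<^esub> (b \<ominus>\<^bsub>M\<^esub> d)"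
  using assms by (simp add: M.module.M.minus_eq M.module.M.minus_add M.module.M.a_ac)

lemma minus_smult:
  assumes "a \<in> carrier K" "x \<in> carrier M" "y \<in> carrier M"
  shows "a \<odot>\<^bsub>M\<^esub> (x \<ominus>\<^bsub>M\<^esub> y) = (a \<odot>\<^bsub>M\<^esub> x) \<ominus>\<^bsub>M\<^esub> (a \<odot>\<^bsub>M\<^esub> y)"
  using assms by (simp add: M.module.M.minus_eq M.module.smult_r_distr M.module.smult_r_minus)

lemma minus_smult_m1:
  assumes "x \<in> carrier M" "y \<in> carrier M"
  shows "x \<ominus>\<^bsub>M\<^esub> y = x \<oplus>\<^bsub>M\<^esub> ((\<ominus>\<^bsub>K\<^esub> \<one>\<^bsub>K\<^esub>) \<odot>\<^bsub>M\<^esub> y)"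
  using assms by (simp add: M.module.M.minus_eq M.module.smult_l_minus)

lemma add_minus_cancel_left: "\<lbrakk>x \<in> carrier M; y \<in> carrier M\<rbrakk> \<Longrightarrow> y \<oplus>\<^bsub>M\<^esub> (x \<ominus>\<^bsub>M\<^esub> y) = x"
  by (metis M.module.M.add.m_comm M.module.M.minus_closed M.module.M.add.inv_solve_right M.module.M.minus_eq M.module.M.add.inv_closed)

lemma minus_self: "x \<in> carrier M \<Longrightarrow> x \<ominus>\<^bsub>M\<^esub> x = \<zero>\<^bsub>M\<^esub>"
  by (simp add: M.module.M.minus_eq M.module.M.r_neg)

lemma minus_zero_iff: "\<lbrakk>x \<in> carrier M; y \<in> carrier M\<rbrakk> \<Longrightarrow> x \<ominus>\<^bsub>M\<^esub> y = \<zero>\<^bsub>M\<^esub> \<longleftrightarrow> x = y"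
  by (metis add_minus_cancel_left minus_self M.module.M.r_zero)

lemma deg_add:
  assumes "q \<in> maps" "q' \<in> maps" "deg d q" "deg d q'"
  shows "deg d (\<lambda>v. q v \<oplus>\<^bsub>M\<^esub> q' v)"
  using assms
proof (induction d arbitrary: q q')
  case (Suc d)
  show ?case
    unfolding degree_less.simps
  proof
    fix u assume u: "u \<in> carrier G"
    have "deg d (\<lambda>v. (q (u \<otimes>\<^bsub>G\<^esub> v) \<ominus>\<^bsub>M\<^esub> q v) \<oplus>\<^bsub>M\<^esub> (q' (u \<otimes>\<^bsub>G\<^esub> v) \<ominus>\<^bsub>M\<^esub> q' v))"
      using Suc.prems u by (intro Suc.IH) (auto simp: Pi_iff)
    then show "deg d (\<lambda>v. (q (u \<otimes>\<^bsub>G\<^esub> v) \<oplus>\<^bsub>M\<^esub> q' (u \<otimes>\<^bsub>G\<^esub> v)) \<ominus>\<^bsub>M\<^esub> (q v \<oplus>\<^bsub>M\<^esub> q' v))"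
      using Suc.prems u
      by (subst degree_less_cong[OF G.is_group]) (auto simp: Pi_iff minus_add_minus)
  qed
qed auto

lemma deg_smult:
  assumes "q \<in> maps" "a \<in> carrier K" "deg d q"
  shows "deg d (\<lambda>v. a \<odot>\<^bsub>M\<^esub> q v)"
  using assms
proof (induction d arbitrary: q)
  case (Suc d)
  show ?case
    unfolding degree_less.simps
  proof
    fix u assume u: "u \<in> carrier G"
    have "deg d (\<lambda>v. a \<odot>\<^bsub>M\<^esub> (q (u \<otimes>\<^bsub>G\<^esub> v) \<ominus>\<^bsub>M\<^esub> q v))"
      using Suc.prems u by (intro Suc.IH) (auto simp: Pi_iff)
    then show "deg d (\<lambda>v. (a \<odot>\<^bsub>M\<^esub> q (u \<otimes>\<^bsub>G\<^esub> v)) \<ominus>\<^bsub>M\<^esub> (a \<odot>\<^bsub>M\<^esub> q v))"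
      using Suc.prems u
      by (subst degree_less_cong[OF G.is_group]) (auto simp: Pi_iff minus_smult)
  qed
qed auto

lemma deg_minus:
  assumes "q \<in> maps" "q' \<in> maps" "deg d q" "deg d q'"
  shows "deg d (\<lambda>v. q v \<ominus>\<^bsub>M\<^esub> q' v)"
proof -
  have "deg d (\<lambda>v. q v \<oplus>\<^bsub>M\<^esub> ((\<ominus>\<^bsub>K\<^esub> \<one>\<^bsub>K\<^esub>) \<odot>\<^bsub>M\<^esub> q' v))"
    using assms by (intro deg_add deg_smult) (auto simp: Pi_iff)
  then show ?thesis
    using assms by (subst degree_less_cong[OF G.is_group]) (auto simp: Pi_iff minus_smult_m1)
qed

lemma deg_zero: "deg d (\<lambda>v. \<zero>\<^bsub>M\<^esub>)"
  by (induction d) (simp_all add: minus_self)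

lemma deg_Suc:
  assumes "q \<in> maps" "deg d q"
  shows "deg (Suc d) q"
  using assms
proof (induction d arbitrary: q)
  case 0
  then show ?case by (simp add: minus_self)
next
  case (Suc d)
  show ?case
    unfolding degree_less.simps(2)[where d = "Suc d"]
    using Suc.prems by (intro ballI Suc.IH) (auto simp: Pi_iff)
qed

lemma deg_mono:
  assumes "q \<in> maps" "deg d q" "d \<le> e"
  shows "deg e q"
  using assms(3) by (induction rule: dec_induct) (use assms deg_Suc in auto)

lemma deg_shift:
  assumes "q \<in> maps" "deg d q" "u \<in> carrier G"
  shows "deg d (\<lambda>v. q (u \<otimes>\<^bsub>G\<^esub> v))"
proof -
  have "deg (Suc d) q" using assms deg_Suc by blast
  then have "deg d (\<lambda>v. q v \<oplus>\<^bsub>M\<^esub> (q (u \<otimes>\<^bsub>G\<^esub> v) \<ominus>\<^bsub>M\<^esub> q v))"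
    using assms by (intro deg_add) (auto simp: Pi_iff)
  then show ?thesis
    using assms
    by (subst degree_less_cong[OF G.is_group]) (auto simp: Pi_iff add_minus_cancel_left)
qed

lemma deg_linear:
  fixes M' :: "('k, 'w, 'g) module_scheme"
  assumes "vectorspace K M'" "L \<in> module_hom K M M'" "q \<in> maps" "deg d q"
  shows "degree_less G M' d (\<lambda>v. L (q v))"
  using assms(3,4)
proof -
  interpret L: linear_map K M M' L
    using assms(1,2) by (intro linear_map.intro mod_hom.intro M.vectorspace_axioms mod_hom_axioms.intro)
      (use M.module.module_axioms in \<open>auto simp: vectorspace_def\<close>)
  show ?thesis using assms(3,4)
  proof (induction d arbitrary: q)
    case (Suc d)
    show ?case
      unfolding degree_less.simps
    proof
      fix u assume u: "u \<in> carrier G"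
      have "degree_less G M' d (\<lambda>v. L (q (u \<otimes>\<^bsub>G\<^esub> v) \<ominus>\<^bsub>M\<^esub> q v))"
        using Suc.prems u by (intro Suc.IH) (auto simp: Pi_iff)
      then show "degree_less G M' d (\<lambda>v. L (q (u \<otimes>\<^bsub>G\<^esub> v)) \<ominus>\<^bsub>M'\<^esub> L (q v))"
        using Suc.prems u
        by (subst degree_less_cong[OF G.is_group]) (auto simp: Pi_iff L.T_minus)
    qed
  qed auto
qed

lemma deg_Suc_const:
  assumes "q \<in> maps" "deg (Suc 0) q" "v \<in> carrier G" "u \<in> carrier G"
  shows "q v = q u"
proof -
  have "q (v \<otimes>\<^bsub>G\<^esub> inv\<^bsub>G\<^esub> u \<otimes>\<^bsub>G\<^esub> u) \<ominus>\<^bsub>M\<^esub> q u = \<zero>\<^bsub>M\<^esub>"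
    using assms by simp
  then show ?thesis
    using assms by (simp add: minus_zero_iff Pi_iff G.m_assoc)
qed

end

text \<open>The multiplicative fields of the record are arbitrary fillers.\<close>

definition Lin :: "'k ring \<Rightarrow> ('k, 'v) module \<Rightarrow> ('k, 'v) module \<Rightarrow> ('k, 'v \<Rightarrow> 'v) module" where
  "Lin K V W = \<lparr>carrier = Hom (Vect K) V W, monoid.mult = (\<lambda>f g. f), one = hom_zero (Vect K) V W,
    ring.zero = hom_zero (Vect K) V W, ring.add = hom_add (Vect K) V W,
    smult = (\<lambda>a f. \<lambda>v\<in>carrier V. a \<odot>\<^bsub>W\<^esub> f v)\<rparr>"

lemma Lin_simps:
  "carrier (Lin K V W) = Hom (Vect K) V W"
  "\<zero>\<^bsub>Lin K V W\<^esub> = hom_zero (Vect K) V W"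
  "f \<oplus>\<^bsub>Lin K V W\<^esub> g = hom_add (Vect K) V W f g"
  "a \<odot>\<^bsub>Lin K V W\<^esub> f = (\<lambda>v\<in>carrier V. a \<odot>\<^bsub>W\<^esub> f v)"
  by (simp_all add: Lin_def)

lemma vectorspace_Lin:
  assumes V: "vectorspace K V" and W: "vectorspace K W"
  shows "vectorspace K (Lin K V W)"
proof -
  interpret V: vectorspace K V by fact
  interpret W: vectorspace K W by fact
  interpret H: comm_group "hom_group (Vect K) V W"
    using V W preadditive_category.hom_comm_group[OF preadditive_category_Vect] by simp
  have [simp]: "carrier (hom_group (Vect K) V W) = carrier (Lin K V W)"
    "\<one>\<^bsub>hom_group (Vect K) V W\<^esub> = \<zero>\<^bsub>Lin K V W\<^esub>"
    "x \<otimes>\<^bsub>hom_group (Vect K) V W\<^esub> y = x \<oplus>\<^bsub>Lin K V W\<^esub> y" for x y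
    by (simp_all add: Lin_def hom_group_def)
  have "abelian_group (Lin K V W)"
    using H.m_closed H.m_assoc H.m_comm H.l_one H.l_inv_ex H.one_closed
    by (intro abelian_groupI) simp_all
  then have "module K (Lin K V W)"
  proof (intro moduleI V.R.is_cring)
    fix a f assume "a \<in> carrier K" "f \<in> carrier (Lin K V W)"
    then show "a \<odot>\<^bsub>Lin K V W\<^esub> f \<in> carrier (Lin K V W)"
      by (auto simp: Lin_simps module_hom_def W.module.smult_r_distr Pi_iff V.R.m_ac
          W.module.smult_assoc1[symmetric])
  next
    fix a b f assume "a \<in> carrier K" "b \<in> carrier K" "f \<in> carrier (Lin K V W)"
    then show "(a \<oplus>\<^bsub>K\<^esub> b) \<odot>\<^bsub>Lin K V W\<^esub> f
        = a \<odot>\<^bsub>Lin K V W\<^esub> f \<oplus>\<^bsub>Lin K V W\<^esub> b \<odot>\<^bsub>Lin K V W\<^esub> f"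
      by (auto simp: Lin_simps module_hom_def W.module.smult_l_distr Pi_iff fun_eq_iff)
  next
    fix a f g assume "a \<in> carrier K" "f \<in> carrier (Lin K V W)" "g \<in> carrier (Lin K V W)"
    then show "a \<odot>\<^bsub>Lin K V W\<^esub> (f \<oplus>\<^bsub>Lin K V W\<^esub> g)
        = a \<odot>\<^bsub>Lin K V W\<^esub> f \<oplus>\<^bsub>Lin K V W\<^esub> a \<odot>\<^bsub>Lin K V W\<^esub> g"
      by (auto simp: Lin_simps module_hom_def W.module.smult_r_distr Pi_iff fun_eq_iff)
  next
    fix a b f assume "a \<in> carrier K" "b \<in> carrier K" "f \<in> carrier (Lin K V W)"
    then show "(a \<otimes>\<^bsub>K\<^esub> b) \<odot>\<^bsub>Lin K V W\<^esub> f = a \<odot>\<^bsub>Lin K V W\<^esub> (b \<odot>\<^bsub>Lin K V W\<^esub> f)"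
      by (auto simp: Lin_simps module_hom_def W.module.smult_assoc1 Pi_iff fun_eq_iff)
  next
    fix f assume "f \<in> carrier (Lin K V W)"
    then show "\<one>\<^bsub>K\<^esub> \<odot>\<^bsub>Lin K V W\<^esub> f = f"
      by (auto simp: Lin_simps module_hom_def Pi_iff fun_eq_iff extensional_def)
  qed
  then show ?thesis by (intro vectorspace.intro V.field_axioms)
qed

section \<open>Maps that are polynomial on the cosets of a subgroup\<close>

primrec nat_in :: "('k, 'l) ring_scheme \<Rightarrow> nat \<Rightarrow> 'k" where
  "nat_in K 0 = \<zero>\<^bsub>K\<^esub>"
| "nat_in K (Suc n) = \<one>\<^bsub>K\<^esub> \<oplus>\<^bsub>K\<^esub> nat_in K n"

lemma (in ring) nat_in_closed [simp]: "nat_in R n \<in> carrier R"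
  by (induction n) simp_all

lemma (in ring) nat_in_add: "nat_in R (m + n) = nat_in R m \<oplus> nat_in R n"
  by (induction m) (simp_all add: a_assoc)

lemma (in ring) nat_in_mult: "nat_in R (m * n) = nat_in R m \<otimes> nat_in R n"
  by (induction m) (simp_all add: nat_in_add l_distr)

text \<open>Subtract successively the homogeneous components of degrees \<open>j - 1, \<dots>, 0\<close> under \<open>\<phi>\<close>,
  the dilation by \<open>1 / a\<close>.\<close>

primrec dilation_defect ::
    "('k, 'l) ring_scheme \<Rightarrow> ('k, 'v, 'f) module_scheme \<Rightarrow> 'k \<Rightarrow> ('a \<Rightarrow> 'a) \<Rightarrow> nat
      \<Rightarrow> ('a \<Rightarrow> 'v) \<Rightarrow> 'a \<Rightarrow> 'v" where
  "dilation_defect K M a \<phi> 0 q = q"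
| "dilation_defect K M a \<phi> (Suc j) q =
    dilation_defect K M a \<phi> j (\<lambda>w. q w \<ominus>\<^bsub>M\<^esub> (a [^]\<^bsub>K\<^esub> j) \<odot>\<^bsub>M\<^esub> q (\<phi> w))"

text \<open>If \<open>H\<close> is a subgroup, this says that \<open>Hom(G / H, M) = 0\<close>.\<close>

definition no_homs :: "('a, 'e) monoid_scheme \<Rightarrow> ('k, 'v, 'f) module_scheme \<Rightarrow> 'a set \<Rightarrow> bool" where
  "no_homs G M H \<longleftrightarrow> (\<forall>a\<in>hom G (add_monoid M).
    (\<forall>h\<in>H. a h = \<zero>\<^bsub>M\<^esub>) \<longrightarrow> (\<forall>u\<in>carrier G. a u = \<zero>\<^bsub>M\<^esub>))"

context poly_maps
begin

lemma telescope:
  assumes "a \<in> carrier M" "b \<in> carrier M" "c \<in> carrier M"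
  shows "(a \<ominus>\<^bsub>M\<^esub> b) \<oplus>\<^bsub>M\<^esub> (b \<ominus>\<^bsub>M\<^esub> c) = a \<ominus>\<^bsub>M\<^esub> c"
  using assms by (simp add: M.module.M.minus_eq M.module.M.a_assoc M.module.M.r_neg1)

lemma minus_minus_minus:
  assumes "a \<in> carrier M" "b \<in> carrier M" "c \<in> carrier M" "d \<in> carrier M"
  shows "(a \<ominus>\<^bsub>M\<^esub> b) \<ominus>\<^bsub>M\<^esub> (c \<ominus>\<^bsub>M\<^esub> d) = (a \<ominus>\<^bsub>M\<^esub> c) \<ominus>\<^bsub>M\<^esub> (b \<ominus>\<^bsub>M\<^esub> d)"
  using assms by (simp add: M.module.M.minus_eq M.module.M.minus_add M.module.M.a_ac)

lemma smult_0_iff: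
  assumes "a \<in> carrier K" "a \<noteq> \<zero>\<^bsub>K\<^esub>" "x \<in> carrier M" "a \<odot>\<^bsub>M\<^esub> x = \<zero>\<^bsub>M\<^esub>"
  shows "x = \<zero>\<^bsub>M\<^esub>"
  using M.mult_inverse[OF assms(1,3,4,2)] assms(1,2) by (simp add: M.field_Units)

text \<open>Differences of \<open>q\<close> by multiples \<open>n u\<close> are sums of \<open>n\<close> translates of the difference by \<open>u\<close>, and
  translating changes a map only by a term of lower degree.\<close>

lemma deg_diff_pow:
  assumes q: "q \<in> maps" "deg (Suc (Suc d)) q" and u: "u \<in> carrier G"
  shows "deg d (\<lambda>v. (q (u [^]\<^bsub>G\<^esub> n \<otimes>\<^bsub>G\<^esub> v) \<ominus>\<^bsub>M\<^esub> q v)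
    \<ominus>\<^bsub>M\<^esub> nat_in K n \<odot>\<^bsub>M\<^esub> (q (u \<otimes>\<^bsub>G\<^esub> v) \<ominus>\<^bsub>M\<^esub> q v))"
proof (induction n)
  case 0
  show ?case
    using q u deg_zero[of d]
    by (subst degree_less_cong[OF G.is_group, where q' = "\<lambda>v. \<zero>\<^bsub>M\<^esub>"]) (auto simp: Pi_iff minus_self)
next
  case (Suc n)
  let ?D = "\<lambda>v. q (u \<otimes>\<^bsub>G\<^esub> v) \<ominus>\<^bsub>M\<^esub> q v"
  have "deg (Suc d) ?D" using q(2) u by simp
  then have "deg d (\<lambda>v. ?D (u [^]\<^bsub>G\<^esub> n \<otimes>\<^bsub>G\<^esub> v) \<ominus>\<^bsub>M\<^esub> ?D v)" using u by simp
  then have "deg d (\<lambda>v. (?D (u [^]\<^bsub>G\<^esub> n \<otimes>\<^bsub>G\<^esub> v) \<ominus>\<^bsub>M\<^esub> ?D v) \<oplus>\<^bsub>M\<^esub>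
      ((q (u [^]\<^bsub>G\<^esub> n \<otimes>\<^bsub>G\<^esub> v) \<ominus>\<^bsub>M\<^esub> q v) \<ominus>\<^bsub>M\<^esub> nat_in K n \<odot>\<^bsub>M\<^esub> ?D v))"
    using Suc q u by (intro deg_add) (auto simp: Pi_iff)
  also have "?this \<longleftrightarrow> ?case"
  proof (rule degree_less_cong[OF G.is_group])
    fix v assume v: "v \<in> carrier G"
    have *: "u [^]\<^bsub>G\<^esub> Suc n \<otimes>\<^bsub>G\<^esub> v = u \<otimes>\<^bsub>G\<^esub> (u [^]\<^bsub>G\<^esub> n \<otimes>\<^bsub>G\<^esub> v)"
      using u v by (simp add: G.m_ac)
    have "(q (u \<otimes>\<^bsub>G\<^esub> (u [^]\<^bsub>G\<^esub> n \<otimes>\<^bsub>G\<^esub> v)) \<ominus>\<^bsub>M\<^esub> q v)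
        \<ominus>\<^bsub>M\<^esub> (?D v \<oplus>\<^bsub>M\<^esub> nat_in K n \<odot>\<^bsub>M\<^esub> ?D v)
      = (?D (u [^]\<^bsub>G\<^esub> n \<otimes>\<^bsub>G\<^esub> v) \<ominus>\<^bsub>M\<^esub> ?D v) \<oplus>\<^bsub>M\<^esub>
      ((q (u [^]\<^bsub>G\<^esub> n \<otimes>\<^bsub>G\<^esub> v) \<ominus>\<^bsub>M\<^esub> q v) \<ominus>\<^bsub>M\<^esub> nat_in K n \<odot>\<^bsub>M\<^esub> ?D v)"
      using q u v
      by (subst minus_add_minus[symmetric]) (auto simp: Pi_iff telescope)
    then show "(?D (u [^]\<^bsub>G\<^esub> n \<otimes>\<^bsub>G\<^esub> v) \<ominus>\<^bsub>M\<^esub> ?D v) \<oplus>\<^bsub>M\<^esub>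
      ((q (u [^]\<^bsub>G\<^esub> n \<otimes>\<^bsub>G\<^esub> v) \<ominus>\<^bsub>M\<^esub> q v) \<ominus>\<^bsub>M\<^esub> nat_in K n \<odot>\<^bsub>M\<^esub> ?D v)
      = (q (u [^]\<^bsub>G\<^esub> Suc n \<otimes>\<^bsub>G\<^esub> v) \<ominus>\<^bsub>M\<^esub> q v) \<ominus>\<^bsub>M\<^esub> nat_in K (Suc n) \<odot>\<^bsub>M\<^esub> ?D v"
      unfolding * using q u v by (simp add: M.module.smult_l_distr Pi_iff)
  qed
  finally show ?case .
qed

lemma pow_hom: "(\<lambda>w. w [^]\<^bsub>G\<^esub> (N::nat)) \<in> hom G G"
  by (auto simp: hom_def G.nat_pow_distrib)

text \<open>The dilation by \<open>N\<close> multiplies the component of top degree \<open>d\<close> by \<open>N^d\<close>.\<close>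

lemma deg_dilation:
  assumes "q \<in> maps" "deg (Suc d) q"
  shows "deg d (\<lambda>w. q (w [^]\<^bsub>G\<^esub> N) \<ominus>\<^bsub>M\<^esub> (nat_in K N [^]\<^bsub>K\<^esub> d) \<odot>\<^bsub>M\<^esub> q w)"
  using assms
proof (induction d arbitrary: q)
  case 0
  then have "q (w [^]\<^bsub>G\<^esub> N) = q w" if "w \<in> carrier G" for w
    using that deg_Suc_const by simp
  then show ?case using 0(1) by (auto simp: minus_self Pi_iff)
next
  case (Suc d)
  let ?c = "nat_in K N"
  show ?case
    unfolding degree_less.simps(2)
  proof
    fix u assume u: "u \<in> carrier G"
    define p where "p w = q (u [^]\<^bsub>G\<^esub> N \<otimes>\<^bsub>G\<^esub> w) \<ominus>\<^bsub>M\<^esub> q w" for w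
    define D where "D w = q (u \<otimes>\<^bsub>G\<^esub> w) \<ominus>\<^bsub>M\<^esub> q w" for w
    have cl: "p \<in> maps" "D \<in> maps" using Suc.prems u by (auto simp: p_def D_def Pi_iff)
    have "deg (Suc d) p" using Suc.prems u unfolding p_def by simp
    from Suc.IH[OF cl(1) this]
    have 1: "deg d (\<lambda>w. p (w [^]\<^bsub>G\<^esub> N) \<ominus>\<^bsub>M\<^esub> (?c [^]\<^bsub>K\<^esub> d) \<odot>\<^bsub>M\<^esub> p w)" .
    have "deg d (\<lambda>w. p w \<ominus>\<^bsub>M\<^esub> ?c \<odot>\<^bsub>M\<^esub> D w)"
      using deg_diff_pow[OF Suc.prems u, of N] unfolding p_def D_def .
    then have 2: "deg d (\<lambda>w. (?c [^]\<^bsub>K\<^esub> d) \<odot>\<^bsub>M\<^esub> (p w \<ominus>\<^bsub>M\<^esub> ?c \<odot>\<^bsub>M\<^esub> D w))"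
      using cl by (intro deg_smult) (auto simp: Pi_iff)
    have "deg d (\<lambda>w. (p (w [^]\<^bsub>G\<^esub> N) \<ominus>\<^bsub>M\<^esub> (?c [^]\<^bsub>K\<^esub> d) \<odot>\<^bsub>M\<^esub> p w)
        \<oplus>\<^bsub>M\<^esub> (?c [^]\<^bsub>K\<^esub> d) \<odot>\<^bsub>M\<^esub> (p w \<ominus>\<^bsub>M\<^esub> ?c \<odot>\<^bsub>M\<^esub> D w))"
      using cl 1 2 by (intro deg_add) (auto simp: Pi_iff)
    also have "?this \<longleftrightarrow> deg d (\<lambda>v. (q ((u \<otimes>\<^bsub>G\<^esub> v) [^]\<^bsub>G\<^esub> N) \<ominus>\<^bsub>M\<^esub> (?c [^]\<^bsub>K\<^esub> Suc d) \<odot>\<^bsub>M\<^esub> q (u \<otimes>\<^bsub>G\<^esub> v))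
       \<ominus>\<^bsub>M\<^esub> (q (v [^]\<^bsub>G\<^esub> N) \<ominus>\<^bsub>M\<^esub> (?c [^]\<^bsub>K\<^esub> Suc d) \<odot>\<^bsub>M\<^esub> q v))" (is "_ \<longleftrightarrow> deg d ?R")
    proof (rule degree_less_cong[OF G.is_group])
      fix w assume w: "w \<in> carrier G"
      have pD: "p w \<in> carrier M" "p (w [^]\<^bsub>G\<^esub> N) \<in> carrier M" "D w \<in> carrier M"
        using cl w by (auto simp: Pi_iff)
      have "(p (w [^]\<^bsub>G\<^esub> N) \<ominus>\<^bsub>M\<^esub> (?c [^]\<^bsub>K\<^esub> d) \<odot>\<^bsub>M\<^esub> p w)
          \<oplus>\<^bsub>M\<^esub> (?c [^]\<^bsub>K\<^esub> d) \<odot>\<^bsub>M\<^esub> (p w \<ominus>\<^bsub>M\<^esub> ?c \<odot>\<^bsub>M\<^esub> D w)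
        = p (w [^]\<^bsub>G\<^esub> N) \<ominus>\<^bsub>M\<^esub> (?c [^]\<^bsub>K\<^esub> Suc d) \<odot>\<^bsub>M\<^esub> D w"
        using pD by (simp add: minus_smult telescope M.module.smult_assoc1)
      also have "\<dots> = ?R w"
        using Suc.prems u w unfolding p_def D_def
        by (subst minus_minus_minus)
          (auto simp: Pi_iff minus_smult G.nat_pow_distrib)
      finally show "(p (w [^]\<^bsub>G\<^esub> N) \<ominus>\<^bsub>M\<^esub> (?c [^]\<^bsub>K\<^esub> d) \<odot>\<^bsub>M\<^esub> p w)
          \<oplus>\<^bsub>M\<^esub> (?c [^]\<^bsub>K\<^esub> d) \<odot>\<^bsub>M\<^esub> (p w \<ominus>\<^bsub>M\<^esub> ?c \<odot>\<^bsub>M\<^esub> D w) = ?R w" .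
    qed
    finally show "deg d ?R" .
  qed
qed

lemma dilation_defect_closed:
  assumes "q \<in> maps" "a \<in> carrier K" "\<phi> \<in> carrier G \<rightarrow> carrier G"
  shows "dilation_defect K M a \<phi> j q \<in> maps"
  using assms(1) by (induction j arbitrary: q) (use assms(2,3) in \<open>auto simp: Pi_iff\<close>)

text \<open>Each step removes the homogeneous component of top degree, by \<open>deg_dilation\<close>.\<close>

lemma dilation_defect_vanishes:
  assumes N: "nat_in K N \<noteq> \<zero>\<^bsub>K\<^esub>" and "q \<in> maps" "deg d q" "w \<in> carrier G"
  shows "dilation_defect K M (inv\<^bsub>K\<^esub> (nat_in K N)) (\<lambda>w. w [^]\<^bsub>G\<^esub> N) d q w = \<zero>\<^bsub>M\<^esub>"
  using assms(2,3)
proof (induction d arbitrary: q)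
  case 0
  then show ?case using assms(4) by simp
next
  case (Suc d)
  let ?c = "nat_in K N" let ?i = "inv\<^bsub>K\<^esub> ?c"
  have i: "?i \<in> carrier K" "?i \<otimes>\<^bsub>K\<^esub> ?c = \<one>\<^bsub>K\<^esub>"
    using N M.field_Units by (simp_all add: M.Units_l_inv)
  have ci: "(?i [^]\<^bsub>K\<^esub> d) \<otimes>\<^bsub>K\<^esub> (?c [^]\<^bsub>K\<^esub> d) = \<one>\<^bsub>K\<^esub>"
    using i by (simp flip: M.nat_pow_distrib)
  have "deg d (\<lambda>w. (\<ominus>\<^bsub>K\<^esub> (?i [^]\<^bsub>K\<^esub> d)) \<odot>\<^bsub>M\<^esub>
      (q (w [^]\<^bsub>G\<^esub> N) \<ominus>\<^bsub>M\<^esub> (?c [^]\<^bsub>K\<^esub> d) \<odot>\<^bsub>M\<^esub> q w))"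
    using Suc.prems i deg_dilation[OF Suc.prems, of N] by (intro deg_smult) (auto simp: Pi_iff)
  also have "?this \<longleftrightarrow> deg d (\<lambda>w. q w \<ominus>\<^bsub>M\<^esub> (?i [^]\<^bsub>K\<^esub> d) \<odot>\<^bsub>M\<^esub> q (w [^]\<^bsub>G\<^esub> N))"
  proof (rule degree_less_cong[OF G.is_group])
    fix w assume w: "w \<in> carrier G"
    have cl: "q w \<in> carrier M" "q (w [^]\<^bsub>G\<^esub> N) \<in> carrier M" using Suc.prems w by auto
    have "(?i [^]\<^bsub>K\<^esub> d) \<odot>\<^bsub>M\<^esub> (q (w [^]\<^bsub>G\<^esub> N) \<ominus>\<^bsub>M\<^esub> (?c [^]\<^bsub>K\<^esub> d) \<odot>\<^bsub>M\<^esub> q w)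
      = (?i [^]\<^bsub>K\<^esub> d) \<odot>\<^bsub>M\<^esub> q (w [^]\<^bsub>G\<^esub> N) \<ominus>\<^bsub>M\<^esub> q w"
      using cl i ci by (simp add: minus_smult flip: M.module.smult_assoc1)
    then have "(\<ominus>\<^bsub>K\<^esub> (?i [^]\<^bsub>K\<^esub> d)) \<odot>\<^bsub>M\<^esub> (q (w [^]\<^bsub>G\<^esub> N) \<ominus>\<^bsub>M\<^esub> (?c [^]\<^bsub>K\<^esub> d) \<odot>\<^bsub>M\<^esub> q w)
      = \<ominus>\<^bsub>M\<^esub> ((?i [^]\<^bsub>K\<^esub> d) \<odot>\<^bsub>M\<^esub> q (w [^]\<^bsub>G\<^esub> N) \<ominus>\<^bsub>M\<^esub> q w)"
      using cl i by (simp add: M.module.smult_l_minus)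
    also have "\<dots> = q w \<ominus>\<^bsub>M\<^esub> (?i [^]\<^bsub>K\<^esub> d) \<odot>\<^bsub>M\<^esub> q (w [^]\<^bsub>G\<^esub> N)"
      using cl i by (simp add: M.module.M.minus_eq M.module.M.minus_add M.module.M.a_ac)
    finally show "(\<ominus>\<^bsub>K\<^esub> (?i [^]\<^bsub>K\<^esub> d)) \<odot>\<^bsub>M\<^esub> (q (w [^]\<^bsub>G\<^esub> N) \<ominus>\<^bsub>M\<^esub> (?c [^]\<^bsub>K\<^esub> d) \<odot>\<^bsub>M\<^esub> q w)
      = q w \<ominus>\<^bsub>M\<^esub> (?i [^]\<^bsub>K\<^esub> d) \<odot>\<^bsub>M\<^esub> q (w [^]\<^bsub>G\<^esub> N)" .
  qed
  finally show ?case
    using Suc.prems i by (simp, intro Suc.IH) (auto simp: Pi_iff)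
qed

text \<open>The difference between \<open>q\<close> and its defect involves only proper dilates of \<open>q\<close>. Their degrees
  are bounded by that of \<open>q \<circ> \<phi>\<close>.\<close>

lemma deg_minus_dilation_defect:
  assumes a: "a \<in> carrier K" and \<phi>: "\<phi> \<in> hom G G" and "q \<in> maps" "deg e (\<lambda>w. q (\<phi> w))"
  shows "deg e (\<lambda>w. q w \<ominus>\<^bsub>M\<^esub> dilation_defect K M a \<phi> j q w)"
  using assms(3,4)
proof (induction j arbitrary: q)
  case 0
  then show ?case using deg_zero[of e]
    by (subst degree_less_cong[OF G.is_group, where q' = "\<lambda>v. \<zero>\<^bsub>M\<^esub>"]) (auto simp: Pi_iff minus_self)
next
  case (Suc j)
  have \<phi>c: "\<phi> w \<in> carrier G" if "w \<in> carrier G" for w using \<phi> that by (auto simp: hom_def)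
  define q' where "q' w = q w \<ominus>\<^bsub>M\<^esub> (a [^]\<^bsub>K\<^esub> j) \<odot>\<^bsub>M\<^esub> q (\<phi> w)" for w
  have q': "q' \<in> maps" using Suc.prems a \<phi>c by (auto simp: q'_def Pi_iff)
  have 1: "deg e (\<lambda>w. (a [^]\<^bsub>K\<^esub> j) \<odot>\<^bsub>M\<^esub> q (\<phi> w))"
    using Suc.prems a \<phi>c by (intro deg_smult) (auto simp: Pi_iff)
  have "deg e (\<lambda>w. (a [^]\<^bsub>K\<^esub> j) \<odot>\<^bsub>M\<^esub> q (\<phi> (\<phi> w)))"
    using degree_less_hom[OF G.is_group G.is_group \<phi> 1] .
  then have "deg e (\<lambda>w. q' (\<phi> w))"
    unfolding q'_def using Suc.prems a \<phi>c by (intro deg_minus) (auto simp: Pi_iff)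
  note IH = Suc.IH[OF q' this]
  have L: "dilation_defect K M a \<phi> j q' \<in> maps"
    using q' a \<phi>c by (intro dilation_defect_closed) auto
  have "deg e (\<lambda>w. (a [^]\<^bsub>K\<^esub> j) \<odot>\<^bsub>M\<^esub> q (\<phi> w) \<oplus>\<^bsub>M\<^esub>
      (q' w \<ominus>\<^bsub>M\<^esub> dilation_defect K M a \<phi> j q' w))"
    using Suc.prems a \<phi>c L q' 1 IH by (intro deg_add) (auto simp: Pi_iff)
  also have "?this \<longleftrightarrow> deg e (\<lambda>w. q w \<ominus>\<^bsub>M\<^esub> dilation_defect K M a \<phi> j q' w)"
  proof (rule degree_less_cong[OF G.is_group])
    fix w assume w: "w \<in> carrier G"
    have cl: "q w \<in> carrier M" "q (\<phi> w) \<in> carrier M" "dilation_defect K M a \<phi> j q' w \<in> carrier M"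
      "q' w \<in> carrier M"
      using w \<phi>c Suc.prems L q' by auto
    have "(a [^]\<^bsub>K\<^esub> j) \<odot>\<^bsub>M\<^esub> q (\<phi> w) = q w \<ominus>\<^bsub>M\<^esub> q' w"
      unfolding q'_def using cl a
      by (simp add: M.module.M.minus_eq M.module.M.minus_add M.module.M.r_neg2
          flip: M.module.M.a_assoc) (simp add: M.module.M.r_neg)
    then show "(a [^]\<^bsub>K\<^esub> j) \<odot>\<^bsub>M\<^esub> q (\<phi> w) \<oplus>\<^bsub>M\<^esub>
      (q' w \<ominus>\<^bsub>M\<^esub> dilation_defect K M a \<phi> j q' w) = q w \<ominus>\<^bsub>M\<^esub> dilation_defect K M a \<phi> j q' w"
      using cl by (simp add: telescope)
  qed
  finally show ?case by (simp add: q'_def[abs_def])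
qed

text \<open>The differences of a periodic polynomial map have lower degree, hence are constant by
  induction; so the map is affine, and its linear part vanishes on the periods.\<close>

lemma periodic_deg_const:
  assumes "q \<in> maps" "deg d q" and H: "no_homs G M H" "H \<subseteq> carrier G"
    and "\<And>h v. \<lbrakk>h \<in> H; v \<in> carrier G\<rbrakk> \<Longrightarrow> q (h \<otimes>\<^bsub>G\<^esub> v) = q v"
    and "v \<in> carrier G"
  shows "q v = q \<one>\<^bsub>G\<^esub>"
  using assms(1,2,5,6)
proof (induction d arbitrary: q v)
  case 0
  then show ?case by simp
next
  case (Suc d)
  have cl: "q v \<in> carrier M" if "v \<in> carrier G" for v using Suc.prems that by auto
  have const: "q (u \<otimes>\<^bsub>G\<^esub> v) \<ominus>\<^bsub>M\<^esub> q v = q u \<ominus>\<^bsub>M\<^esub> q \<one>\<^bsub>G\<^esub>"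
    if u: "u \<in> carrier G" and v: "v \<in> carrier G" for u v
  proof -
    define D where "D v = q (u \<otimes>\<^bsub>G\<^esub> v) \<ominus>\<^bsub>M\<^esub> q v" for v
    have "D v = D \<one>\<^bsub>G\<^esub>"
    proof (rule Suc.IH)
      show "deg d D" using Suc.prems(2) u by (simp add: D_def[abs_def])
      show "D \<in> maps" using u cl by (auto simp: D_def)
      fix h v assume hv: "h \<in> H" "v \<in> carrier G"
      then have "u \<otimes>\<^bsub>G\<^esub> (h \<otimes>\<^bsub>G\<^esub> v) = h \<otimes>\<^bsub>G\<^esub> (u \<otimes>\<^bsub>G\<^esub> v)"
        using u H(2) by (intro G.m_lcomm) auto
      then show "D (h \<otimes>\<^bsub>G\<^esub> v) = D v" using hv u Suc.prems(3) by (simp add: D_def)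
    qed (rule v)
    then show ?thesis using u by (simp add: D_def)
  qed
  have "(\<lambda>u. q u \<ominus>\<^bsub>M\<^esub> q \<one>\<^bsub>G\<^esub>) \<in> hom G (add_monoid M)"
  proof (rule homI)
    fix u v assume uv: "u \<in> carrier G" "v \<in> carrier G"
    then show "q (u \<otimes>\<^bsub>G\<^esub> v) \<ominus>\<^bsub>M\<^esub> q \<one>\<^bsub>G\<^esub>
        = (q u \<ominus>\<^bsub>M\<^esub> q \<one>\<^bsub>G\<^esub>) \<otimes>\<^bsub>add_monoid M\<^esub> (q v \<ominus>\<^bsub>M\<^esub> q \<one>\<^bsub>G\<^esub>)"
      using const[OF uv] cl by (simp add: telescope flip: const[OF uv])
  qed (use cl in auto)
  moreover have "q h \<ominus>\<^bsub>M\<^esub> q \<one>\<^bsub>G\<^esub> = \<zero>\<^bsub>M\<^esub>" if "h \<in> H" for h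
    using Suc.prems(3)[of h "\<one>\<^bsub>G\<^esub>"] that H(2) cl by (auto simp: minus_self)
  ultimately have "q v \<ominus>\<^bsub>M\<^esub> q \<one>\<^bsub>G\<^esub> = \<zero>\<^bsub>M\<^esub>"
    using H(1) Suc.prems(4) unfolding no_homs_def by fast
  then show ?case using cl Suc.prems(4) by (simp add: minus_zero_iff)
qed

text \<open>The differences of \<open>q\<close> by elements of \<open>H\<close> vanish on the same coset and have lower degree, so they
  vanish by induction. Hence \<open>q\<close> is periodic, and therefore constant.\<close>

lemma deg_vanishes_if_on_coset:
  assumes "q \<in> maps" "deg d q" and H: "no_homs G M H" "subgroup H G" and v0: "v0 \<in> carrier G"
    and "\<And>h. h \<in> H \<Longrightarrow> q (v0 \<otimes>\<^bsub>G\<^esub> h) = \<zero>\<^bsub>M\<^esub>" and "v \<in> carrier G"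
  shows "q v = \<zero>\<^bsub>M\<^esub>"
  using assms(1,2,6,7)
proof (induction d arbitrary: q v)
  case 0
  then show ?case by simp
next
  case (Suc d)
  interpret H: subgroup H G by fact
  have cl: "q v \<in> carrier M" if "v \<in> carrier G" for v using Suc.prems that by auto
  have per: "q (k \<otimes>\<^bsub>G\<^esub> v) = q v" if k: "k \<in> H" and v: "v \<in> carrier G" for k v
  proof -
    have "q (k \<otimes>\<^bsub>G\<^esub> v) \<ominus>\<^bsub>M\<^esub> q v = \<zero>\<^bsub>M\<^esub>"
    proof (rule Suc.IH[of "\<lambda>v. q (k \<otimes>\<^bsub>G\<^esub> v) \<ominus>\<^bsub>M\<^esub> q v"])
      show "deg d (\<lambda>v. q (k \<otimes>\<^bsub>G\<^esub> v) \<ominus>\<^bsub>M\<^esub> q v)" using Suc.prems(2) k by simp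
      show "(\<lambda>v. q (k \<otimes>\<^bsub>G\<^esub> v) \<ominus>\<^bsub>M\<^esub> q v) \<in> maps" using k cl by auto
      fix h assume h: "h \<in> H"
      have "k \<otimes>\<^bsub>G\<^esub> (v0 \<otimes>\<^bsub>G\<^esub> h) = v0 \<otimes>\<^bsub>G\<^esub> (k \<otimes>\<^bsub>G\<^esub> h)"
        using k h v0 by (intro G.m_lcomm) auto
      then show "q (k \<otimes>\<^bsub>G\<^esub> (v0 \<otimes>\<^bsub>G\<^esub> h)) \<ominus>\<^bsub>M\<^esub> q (v0 \<otimes>\<^bsub>G\<^esub> h) = \<zero>\<^bsub>M\<^esub>"
        using k h Suc.prems(3) by (simp add: minus_self)
    qed (rule v)
    then show ?thesis using k v cl by (simp add: minus_zero_iff)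
  qed
  have "q v = q v0"
    using periodic_deg_const[OF Suc.prems(1,2) H(1) H.subset per] Suc.prems(4) v0 by metis
  then show ?case using Suc.prems(3)[OF H.one_closed] v0 by simp
qed

text \<open>By periodicity in the second variable, \<open>r(-, v)\<close> agrees on the coset of \<open>v\<close> with the restriction of
  \<open>r\<close> to the diagonal.\<close>

lemma bipoly_vanishes_if_on_diagonal:
  assumes r: "\<And>u v. \<lbrakk>u \<in> carrier G; v \<in> carrier G\<rbrakk> \<Longrightarrow> r u v \<in> carrier M"
    and poly: "\<And>v. v \<in> carrier G \<Longrightarrow> \<exists>d. deg d (\<lambda>u. r u v)"
    and H: "no_homs G M H" "subgroup H G"
    and per: "\<And>u v h. \<lbrakk>u \<in> carrier G; v \<in> carrier G; h \<in> H\<rbrakk> \<Longrightarrow> r u (v \<otimes>\<^bsub>G\<^esub> h) = r u v"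
    and diag: "\<And>u. u \<in> carrier G \<Longrightarrow> r u u = \<zero>\<^bsub>M\<^esub>"
    and uv: "u \<in> carrier G" "v \<in> carrier G"
  shows "r u v = \<zero>\<^bsub>M\<^esub>"
proof -
  interpret H: subgroup H G by fact
  obtain d where "deg d (\<lambda>u. r u v)" using poly uv by blast
  then show ?thesis
  proof (rule deg_vanishes_if_on_coset[rotated, OF _ H uv(2) _ uv(1)])
    fix h assume h: "h \<in> H"
    have "r (v \<otimes>\<^bsub>G\<^esub> h) v = r (v \<otimes>\<^bsub>G\<^esub> h) (v \<otimes>\<^bsub>G\<^esub> h)" using per uv h by simp
    then show "r (v \<otimes>\<^bsub>G\<^esub> h) v = \<zero>\<^bsub>M\<^esub>" using diag uv h by simp
  qed (use r uv in auto)
qed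

lemma hom_nat_pow:
  assumes "a \<in> hom G (add_monoid M)" "v \<in> carrier G"
  shows "a (v [^]\<^bsub>G\<^esub> n) = nat_in K n \<odot>\<^bsub>M\<^esub> a v"
proof -
  have av: "a v \<in> carrier M" using assms by (auto simp: hom_def)
  have "a \<one>\<^bsub>G\<^esub> = \<zero>\<^bsub>M\<^esub>" using hom_one[OF assms(1) G.is_group M.module.M.a_group] by simp
  then show ?thesis
    by (induction n) (use assms av in \<open>auto simp: hom_def M.module.smult_l_distr M.module.M.a_comm\<close>)
qed

text \<open>If \<open>a\<close> vanishes on \<open>H\<close>, then \<open>N a(u) = a(N u) = 0\<close>.\<close>

lemma no_homs_pow:
  assumes "nat_in K N \<noteq> \<zero>\<^bsub>K\<^esub>" "\<And>v. v \<in> carrier G \<Longrightarrow> v [^]\<^bsub>G\<^esub> N \<in> H"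
  shows "no_homs G M H"
  unfolding no_homs_def
proof (intro ballI impI)
  fix a u assume a: "a \<in> hom G (add_monoid M)" "\<forall>h\<in>H. a h = \<zero>\<^bsub>M\<^esub>" and u: "u \<in> carrier G"
  have "nat_in K N \<odot>\<^bsub>M\<^esub> a u = \<zero>\<^bsub>M\<^esub>" using hom_nat_pow[OF a(1) u, of N] a(2) assms(2)[OF u] by simp
  moreover have "a u \<in> carrier M" using a(1) u by (auto simp: hom_def)
  ultimately show "a u = \<zero>\<^bsub>M\<^esub>"
    using assms(1) smult_0_iff[of "nat_in K N" "a u"] by simp
qed

text \<open>If the restrictions of \<open>f\<close> to the cosets of \<open>H\<close> are polynomial, then they have polynomial
  extensions to the whole group, and \<open>bi_ext d N f u v\<close> is the value at \<open>u\<close> of the extension of the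
  restriction of \<open>f\<close> to the coset of \<open>v\<close>.\<close>

definition bi_ext where
  "bi_ext d N f u v = f (v \<otimes>\<^bsub>G\<^esub> (u \<otimes>\<^bsub>G\<^esub> inv\<^bsub>G\<^esub> v)) \<ominus>\<^bsub>M\<^esub>
    dilation_defect K M (inv\<^bsub>K\<^esub> (nat_in K N)) (\<lambda>w. w [^]\<^bsub>G\<^esub> N) d (\<lambda>w. f (v \<otimes>\<^bsub>G\<^esub> w)) (u \<otimes>\<^bsub>G\<^esub> inv\<^bsub>G\<^esub> v)"

lemma bi_ext:
  assumes N: "nat_in K N \<noteq> \<zero>\<^bsub>K\<^esub>" "\<And>v. v \<in> carrier G \<Longrightarrow> v [^]\<^bsub>G\<^esub> N \<in> H" and H: "subgroup H G"
    and f: "f \<in> maps"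
    and deg: "\<And>v. v \<in> carrier G \<Longrightarrow> degree_less (G\<lparr>carrier := H\<rparr>) M d (\<lambda>w. f (v \<otimes>\<^bsub>G\<^esub> w))"
  shows "\<And>u v. \<lbrakk>u \<in> carrier G; v \<in> carrier G\<rbrakk> \<Longrightarrow> bi_ext d N f u v \<in> carrier M"
    and "\<And>v. v \<in> carrier G \<Longrightarrow> deg d (\<lambda>u. bi_ext d N f u v)"
    and "\<And>u v h. \<lbrakk>u \<in> carrier G; v \<in> carrier G; h \<in> H\<rbrakk>
      \<Longrightarrow> bi_ext d N f u (v \<otimes>\<^bsub>G\<^esub> h) = bi_ext d N f u v"
    and "\<And>u. u \<in> carrier G \<Longrightarrow> bi_ext d N f u u = f u"
proof -
  interpret H: subgroup H G by fact
  let ?i = "inv\<^bsub>K\<^esub> (nat_in K N)" let ?\<phi> = "\<lambda>w. w [^]\<^bsub>G\<^esub> N"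
  let ?H = "G\<lparr>carrier := H\<rparr>"
  interpret Hg: comm_group ?H
    using group.group_comm_groupI[OF G.subgroup_imp_group[OF H]] G.m_comm by simp
  interpret PH: poly_maps ?H K M by intro_locales
  have i: "?i \<in> carrier K" using N(1) M.field_Units by simp
  have fv: "(\<lambda>w. f (v \<otimes>\<^bsub>G\<^esub> w)) \<in> maps" if "v \<in> carrier G" for v using f that by auto
  show 1: "bi_ext d N f u v \<in> carrier M" if "u \<in> carrier G" "v \<in> carrier G" for u v
    using dilation_defect_closed[OF fv[OF that(2)] i, of ?\<phi> d] that f unfolding bi_ext_def
    by (auto simp: Pi_iff)
  \<comment> \<open>On \<open>H\<close> itself the defect vanishes, so nothing is subtracted on the coset of \<open>v\<close>.\<close>
  have on_coset: "bi_ext d N f (v \<otimes>\<^bsub>G\<^esub> h) v = f (v \<otimes>\<^bsub>G\<^esub> h)" if v: "v \<in> carrier G" and h: "h \<in> H" for v h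
  proof -
    have "dilation_defect K M ?i ?\<phi> d (\<lambda>w. f (v \<otimes>\<^bsub>G\<^esub> w)) h = \<zero>\<^bsub>M\<^esub>"
      using PH.dilation_defect_vanishes[OF N(1) _ deg[OF v], of h] f v h
      by (auto simp: Pi_iff G.nat_pow_consistent[symmetric])
    moreover have "v \<otimes>\<^bsub>G\<^esub> h \<otimes>\<^bsub>G\<^esub> inv\<^bsub>G\<^esub> v = h" using v h by (simp add: G.m_ac)
    moreover have "f (v \<otimes>\<^bsub>G\<^esub> h) \<in> carrier M" using f v h by auto
    ultimately show ?thesis by (simp add: bi_ext_def M.module.M.minus_eq)
  qed
  show "bi_ext d N f u u = f u" if "u \<in> carrier G" for u
    using on_coset[OF that H.one_closed] that by simp
  show 2: "deg d (\<lambda>u. bi_ext d N f u v)" if v: "v \<in> carrier G" for v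
  proof -
    define Q where "Q w = f (v \<otimes>\<^bsub>G\<^esub> w) \<ominus>\<^bsub>M\<^esub> dilation_defect K M ?i ?\<phi> d (\<lambda>w. f (v \<otimes>\<^bsub>G\<^esub> w)) w" for w
    have "?\<phi> \<in> hom G ?H" using N(2) by (auto simp: hom_def G.nat_pow_distrib)
    from degree_less_hom[OF Hg.is_group G.is_group this deg[OF v]]
    have "deg d Q"
      unfolding Q_def using fv[OF v] i pow_hom by (intro deg_minus_dilation_defect) auto
    moreover have "Q \<in> maps"
      using dilation_defect_closed[OF fv[OF v] i, of ?\<phi> d] fv[OF v] v unfolding Q_def
      by (auto simp: Pi_iff)
    ultimately have "deg d (\<lambda>u. Q (inv\<^bsub>G\<^esub> v \<otimes>\<^bsub>G\<^esub> u))" using v by (intro deg_shift) auto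
    then show ?thesis
      using v by (subst degree_less_cong[OF G.is_group]) (auto simp: bi_ext_def Q_def G.m_comm)
  qed
  show "bi_ext d N f u (v \<otimes>\<^bsub>G\<^esub> h) = bi_ext d N f u v"
    if u: "u \<in> carrier G" and v: "v \<in> carrier G" and h: "h \<in> H" for u v h
  proof -
    have vh: "v \<otimes>\<^bsub>G\<^esub> h \<in> carrier G" using v h by simp
    have "bi_ext d N f u (v \<otimes>\<^bsub>G\<^esub> h) \<ominus>\<^bsub>M\<^esub> bi_ext d N f u v = \<zero>\<^bsub>M\<^esub>"
    proof (rule deg_vanishes_if_on_coset[OF _ _ no_homs_pow[OF N] H v _ u,
          where q = "\<lambda>u. bi_ext d N f u (v \<otimes>\<^bsub>G\<^esub> h) \<ominus>\<^bsub>M\<^esub> bi_ext d N f u v"])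
      show "(\<lambda>u. bi_ext d N f u (v \<otimes>\<^bsub>G\<^esub> h) \<ominus>\<^bsub>M\<^esub> bi_ext d N f u v) \<in> maps" using 1 v vh by auto
      show "deg d (\<lambda>u. bi_ext d N f u (v \<otimes>\<^bsub>G\<^esub> h) \<ominus>\<^bsub>M\<^esub> bi_ext d N f u v)"
        using 1 2 v vh by (intro deg_minus) auto
      fix k assume k: "k \<in> H"
      have "v \<otimes>\<^bsub>G\<^esub> k = (v \<otimes>\<^bsub>G\<^esub> h) \<otimes>\<^bsub>G\<^esub> (inv\<^bsub>G\<^esub> h \<otimes>\<^bsub>G\<^esub> k)"
        using v h k by (simp add: G.m_assoc G.inv_solve_left')
          (metis G.inv_solve_left H.mem_carrier G.m_closed G.inv_closed)
      then have "bi_ext d N f (v \<otimes>\<^bsub>G\<^esub> k) (v \<otimes>\<^bsub>G\<^esub> h) = f (v \<otimes>\<^bsub>G\<^esub> k)"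
        using on_coset[OF vh, of "inv\<^bsub>G\<^esub> h \<otimes>\<^bsub>G\<^esub> k"] h k by simp
      then show "bi_ext d N f (v \<otimes>\<^bsub>G\<^esub> k) (v \<otimes>\<^bsub>G\<^esub> h) \<ominus>\<^bsub>M\<^esub> bi_ext d N f (v \<otimes>\<^bsub>G\<^esub> k) v = \<zero>\<^bsub>M\<^esub>"
        using on_coset[OF v k] 1[of "v \<otimes>\<^bsub>G\<^esub> k" v] v k by (simp add: minus_self)
    qed
    then show ?thesis using 1 u v vh by (simp add: minus_zero_iff)
  qed
qed

end

section \<open>Deviations\<close>

text \<open>A deviation is an iterated difference, evaluated at the neutral element.\<close>

lemma deviation_Suc:
  assumes U: "comm_group U" and V: "comm_group V" and f: "f \<in> carrier U \<rightarrow> carrier V"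
    and u: "u \<in> {1..Suc d} \<rightarrow> carrier U"
  shows "deviation U V (Suc d) f u
    = deviation U V d (\<lambda>x. f (u (Suc d) \<otimes>\<^bsub>U\<^esub> x) \<otimes>\<^bsub>V\<^esub> inv\<^bsub>V\<^esub> f x) u"
proof -
  interpret U: comm_group U by fact
  interpret V: comm_group V by fact
  let ?e = "\<lambda>I. (- 1 :: int) ^ (d - card I)"
  have uI: "(\<Otimes>\<^bsub>U\<^esub>i\<in>I. u i) \<in> carrier U" if "I \<subseteq> {1..Suc d}" for I
    using that u by (intro U.finprod_closed) auto
  have fI: "f (\<Otimes>\<^bsub>U\<^esub>i\<in>I. u i) \<in> carrier V" if "I \<subseteq> {1..Suc d}" for I
    using uI[OF that] f by auto
  have sub: "I \<subseteq> {1..Suc d}" "Suc d \<notin> I" "finite I" "card I \<le> d" "insert (Suc d) I \<subseteq> {1..Suc d}"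
    if "I \<in> Pow {1..d}" for I
    using that card_mono[of "{1..d}" I] by (auto dest: finite_subset)
  have ins: "(\<Otimes>\<^bsub>U\<^esub>i\<in>insert (Suc d) I. u i) = u (Suc d) \<otimes>\<^bsub>U\<^esub> (\<Otimes>\<^bsub>U\<^esub>i\<in>I. u i)"
    if "I \<in> Pow {1..d}" for I
    using u sub[OF that] by (intro U.finprod_insert) auto
  let ?g = "\<lambda>I. f (\<Otimes>\<^bsub>U\<^esub>i\<in>I. u i) [^]\<^bsub>V\<^esub> ((- 1 :: int) ^ (Suc d - card I))"
  have Pow: "Pow {1..Suc d} = Pow {1..d} \<union> insert (Suc d) ` Pow {1..d}"
    by (simp add: atLeastAtMostSuc_conv Pow_insert)
  have "deviation U V (Suc d) f u
      = (\<Otimes>\<^bsub>V\<^esub>I\<in>Pow {1..d}. ?g I) \<otimes>\<^bsub>V\<^esub> (\<Otimes>\<^bsub>V\<^esub>I\<in>insert (Suc d) ` Pow {1..d}. ?g I)"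
    unfolding deviation_def Pow using fI sub
    by (intro V.finprod_Un_disjoint) (auto intro!: V.int_pow_closed)
  also have "(\<Otimes>\<^bsub>V\<^esub>I\<in>insert (Suc d) ` Pow {1..d}. ?g I) = (\<Otimes>\<^bsub>V\<^esub>I\<in>Pow {1..d}. ?g (insert (Suc d) I))"
  proof (rule V.finprod_reindex)
    show "inj_on (insert (Suc d)) (Pow {1..d})"
      by (rule inj_onI) (metis insert_ident sub(2))
    show "?g \<in> insert (Suc d) ` Pow {1..d} \<rightarrow> carrier V"
      using fI[OF sub(5)] by (intro funcsetI) (auto intro!: V.int_pow_closed)
  qed
  also have "(\<Otimes>\<^bsub>V\<^esub>I\<in>Pow {1..d}. ?g I) \<otimes>\<^bsub>V\<^esub> (\<Otimes>\<^bsub>V\<^esub>I\<in>Pow {1..d}. ?g (insert (Suc d) I))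
      = (\<Otimes>\<^bsub>V\<^esub>I\<in>Pow {1..d}. ?g I \<otimes>\<^bsub>V\<^esub> ?g (insert (Suc d) I))"
    using fI sub(1,5) by (intro V.finprod_multf[symmetric]) (auto intro!: V.int_pow_closed)
  also have "\<dots> = deviation U V d (\<lambda>x. f (u (Suc d) \<otimes>\<^bsub>U\<^esub> x) \<otimes>\<^bsub>V\<^esub> inv\<^bsub>V\<^esub> f x) u"
    unfolding deviation_def
  proof (rule V.finprod_cong')
    fix I assume I: "I \<in> Pow {1..d}"
    have "(- 1 :: int) ^ (Suc d - card I) = - ?e I" using sub(4)[OF I] by (simp add: Suc_diff_le)
    moreover have "(- 1 :: int) ^ (Suc d - card (insert (Suc d) I)) = ?e I" using sub[OF I] by simp
    ultimately show "?g I \<otimes>\<^bsub>V\<^esub> ?g (insert (Suc d) I)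
        = (f (u (Suc d) \<otimes>\<^bsub>U\<^esub> (\<Otimes>\<^bsub>U\<^esub>i\<in>I. u i)) \<otimes>\<^bsub>V\<^esub> inv\<^bsub>V\<^esub> f (\<Otimes>\<^bsub>U\<^esub>i\<in>I. u i)) [^]\<^bsub>V\<^esub> ?e I"
      using fI[OF sub(1)[OF I]] fI[OF sub(5)[OF I]] ins[OF I]
      by (simp add: V.int_pow_distrib V.int_pow_neg V.int_pow_inv V.m_comm)
  next
    show "(\<lambda>I. (f (u (Suc d) \<otimes>\<^bsub>U\<^esub> (\<Otimes>\<^bsub>U\<^esub>i\<in>I. u i)) \<otimes>\<^bsub>V\<^esub> inv\<^bsub>V\<^esub> f (\<Otimes>\<^bsub>U\<^esub>i\<in>I. u i)) [^]\<^bsub>V\<^esub> ?e I)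
        \<in> Pow {1..d} \<rightarrow> carrier V"
      using fI sub(1,5) by (auto simp flip: ins intro!: V.int_pow_closed)
  qed simp
  finally show ?thesis .
qed

lemma deviation_cong:
  assumes U: "comm_group U" and V: "comm_group V" and f: "f \<in> carrier U \<rightarrow> carrier V"
    and u: "u \<in> {1..d} \<rightarrow> carrier U" "\<And>i. i \<in> {1..d} \<Longrightarrow> u i = u' i"
  shows "deviation U V d f u = deviation U V d f u'"
proof -
  interpret U: comm_group U by fact
  interpret V: comm_group V by fact
  have eq: "(\<Otimes>\<^bsub>U\<^esub>i\<in>I. u i) = (\<Otimes>\<^bsub>U\<^esub>i\<in>I. u' i)" if "I \<in> Pow {1..d}" for I
    using that u by (intro U.finprod_cong') (auto simp: Pi_iff subset_iff)
  have "(\<Otimes>\<^bsub>U\<^esub>i\<in>I. u' i) \<in> carrier U" if "I \<in> Pow {1..d}" for I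
    using that u by (intro U.finprod_closed) (auto simp: Pi_iff subset_iff)
  then show ?thesis
    unfolding deviation_def using eq f
    by (intro V.finprod_cong') (auto simp: Pi_iff intro!: V.int_pow_closed)
qed

lemma (in poly_maps) polynomial_map_iff_deg:
  assumes W: "comm_group W" "carrier W = carrier M" "monoid.mult W = ring.add M" "one W = \<zero>\<^bsub>M\<^esub>"
    and f: "f \<in> maps"
  shows "polynomial_map G W d f \<longleftrightarrow> deg (Suc d) f"
  using f
proof (induction d arbitrary: f)
  interpret W: comm_group W by fact
  have minus: "x \<otimes>\<^bsub>W\<^esub> inv\<^bsub>W\<^esub> y = x \<ominus>\<^bsub>M\<^esub> y" for x y
    using W(2-4) by (simp add: a_minus_def a_inv_def m_inv_def)
  {
    case 0
    have "deviation G W (Suc 0) f u = f (u 1) \<ominus>\<^bsub>M\<^esub> f \<one>\<^bsub>G\<^esub>" if "u \<in> {1..1} \<rightarrow> carrier G" for u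
    proof -
      have cl: "f (u 1) \<in> carrier M" "f \<one>\<^bsub>G\<^esub> \<in> carrier M" using that 0 by auto
      have "f \<in> carrier G \<rightarrow> carrier W" using 0 W by simp
      then have "deviation G W (Suc 0) f u
          = deviation G W 0 (\<lambda>x. f (u 1 \<otimes>\<^bsub>G\<^esub> x) \<ominus>\<^bsub>M\<^esub> f x) u"
        using deviation_Suc[of G W f u 0] that W(1) G.comm_group_axioms by (simp add: minus)
      also have "\<dots> = f (u 1) \<ominus>\<^bsub>M\<^esub> f \<one>\<^bsub>G\<^esub>"
        using that cl W(2) W.finprod_insert[of "{}" "{}"] by (auto simp: deviation_def Pi_iff)
      finally show ?thesis .
    qed
    then have "polynomial_map G W 0 f \<longleftrightarrow> (\<forall>u\<in>{1..1} \<rightarrow> carrier G. f (u (1::nat)) \<ominus>\<^bsub>M\<^esub> f \<one>\<^bsub>G\<^esub> = \<zero>\<^bsub>M\<^esub>)"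
      by (simp add: polynomial_map_def W)
    also have "\<dots> \<longleftrightarrow> (\<forall>v\<in>carrier G. f v = f \<one>\<^bsub>G\<^esub>)"
    proof safe
      fix v assume *: "\<forall>u\<in>{1..1} \<rightarrow> carrier G. f (u (1::nat)) \<ominus>\<^bsub>M\<^esub> f \<one>\<^bsub>G\<^esub> = \<zero>\<^bsub>M\<^esub>" "v \<in> carrier G"
      then show "f v = f \<one>\<^bsub>G\<^esub>" using bspec[OF *(1), of "\<lambda>_. v"] 0 by (simp add: minus_zero_iff Pi_iff)
    next
      fix u :: "nat \<Rightarrow> 'a" assume *: "\<forall>v\<in>carrier G. f v = f \<one>\<^bsub>G\<^esub>" and u: "u \<in> {1..1} \<rightarrow> carrier G"
      have "f (u 1) = f \<one>\<^bsub>G\<^esub>" using u by (intro bspec[OF *]) auto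
      then show "f (u 1) \<ominus>\<^bsub>M\<^esub> f \<one>\<^bsub>G\<^esub> = \<zero>\<^bsub>M\<^esub>" using 0 by (auto simp: minus_self Pi_iff)
    qed
    also have "\<dots> \<longleftrightarrow> deg (Suc 0) f"
    proof
      assume *: "\<forall>v\<in>carrier G. f v = f \<one>\<^bsub>G\<^esub>"
      then have "f (u \<otimes>\<^bsub>G\<^esub> v) = f v" if "u \<in> carrier G" "v \<in> carrier G" for u v
        using that bspec[OF *] G.m_closed by metis
      then have "f (u \<otimes>\<^bsub>G\<^esub> v) \<ominus>\<^bsub>M\<^esub> f v = \<zero>\<^bsub>M\<^esub>" if "u \<in> carrier G" "v \<in> carrier G" for u v
        using that 0 by (simp add: minus_self Pi_iff)
      then show "deg (Suc 0) f" by simp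
    next
      assume "deg (Suc 0) f"
      then show "\<forall>v\<in>carrier G. f v = f \<one>\<^bsub>G\<^esub>" using deg_Suc_const[OF 0] by blast
    qed
    finally show ?case .
  next
    case (Suc d)
    let ?D = "\<lambda>w v. f (w \<otimes>\<^bsub>G\<^esub> v) \<ominus>\<^bsub>M\<^esub> f v"
    have D: "?D w \<in> maps" if "w \<in> carrier G" for w using that Suc.prems by auto
    have dev: "deviation G W (d + 2) f u = deviation G W (d + 1) (?D (u (d + 2))) u"
      if "u \<in> {1..d + 2} \<rightarrow> carrier G" for u
    proof -
      have "f \<in> carrier G \<rightarrow> carrier W" using Suc.prems W by simp
      then show ?thesis
        using deviation_Suc[of G W f u "d + 1"] that W(1) G.comm_group_axioms by (simp add: minus)
    qed
    have "polynomial_map G W (Suc d) f \<longleftrightarrow> (\<forall>w\<in>carrier G. polynomial_map G W d (?D w))"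
    proof
      assume *: "polynomial_map G W (Suc d) f"
      show "\<forall>w\<in>carrier G. polynomial_map G W d (?D w)"
        unfolding polynomial_map_def
      proof (intro ballI)
        fix w u assume w: "w \<in> carrier G" and u: "u \<in> {1..d + 1} \<rightarrow> carrier G"
        let ?u = "u(d + 2 := w)"
        have u': "?u \<in> {1..d + 2} \<rightarrow> carrier G" using w u by (auto simp: Pi_iff)
        have "deviation G W (d + 1) (?D w) u = deviation G W (d + 1) (?D w) ?u"
          using w u D[OF w] W by (intro deviation_cong G.comm_group_axioms) auto
        also have "\<dots> = deviation G W (d + 2) f ?u" using dev[OF u'] by simp
        also have "\<dots> = \<one>\<^bsub>W\<^esub>" using * u' unfolding polynomial_map_def by simp
        finally show "deviation G W (d + 1) (?D w) u = \<one>\<^bsub>W\<^esub>" .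
      qed
    next
      assume *: "\<forall>w\<in>carrier G. polynomial_map G W d (?D w)"
      show "polynomial_map G W (Suc d) f"
        unfolding polynomial_map_def
      proof
        fix u assume u: "u \<in> {1..Suc d + 1} \<rightarrow> carrier G"
        then have "u (d + 2) \<in> carrier G" "u \<in> {1..d + 1} \<rightarrow> carrier G" by (auto simp: Pi_iff)
        with * dev[of u] u show "deviation G W (Suc d + 1) f u = \<one>\<^bsub>W\<^esub>"
          unfolding polynomial_map_def by simp
      qed
    qed
    also have "\<dots> \<longleftrightarrow> (\<forall>w\<in>carrier G. deg (Suc d) (?D w))"
      by (rule ball_cong[OF refl]) (rule Suc.IH[OF D])
    also have "\<dots> \<longleftrightarrow> deg (Suc (Suc d)) f" by (rule degree_less.simps(2)[symmetric])
    finally show ?case .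
  }
qed

section \<open>Commuting operators on a finite-dimensional space\<close>

lemma (in ring) eval_replicate_one:
  assumes "x \<in> carrier R"
  shows "eval (replicate n \<one>) x \<otimes> (x \<ominus> \<one>) = x [^] n \<ominus> \<one>"
proof (induction n)
  case 0
  show ?case using assms by (simp add: minus_eq r_neg)
next
  case (Suc n)
  let ?e = "eval (replicate n \<one>) x"
  have e: "?e \<in> carrier R" using assms by (intro eval_in_carrier) auto
  have "eval (replicate (Suc n) \<one>) x = ?e \<otimes> x \<oplus> \<one>"
    unfolding replicate_Suc replicate_append_same[symmetric]
    using assms by (intro eval_append_aux) auto
  then have "eval (replicate (Suc n) \<one>) x \<otimes> (x \<ominus> \<one>) = (?e \<otimes> x \<oplus> \<one>) \<otimes> (x \<ominus> \<one>)" by simp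
  also have "\<dots> = ?e \<otimes> (x \<ominus> \<one>) \<otimes> x \<oplus> (x \<ominus> \<one>)"
    using e assms by (simp add: minus_eq l_distr r_distr l_minus r_minus m_assoc minus_add a_ac)
  also have "\<dots> = (x [^] n \<ominus> \<one>) \<otimes> x \<oplus> (x \<ominus> \<one>)" by (simp only: Suc)
  also have "\<dots> = x [^] Suc n \<ominus> \<one>"
    using assms by (simp add: minus_eq l_distr l_minus a_assoc r_neg1)
  finally show ?case .
qed

lemma (in ring) eval_replicate_one_one: "eval (replicate n \<one>) \<one> = nat_in R n"
proof (induction n)
  case (Suc n)
  have "eval (replicate (Suc n) \<one>) \<one> = eval (replicate n \<one>) \<one> \<otimes> \<one> \<oplus> \<one>"
    unfolding replicate_Suc replicate_append_same[symmetric] by (intro eval_append_aux) auto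
  then show ?case using Suc by (simp add: a_comm)
qed simp

text \<open>If the order \<open>n\<close> of the group \<open>S\<close> were zero in the field, then all elements of \<open>S\<close> would be
  roots of \<open>1 + x + \<dots> + x^(n - 1)\<close>.\<close>

lemma (in field) finite_subgroup_of_units:
  assumes S: "finite S" "S \<subseteq> carrier R" "\<one> \<in> S"
    and mult: "\<And>x y. \<lbrakk>x \<in> S; y \<in> S\<rbrakk> \<Longrightarrow> x \<otimes> y \<in> S"
    and inv: "\<And>x. x \<in> S \<Longrightarrow> \<exists>y\<in>S. y \<otimes> x = \<one>"
  shows "\<And>x. x \<in> S \<Longrightarrow> x [^] card S = \<one>" and "nat_in R (card S) \<noteq> \<zero>"
proof -
  let ?S = "\<lparr>carrier = S, monoid.mult = (\<otimes>), one = \<one>\<rparr>"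
  interpret S: group ?S
    using S mult inv by (intro groupI) (auto simp: m_assoc subset_iff)
  show pow: "x [^] card S = \<one>" if "x \<in> S" for x
    using S.pow_order_eq_1[of x] that by (simp add: order_def nat_pow_def)
  show "nat_in R (card S) \<noteq> \<zero>"
  proof
    assume 0: "nat_in R (card S) = \<zero>"
    define p where "p = replicate (card S) \<one>"
    have "card S > 0" using S by (auto simp: card_gt_0_iff)
    then have p: "p \<in> carrier (poly_ring R)" "p \<noteq> []"
      by (auto simp: p_def univ_poly_carrier[symmetric] polynomial_def)
    have "is_root p x" if "x \<in> S" for x
    proof (cases "x = \<one>")
      case True
      then show ?thesis using p 0 by (simp add: is_root_def p_def eval_replicate_one_one)
    next
      case False
      have x: "x \<in> carrier R" using that S by auto
      have e: "eval p x \<in> carrier R" using x by (intro eval_in_carrier) (auto simp: p_def)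
      have "eval p x \<otimes> (x \<ominus> \<one>) = \<zero>"
        using eval_replicate_one[OF x, of "card S"] pow[OF that] by (simp add: p_def minus_eq r_neg)
      moreover have "x \<ominus> \<one> \<noteq> \<zero>" using False x by simp
      ultimately have "eval p x = \<zero>" using e x integral[of "eval p x" "x \<ominus> \<one>"] by auto
      then show ?thesis using p x by (simp add: is_root_def)
    qed
    then have "S \<subseteq> set_mset (roots p)" using roots_mem_iff_is_root[OF p(1)] by auto
    then have "card S \<le> card (set_mset (roots p))" by (intro card_mono) auto
    also have "\<dots> \<le> size (roots p)" using size_mset_mono[OF mset_set_set_mset_msubset] by (metis size_mset_set)
    also have "\<dots> \<le> degree p" by (rule size_roots_le_degree[OF p(1)])
    finally show False using \<open>card S > 0\<close> by (simp add: p_def)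
  qed
qed

lemma (in algebraically_closed) ex_root:
  assumes "set p \<subseteq> carrier L" "length p \<ge> 2" "hd p \<noteq> \<zero>"
  shows "\<exists>a\<in>carrier L. eval p a = \<zero>"
proof -
  have p: "p \<in> carrier (poly_ring L)"
    using assms by (auto simp: univ_poly_carrier[symmetric] polynomial_def)
  then have "size (roots p) = degree p" using roots_over_carrier splitted_def by blast
  then have "roots p \<noteq> {#}" using assms(2) by auto
  then obtain a where "a \<in># roots p" by blast
  then show ?thesis using roots_mem_iff_is_root[OF p] by (auto simp: is_root_def)
qed

text \<open>Horner's scheme for applying a polynomial in the operator \<open>T\<close> to a vector.\<close>

definition op_eval :: "('k, 'v, 'f) module_scheme \<Rightarrow> ('v \<Rightarrow> 'v) \<Rightarrow> 'k list \<Rightarrow> 'v \<Rightarrow> 'v" where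
  "op_eval V T p v = foldl (\<lambda>x c. T x \<oplus>\<^bsub>V\<^esub> c \<odot>\<^bsub>V\<^esub> v) \<zero>\<^bsub>V\<^esub> p"

lemma op_eval_simps:
  "op_eval V T [] v = \<zero>\<^bsub>V\<^esub>"
  "op_eval V T (p @ [c]) v = T (op_eval V T p v) \<oplus>\<^bsub>V\<^esub> c \<odot>\<^bsub>V\<^esub> v"
  by (simp_all add: op_eval_def)

context vectorspace
begin

lemma subspaceI:
  assumes "S \<subseteq> carrier V" "\<zero>\<^bsub>V\<^esub> \<in> S" "\<And>v w. \<lbrakk>v \<in> S; w \<in> S\<rbrakk> \<Longrightarrow> v \<oplus>\<^bsub>V\<^esub> w \<in> S"
    "\<And>a v. \<lbrakk>a \<in> carrier K; v \<in> S\<rbrakk> \<Longrightarrow> a \<odot>\<^bsub>V\<^esub> v \<in> S"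
  shows "subspace K S V"
  using assms by (intro subspace.intro submodule.intro vectorspace_axioms module_axioms) auto

lemma subspaceD:
  assumes "subspace K S V"
  shows "S \<subseteq> carrier V" "\<zero>\<^bsub>V\<^esub> \<in> S" "\<And>v w. \<lbrakk>v \<in> S; w \<in> S\<rbrakk> \<Longrightarrow> v \<oplus>\<^bsub>V\<^esub> w \<in> S"
    "\<And>a v. \<lbrakk>a \<in> carrier K; v \<in> S\<rbrakk> \<Longrightarrow> a \<odot>\<^bsub>V\<^esub> v \<in> S"
    "\<And>v. v \<in> S \<Longrightarrow> \<ominus>\<^bsub>V\<^esub> v \<in> S" "\<And>v w. \<lbrakk>v \<in> S; w \<in> S\<rbrakk> \<Longrightarrow> v \<ominus>\<^bsub>V\<^esub> w \<in> S"
    "\<And>v. v \<in> S \<Longrightarrow> v \<in> carrier V"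
proof -
  interpret subspace K S V by fact
  interpret submodule K S V by (rule submod)
  show 1: "S \<subseteq> carrier V" "\<zero>\<^bsub>V\<^esub> \<in> S" and 2: "\<And>v w. \<lbrakk>v \<in> S; w \<in> S\<rbrakk> \<Longrightarrow> v \<oplus>\<^bsub>V\<^esub> w \<in> S"
    and 3: "\<And>a v. \<lbrakk>a \<in> carrier K; v \<in> S\<rbrakk> \<Longrightarrow> a \<odot>\<^bsub>V\<^esub> v \<in> S"
    using subset by auto
  show "\<And>v. v \<in> S \<Longrightarrow> v \<in> carrier V" using subset by auto
  show 4: "\<ominus>\<^bsub>V\<^esub> v \<in> S" if "v \<in> S" for v
  proof -
    have "(\<ominus>\<^bsub>K\<^esub> \<one>\<^bsub>K\<^esub>) \<odot>\<^bsub>V\<^esub> v \<in> S" using that by (intro 3) auto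
    moreover have "(\<ominus>\<^bsub>K\<^esub> \<one>\<^bsub>K\<^esub>) \<odot>\<^bsub>V\<^esub> v = \<ominus>\<^bsub>V\<^esub> v" using that 1 by (auto simp: smult_l_minus)
    ultimately show ?thesis by simp
  qed
  show "v \<ominus>\<^bsub>V\<^esub> w \<in> S" if "v \<in> S" "w \<in> S" for v w
    using 2 4 that by (simp add: M.minus_eq)
qed

lemma subspace_carrier: "subspace K (carrier V) V"
  by (rule subspaceI) auto

lemma subspace_zero: "subspace K {\<zero>\<^bsub>V\<^esub>} V"
  by (rule subspaceI) auto

lemma subspace_Int: "subspace K S V \<Longrightarrow> subspace K S' V \<Longrightarrow> subspace K (S \<inter> S') V"
  by (rule subspaceI) (auto dest: subspaceD)

lemma subspace_INT:
  assumes "subspace K M V" "\<And>i. i \<in> I \<Longrightarrow> subspace K (S i) V"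
  shows "subspace K {v \<in> M. \<forall>i\<in>I. v \<in> S i} V"
  by (rule subspaceI) (use subspaceD[OF assms(1)] subspaceD[OF assms(2)] in auto)

abbreviation endo where "endo T \<equiv> T \<in> module_hom K V V"

lemma endoD:
  assumes "endo T"
  shows "v \<in> carrier V \<Longrightarrow> T v \<in> carrier V"
    "\<lbrakk>v \<in> carrier V; w \<in> carrier V\<rbrakk> \<Longrightarrow> T (v \<oplus>\<^bsub>V\<^esub> w) = T v \<oplus>\<^bsub>V\<^esub> T w"
    "\<lbrakk>a \<in> carrier K; v \<in> carrier V\<rbrakk> \<Longrightarrow> T (a \<odot>\<^bsub>V\<^esub> v) = a \<odot>\<^bsub>V\<^esub> T v"
    "T \<zero>\<^bsub>V\<^esub> = \<zero>\<^bsub>V\<^esub>" "v \<in> carrier V \<Longrightarrow> T (\<ominus>\<^bsub>V\<^esub> v) = \<ominus>\<^bsub>V\<^esub> T v"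
    "\<lbrakk>v \<in> carrier V; w \<in> carrier V\<rbrakk> \<Longrightarrow> T (v \<ominus>\<^bsub>V\<^esub> w) = T v \<ominus>\<^bsub>V\<^esub> T w"
proof -
  interpret T: mod_hom K V V T
    by (intro mod_hom.intro mod_hom_axioms.intro module_axioms assms)
  show "v \<in> carrier V \<Longrightarrow> T v \<in> carrier V"
    "\<lbrakk>v \<in> carrier V; w \<in> carrier V\<rbrakk> \<Longrightarrow> T (v \<oplus>\<^bsub>V\<^esub> w) = T v \<oplus>\<^bsub>V\<^esub> T w"
    "\<lbrakk>a \<in> carrier K; v \<in> carrier V\<rbrakk> \<Longrightarrow> T (a \<odot>\<^bsub>V\<^esub> v) = a \<odot>\<^bsub>V\<^esub> T v"
    "T \<zero>\<^bsub>V\<^esub> = \<zero>\<^bsub>V\<^esub>" "v \<in> carrier V \<Longrightarrow> T (\<ominus>\<^bsub>V\<^esub> v) = \<ominus>\<^bsub>V\<^esub> T v"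
    "\<lbrakk>v \<in> carrier V; w \<in> carrier V\<rbrakk> \<Longrightarrow> T (v \<ominus>\<^bsub>V\<^esub> w) = T v \<ominus>\<^bsub>V\<^esub> T w"
    by (auto simp: T.f_neg T.f_minus)
qed

lemma endo_minus_smult:
  assumes T: "endo T" and a: "a \<in> carrier K"
  shows "endo (\<lambda>v. T v \<ominus>\<^bsub>V\<^esub> a \<odot>\<^bsub>V\<^esub> v)"
  unfolding module_hom_def
  using endoD[OF T] a
  by (auto simp: M.minus_eq smult_r_distr M.minus_add M.a_ac smult_r_minus smult_assoc1[symmetric] R.m_comm)

lemma subspace_vimage:
  assumes T: "endo T" and S: "subspace K S V"
  shows "subspace K {v \<in> carrier V. T v \<in> S} V"
  using endoD[OF T] subspaceD[OF S] by (intro subspaceI) auto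

text \<open>The codimension, which serves as a termination measure, computed from the largest size of a
  linearly independent subset.\<close>

lemma subspace_measure:
  assumes fd: fin_dim
  shows "\<exists>\<mu> :: 'c set \<Rightarrow> nat. \<forall>S S'. subspace K S V \<longrightarrow> subspace K S' V \<longrightarrow> S \<subset> S' \<longrightarrow> \<mu> S' < \<mu> S"
proof -
  define I where "I S = {B. B \<subseteq> S \<and> lin_indpt B}" for S
  define m where "m S = Max (card ` I S)" for S
  have fin: "finite (card ` I S)" and le: "card B \<le> dim" if "S \<subseteq> carrier V" "B \<in> I S" for S B
  proof -
    have "card ` I S \<subseteq> {..dim}" using that li_le_dim(2)[OF fd] by (auto simp: I_def)
    then show "finite (card ` I S)" by (rule finite_subset) simp
    show "card B \<le> dim" using that li_le_dim(2)[OF fd] by (auto simp: I_def)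
  qed
  have empty: "{} \<in> I S" for S by (auto simp: I_def lin_dep_def)
  have "m S < m S'" if S: "subspace K S V" "subspace K S' V" "S \<subset> S'" for S S'
  proof -
    have sub: "S \<subseteq> carrier V" "S' \<subseteq> carrier V" using subspaceD(1) S by auto
    have "m S \<in> card ` I S"
      unfolding m_def using fin[OF sub(1) empty] empty by (intro Max_in) auto
    then obtain B where B: "B \<in> I S" "m S = card B" by auto
    obtain v where v: "v \<in> S'" "v \<notin> S" using S(3) by blast
    have "span B \<subseteq> S"
      using B(1) S(1) by (intro span_is_subset) (auto simp: I_def)
    then have "v \<notin> span B" using v by blast
    moreover have "v \<notin> B" using v B(1) by (auto simp: I_def)
    ultimately have "lin_indpt (B \<union> {v})"
      using lin_dep_iff_in_span[of B v] B(1) sub v by (auto simp: I_def)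
    then have "B \<union> {v} \<in> I S'" using B(1) v S(3) by (auto simp: I_def)
    then have "card (B \<union> {v}) \<le> m S'"
      unfolding m_def using fin[OF sub(2)] by (intro Max_ge) auto
    moreover have "finite B" using B(1) sub li_le_dim(1)[OF fd] by (auto simp: I_def)
    then have "card (B \<union> {v}) = Suc (m S)" using B(2) \<open>v \<notin> B\<close> by simp
    ultimately show ?thesis by simp
  qed
  moreover have "m S \<le> dim" if "S \<subseteq> carrier V" for S
    unfolding m_def using fin[OF that empty] empty le[OF that] by (subst Max_le_iff) auto
  ultimately have "dim - m S' < dim - m S"
    if "subspace K S V" "subspace K S' V" "S \<subset> S'" for S S'
    using that subspaceD(1)[OF that(2)] by (meson diff_less_mono2 less_le_trans)
  then show ?thesis by (intro exI[of _ "\<lambda>S. dim - m S"]) blast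
qed

lemma op_eval_in:
  assumes "endo T" "subspace K M V" "T ` M \<subseteq> M" "set p \<subseteq> carrier K" "v \<in> M"
  shows "op_eval V T p v \<in> M"
  using assms(4)
  by (induction p rule: rev_induct) (use assms subspaceD[OF assms(2)] in \<open>auto simp: op_eval_simps\<close>)

text \<open>Synthetic division of \<open>p\<close> by the linear factor with root \<open>a\<close>: the remainder is the value at \<open>a\<close>.\<close>

lemma op_eval_divide:
  assumes T: "endo T" and a: "a \<in> carrier K" and p: "set p \<subseteq> carrier K"
  shows "\<exists>q. set q \<subseteq> carrier K \<and> length q = length p - 1 \<and> (2 \<le> length p \<longrightarrow> hd q = hd p) \<and>
    (\<forall>v\<in>carrier V. op_eval V T p v
      = (T (op_eval V T q v) \<ominus>\<^bsub>V\<^esub> a \<odot>\<^bsub>V\<^esub> op_eval V T q v) \<oplus>\<^bsub>V\<^esub> eval p a \<odot>\<^bsub>V\<^esub> v)"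
  using p
proof (induction p rule: rev_induct)
  case Nil
  show ?case using endoD[OF T] a
    by (intro exI[of _ "[]"]) (auto simp: op_eval_simps M.minus_eq M.r_neg)
next
  case (snoc c p)
  then have cp: "c \<in> carrier K" "set p \<subseteq> carrier K" by auto
  obtain q where q: "set q \<subseteq> carrier K" "length q = length p - 1" "2 \<le> length p \<longrightarrow> hd q = hd p"
    "\<And>v. v \<in> carrier V \<Longrightarrow> op_eval V T p v
      = (T (op_eval V T q v) \<ominus>\<^bsub>V\<^esub> a \<odot>\<^bsub>V\<^esub> op_eval V T q v) \<oplus>\<^bsub>V\<^esub> eval p a \<odot>\<^bsub>V\<^esub> v"
    using snoc cp by blast
  show ?case
  proof (cases "p = []")
    case True
    have "eval [c] a = c" using cp a by simp
    then show ?thesis using True cp a endoD[OF T]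
      by (intro exI[of _ "[]"]) (auto simp: op_eval_simps op_eval_simps(2)[of _ _ "[]", simplified] M.minus_eq)
  next
    case False
    have r: "eval p a \<in> carrier K" using cp a by (intro eval_in_carrier)
    show ?thesis
    proof (intro exI[of _ "q @ [eval p a]"] conjI ballI impI)
      show "set (q @ [eval p a]) \<subseteq> carrier K" using q r by simp
      show "length (q @ [eval p a]) = length (p @ [c]) - 1" using q(2) False by (cases p) auto
      show "hd (q @ [eval p a]) = hd (p @ [c])"
      proof (cases "length p \<ge> 2")
        case True
        then show ?thesis using q(2,3) False by (cases q) auto
      next
        case len: False
        then obtain x where x: "p = [x]" using False by (cases p) (auto simp: Suc_le_eq)
        then have "eval p a = x" using cp a by simp
        then show ?thesis using x q(2) by simp
      qed
    next
      fix v assume v: "v \<in> carrier V"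
      define Q where "Q = op_eval V T q v"
      have Q: "Q \<in> carrier V"
        unfolding Q_def using T q(1) v endoD(1)[OF T] by (intro op_eval_in subspace_carrier) auto
      have e: "eval (p @ [c]) a = eval p a \<otimes>\<^bsub>K\<^esub> a \<oplus>\<^bsub>K\<^esub> c" using cp a by (intro eval_append_aux)
      note TD = endoD[OF T]
      have "op_eval V T (p @ [c]) v
          = T ((T Q \<ominus>\<^bsub>V\<^esub> a \<odot>\<^bsub>V\<^esub> Q) \<oplus>\<^bsub>V\<^esub> eval p a \<odot>\<^bsub>V\<^esub> v) \<oplus>\<^bsub>V\<^esub> c \<odot>\<^bsub>V\<^esub> v"
        unfolding op_eval_simps q(4)[OF v] Q_def ..
      also have "\<dots> = (T (T Q) \<ominus>\<^bsub>V\<^esub> a \<odot>\<^bsub>V\<^esub> T Q) \<oplus>\<^bsub>V\<^esub> eval p a \<odot>\<^bsub>V\<^esub> T v \<oplus>\<^bsub>V\<^esub> c \<odot>\<^bsub>V\<^esub> v"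
        using Q v a r cp by (simp add: TD)
      also have "\<dots> = (T (T Q \<oplus>\<^bsub>V\<^esub> eval p a \<odot>\<^bsub>V\<^esub> v) \<ominus>\<^bsub>V\<^esub> a \<odot>\<^bsub>V\<^esub> (T Q \<oplus>\<^bsub>V\<^esub> eval p a \<odot>\<^bsub>V\<^esub> v))
          \<oplus>\<^bsub>V\<^esub> (eval p a \<otimes>\<^bsub>K\<^esub> a \<oplus>\<^bsub>K\<^esub> c) \<odot>\<^bsub>V\<^esub> v"
      proof -
        have *: "(x \<ominus>\<^bsub>V\<^esub> y) \<oplus>\<^bsub>V\<^esub> z \<oplus>\<^bsub>V\<^esub> s = ((x \<oplus>\<^bsub>V\<^esub> z) \<ominus>\<^bsub>V\<^esub> (y \<oplus>\<^bsub>V\<^esub> t)) \<oplus>\<^bsub>V\<^esub> (t \<oplus>\<^bsub>V\<^esub> s)"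
          if "x \<in> carrier V" "y \<in> carrier V" "z \<in> carrier V" "s \<in> carrier V" "t \<in> carrier V" for x y z s t
        proof -
          have "((x \<oplus>\<^bsub>V\<^esub> z) \<ominus>\<^bsub>V\<^esub> (y \<oplus>\<^bsub>V\<^esub> t)) \<oplus>\<^bsub>V\<^esub> (t \<oplus>\<^bsub>V\<^esub> s)
              = (x \<oplus>\<^bsub>V\<^esub> z \<oplus>\<^bsub>V\<^esub> \<ominus>\<^bsub>V\<^esub> y) \<oplus>\<^bsub>V\<^esub> (\<ominus>\<^bsub>V\<^esub> t \<oplus>\<^bsub>V\<^esub> (t \<oplus>\<^bsub>V\<^esub> s))"
            using that by (simp add: M.minus_eq M.minus_add M.a_assoc)
          also have "\<ominus>\<^bsub>V\<^esub> t \<oplus>\<^bsub>V\<^esub> (t \<oplus>\<^bsub>V\<^esub> s) = s" using that by (simp add: M.r_neg1)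
          finally show ?thesis using that by (simp add: M.minus_eq M.a_ac)
        qed
        have 1: "a \<odot>\<^bsub>V\<^esub> (T Q \<oplus>\<^bsub>V\<^esub> eval p a \<odot>\<^bsub>V\<^esub> v) = a \<odot>\<^bsub>V\<^esub> T Q \<oplus>\<^bsub>V\<^esub> (eval p a \<otimes>\<^bsub>K\<^esub> a) \<odot>\<^bsub>V\<^esub> v"
          using Q v a r by (simp add: TD smult_r_distr smult_assoc1[symmetric] R.m_comm)
        have 2: "(eval p a \<otimes>\<^bsub>K\<^esub> a \<oplus>\<^bsub>K\<^esub> c) \<odot>\<^bsub>V\<^esub> v = (eval p a \<otimes>\<^bsub>K\<^esub> a) \<odot>\<^bsub>V\<^esub> v \<oplus>\<^bsub>V\<^esub> c \<odot>\<^bsub>V\<^esub> v"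
          using v a r cp by (simp add: smult_l_distr)
        have 3: "T (T Q \<oplus>\<^bsub>V\<^esub> eval p a \<odot>\<^bsub>V\<^esub> v) = T (T Q) \<oplus>\<^bsub>V\<^esub> eval p a \<odot>\<^bsub>V\<^esub> T v"
          using Q v a r by (simp add: TD)
        show ?thesis unfolding 1 2 3 using Q v a r cp by (intro *) (auto simp: TD)
      qed
      finally show "op_eval V T (p @ [c]) v
        = (T (op_eval V T (q @ [eval p a]) v) \<ominus>\<^bsub>V\<^esub> a \<odot>\<^bsub>V\<^esub> op_eval V T (q @ [eval p a]) v)
          \<oplus>\<^bsub>V\<^esub> eval (p @ [c]) a \<odot>\<^bsub>V\<^esub> v"
        unfolding e op_eval_simps Q_def .
    qed
  qed
qed

text \<open>The span of the first \<open>k\<close> iterates of \<open>T\<close> on \<open>w\<close>.\<close>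

primrec krylov :: "('c \<Rightarrow> 'c) \<Rightarrow> 'c \<Rightarrow> nat \<Rightarrow> 'c set" where
  "krylov T w 0 = {\<zero>\<^bsub>V\<^esub>}"
| "krylov T w (Suc k) = {T x \<oplus>\<^bsub>V\<^esub> c \<odot>\<^bsub>V\<^esub> w | x c. x \<in> krylov T w k \<and> c \<in> carrier K}"

text \<open>The Krylov subspaces of \<open>w\<close> cannot grow strictly forever.\<close>

lemma ex_annihilating_polynomial:
  assumes fd: fin_dim and T: "endo T" and w: "w \<in> carrier V"
  shows "\<exists>p. set p \<subseteq> carrier K \<and> p \<noteq> [] \<and> hd p = \<one>\<^bsub>K\<^esub> \<and> op_eval V T p w = \<zero>\<^bsub>V\<^esub>"
proof -
  note TD = endoD[OF T]
  have sub: "subspace K (krylov T w k) V" for k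
  proof (induction k)
    case (Suc k)
    note D = subspaceD[OF Suc]
    show ?case
    proof (rule subspaceI)
      show "krylov T w (Suc k) \<subseteq> carrier V" using D(7) TD w by auto
      have "\<zero>\<^bsub>V\<^esub> = T \<zero>\<^bsub>V\<^esub> \<oplus>\<^bsub>V\<^esub> \<zero>\<^bsub>K\<^esub> \<odot>\<^bsub>V\<^esub> w" using TD w by simp
      then show "\<zero>\<^bsub>V\<^esub> \<in> krylov T w (Suc k)" using D(2) by auto
    next
      fix u v assume "u \<in> krylov T w (Suc k)" "v \<in> krylov T w (Suc k)"
      then obtain x c y d where *: "u = T x \<oplus>\<^bsub>V\<^esub> c \<odot>\<^bsub>V\<^esub> w" "v = T y \<oplus>\<^bsub>V\<^esub> d \<odot>\<^bsub>V\<^esub> w"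
        "x \<in> krylov T w k" "y \<in> krylov T w k" "c \<in> carrier K" "d \<in> carrier K" by auto
      then have "u \<oplus>\<^bsub>V\<^esub> v = T (x \<oplus>\<^bsub>V\<^esub> y) \<oplus>\<^bsub>V\<^esub> (c \<oplus>\<^bsub>K\<^esub> d) \<odot>\<^bsub>V\<^esub> w"
        using w D(7)[of x] D(7)[of y] by (simp add: TD smult_l_distr M.a_ac)
      then show "u \<oplus>\<^bsub>V\<^esub> v \<in> krylov T w (Suc k)" using * D(3) by auto
    next
      fix a u assume a: "a \<in> carrier K" and "u \<in> krylov T w (Suc k)"
      then obtain x c where *: "u = T x \<oplus>\<^bsub>V\<^esub> c \<odot>\<^bsub>V\<^esub> w" "x \<in> krylov T w k" "c \<in> carrier K" by auto
      then have "a \<odot>\<^bsub>V\<^esub> u = T (a \<odot>\<^bsub>V\<^esub> x) \<oplus>\<^bsub>V\<^esub> (a \<otimes>\<^bsub>K\<^esub> c) \<odot>\<^bsub>V\<^esub> w"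
        using w a D(7)[of x] by (simp add: TD smult_r_distr smult_assoc1)
      then show "a \<odot>\<^bsub>V\<^esub> u \<in> krylov T w (Suc k)" using * D(4) a by auto
    qed
  qed (simp add: subspace_zero)
  have mono: "krylov T w k \<subseteq> krylov T w (Suc k)" for k
  proof (induction k)
    case 0
    have "\<zero>\<^bsub>V\<^esub> \<in> krylov T w 1" using subspaceD(2)[OF sub, of 1] .
    then show ?case by simp
  qed auto
  obtain \<mu> :: "'c set \<Rightarrow> nat" where \<mu>: "\<And>S S'. \<lbrakk>subspace K S V; subspace K S' V; S \<subset> S'\<rbrakk> \<Longrightarrow> \<mu> S' < \<mu> S"
    using subspace_measure[OF fd] by metis
  have "\<exists>k. krylov T w k = krylov T w (Suc k)"
  proof (rule ccontr)
    assume "\<not> ?thesis"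
    then have step: "\<mu> (krylov T w (Suc k)) < \<mu> (krylov T w k)" for k
      using \<mu>[OF sub sub] mono by (metis psubsetI)
    have "\<mu> (krylov T w k) + k \<le> \<mu> (krylov T w 0)" for k
    proof (induction k)
      case (Suc k)
      then show ?case using step[of k] by linarith
    qed simp
    from this[of "Suc (\<mu> (krylov T w 0))"] show False by simp
  qed
  then obtain k where k: "krylov T w k = krylov T w (Suc k)" ..
  have iter: "(T ^^ k) w \<in> krylov T w (Suc k)" for k
  proof (induction k)
    case 0
    have "w = T \<zero>\<^bsub>V\<^esub> \<oplus>\<^bsub>V\<^esub> \<one>\<^bsub>K\<^esub> \<odot>\<^bsub>V\<^esub> w" using TD w by simp
    then show ?case by auto
  next
    case (Suc k)
    have "(T ^^ k) w \<in> carrier V" using subspaceD(7)[OF sub Suc] .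
    then have "(T ^^ Suc k) w = T ((T ^^ k) w) \<oplus>\<^bsub>V\<^esub> \<zero>\<^bsub>K\<^esub> \<odot>\<^bsub>V\<^esub> w" using TD w by simp
    then show ?case unfolding krylov.simps(2)[of T w "Suc k"] using Suc R.zero_closed by blast
  qed
  have poly: "\<exists>q. set q \<subseteq> carrier K \<and> x \<oplus>\<^bsub>V\<^esub> (T ^^ k) w = op_eval V T (\<one>\<^bsub>K\<^esub> # q) w"
    if "x \<in> krylov T w k" for x k
    using that
  proof (induction k arbitrary: x)
    case 0
    then show ?case using w TD op_eval_simps(2)[of V T "[]"]
      by (intro exI[of _ "[]"]) (simp add: op_eval_simps)
  next
    case (Suc k)
    then obtain y c where y: "x = T y \<oplus>\<^bsub>V\<^esub> c \<odot>\<^bsub>V\<^esub> w" "y \<in> krylov T w k" "c \<in> carrier K" by auto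
    then obtain q where q: "set q \<subseteq> carrier K" "y \<oplus>\<^bsub>V\<^esub> (T ^^ k) w = op_eval V T (\<one>\<^bsub>K\<^esub> # q) w"
      using Suc.IH by blast
    have "y \<in> carrier V" "(T ^^ k) w \<in> carrier V"
      using subspaceD(7)[OF sub] y(2) iter by blast+
    then have "x \<oplus>\<^bsub>V\<^esub> (T ^^ Suc k) w = T (y \<oplus>\<^bsub>V\<^esub> (T ^^ k) w) \<oplus>\<^bsub>V\<^esub> c \<odot>\<^bsub>V\<^esub> w"
      using y w by (simp add: TD M.a_ac)
    also have "\<dots> = op_eval V T (\<one>\<^bsub>K\<^esub> # (q @ [c])) w"
      unfolding q(2) using op_eval_simps(2)[of V T "\<one>\<^bsub>K\<^esub> # q" c w] by simp
    finally show ?case using q y by (intro exI[of _ "q @ [c]"]) simp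
  qed
  have it: "(T ^^ k) w \<in> krylov T w k" using iter[of k] unfolding k[symmetric] .
  then have "\<ominus>\<^bsub>V\<^esub> (T ^^ k) w \<in> krylov T w k" by (rule subspaceD(5)[OF sub])
  from poly[OF this] obtain q where "set q \<subseteq> carrier K"
    "\<ominus>\<^bsub>V\<^esub> (T ^^ k) w \<oplus>\<^bsub>V\<^esub> (T ^^ k) w = op_eval V T (\<one>\<^bsub>K\<^esub> # q) w" by blast
  then show ?thesis
    using subspaceD(7)[OF sub it] by (intro exI[of _ "\<one>\<^bsub>K\<^esub> # q"]) (simp add: M.l_neg)
qed

end

section \<open>Unipotence of the centre of a Heisenberg group\<close>

text \<open>The function \<open>\<kappa>\<close> is at least as fine as the projection onto the cosets of \<open>H\<close>.\<close>

definition finite_index :: "('a, 'e) monoid_scheme \<Rightarrow> 'a set \<Rightarrow> bool" where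
  "finite_index G H \<longleftrightarrow> (\<exists>\<kappa> :: 'a \<Rightarrow> nat. finite (\<kappa> ` carrier G) \<and>
    (\<forall>u\<in>carrier G. \<forall>v\<in>carrier G. \<kappa> u = \<kappa> v \<longrightarrow> u \<otimes>\<^bsub>G\<^esub> inv\<^bsub>G\<^esub> v \<in> H))"

lemma finite_indexI:
  assumes "finite (\<kappa> ` carrier G)"
    and "\<And>u v. \<lbrakk>u \<in> carrier G; v \<in> carrier G; \<kappa> u = \<kappa> v\<rbrakk> \<Longrightarrow> u \<otimes>\<^bsub>G\<^esub> inv\<^bsub>G\<^esub> v \<in> H"
  shows "finite_index G H"
proof -
  obtain e :: "_ \<Rightarrow> nat" where e: "inj_on e (\<kappa> ` carrier G)"
    using finite_imp_inj_to_nat_seg[OF assms(1)] by blast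
  have "e (\<kappa> u) = e (\<kappa> v) \<longleftrightarrow> \<kappa> u = \<kappa> v" if "u \<in> carrier G" "v \<in> carrier G" for u v
    using e that by (auto simp: inj_on_def)
  moreover have "finite ((\<lambda>u. e (\<kappa> u)) ` carrier G)"
    using finite_imageI[OF assms(1), of e] by (simp add: image_image)
  ultimately show ?thesis
    unfolding finite_index_def using assms(2) by (intro exI[of _ "\<lambda>u. e (\<kappa> u)"]) simp
qed

lemma finite_index_Int:
  assumes "finite_index G H" "finite_index G H'"
  shows "finite_index G (H \<inter> H')"
proof -
  obtain \<kappa> :: "'a \<Rightarrow> nat" where \<kappa>: "finite (\<kappa> ` carrier G)"
    "\<And>u v. \<lbrakk>u \<in> carrier G; v \<in> carrier G; \<kappa> u = \<kappa> v\<rbrakk> \<Longrightarrow> u \<otimes>\<^bsub>G\<^esub> inv\<^bsub>G\<^esub> v \<in> H"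
    using assms(1) unfolding finite_index_def by metis
  obtain \<kappa>' :: "'a \<Rightarrow> nat" where \<kappa>': "finite (\<kappa>' ` carrier G)"
    "\<And>u v. \<lbrakk>u \<in> carrier G; v \<in> carrier G; \<kappa>' u = \<kappa>' v\<rbrakk> \<Longrightarrow> u \<otimes>\<^bsub>G\<^esub> inv\<^bsub>G\<^esub> v \<in> H'"
    using assms(2) unfolding finite_index_def by metis
  show ?thesis
  proof (rule finite_indexI[where \<kappa> = "\<lambda>u. (\<kappa> u, \<kappa>' u)"])
    show "finite ((\<lambda>u. (\<kappa> u, \<kappa>' u)) ` carrier G)"
      by (rule finite_subset[OF _ finite_cartesian_product[OF \<kappa>(1) \<kappa>'(1)]]) auto
  qed (use \<kappa>(2) \<kappa>'(2) in auto)
qed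

text \<open>Unipotency of the operators \<open>Z h\<close> modulo \<open>S\<close>, tested on one vector.\<close>

primrec nil_on ::
    "('k, 'v, 'f) module_scheme \<Rightarrow> ('a \<Rightarrow> 'v \<Rightarrow> 'v) \<Rightarrow> 'a set \<Rightarrow> 'v set \<Rightarrow> nat \<Rightarrow> 'v \<Rightarrow> bool" where
  "nil_on V Z H S 0 x \<longleftrightarrow> x \<in> S"
| "nil_on V Z H S (Suc n) x \<longleftrightarrow> (\<forall>h\<in>H. nil_on V Z H S n (Z h x \<ominus>\<^bsub>V\<^esub> x))"

locale fd_space = vectorspace K V + alg: algebraically_closed K
  for K :: "'k ring" and V :: "('k, 'v) module" +
  assumes fd: fin_dim
begin

text \<open>Divide an annihilating polynomial of \<open>w\<close> by a linear factor. If the quotient maps \<open>w\<close> outside \<open>S\<close>, this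
  gives an eigenvector modulo \<open>S\<close>; otherwise continue with the quotient.\<close>

lemma eigenvector_mod:
  assumes T: "endo T" and S: "subspace K S V" and M: "subspace K M V" "T ` M \<subseteq> M"
    and w: "w \<in> M" "w \<notin> S"
  shows "\<exists>a\<in>carrier K. \<exists>w\<in>M. w \<notin> S \<and> T w \<ominus>\<^bsub>V\<^esub> a \<odot>\<^bsub>V\<^esub> w \<in> S"
proof -
  have wV: "w \<in> carrier V" using subspaceD(7)[OF M(1) w(1)] .
  obtain p where p: "set p \<subseteq> carrier K" "p \<noteq> []" "hd p = \<one>\<^bsub>K\<^esub>" "op_eval V T p w = \<zero>\<^bsub>V\<^esub>"
    using ex_annihilating_polynomial[OF fd T wV] by blast
  have "op_eval V T p w \<in> S" using p(4) subspaceD(2)[OF S] by simp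
  with p(1-3) show ?thesis
  proof (induction "length p" arbitrary: p rule: less_induct)
    case less
    show ?case
    proof (cases "length p \<ge> 2")
      case False
      then have "length p = 1" using less.prems(2) by (cases p) (auto simp: Suc_le_eq)
      then have "p = [\<one>\<^bsub>K\<^esub>]" using less.prems(3) by (cases p) auto
      then have "op_eval V T p w = T \<zero>\<^bsub>V\<^esub> \<oplus>\<^bsub>V\<^esub> \<one>\<^bsub>K\<^esub> \<odot>\<^bsub>V\<^esub> w"
        using op_eval_simps(2)[of V T "[]"] by (simp add: op_eval_simps)
      then show ?thesis using less.prems(4) w wV endoD[OF T] by simp
    next
      case True
      obtain a where a: "a \<in> carrier K" "eval p a = \<zero>\<^bsub>K\<^esub>"
        using alg.ex_root[OF less.prems(1) True] less.prems(3) by auto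
      obtain q where q: "set q \<subseteq> carrier K" "length q = length p - 1" "hd q = hd p"
        "\<And>v. v \<in> carrier V \<Longrightarrow> op_eval V T p v
        = (T (op_eval V T q v) \<ominus>\<^bsub>V\<^esub> a \<odot>\<^bsub>V\<^esub> op_eval V T q v) \<oplus>\<^bsub>V\<^esub> eval p a \<odot>\<^bsub>V\<^esub> v"
        using op_eval_divide[OF T a(1) less.prems(1)] True by blast
      have qM: "op_eval V T q w \<in> M" by (rule op_eval_in[OF T M q(1) w(1)])
      then have qV: "op_eval V T q w \<in> carrier V" using subspaceD(7)[OF M(1)] by blast
      show ?thesis
      proof (cases "op_eval V T q w \<in> S")
        case True
        have "length q < length p" "q \<noteq> []" using q(2) \<open>length p \<ge> 2\<close> by auto
        then show ?thesis using less.hyps[of q] q(1,3) less.prems(3) True by simp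
      next
        case False
        have "T (op_eval V T q w) \<ominus>\<^bsub>V\<^esub> a \<odot>\<^bsub>V\<^esub> op_eval V T q w = op_eval V T p w"
          using q(4)[OF wV] a qV wV endoD[OF T] by simp
        then show ?thesis using a(1) qM False less.prems(4) by (intro bexI[of _ a] bexI[of _ "op_eval V T q w"]) auto
      qed
    qed
  qed
qed

lemma eigenspace_mod:
  assumes "endo T" "a \<in> carrier K" "subspace K S V"
  shows "subspace K {v \<in> carrier V. T v \<ominus>\<^bsub>V\<^esub> a \<odot>\<^bsub>V\<^esub> v \<in> S} V"
  using assms by (intro subspace_vimage endo_minus_smult)

lemma eigenspace_mod_stable:
  assumes "endo T" "endo Y" "\<And>v. v \<in> carrier V \<Longrightarrow> T (Y v) = Y (T v)"
    and "Y ` S \<subseteq> S" "v \<in> carrier V" "a \<in> carrier K" "T v \<ominus>\<^bsub>V\<^esub> a \<odot>\<^bsub>V\<^esub> v \<in> S"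
  shows "T (Y v) \<ominus>\<^bsub>V\<^esub> a \<odot>\<^bsub>V\<^esub> Y v \<in> S"
proof -
  have "T (Y v) \<ominus>\<^bsub>V\<^esub> a \<odot>\<^bsub>V\<^esub> Y v = Y (T v \<ominus>\<^bsub>V\<^esub> a \<odot>\<^bsub>V\<^esub> v)"
    using assms endoD[OF assms(1)] endoD[OF assms(2)] by simp
  then show ?thesis using assms by auto
qed

text \<open>A minimal stable subspace properly containing \<open>S\<close> consists of eigenvectors modulo \<open>S\<close>.\<close>

lemma common_eigenvector_mod:
  assumes Z: "\<And>f. f \<in> U \<Longrightarrow> endo (Z f)"
    and comm: "\<And>f g v. \<lbrakk>f \<in> U; g \<in> U; v \<in> carrier V\<rbrakk> \<Longrightarrow> Z f (Z g v) = Z g (Z f v)"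
    and S: "subspace K S V" "S \<noteq> carrier V" "\<And>f. f \<in> U \<Longrightarrow> Z f ` S \<subseteq> S"
  shows "\<exists>\<chi>\<in>U \<rightarrow> carrier K. \<exists>w\<in>carrier V. w \<notin> S \<and> (\<forall>f\<in>U. Z f w \<ominus>\<^bsub>V\<^esub> \<chi> f \<odot>\<^bsub>V\<^esub> w \<in> S)"
proof -
  obtain \<mu> :: "'v set \<Rightarrow> nat" where \<mu>: "\<And>S S'. \<lbrakk>subspace K S V; subspace K S' V; S \<subset> S'\<rbrakk> \<Longrightarrow> \<mu> S' < \<mu> S"
    using subspace_measure[OF fd] by metis
  define P where "P M \<longleftrightarrow> subspace K M V \<and> S \<subset> M \<and> (\<forall>f\<in>U. Z f ` M \<subseteq> M)" for M
  have "P (carrier V)"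
    using S subspaceD(1)[OF S(1)] endoD(1)[OF Z] by (auto simp: P_def subspace_carrier)
  moreover have "\<forall>M. P M \<longrightarrow> \<mu> M < \<mu> S" using \<mu> S(1) by (auto simp: P_def)
  ultimately obtain M where M: "P M" "\<And>M'. P M' \<Longrightarrow> \<mu> M' \<le> \<mu> M"
    using ex_has_greatest_nat[of P "carrier V" \<mu> "\<mu> S"] by auto
  have MD: "subspace K M V" "S \<subset> M" "\<And>f. f \<in> U \<Longrightarrow> Z f ` M \<subseteq> M" using M(1) by (auto simp: P_def)
  obtain w where w: "w \<in> M" "w \<notin> S" using MD(2) by blast
  have "\<exists>a\<in>carrier K. \<forall>m\<in>M. Z f m \<ominus>\<^bsub>V\<^esub> a \<odot>\<^bsub>V\<^esub> m \<in> S" if f: "f \<in> U" for f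
  proof -
    obtain a w' where a: "a \<in> carrier K" "w' \<in> M" "w' \<notin> S" "Z f w' \<ominus>\<^bsub>V\<^esub> a \<odot>\<^bsub>V\<^esub> w' \<in> S"
      using eigenvector_mod[OF Z[OF f] S(1) MD(1) MD(3)[OF f] w] by blast
    define M' where "M' = M \<inter> {v \<in> carrier V. Z f v \<ominus>\<^bsub>V\<^esub> a \<odot>\<^bsub>V\<^esub> v \<in> S}"
    have sub: "subspace K M' V"
      unfolding M'_def by (intro subspace_Int MD(1) eigenspace_mod Z f a(1) S(1))
    have "S \<subseteq> M'"
    proof
      fix s assume s: "s \<in> S"
      then have "Z f s \<in> S" "a \<odot>\<^bsub>V\<^esub> s \<in> S" using S(3)[OF f] subspaceD(4)[OF S(1) a(1)] by auto
      then show "s \<in> M'" using s MD(2) subspaceD(6,7)[OF S(1)] by (auto simp: M'_def)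
    qed
    moreover have "w' \<in> M'" using a subspaceD(7)[OF MD(1)] by (auto simp: M'_def)
    moreover have "Z g ` M' \<subseteq> M'" if g: "g \<in> U" for g
    proof
      fix x assume "x \<in> Z g ` M'"
      then obtain v where v: "x = Z g v" "v \<in> M" "v \<in> carrier V" "Z f v \<ominus>\<^bsub>V\<^esub> a \<odot>\<^bsub>V\<^esub> v \<in> S"
        by (auto simp: M'_def)
      have "Z f (Z g v) \<ominus>\<^bsub>V\<^esub> a \<odot>\<^bsub>V\<^esub> Z g v \<in> S"
        by (rule eigenspace_mod_stable[OF Z[OF f] Z[OF g] comm[OF f g] S(3)[OF g] v(3) a(1) v(4)])
      then show "x \<in> M'" using v MD(3)[OF g] endoD(1)[OF Z[OF g]] by (auto simp: M'_def)
    qed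
    ultimately have "P M'" using sub a(3) by (auto simp: P_def)
    then have "\<not> M' \<subset> M" using \<mu>[OF sub MD(1)] M(2)[of M'] by auto
    then have "M' = M" by (auto simp: M'_def)
    then show ?thesis using a(1) by (intro bexI[of _ a]) (auto simp: M'_def)
  qed
  then obtain \<chi> where "\<And>f. f \<in> U \<Longrightarrow> \<chi> f \<in> carrier K \<and> (\<forall>m\<in>M. Z f m \<ominus>\<^bsub>V\<^esub> \<chi> f \<odot>\<^bsub>V\<^esub> m \<in> S)"
    by metis
  then show ?thesis
    using w subspaceD(7)[OF MD(1) w(1)] by (intro bexI[of _ \<chi>] bexI[of _ w]) auto
qed

lemma smult_minus_smult:
  assumes "a \<in> carrier K" "b \<in> carrier K" "v \<in> carrier V"
  shows "(a \<ominus>\<^bsub>K\<^esub> b) \<odot>\<^bsub>V\<^esub> v = a \<odot>\<^bsub>V\<^esub> v \<ominus>\<^bsub>V\<^esub> b \<odot>\<^bsub>V\<^esub> v"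
  using assms by (simp add: R.minus_eq M.minus_eq smult_l_distr smult_l_minus)

lemma smult_in_subspaceD:
  assumes S: "subspace K S V" and "a \<in> carrier K" "v \<in> carrier V" "a \<odot>\<^bsub>V\<^esub> v \<in> S" "v \<notin> S"
  shows "a = \<zero>\<^bsub>K\<^esub>"
proof (rule ccontr)
  assume a: "a \<noteq> \<zero>\<^bsub>K\<^esub>"
  then have "v = inv\<^bsub>K\<^esub> a \<odot>\<^bsub>V\<^esub> (a \<odot>\<^bsub>V\<^esub> v)" using mult_inverse[OF assms(2,3) refl] by simp
  moreover have "inv\<^bsub>K\<^esub> a \<in> carrier K" using a assms(2) field_Units by simp
  ultimately show False using assms(4,5) subspaceD(4)[OF S] by metis
qed

lemma eigenvalue_mod_unique:
  assumes S: "subspace K S V" and v: "v \<in> carrier V" "v \<notin> S" and ab: "a \<in> carrier K" "b \<in> carrier K"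
    and x: "x \<in> carrier V" "x \<ominus>\<^bsub>V\<^esub> a \<odot>\<^bsub>V\<^esub> v \<in> S" "x \<ominus>\<^bsub>V\<^esub> b \<odot>\<^bsub>V\<^esub> v \<in> S"
  shows "a = b"
proof -
  have "(x \<ominus>\<^bsub>V\<^esub> b \<odot>\<^bsub>V\<^esub> v) \<ominus>\<^bsub>V\<^esub> (x \<ominus>\<^bsub>V\<^esub> a \<odot>\<^bsub>V\<^esub> v) = (a \<ominus>\<^bsub>K\<^esub> b) \<odot>\<^bsub>V\<^esub> v"
  proof -
    have "(x \<ominus>\<^bsub>V\<^esub> b \<odot>\<^bsub>V\<^esub> v) \<ominus>\<^bsub>V\<^esub> (x \<ominus>\<^bsub>V\<^esub> a \<odot>\<^bsub>V\<^esub> v)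
        = (\<ominus>\<^bsub>V\<^esub> (b \<odot>\<^bsub>V\<^esub> v) \<oplus>\<^bsub>V\<^esub> a \<odot>\<^bsub>V\<^esub> v) \<oplus>\<^bsub>V\<^esub> (x \<oplus>\<^bsub>V\<^esub> \<ominus>\<^bsub>V\<^esub> x)"
      using v x(1) ab by (simp add: M.minus_eq M.minus_add M.a_ac)
    then show ?thesis using v x(1) ab
      by (simp add: smult_minus_smult M.r_neg) (simp add: M.minus_eq M.a_comm)
  qed
  then have "(a \<ominus>\<^bsub>K\<^esub> b) \<odot>\<^bsub>V\<^esub> v \<in> S" using subspaceD(6)[OF S x(3,2)] by simp
  from smult_in_subspaceD[OF S _ v(1) this v(2)] show ?thesis using ab by simp
qed

text \<open>Enlarge \<open>S\<close> by the eigenvectors for one eigenvalue \<open>b\<close>. An eigenvector modulo \<open>S\<close> for another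
  eigenvalue remains one modulo the enlarged subspace.\<close>

lemma finite_eigenvalues_mod:
  assumes T: "endo T" and S: "subspace K S V" "T ` S \<subseteq> S"
  shows "\<exists>E. finite E \<and> (\<forall>a\<in>carrier K. \<forall>w\<in>carrier V. w \<notin> S \<longrightarrow> T w \<ominus>\<^bsub>V\<^esub> a \<odot>\<^bsub>V\<^esub> w \<in> S \<longrightarrow> a \<in> E)"
proof -
  obtain \<mu> :: "'v set \<Rightarrow> nat" where \<mu>: "\<And>S S'. \<lbrakk>subspace K S V; subspace K S' V; S \<subset> S'\<rbrakk> \<Longrightarrow> \<mu> S' < \<mu> S"
    using subspace_measure[OF fd] by metis
  show ?thesis using S
  proof (induction "\<mu> S" arbitrary: S rule: less_induct)
    case less
    note S = less.prems(1)
    show ?case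
    proof (cases "S = carrier V")
      case True
      then show ?thesis by (intro exI[of _ "{}"]) auto
    next
      case False
      then obtain w where "w \<in> carrier V" "w \<notin> S" using subspaceD(1)[OF S] by blast
      from eigenvector_mod[OF T S subspace_carrier _ this] endoD(1)[OF T]
      obtain b w where b: "b \<in> carrier K" "w \<in> carrier V" "w \<notin> S" "T w \<ominus>\<^bsub>V\<^esub> b \<odot>\<^bsub>V\<^esub> w \<in> S"
        by blast
      define S' where "S' = {v \<in> carrier V. T v \<ominus>\<^bsub>V\<^esub> b \<odot>\<^bsub>V\<^esub> v \<in> S}"
      have S': "subspace K S' V" unfolding S'_def by (rule eigenspace_mod[OF T b(1) S])
      have "S \<subseteq> S'"
        using less.prems(2) subspaceD[OF S] b(1) by (auto simp: S'_def image_subset_iff)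
      moreover have "w \<in> S'" using b by (simp add: S'_def)
      ultimately have lt: "S \<subset> S'" using b by blast
      have "T ` S' \<subseteq> S'"
        using eigenspace_mod_stable[OF T T refl less.prems(2) _ b(1)] endoD(1)[OF T]
        by (auto simp: S'_def)
      from less.hyps[OF \<mu>[OF S S' lt] S' this]
      obtain E where E: "finite E" "\<And>a w. \<lbrakk>a \<in> carrier K; w \<in> carrier V; w \<notin> S';
          T w \<ominus>\<^bsub>V\<^esub> a \<odot>\<^bsub>V\<^esub> w \<in> S'\<rbrakk> \<Longrightarrow> a \<in> E" by blast
      have "a \<in> insert b E"
        if a: "a \<in> carrier K" and w: "w \<in> carrier V" "w \<notin> S" "T w \<ominus>\<^bsub>V\<^esub> a \<odot>\<^bsub>V\<^esub> w \<in> S" for a w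
      proof (cases "w \<in> S'")
        case True
        then have "T w \<ominus>\<^bsub>V\<^esub> b \<odot>\<^bsub>V\<^esub> w \<in> S" by (simp add: S'_def)
        then have "a = b"
          using eigenvalue_mod_unique[OF S w(1,2) a b(1) endoD(1)[OF T w(1)] w(3)] by blast
        then show ?thesis by simp
      next
        case False
        then show ?thesis using E(2)[OF a w(1)] w(3) lt by blast
      qed
      then show ?thesis using E(1) by (intro exI[of _ "insert b E"]) auto
    qed
  qed
qed

lemma nil_on_extend:
  assumes "\<And>x h. \<lbrakk>x \<in> S'; h \<in> H\<rbrakk> \<Longrightarrow> Z h x \<ominus>\<^bsub>V\<^esub> x \<in> S" "H \<subseteq> H'"
    and "nil_on V Z H' S' n x"
  shows "nil_on V Z H S (Suc n) x"
  using assms(3)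
proof (induction n arbitrary: x)
  case 0
  then show ?case using assms(1) by simp
next
  case (Suc n)
  show ?case
    unfolding nil_on.simps(2)[of V Z H S "Suc n"] using Suc assms(2) by auto
qed

end

text \<open>A finite-dimensional representation of a group of Heisenberg type, given by the operators
  \<open>Z f\<close> of its centre, one operator \<open>T\<close> and operators \<open>B f\<close> whose commutator with \<open>T\<close> is \<open>Z f\<close>.\<close>

locale heisenberg = fd_space K V + G: comm_group G
  for K :: "'k ring" and V :: "('k, 'v) module" and G :: "('a, 'e) monoid_scheme" +
  fixes Z B :: "'a \<Rightarrow> 'v \<Rightarrow> 'v" and T T' :: "'v \<Rightarrow> 'v"
  assumes endo_Z: "f \<in> carrier G \<Longrightarrow> endo (Z f)"
    and endo_B: "f \<in> carrier G \<Longrightarrow> endo (B f)"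
    and endo_T: "endo T"
    and endo_T': "endo T'"
    and Z_mult: "\<lbrakk>f \<in> carrier G; g \<in> carrier G; v \<in> carrier V\<rbrakk> \<Longrightarrow> Z (f \<otimes>\<^bsub>G\<^esub> g) v = Z f (Z g v)"
    and Z_one: "v \<in> carrier V \<Longrightarrow> Z \<one>\<^bsub>G\<^esub> v = v"
    and T'_T: "v \<in> carrier V \<Longrightarrow> T' (T v) = v"
    and B_inv: "\<lbrakk>f \<in> carrier G; v \<in> carrier V\<rbrakk> \<Longrightarrow> B (inv\<^bsub>G\<^esub> f) (B f v) = v"
    and Z_T: "\<lbrakk>f \<in> carrier G; v \<in> carrier V\<rbrakk> \<Longrightarrow> Z f (T v) = T (Z f v)"
    and Z_T': "\<lbrakk>f \<in> carrier G; v \<in> carrier V\<rbrakk> \<Longrightarrow> Z f (T' v) = T' (Z f v)"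
    and Z_B: "\<lbrakk>f \<in> carrier G; g \<in> carrier G; v \<in> carrier V\<rbrakk> \<Longrightarrow> Z f (B g v) = B g (Z f v)"
    and B_T: "\<lbrakk>f \<in> carrier G; v \<in> carrier V\<rbrakk> \<Longrightarrow> B f (T v) = Z f (T (B f v))"
begin

definition stable where
  "stable S \<longleftrightarrow> subspace K S V \<and> T ` S \<subseteq> S \<and> T' ` S \<subseteq> S \<and>
    (\<forall>f\<in>carrier G. Z f ` S \<subseteq> S \<and> B f ` S \<subseteq> S)"

lemma Z_comm:
  assumes "f \<in> carrier G" "g \<in> carrier G" "v \<in> carrier V"
  shows "Z f (Z g v) = Z g (Z f v)"
  using assms Z_mult[of f g v] Z_mult[of g f v] by (simp add: G.m_comm)

text \<open>Passing from an eigenvector \<open>v\<close> of \<open>T\<close> to \<open>B f v\<close> divides the eigenvalue by \<open>\<chi> f\<close>, so \<open>\<chi>\<close>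
  has a finite image.\<close>

lemma central_character:
  assumes S: "stable S" "S \<noteq> carrier V"
  obtains \<chi> S' where "\<chi> \<in> carrier G \<rightarrow> carrier K" "\<chi> \<one>\<^bsub>G\<^esub> = \<one>\<^bsub>K\<^esub>"
    "\<And>f g. \<lbrakk>f \<in> carrier G; g \<in> carrier G\<rbrakk> \<Longrightarrow> \<chi> (f \<otimes>\<^bsub>G\<^esub> g) = \<chi> f \<otimes>\<^bsub>K\<^esub> \<chi> g"
    "finite (\<chi> ` carrier G)" "stable S'" "S \<subset> S'"
    "\<And>f v. \<lbrakk>f \<in> carrier G; v \<in> S'\<rbrakk> \<Longrightarrow> Z f v \<ominus>\<^bsub>V\<^esub> \<chi> f \<odot>\<^bsub>V\<^esub> v \<in> S"
proof -
  have SD: "subspace K S V" "T ` S \<subseteq> S" "T' ` S \<subseteq> S" "\<And>f. f \<in> carrier G \<Longrightarrow> Z f ` S \<subseteq> S"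
    "\<And>f. f \<in> carrier G \<Longrightarrow> B f ` S \<subseteq> S" using S by (auto simp: stable_def)
  note SS = subspaceD[OF SD(1)]
  have "\<exists>\<chi>\<in>carrier G \<rightarrow> carrier K. \<exists>w\<in>carrier V. w \<notin> S \<and>
      (\<forall>f\<in>carrier G. Z f w \<ominus>\<^bsub>V\<^esub> \<chi> f \<odot>\<^bsub>V\<^esub> w \<in> S)"
    by (rule common_eigenvector_mod) (fact endo_Z Z_comm SD S)+
  then obtain \<chi> w where \<chi>: "\<chi> \<in> carrier G \<rightarrow> carrier K" and w: "w \<in> carrier V" "w \<notin> S"
    "\<And>f. f \<in> carrier G \<Longrightarrow> Z f w \<ominus>\<^bsub>V\<^esub> \<chi> f \<odot>\<^bsub>V\<^esub> w \<in> S"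
    by blast
  have \<chi>c: "\<chi> f \<in> carrier K" if "f \<in> carrier G" for f using \<chi> that by auto
  have one: "\<chi> \<one>\<^bsub>G\<^esub> = \<one>\<^bsub>K\<^esub>"
  proof (rule eigenvalue_mod_unique[OF SD(1) w(1,2) _ _ w(1)])
    show "w \<ominus>\<^bsub>V\<^esub> \<chi> \<one>\<^bsub>G\<^esub> \<odot>\<^bsub>V\<^esub> w \<in> S" using w(3)[of "\<one>\<^bsub>G\<^esub>"] Z_one w(1) by simp
    show "w \<ominus>\<^bsub>V\<^esub> \<one>\<^bsub>K\<^esub> \<odot>\<^bsub>V\<^esub> w \<in> S" using w(1) SS(2) by (simp add: M.minus_eq M.r_neg)
  qed (use \<chi>c in auto)
  have mult: "\<chi> (f \<otimes>\<^bsub>G\<^esub> g) = \<chi> f \<otimes>\<^bsub>K\<^esub> \<chi> g" if fg: "f \<in> carrier G" "g \<in> carrier G" for f g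
  proof (rule eigenvalue_mod_unique[OF SD(1) w(1,2)])
    note Zf = endoD[OF endo_Z[OF fg(1)]] and Zg = endoD[OF endo_Z[OF fg(2)]]
    show "Z (f \<otimes>\<^bsub>G\<^esub> g) w \<in> carrier V" using fg w(1) endoD(1)[OF endo_Z] by simp
    show "Z (f \<otimes>\<^bsub>G\<^esub> g) w \<ominus>\<^bsub>V\<^esub> \<chi> (f \<otimes>\<^bsub>G\<^esub> g) \<odot>\<^bsub>V\<^esub> w \<in> S" using w(3) fg by simp
    have "Z f (Z g w \<ominus>\<^bsub>V\<^esub> \<chi> g \<odot>\<^bsub>V\<^esub> w) \<in> S" using w(3)[OF fg(2)] SD(4)[OF fg(1)] by blast
    moreover have "Z f (Z g w \<ominus>\<^bsub>V\<^esub> \<chi> g \<odot>\<^bsub>V\<^esub> w) = Z (f \<otimes>\<^bsub>G\<^esub> g) w \<ominus>\<^bsub>V\<^esub> \<chi> g \<odot>\<^bsub>V\<^esub> Z f w"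
      using fg w(1) \<chi>c by (simp add: Zf Zg Z_mult)
    moreover have "\<chi> g \<odot>\<^bsub>V\<^esub> (Z f w \<ominus>\<^bsub>V\<^esub> \<chi> f \<odot>\<^bsub>V\<^esub> w) \<in> S" using w(3) fg \<chi>c SS(4) by simp
    moreover have "\<chi> g \<odot>\<^bsub>V\<^esub> (Z f w \<ominus>\<^bsub>V\<^esub> \<chi> f \<odot>\<^bsub>V\<^esub> w)
        = \<chi> g \<odot>\<^bsub>V\<^esub> Z f w \<ominus>\<^bsub>V\<^esub> (\<chi> f \<otimes>\<^bsub>K\<^esub> \<chi> g) \<odot>\<^bsub>V\<^esub> w"
      using fg w(1) \<chi>c by (simp add: Zf M.minus_eq smult_r_distr smult_r_minus smult_assoc1[symmetric] R.m_comm)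
    ultimately have *: "(Z (f \<otimes>\<^bsub>G\<^esub> g) w \<ominus>\<^bsub>V\<^esub> \<chi> g \<odot>\<^bsub>V\<^esub> Z f w) \<oplus>\<^bsub>V\<^esub>
        (\<chi> g \<odot>\<^bsub>V\<^esub> Z f w \<ominus>\<^bsub>V\<^esub> (\<chi> f \<otimes>\<^bsub>K\<^esub> \<chi> g) \<odot>\<^bsub>V\<^esub> w) \<in> S" using SS(3) by simp
    have cl: "Z (f \<otimes>\<^bsub>G\<^esub> g) w \<in> carrier V" "\<chi> g \<odot>\<^bsub>V\<^esub> Z f w \<in> carrier V"
      "(\<chi> f \<otimes>\<^bsub>K\<^esub> \<chi> g) \<odot>\<^bsub>V\<^esub> w \<in> carrier V"
      using fg w(1) \<chi>c endoD(1)[OF endo_Z] by simp_all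
    then show "Z (f \<otimes>\<^bsub>G\<^esub> g) w \<ominus>\<^bsub>V\<^esub> (\<chi> f \<otimes>\<^bsub>K\<^esub> \<chi> g) \<odot>\<^bsub>V\<^esub> w \<in> S"
      using * by (simp add: M.minus_eq M.a_assoc M.r_neg1)
  qed (use fg \<chi>c in auto)
  define S' where "S' = {v \<in> carrier V. \<forall>f\<in>carrier G. v \<in> {v \<in> carrier V. Z f v \<ominus>\<^bsub>V\<^esub> \<chi> f \<odot>\<^bsub>V\<^esub> v \<in> S}}"
  have S'_iff: "v \<in> S' \<longleftrightarrow> v \<in> carrier V \<and> (\<forall>f\<in>carrier G. Z f v \<ominus>\<^bsub>V\<^esub> \<chi> f \<odot>\<^bsub>V\<^esub> v \<in> S)" for v
    by (auto simp: S'_def)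
  have S': "subspace K S' V"
    unfolding S'_def by (intro subspace_INT subspace_carrier eigenspace_mod endo_Z \<chi>c SD(1))
  have "S \<subseteq> S'"
  proof
    fix s assume s: "s \<in> S"
    have "Z f s \<ominus>\<^bsub>V\<^esub> \<chi> f \<odot>\<^bsub>V\<^esub> s \<in> S" if f: "f \<in> carrier G" for f
      using SD(4)[OF f] s SS(4)[OF \<chi>c[OF f] s] SS(6) by blast
    then show "s \<in> S'" using s SS(7) by (simp add: S'_iff)
  qed
  moreover have "w \<in> S'" using w by (simp add: S'_iff)
  ultimately have lt: "S \<subset> S'" using w(2) by blast
  have pres: "Y ` S' \<subseteq> S'"
    if Y: "endo Y" "Y ` S \<subseteq> S" "\<And>f v. \<lbrakk>f \<in> carrier G; v \<in> carrier V\<rbrakk> \<Longrightarrow> Z f (Y v) = Y (Z f v)" for Y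
  proof
    fix x assume "x \<in> Y ` S'"
    then obtain v where v: "x = Y v" "v \<in> carrier V"
      "\<And>f. f \<in> carrier G \<Longrightarrow> Z f v \<ominus>\<^bsub>V\<^esub> \<chi> f \<odot>\<^bsub>V\<^esub> v \<in> S" by (auto simp: S'_iff)
    have "Z f (Y v) \<ominus>\<^bsub>V\<^esub> \<chi> f \<odot>\<^bsub>V\<^esub> Y v \<in> S" if f: "f \<in> carrier G" for f
      using eigenspace_mod_stable[OF endo_Z[OF f] Y(1) Y(3)[OF f] Y(2) v(2) \<chi>c[OF f] v(3)[OF f]] .
    then show "x \<in> S'" using v endoD(1)[OF Y(1)] by (simp add: S'_iff)
  qed
  have st: "stable S'"
    unfolding stable_def using S' SD endo_T endo_T' endo_Z endo_B Z_T Z_T' Z_comm Z_B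
    by (intro conjI ballI pres) auto
  then have TS': "T ` S' \<subseteq> S'" by (simp add: stable_def)
  obtain m v where m: "m \<in> carrier K" and v: "v \<in> S'" "v \<notin> S" "T v \<ominus>\<^bsub>V\<^esub> m \<odot>\<^bsub>V\<^esub> v \<in> S"
    using eigenvector_mod[OF endo_T SD(1) S' TS' \<open>w \<in> S'\<close> w(2)] by blast
  have vV: "v \<in> carrier V" using v(1) by (simp add: S'_iff)
  note TD = endoD[OF endo_T]
  have m0: "m \<noteq> \<zero>\<^bsub>K\<^esub>"
  proof
    assume "m = \<zero>\<^bsub>K\<^esub>"
    then have "(T v \<ominus>\<^bsub>V\<^esub> m \<odot>\<^bsub>V\<^esub> v) = T v"
      using vV TD(1)[OF vV] M.r_neg[of "\<zero>\<^bsub>V\<^esub>"] M.l_zero[OF M.a_inv_closed[OF M.zero_closed]]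
      by (simp add: M.minus_eq del: M.r_zero)
    then have "T v \<in> S" using v(3) by simp
    then have "T' (T v) \<in> S" using SD(3) by blast
    then show False using T'_T vV v(2) by simp
  qed
  obtain E where E: "finite E" "\<And>a w. \<lbrakk>a \<in> carrier K; w \<in> carrier V; w \<notin> S;
      T w \<ominus>\<^bsub>V\<^esub> a \<odot>\<^bsub>V\<^esub> w \<in> S\<rbrakk> \<Longrightarrow> a \<in> E"
    using finite_eigenvalues_mod[OF endo_T SD(1,2)] by blast
  have inE: "m \<otimes>\<^bsub>K\<^esub> \<chi> f \<in> E" if f: "f \<in> carrier G" for f
  proof -
    let ?g = "inv\<^bsub>G\<^esub> f"
    have g: "?g \<in> carrier G" using f by simp
    note Bg = endoD[OF endo_B[OF g]] and Zf = endoD[OF endo_Z[OF f]]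
    have Bv: "B ?g v \<in> carrier V" using Bg vV by simp
    show ?thesis
    proof (rule E(2)[OF _ Bv])
      show "B ?g v \<notin> S"
      proof
        assume "B ?g v \<in> S"
        then have "B (inv\<^bsub>G\<^esub> ?g) (B ?g v) \<in> S" using SD(5)[of "inv\<^bsub>G\<^esub> ?g"] g by blast
        then show False using B_inv[OF g vV] v(2) by simp
      qed
      have "T (B ?g v) = Z f (Z ?g (T (B ?g v)))"
        using f TD(1)[OF Bv] by (simp add: Z_mult[symmetric] Z_one)
      also have "\<dots> = B ?g (T (Z f v))"
        using B_T[OF g vV, symmetric] f g vV TD(1) by (simp add: Z_B Z_T)
      finally have 1: "T (B ?g v) = B ?g (T (Z f v))" .
      have "Z f v \<ominus>\<^bsub>V\<^esub> \<chi> f \<odot>\<^bsub>V\<^esub> v \<in> S" using v(1) f by (simp add: S'_iff)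
      then have "B ?g (T (Z f v \<ominus>\<^bsub>V\<^esub> \<chi> f \<odot>\<^bsub>V\<^esub> v)) \<in> S"
        using SD(2) SD(5)[OF g] by blast
      then have 2: "B ?g (T (Z f v)) \<ominus>\<^bsub>V\<^esub> \<chi> f \<odot>\<^bsub>V\<^esub> B ?g (T v) \<in> S"
        using f vV \<chi>c by (simp add: TD Bg Zf)
      have "\<chi> f \<odot>\<^bsub>V\<^esub> B ?g (T v \<ominus>\<^bsub>V\<^esub> m \<odot>\<^bsub>V\<^esub> v) \<in> S"
        using v(3) SD(5)[OF g] SS(4)[OF \<chi>c[OF f]] by blast
      moreover have "\<chi> f \<odot>\<^bsub>V\<^esub> B ?g (T v \<ominus>\<^bsub>V\<^esub> m \<odot>\<^bsub>V\<^esub> v)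
          = \<chi> f \<odot>\<^bsub>V\<^esub> B ?g (T v) \<ominus>\<^bsub>V\<^esub> (m \<otimes>\<^bsub>K\<^esub> \<chi> f) \<odot>\<^bsub>V\<^esub> B ?g v"
        using vV m \<chi>c[OF f]
        by (simp add: TD Bg M.minus_eq smult_r_distr smult_r_minus smult_assoc1[symmetric] R.m_comm)
      ultimately have "(B ?g (T (Z f v)) \<ominus>\<^bsub>V\<^esub> \<chi> f \<odot>\<^bsub>V\<^esub> B ?g (T v)) \<oplus>\<^bsub>V\<^esub>
          (\<chi> f \<odot>\<^bsub>V\<^esub> B ?g (T v) \<ominus>\<^bsub>V\<^esub> (m \<otimes>\<^bsub>K\<^esub> \<chi> f) \<odot>\<^bsub>V\<^esub> B ?g v) \<in> S"
        using 2 SS(3) by simp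
      moreover have cl: "B ?g (T (Z f v)) \<in> carrier V" "\<chi> f \<odot>\<^bsub>V\<^esub> B ?g (T v) \<in> carrier V"
        "(m \<otimes>\<^bsub>K\<^esub> \<chi> f) \<odot>\<^bsub>V\<^esub> B ?g v \<in> carrier V"
        using vV m \<chi>c[OF f] by (simp_all add: TD Bg Zf)
      ultimately show "T (B ?g v) \<ominus>\<^bsub>V\<^esub> (m \<otimes>\<^bsub>K\<^esub> \<chi> f) \<odot>\<^bsub>V\<^esub> B ?g v \<in> S"
        unfolding 1 by (simp add: M.minus_eq M.a_assoc M.r_neg1)
    qed (use m \<chi>c[OF f] in simp)
  qed
  have "inj_on (\<lambda>x. m \<otimes>\<^bsub>K\<^esub> x) (carrier K)"
    using m m0 m_lcancel by (auto simp: inj_on_def)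
  then have "inj_on (\<lambda>x. m \<otimes>\<^bsub>K\<^esub> x) (\<chi> ` carrier G)"
    by (rule inj_on_subset) (use \<chi>c in auto)
  moreover have "(\<lambda>x. m \<otimes>\<^bsub>K\<^esub> x) ` \<chi> ` carrier G \<subseteq> E" using inE by auto
  ultimately have "finite (\<chi> ` carrier G)" using E(1) finite_subset finite_imageD by metis
  from that[OF \<chi> one mult this st lt] show ?thesis by (simp add: S'_iff)
qed

text \<open>Filter the space by stable subspaces on whose successive quotients \<open>G\<close> acts by characters with a
  finite image. Such an image is a finite group of units, whose order is invertible in \<open>K\<close>. The
  subgroup \<open>H\<close> is the common kernel of the characters.\<close>

lemma unipotent_on_finite_index_subgroup:
  "\<exists>H N n. subgroup H G \<and> finite_index G H \<and> nat_in K N \<noteq> \<zero>\<^bsub>K\<^esub> \<and>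
    (\<forall>f\<in>carrier G. f [^]\<^bsub>G\<^esub> (N :: nat) \<in> H) \<and> (\<forall>x\<in>carrier V. nil_on V Z H {\<zero>\<^bsub>V\<^esub>} n x)"
proof -
  obtain \<mu> :: "'v set \<Rightarrow> nat" where \<mu>: "\<And>S S'. \<lbrakk>subspace K S V; subspace K S' V; S \<subset> S'\<rbrakk> \<Longrightarrow> \<mu> S' < \<mu> S"
    using subspace_measure[OF fd] by metis
  have "\<exists>H N n. subgroup H G \<and> finite_index G H \<and> nat_in K N \<noteq> \<zero>\<^bsub>K\<^esub> \<and>
    (\<forall>f\<in>carrier G. f [^]\<^bsub>G\<^esub> (N :: nat) \<in> H) \<and> (\<forall>x\<in>carrier V. nil_on V Z H S n x)"
    if "stable S" for S
    using that
  proof (induction "\<mu> S" arbitrary: S rule: less_induct)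
    case less
    show ?case
    proof (cases "S = carrier V")
      case True
      have "finite_index G (carrier G)"
        by (rule finite_indexI[of "\<lambda>_. 0 :: nat"]) (auto intro: finite_subset[of _ "{0}"])
      moreover have "nat_in K 1 \<noteq> \<zero>\<^bsub>K\<^esub>" by simp
      ultimately show ?thesis using True G.subgroup_self
        by (intro exI[of _ "carrier G"] exI[of _ 1] exI[of _ 0]) auto
    next
      case False
      obtain \<chi> S' where \<chi>: "\<chi> \<in> carrier G \<rightarrow> carrier K" "\<chi> \<one>\<^bsub>G\<^esub> = \<one>\<^bsub>K\<^esub>"
        "\<And>f g. \<lbrakk>f \<in> carrier G; g \<in> carrier G\<rbrakk> \<Longrightarrow> \<chi> (f \<otimes>\<^bsub>G\<^esub> g) = \<chi> f \<otimes>\<^bsub>K\<^esub> \<chi> g"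
        "finite (\<chi> ` carrier G)" and S': "stable S'" "S \<subset> S'"
        "\<And>f v. \<lbrakk>f \<in> carrier G; v \<in> S'\<rbrakk> \<Longrightarrow> Z f v \<ominus>\<^bsub>V\<^esub> \<chi> f \<odot>\<^bsub>V\<^esub> v \<in> S"
        using central_character[OF less.prems False] by metis
      have \<chi>c: "\<chi> f \<in> carrier K" if "f \<in> carrier G" for f using \<chi>(1) that by auto
      have "\<mu> S' < \<mu> S" using less.prems S' by (intro \<mu>) (auto simp: stable_def)
      from less.hyps[OF this S'(1)]
      obtain H N n where H: "subgroup H G" "finite_index G H" "nat_in K N \<noteq> \<zero>\<^bsub>K\<^esub>"
        "\<And>f. f \<in> carrier G \<Longrightarrow> f [^]\<^bsub>G\<^esub> (N :: nat) \<in> H" "\<And>x. x \<in> carrier V \<Longrightarrow> nil_on V Z H S' n x"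
        by blast
      interpret H: subgroup H G by fact
      define H1 where "H1 = {f \<in> carrier G. \<chi> f = \<one>\<^bsub>K\<^esub>}"
      have inv: "\<chi> (inv\<^bsub>G\<^esub> f) \<otimes>\<^bsub>K\<^esub> \<chi> f = \<one>\<^bsub>K\<^esub>" if "f \<in> carrier G" for f
        using that \<chi>(2) by (simp flip: \<chi>(3))
      have H1: "subgroup H1 G"
      proof (rule G.subgroupI)
        show "H1 \<noteq> {}" using \<chi>(2) by (auto simp: H1_def)
        show "inv\<^bsub>G\<^esub> f \<in> H1" if "f \<in> H1" for f
          using that inv[of f] \<chi>c[of "inv\<^bsub>G\<^esub> f"] by (auto simp: H1_def)
      qed (auto simp: H1_def \<chi>(3))
      have fin1: "finite_index G H1"
      proof (rule finite_indexI[OF \<chi>(4)])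
        fix u v assume uv: "u \<in> carrier G" "v \<in> carrier G" "\<chi> u = \<chi> v"
        then have "\<chi> (u \<otimes>\<^bsub>G\<^esub> inv\<^bsub>G\<^esub> v) = \<one>\<^bsub>K\<^esub>"
          using inv[of v] \<chi>c by (simp add: \<chi>(3) R.m_comm)
        then show "u \<otimes>\<^bsub>G\<^esub> inv\<^bsub>G\<^esub> v \<in> H1" using uv by (simp add: H1_def)
      qed
      define c where "c = card (\<chi> ` carrier G)"
      have "\<chi> ` carrier G \<subseteq> carrier K" using \<chi>(1) by auto
      note Y = finite_subgroup_of_units[OF \<chi>(4) this, folded c_def]
      have X': "\<one>\<^bsub>K\<^esub> \<in> \<chi> ` carrier G" using \<chi>(2) by (metis G.one_closed imageI)
      have Xm: "x \<otimes>\<^bsub>K\<^esub> y \<in> \<chi> ` carrier G" if "x \<in> \<chi> ` carrier G" "y \<in> \<chi> ` carrier G" for x y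
        using that by (auto simp flip: \<chi>(3))
      have Xi: "\<exists>y\<in>\<chi> ` carrier G. y \<otimes>\<^bsub>K\<^esub> x = \<one>\<^bsub>K\<^esub>" if "x \<in> \<chi> ` carrier G" for x
        using that inv by auto
      have c0: "nat_in K c \<noteq> \<zero>\<^bsub>K\<^esub>" using Y(2)[OF X' Xm Xi] .
      have \<chi>pow: "\<chi> (f [^]\<^bsub>G\<^esub> (k::nat)) = \<chi> f [^]\<^bsub>K\<^esub> k" if "f \<in> carrier G" for f k
        using that by (induction k) (auto simp: \<chi>(2,3))
      have powc: "f [^]\<^bsub>G\<^esub> c \<in> H1" if f: "f \<in> carrier G" for f
        using f Y(1)[OF X' Xm Xi, of "\<chi> f"] by (simp add: H1_def \<chi>pow)
      show ?thesis
      proof (rule exI[of _ "H \<inter> H1"], rule exI[of _ "N * c"], rule exI[of _ "Suc n"], intro conjI ballI)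
        show "subgroup (H \<inter> H1) G" by (rule G.subgroups_Inter_pair[OF H(1) H1])
        show "finite_index G (H \<inter> H1)" by (rule finite_index_Int[OF H(2) fin1])
        show "nat_in K (N * c) \<noteq> \<zero>\<^bsub>K\<^esub>"
          using H(3) c0 by (simp add: R.nat_in_mult integral_iff)
        fix f assume f: "f \<in> carrier G"
        have "(f [^]\<^bsub>G\<^esub> c) [^]\<^bsub>G\<^esub> N \<in> H" "(f [^]\<^bsub>G\<^esub> N) [^]\<^bsub>G\<^esub> c \<in> H1" using f H(4) powc by auto
        then show "f [^]\<^bsub>G\<^esub> (N * c) \<in> H \<inter> H1" using f by (simp add: G.nat_pow_pow mult.commute)
      next
        fix x assume x: "x \<in> carrier V"
        show "nil_on V Z (H \<inter> H1) S (Suc n) x"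
        proof (rule nil_on_extend[OF _ _ H(5)[OF x]])
          fix x h assume xh: "x \<in> S'" "h \<in> H \<inter> H1"
          then have "x \<in> carrier V" using S'(1) subspaceD(7) by (auto simp: stable_def)
          then show "Z h x \<ominus>\<^bsub>V\<^esub> x \<in> S" using S'(3)[of h x] xh by (simp add: H1_def)
        qed auto
      qed
    qed
  qed
  moreover have "stable {\<zero>\<^bsub>V\<^esub>}"
    unfolding stable_def
    using subspace_zero endoD(4)[OF endo_Z] endoD(4)[OF endo_B] endoD(4)[OF endo_T] endoD(4)[OF endo_T']
    by auto
  ultimately show ?thesis by blast
qed

end

section \<open>Additive categories\<close>

lemma hom_group_simps [simp]:
  "carrier (hom_group C x y) = Hom C x y" "f \<otimes>\<^bsub>hom_group C x y\<^esub> g = hom_add C x y f g"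
  "\<one>\<^bsub>hom_group C x y\<^esub> = hom_zero C x y"
  by (simp_all add: hom_group_def)

lemma hom_into_hom_group: "L \<in> hom G (hom_group C x y) \<longleftrightarrow>
    (\<forall>u\<in>carrier G. L u \<in> Hom C x y) \<and>
    (\<forall>u\<in>carrier G. \<forall>v\<in>carrier G. L (u \<otimes>\<^bsub>G\<^esub> v) = hom_add C x y (L u) (L v))"
  by (auto simp: hom_def)

context preadditive_category
begin

lemma add_closed [simp]:
  "\<lbrakk>x \<in> Obj C; y \<in> Obj C; f \<in> Hom C x y; g \<in> Hom C x y\<rbrakk> \<Longrightarrow> hom_add C x y f g \<in> Hom C x y"
  and zero_closed [simp]: "\<lbrakk>x \<in> Obj C; y \<in> Obj C\<rbrakk> \<Longrightarrow> hom_zero C x y \<in> Hom C x y"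
  and zero_add [simp]: "\<lbrakk>x \<in> Obj C; y \<in> Obj C; f \<in> Hom C x y\<rbrakk>
    \<Longrightarrow> hom_add C x y (hom_zero C x y) f = f"
  and add_zero [simp]: "\<lbrakk>x \<in> Obj C; y \<in> Obj C; f \<in> Hom C x y\<rbrakk>
    \<Longrightarrow> hom_add C x y f (hom_zero C x y) = f"
  and add_comm: "\<lbrakk>x \<in> Obj C; y \<in> Obj C; f \<in> Hom C x y; g \<in> Hom C x y\<rbrakk>
    \<Longrightarrow> hom_add C x y f g = hom_add C x y g f"
  and add_assoc: "\<lbrakk>x \<in> Obj C; y \<in> Obj C; f \<in> Hom C x y; g \<in> Hom C x y; h \<in> Hom C x y\<rbrakk>
    \<Longrightarrow> hom_add C x y (hom_add C x y f g) h = hom_add C x y f (hom_add C x y g h)"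
  and add_left_comm: "\<lbrakk>x \<in> Obj C; y \<in> Obj C; f \<in> Hom C x y; g \<in> Hom C x y; h \<in> Hom C x y\<rbrakk>
    \<Longrightarrow> hom_add C x y f (hom_add C x y g h) = hom_add C x y g (hom_add C x y f h)"
  and neg_closed [simp]: "\<lbrakk>x \<in> Obj C; y \<in> Obj C; f \<in> Hom C x y\<rbrakk>
    \<Longrightarrow> inv\<^bsub>hom_group C x y\<^esub> f \<in> Hom C x y"
  and add_neg [simp]: "\<lbrakk>x \<in> Obj C; y \<in> Obj C; f \<in> Hom C x y\<rbrakk>
    \<Longrightarrow> hom_add C x y f (inv\<^bsub>hom_group C x y\<^esub> f) = hom_zero C x y"
  and add_idem_zero: "\<lbrakk>x \<in> Obj C; y \<in> Obj C; f \<in> Hom C x y; hom_add C x y f f = f\<rbrakk>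
    \<Longrightarrow> f = hom_zero C x y"
proof -
  assume xy: "x \<in> Obj C" "y \<in> Obj C"
  interpret H: comm_group "hom_group C x y" using hom_comm_group xy by blast
  note c = H.m_closed H.one_closed H.l_one H.r_one H.m_comm H.m_assoc H.m_lcomm H.inv_closed H.r_inv
  show "f \<in> Hom C x y \<Longrightarrow> g \<in> Hom C x y \<Longrightarrow> hom_add C x y f g \<in> Hom C x y"
    "hom_zero C x y \<in> Hom C x y"
    "f \<in> Hom C x y \<Longrightarrow> hom_add C x y (hom_zero C x y) f = f"
    "f \<in> Hom C x y \<Longrightarrow> hom_add C x y f (hom_zero C x y) = f"
    "f \<in> Hom C x y \<Longrightarrow> g \<in> Hom C x y \<Longrightarrow> hom_add C x y f g = hom_add C x y g f"
    "f \<in> Hom C x y \<Longrightarrow> g \<in> Hom C x y \<Longrightarrow> h \<in> Hom C x y \<Longrightarrow>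
      hom_add C x y (hom_add C x y f g) h = hom_add C x y f (hom_add C x y g h)"
    "f \<in> Hom C x y \<Longrightarrow> g \<in> Hom C x y \<Longrightarrow> h \<in> Hom C x y \<Longrightarrow>
      hom_add C x y f (hom_add C x y g h) = hom_add C x y g (hom_add C x y f h)"
    "f \<in> Hom C x y \<Longrightarrow> inv\<^bsub>hom_group C x y\<^esub> f \<in> Hom C x y"
    "f \<in> Hom C x y \<Longrightarrow> hom_add C x y f (inv\<^bsub>hom_group C x y\<^esub> f) = hom_zero C x y"
    using c by simp_all
  show "f \<in> Hom C x y \<Longrightarrow> hom_add C x y f f = f \<Longrightarrow> f = hom_zero C x y"
    using H.l_cancel_one[of f f] by simp
qed

lemma comp_zero_left [simp]:
  assumes "x \<in> Obj C" "y \<in> Obj C" "z \<in> Obj C" "f \<in> Hom C x y"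
  shows "Comp C x y z (hom_zero C y z) f = hom_zero C x z"
  using assms Comp_add_left[of x y z f "hom_zero C y z" "hom_zero C y z"]
  by (intro add_idem_zero) (simp_all add: Comp_closed)

lemma comp_zero_right [simp]:
  assumes "x \<in> Obj C" "y \<in> Obj C" "z \<in> Obj C" "f \<in> Hom C y z"
  shows "Comp C x y z f (hom_zero C x y) = hom_zero C x z"
  using assms Comp_add_right[of x y z "hom_zero C x y" "hom_zero C x y" f]
  by (intro add_idem_zero) (simp_all add: Comp_closed)

lemma precomp_hom:
  assumes "x \<in> Obj C" "y \<in> Obj C" "z \<in> Obj C" "f \<in> Hom C x y"
  shows "(\<lambda>g. Comp C x y z g f) \<in> hom (hom_group C y z) (hom_group C x z)"
  using assms by (simp add: hom_into_hom_group Comp_closed Comp_add_left)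

lemma postcomp_hom:
  assumes "x \<in> Obj C" "y \<in> Obj C" "z \<in> Obj C" "g \<in> Hom C y z"
  shows "(\<lambda>f. Comp C x y z g f) \<in> hom (hom_group C x y) (hom_group C x z)"
  using assms by (simp add: hom_into_hom_group Comp_closed Comp_add_right)

definition End where
  "End s = \<lparr>carrier = Hom C s s, monoid.mult = (\<lambda>g f. Comp C s s s g f), one = Id C s,
    ring.zero = hom_zero C s s, ring.add = hom_add C s s\<rparr>"

lemma ring_End:
  assumes s: "s \<in> Obj C"
  shows "ring (End s)"
proof (rule ringI)
  show "abelian_group (End s)"
  proof (rule abelian_groupI)
    fix f assume "f \<in> carrier (End s)"
    then show "\<exists>g\<in>carrier (End s). g \<oplus>\<^bsub>End s\<^esub> f = \<zero>\<^bsub>End s\<^esub>"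
      using s by (intro bexI[of _ "inv\<^bsub>hom_group C s s\<^esub> f"]) (simp_all add: End_def add_comm)
  qed (use s in \<open>auto simp: End_def add_assoc intro: add_comm\<close>)
  show "monoid (End s)"
    using s by unfold_locales (simp_all add: End_def Comp_closed Id_closed Comp_assoc Comp_Id_left Comp_Id_right)
qed (use s in \<open>auto simp: End_def Comp_add_left Comp_add_right\<close>)

end

text \<open>The part of the structure of \<open>t = x \<oplus> x \<oplus> y\<close> that enters the relations between shears of \<open>t\<close>.\<close>

lemma (in additive_category) ex_triple:
  assumes x: "x \<in> Obj C" and y: "y \<in> Obj C"
  obtains t i1 i2 i3 p1 p2 p3 where "t \<in> Obj C"
    "i1 \<in> Hom C x t" "i2 \<in> Hom C x t" "i3 \<in> Hom C y t"
    "p1 \<in> Hom C t x" "p2 \<in> Hom C t x" "p3 \<in> Hom C t y"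
    "Comp C x t x p1 i1 = Id C x" "Comp C x t x p2 i2 = Id C x" "Comp C y t y p3 i3 = Id C y"
    "Comp C x t x p1 i2 = hom_zero C x x" "Comp C y t x p1 i3 = hom_zero C y x"
    "Comp C y t x p2 i3 = hom_zero C y x" "Comp C x t y p3 i1 = hom_zero C x y"
proof -
  obtain s j1 j2 q1 q2 where s: "biproduct C x y s j1 j2 q1 q2" using ex_biproduct x y by blast
  then have sO: "s \<in> Obj C" and j: "j1 \<in> Hom C x s" "j2 \<in> Hom C y s" "q1 \<in> Hom C s x" "q2 \<in> Hom C s y"
    and jq: "Comp C x s x q1 j1 = Id C x" "Comp C y s y q2 j2 = Id C y" "Comp C y s x q1 j2 = hom_zero C y x"
    by (auto simp: biproduct_def)
  obtain t k1 k2 r1 r2 where t: "biproduct C x s t k1 k2 r1 r2" using ex_biproduct x sO by blast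
  then have tO: "t \<in> Obj C" and k: "k1 \<in> Hom C x t" "k2 \<in> Hom C s t" "r1 \<in> Hom C t x" "r2 \<in> Hom C t s"
    and kr: "Comp C x t x r1 k1 = Id C x" "Comp C s t s r2 k2 = Id C s"
      "Comp C s t x r1 k2 = hom_zero C s x" "Comp C x t s r2 k1 = hom_zero C x s"
    by (auto simp: biproduct_def)
  note O = x y sO tO
  have r2k2: "Comp C w t s r2 (Comp C w s t k2 f) = f" if "w \<in> Obj C" "f \<in> Hom C w s" for w f
    using Comp_assoc[of w s t s f k2 r2] that O k kr by (simp add: Comp_Id_left)
  have r1k2: "Comp C w t x r1 (Comp C w s t k2 f) = hom_zero C w x" if "w \<in> Obj C" "f \<in> Hom C w s" for w f
    using Comp_assoc[of w s t x f k2 r1] that O k kr by simp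
  have qr: "Comp C w t z (Comp C t s z q r2) (Comp C w s t k2 f) = Comp C w s z q f"
    if "w \<in> Obj C" "z \<in> Obj C" "f \<in> Hom C w s" "q \<in> Hom C s z" for w z f q
    using Comp_assoc[of w t s z "Comp C w s t k2 f" r2 q] that O k r2k2 by (simp add: Comp_closed)
  show ?thesis
  proof (rule that[OF tO, of k1 "Comp C x s t k2 j1" "Comp C y s t k2 j2" r1
        "Comp C t s x q1 r2" "Comp C t s y q2 r2"])
    show "Comp C x t y (Comp C t s y q2 r2) k1 = hom_zero C x y"
      using Comp_assoc[of x t s y k1 r2 q2] O k j kr by simp
  qed (use O j k kr jq in \<open>simp_all add: Comp_closed qr r1k2\<close>)
qed

section \<open>Polynomiality of functors along subgroups of finite index\<close>

locale vect_functor = C: category C + alg: field K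
  for C :: "('o, 'm, 'e) category_data_scheme" and K :: "'k ring" +
  fixes F :: "('o, 'm, 'k, 'v) vfunctor"
  assumes functor_F: "functor_between C (Vect K) F"
begin

sublocale F: functor_between C "Vect K" F by (rule functor_F)

lemma vs: "x \<in> Obj C \<Longrightarrow> vectorspace K (fobj F x)"
  using F.fobj_closed by simp

lemma arr_linear: "\<lbrakk>x \<in> Obj C; y \<in> Obj C; f \<in> Hom C x y\<rbrakk>
    \<Longrightarrow> farr F x y f \<in> module_hom K (fobj F x) (fobj F y)"
  using F.farr_closed by simp

lemma arr_Lin: "\<lbrakk>x \<in> Obj C; y \<in> Obj C; f \<in> Hom C x y\<rbrakk>
    \<Longrightarrow> farr F x y f \<in> carrier (Lin K (fobj F x) (fobj F y))"
  using F.farr_closed by (simp add: Lin_simps)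

lemma arr_closed: "\<lbrakk>x \<in> Obj C; y \<in> Obj C; f \<in> Hom C x y; v \<in> carrier (fobj F x)\<rbrakk>
    \<Longrightarrow> farr F x y f v \<in> carrier (fobj F y)"
  using arr_linear[of x y f] by (auto simp: module_hom_def)

lemma arr_comp: "\<lbrakk>x \<in> Obj C; y \<in> Obj C; z \<in> Obj C; f \<in> Hom C x y; g \<in> Hom C y z; v \<in> carrier (fobj F x)\<rbrakk>
    \<Longrightarrow> farr F x z (Comp C x y z g f) v = farr F y z g (farr F x y f v)"
  by (simp add: F.farr_Comp compose_def)

lemma arr_Id: "\<lbrakk>x \<in> Obj C; v \<in> carrier (fobj F x)\<rbrakk> \<Longrightarrow> farr F x x (Id C x) v = v"
  by (simp add: F.farr_Id)

end

locale additive_vect_functor = A: additive_category A + vect_functor A K F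
  for A :: "('o, 'm, 'e) preadditive_data_scheme" and K F +
  assumes alg_closed: "algebraically_closed K"
    and fin_dim: "x \<in> Obj A \<Longrightarrow> vectorspace.fin_dim K (fobj F x)"

text \<open>With \<open>z(f)\<close> the shear of \<open>x \<oplus> x \<oplus> y\<close> that adds \<open>f\<close> of the first summand to the third one, \<open>F(f + h)\<close>
  equals \<open>F(p3) F(z(h)) F(z(f)) F(i1)\<close>. So the iterated differences in \<open>h\<close> are given by products of
  operators \<open>F(z(h)) - 1\<close>, and these vanish if the shears \<open>z(h)\<close> act by unipotent operators.\<close>

lemma (in additive_vect_functor) polynomial_on_cosets:
  assumes x: "x \<in> Obj A" and y: "y \<in> Obj A"
  obtains H N d where "subgroup H (hom_group A x y)" "finite_index (hom_group A x y) H"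
    "nat_in K N \<noteq> \<zero>\<^bsub>K\<^esub>" "\<And>f. f \<in> Hom A x y \<Longrightarrow> f [^]\<^bsub>hom_group A x y\<^esub> (N::nat) \<in> H"
    "\<And>f. f \<in> Hom A x y \<Longrightarrow> degree_less (hom_group A x y\<lparr>carrier := H\<rparr>)
      (Lin K (fobj F x) (fobj F y)) d (\<lambda>h. farr F x y (hom_add A x y f h))"
proof -
  obtain t i1 i2 i3 p1 p2 p3 where t: "t \<in> Obj A" and i: "i1 \<in> Hom A x t" "i2 \<in> Hom A x t" "i3 \<in> Hom A y t"
    and p: "p1 \<in> Hom A t x" "p2 \<in> Hom A t x" "p3 \<in> Hom A t y"
    and pi: "Comp A x t x p1 i1 = Id A x" "Comp A x t x p2 i2 = Id A x" "Comp A y t y p3 i3 = Id A y"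
    "Comp A x t x p1 i2 = hom_zero A x x" "Comp A y t x p1 i3 = hom_zero A y x"
    "Comp A y t x p2 i3 = hom_zero A y x" "Comp A x t y p3 i1 = hom_zero A x y"
    using A.ex_triple[OF x y] by blast
  note O = x y t
  note [simp] = A.Comp_closed A.Id_closed
  interpret E: ring "A.End t" by (rule A.ring_End[OF t])
  have Ec [simp]: "carrier (A.End t) = Hom A t t" by (simp add: A.End_def)
  define e where "e w z i f p = Comp A t z t i (Comp A t w z f p)" for w z i f p
  have e_closed: "e w z i f p \<in> Hom A t t"
    if "w \<in> Obj A" "z \<in> Obj A" "i \<in> Hom A z t" "f \<in> Hom A w z" "p \<in> Hom A t w" for w z i f p
    using that t by (simp add: e_def)
  have e_mult: "e w z i f p \<otimes>\<^bsub>A.End t\<^esub> e w' z' i' f' p'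
      = e w' z i (Comp A w' w z f (Comp A w' z' w (Comp A z' t w p i') f')) p'"
    if "w \<in> Obj A" "z \<in> Obj A" "i \<in> Hom A z t" "f \<in> Hom A w z" "p \<in> Hom A t w"
      "w' \<in> Obj A" "z' \<in> Obj A" "i' \<in> Hom A z' t" "f' \<in> Hom A w' z'" "p' \<in> Hom A t w'"
    for w z i f p w' z' i' f' p'
  proof -
    have "Comp A t t t (Comp A t z t i (Comp A t w z f p)) (Comp A t z' t i' (Comp A t w' z' f' p'))
        = Comp A t z t i (Comp A t w z f (Comp A t t w p (Comp A t z' t i' (Comp A t w' z' f' p'))))"
      using that t by (simp flip: A.Comp_assoc)
    also have "\<dots> = Comp A t z t i (Comp A t w' z
        (Comp A w' w z f (Comp A w' z' w (Comp A z' t w p i') f')) p')"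
      using that t by (simp add: A.Comp_assoc)
    finally show ?thesis by (simp add: A.End_def e_def)
  qed
  have e_zero: "e w z i (hom_zero A w z) p = \<zero>\<^bsub>A.End t\<^esub>"
    if "w \<in> Obj A" "z \<in> Obj A" "i \<in> Hom A z t" "p \<in> Hom A t w" for w z i p
    using that t by (simp add: e_def A.End_def)
  have e_add: "e w z i (hom_add A w z f g) p = e w z i f p \<oplus>\<^bsub>A.End t\<^esub> e w z i g p"
    if "w \<in> Obj A" "z \<in> Obj A" "i \<in> Hom A z t" "f \<in> Hom A w z" "g \<in> Hom A w z" "p \<in> Hom A t w"
    for w z i f g p
    using that t by (simp add: e_def A.End_def A.Comp_add_left A.Comp_add_right)
  \<comment> \<open>The matrix units of \<open>t\<close>: \<open>Q\<close> maps the first summand to the second one, \<open>R f\<close> the second one to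
    the third one, and \<open>P f\<close> is their product \<open>R f Q\<close>.\<close>
  define P where "P f = e x y i3 f p1" for f
  define R where "R f = e x y i3 f p2" for f
  define Q where "Q = e x x i2 (Id A x) p1"
  let ?G = "hom_group A x y"
  interpret G: comm_group ?G using A.hom_comm_group x y by blast
  have cl [simp]: "P f \<in> Hom A t t" "R f \<in> Hom A t t" if "f \<in> Hom A x y" for f
    using that O i p by (simp_all add: P_def R_def e_closed)
  have [simp]: "Q \<in> Hom A t t" using O i p by (simp add: Q_def e_closed)
  have prods [simp]:
    "P f \<otimes>\<^bsub>A.End t\<^esub> P g = \<zero>\<^bsub>A.End t\<^esub>" "P f \<otimes>\<^bsub>A.End t\<^esub> Q = \<zero>\<^bsub>A.End t\<^esub>"
    "Q \<otimes>\<^bsub>A.End t\<^esub> P f = \<zero>\<^bsub>A.End t\<^esub>" "P f \<otimes>\<^bsub>A.End t\<^esub> R g = \<zero>\<^bsub>A.End t\<^esub>"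
    "R f \<otimes>\<^bsub>A.End t\<^esub> P g = \<zero>\<^bsub>A.End t\<^esub>" "R f \<otimes>\<^bsub>A.End t\<^esub> R g = \<zero>\<^bsub>A.End t\<^esub>"
    "Q \<otimes>\<^bsub>A.End t\<^esub> R f = \<zero>\<^bsub>A.End t\<^esub>" "Q \<otimes>\<^bsub>A.End t\<^esub> Q = \<zero>\<^bsub>A.End t\<^esub>"
    "R f \<otimes>\<^bsub>A.End t\<^esub> Q = P f"
    if "f \<in> Hom A x y" "g \<in> Hom A x y" for f g
    using that O i p pi
    by (simp_all add: P_def R_def Q_def e_mult e_zero A.Comp_Id_left A.Comp_Id_right)
  have add: "P (hom_add A x y f g) = P f \<oplus>\<^bsub>A.End t\<^esub> P g" "R (hom_add A x y f g) = R f \<oplus>\<^bsub>A.End t\<^esub> R g"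
    if "f \<in> Hom A x y" "g \<in> Hom A x y" for f g
    using that O i p by (simp_all add: P_def R_def e_add)
  have zero: "P (hom_zero A x y) = \<zero>\<^bsub>A.End t\<^esub>" "R (hom_zero A x y) = \<zero>\<^bsub>A.End t\<^esub>"
    using O i p by (simp_all add: P_def R_def e_zero)
  let ?one = "\<one>\<^bsub>A.End t\<^esub>"
  define z where "z f = ?one \<oplus>\<^bsub>A.End t\<^esub> P f" for f
  define b where "b f = ?one \<oplus>\<^bsub>A.End t\<^esub> R f" for f
  define T where "T = ?one \<oplus>\<^bsub>A.End t\<^esub> Q"
  define T' where "T' = ?one \<ominus>\<^bsub>A.End t\<^esub> Q"
  have Ecl: "g \<in> Hom A t t \<Longrightarrow> h \<in> Hom A t t \<Longrightarrow> g \<oplus>\<^bsub>A.End t\<^esub> h \<in> Hom A t t"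
    "g \<in> Hom A t t \<Longrightarrow> \<ominus>\<^bsub>A.End t\<^esub> g \<in> Hom A t t" "?one \<in> Hom A t t" "\<zero>\<^bsub>A.End t\<^esub> \<in> Hom A t t" for g h
    using E.a_closed E.a_inv_closed E.one_closed E.zero_closed by simp_all
  have zc: "z f \<in> Hom A t t" "b f \<in> Hom A t t" if "f \<in> Hom A x y" for f
    using that Ecl by (simp_all add: z_def b_def)
  have Tc: "T \<in> Hom A t t" "T' \<in> Hom A t t" using Ecl by (simp_all add: T_def T'_def E.minus_eq)
  note exp = E.l_distr E.r_distr E.l_one E.r_one E.l_zero E.r_zero E.l_minus E.r_minus E.minus_eq
  have rel: "z (hom_add A x y f g) = z f \<otimes>\<^bsub>A.End t\<^esub> z g"
    "z f \<otimes>\<^bsub>A.End t\<^esub> T = T \<otimes>\<^bsub>A.End t\<^esub> z f" "z f \<otimes>\<^bsub>A.End t\<^esub> T' = T' \<otimes>\<^bsub>A.End t\<^esub> z f"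
    "z f \<otimes>\<^bsub>A.End t\<^esub> b g = b g \<otimes>\<^bsub>A.End t\<^esub> z f" "b (hom_add A x y f g) = b f \<otimes>\<^bsub>A.End t\<^esub> b g"
    "b f \<otimes>\<^bsub>A.End t\<^esub> T = z f \<otimes>\<^bsub>A.End t\<^esub> (T \<otimes>\<^bsub>A.End t\<^esub> b f)"
    if fg: "f \<in> Hom A x y" "g \<in> Hom A x y" for f g
    using fg Ecl by (simp_all add: z_def b_def T_def T'_def exp add E.a_ac)
  have rel0: "z (hom_zero A x y) = ?one" "b (hom_zero A x y) = ?one"
    using Ecl by (simp_all add: z_def b_def zero)
  have T'T: "T' \<otimes>\<^bsub>A.End t\<^esub> T = ?one"
    using Ecl prods(8)[of "hom_zero A x y" "hom_zero A x y"] O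
    by (simp add: T_def T'_def exp E.a_assoc E.l_neg)
  define \<rho> where "\<rho> = farr F t t"
  have \<rho>_mult: "\<rho> (g \<otimes>\<^bsub>A.End t\<^esub> f) v = \<rho> g (\<rho> f v)"
    if "f \<in> Hom A t t" "g \<in> Hom A t t" "v \<in> carrier (fobj F t)" for f g v
    using that t arr_comp[of t t t f g v] by (simp add: \<rho>_def A.End_def)
  have \<rho>_one: "\<rho> ?one v = v" if "v \<in> carrier (fobj F t)" for v
    using that t arr_Id by (simp add: \<rho>_def A.End_def)
  interpret V: vectorspace K "fobj F t" by (rule vs[OF t])
  interpret alg': algebraically_closed K by (rule alg_closed)
  interpret heisenberg K "fobj F t" ?G "\<lambda>f. \<rho> (z f)" "\<lambda>f. \<rho> (b f)" "\<rho> T" "\<rho> T'"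
  proof (unfold_locales, goal_cases)
    case 1 then show ?case using fin_dim[OF t] .
  next
    case (2 f) then show ?case using arr_linear[OF t t zc(1)] by (simp add: \<rho>_def)
  next
    case (3 f) then show ?case using arr_linear[OF t t zc(2)] by (simp add: \<rho>_def)
  next
    case 4 then show ?case using arr_linear[OF t t Tc(1)] by (simp add: \<rho>_def)
  next
    case 5 then show ?case using arr_linear[OF t t Tc(2)] by (simp add: \<rho>_def)
  next
    case (6 f g v) then show ?case using zc by (simp add: rel(1) \<rho>_mult)
  next
    case (7 v) then show ?case by (simp add: rel0 \<rho>_one)
  next
    case (8 v) then show ?case using Tc by (simp add: T'T \<rho>_one flip: \<rho>_mult)
  next
    case (9 f v)
    then have "b (hom_add A x y (inv\<^bsub>?G\<^esub> f) f) = ?one"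
      using rel0 G.l_inv[of f] by simp
    then show ?case using 9 zc O by (simp add: rel(5)[symmetric] \<rho>_one flip: \<rho>_mult)
  next
    case (10 f v) then show ?case using zc Tc by (simp add: rel(2) flip: \<rho>_mult)
  next
    case (11 f v) then show ?case using zc Tc by (simp add: rel(3) flip: \<rho>_mult)
  next
    case (12 f g v) then show ?case using zc Tc by (simp add: rel(4) flip: \<rho>_mult)
  next
    case (13 f v)
    then have "T \<otimes>\<^bsub>A.End t\<^esub> b f \<in> Hom A t t" using zc Tc E.m_closed by simp
    then show ?case using 13 zc Tc by (simp add: rel(6) flip: \<rho>_mult)
  qed
  obtain H N n where H: "subgroup H ?G" "finite_index ?G H" "nat_in K N \<noteq> \<zero>\<^bsub>K\<^esub>"
    "\<And>f. f \<in> Hom A x y \<Longrightarrow> f [^]\<^bsub>?G\<^esub> (N :: nat) \<in> H"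
    "\<And>v. v \<in> carrier (fobj F t) \<Longrightarrow> nil_on (fobj F t) (\<lambda>f. \<rho> (z f)) H {\<zero>\<^bsub>fobj F t\<^esub>} n v"
    using unipotent_on_finite_index_subgroup unfolding hom_group_simps by blast
  interpret H: subgroup H ?G by fact
  let ?H = "?G\<lparr>carrier := H\<rparr>"
  let ?L = "Lin K (fobj F x) (fobj F y)"
  interpret L: vectorspace K ?L by (rule vectorspace_Lin[OF vs[OF x] vs[OF y]])
  interpret Vx: vectorspace K "fobj F x" by (rule vs[OF x])
  interpret Vy: vectorspace K "fobj F y" by (rule vs[OF y])
  have HG: "h \<in> Hom A x y" if "h \<in> H" for h using H.subset that by auto
  have p3: "farr F t y p3 \<in> module_hom K (fobj F t) (fobj F y)" using arr_linear[OF t y p(3)] .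
  interpret p3: linear_map K "fobj F t" "fobj F y" "farr F t y p3"
    using p3 by (intro linear_map.intro mod_hom.intro mod_hom_axioms.intro V.module.module_axioms
        Vy.module.module_axioms V.vectorspace_axioms Vy.vectorspace_axioms)
  define q where "q Y h = (\<lambda>v\<in>carrier (fobj F x). farr F t y p3 (\<rho> (z h) (Y v)))" for Y h
  have key: "degree_less ?H ?L m (q Y)"
    if "Y \<in> module_hom K (fobj F x) (fobj F t)"
      "\<And>v. v \<in> carrier (fobj F x) \<Longrightarrow> nil_on (fobj F t) (\<lambda>f. \<rho> (z f)) H {\<zero>\<^bsub>fobj F t\<^esub>} m (Y v)" for m Y
    using that
  proof (induction m arbitrary: Y)
    case 0
    have "q Y h = \<zero>\<^bsub>?L\<^esub>" if "h \<in> H" for h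
      using 0 V.endoD(4)[OF arr_linear[OF t t zc(1)[OF HG[OF that]]]]
      by (auto simp: q_def Lin_simps \<rho>_def fun_eq_iff)
    then show ?case by simp
  next
    case (Suc m)
    have Yv: "Y v \<in> carrier (fobj F t)" if "v \<in> carrier (fobj F x)" for v
      using Suc.prems(1) that by (auto simp: module_hom_def)
    show ?case
      unfolding degree_less.simps
    proof
      fix k assume "k \<in> carrier ?H"
      then have k: "k \<in> H" "k \<in> Hom A x y" using HG by auto
      define Y' where "Y' v = \<rho> (z k) (Y v) \<ominus>\<^bsub>fobj F t\<^esub> Y v" for v
      have zk: "\<rho> (z k) \<in> module_hom K (fobj F t) (fobj F t)"
        using arr_linear[OF t t zc(1)[OF k(2)]] by (simp add: \<rho>_def)
      note zkD = V.endoD[OF zk]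
      have Y': "Y' \<in> module_hom K (fobj F x) (fobj F t)"
        using Suc.prems(1) zkD unfolding module_hom_def Y'_def
        by (auto simp: Pi_iff V.module.M.minus_eq V.module.smult_r_distr V.module.M.minus_add
            V.module.M.a_ac V.module.smult_r_minus)
      have "degree_less ?H ?L m (q Y')"
      proof (rule Suc.IH[OF Y'])
        fix v assume "v \<in> carrier (fobj F x)"
        from Suc.prems(2)[OF this] show "nil_on (fobj F t) (\<lambda>f. \<rho> (z f)) H {\<zero>\<^bsub>fobj F t\<^esub>} m (Y' v)"
          using k(1) by (simp add: Y'_def)
      qed
      also have "?this \<longleftrightarrow> degree_less ?H ?L m (\<lambda>h. q Y (k \<otimes>\<^bsub>?H\<^esub> h) \<ominus>\<^bsub>?L\<^esub> q Y h)"
      proof (rule degree_less_cong[OF G.subgroup_imp_group[OF H(1)]])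
        fix h assume "h \<in> carrier ?H"
        then have h: "h \<in> H" "h \<in> Hom A x y" using HG by auto
        have zh: "\<rho> (z h) \<in> module_hom K (fobj F t) (fobj F t)"
          using arr_linear[OF t t zc(1)[OF h(2)]] by (simp add: \<rho>_def)
        note zhD = V.endoD[OF zh]
        have qc: "q Y g \<in> carrier ?L" if g: "g \<in> Hom A x y" for g
        proof -
          have "\<rho> (z g) \<in> module_hom K (fobj F t) (fobj F t)"
            using arr_linear[OF t t zc(1)[OF g]] by (simp add: \<rho>_def)
          note D = V.endoD[OF this]
          show ?thesis
            using Suc.prems(1) D by (auto simp: q_def Lin_simps module_hom_def Pi_iff Vx.module.M.a_closed)
        qed
        have sum: "q Y' h \<oplus>\<^bsub>?L\<^esub> q Y h = q Y (hom_add A x y k h)"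
        proof -
          have "farr F t y p3 (\<rho> (z h) (Y' v)) \<oplus>\<^bsub>fobj F y\<^esub> farr F t y p3 (\<rho> (z h) (Y v))
              = farr F t y p3 (\<rho> (z (hom_add A x y k h)) (Y v))" if v: "v \<in> carrier (fobj F x)" for v
          proof -
            have "\<rho> (z h) (Y' v) \<oplus>\<^bsub>fobj F t\<^esub> \<rho> (z h) (Y v) = \<rho> (z h) (Y' v \<oplus>\<^bsub>fobj F t\<^esub> Y v)"
              using zhD Yv[OF v] zkD by (simp add: Y'_def)
            also have "Y' v \<oplus>\<^bsub>fobj F t\<^esub> Y v = \<rho> (z k) (Y v)"
              using Yv[OF v] zkD by (simp add: Y'_def V.module.M.minus_eq V.module.M.a_assoc V.module.M.l_neg)
            also have "\<rho> (z h) (\<rho> (z k) (Y v)) = \<rho> (z (hom_add A x y k h)) (Y v)"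
              using k h Yv[OF v] zc O by (simp add: A.add_comm[of x y k h] rel(1) \<rho>_mult)
            finally have eq: "\<rho> (z h) (Y' v) \<oplus>\<^bsub>fobj F t\<^esub> \<rho> (z h) (Y v)
              = \<rho> (z (hom_add A x y k h)) (Y v)" .
            have "\<rho> (z h) (Y' v) \<in> carrier (fobj F t)" "\<rho> (z h) (Y v) \<in> carrier (fobj F t)"
              using Yv[OF v] zhD(1) zkD(1) by (simp_all add: Y'_def)
            from p3.T_add[OF this] show ?thesis by (simp add: eq)
          qed
          then show ?thesis by (auto simp: q_def Lin_simps fun_eq_iff)
        qed
        have c: "q Y' h \<in> carrier ?L"
          using Y' zhD by (auto simp: q_def Lin_simps module_hom_def Pi_iff Vx.module.M.a_closed)
        show "q Y' h = q Y (k \<otimes>\<^bsub>?H\<^esub> h) \<ominus>\<^bsub>?L\<^esub> q Y h"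
          using c qc[OF h(2)] by (simp add: sum[symmetric] L.module.M.minus_eq L.module.M.a_assoc L.module.M.r_neg)
      qed
      finally show "degree_less ?H ?L m (\<lambda>h. q Y (k \<otimes>\<^bsub>?H\<^esub> h) \<ominus>\<^bsub>?L\<^esub> q Y h)" .
    qed
  qed
  have F_eq: "farr F x y (hom_add A x y f h) = q (\<lambda>v. \<rho> (z f) (farr F x t i1 v)) h"
    if f: "f \<in> Hom A x y" and h: "h \<in> H" for f h
  proof -
    note hh = HG[OF h]
    have fh: "hom_add A x y f h \<in> Hom A x y" using f hh O by simp
    have *: "hom_add A x y f h = Comp A x t y p3 (Comp A x t t (z (hom_add A x y f h)) i1)"
    proof -
      have "Comp A x t t (z (hom_add A x y f h)) i1 = hom_add A x t i1
          (Comp A x t t (P (hom_add A x y f h)) i1)"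
        using fh O i cl by (simp add: z_def A.End_def A.Comp_add_left A.Comp_Id_left)
      also have "Comp A x t t (P (hom_add A x y f h)) i1 = Comp A x y t i3 (hom_add A x y f h)"
        using fh O i p pi by (simp add: P_def e_def A.Comp_Id_right flip: A.Comp_assoc)
      finally show ?thesis
        using fh O i p pi by (simp add: A.Comp_add_right A.Comp_assoc A.Comp_Id_left)
    qed
    show ?thesis
    proof (rule extensionalityI[of _ "carrier (fobj F x)"])
      show "farr F x y (hom_add A x y f h) \<in> extensional (carrier (fobj F x))"
        using F.farr_closed[OF x y fh] by simp
      show "q (\<lambda>v. \<rho> (z f) (farr F x t i1 v)) h \<in> extensional (carrier (fobj F x))"
        by (simp add: q_def)
      fix v assume v: "v \<in> carrier (fobj F x)"
      have iv: "farr F x t i1 v \<in> carrier (fobj F t)" using arr_closed[OF x t i(1) v] .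
      have "farr F x y (hom_add A x y f h) v = farr F t y p3 (\<rho> (z (hom_add A x y f h)) (farr F x t i1 v))"
        unfolding \<rho>_def
        by (subst *) (use v iv fh O i p zc in \<open>simp add: arr_comp\<close>)
      also have "\<rho> (z (hom_add A x y f h)) (farr F x t i1 v) = \<rho> (z h) (\<rho> (z f) (farr F x t i1 v))"
        using f hh iv zc O by (simp add: A.add_comm[of x y f h] rel(1) \<rho>_mult)
      finally show "farr F x y (hom_add A x y f h) v = q (\<lambda>v. \<rho> (z f) (farr F x t i1 v)) h v"
        using v by (simp add: q_def)
    qed
  qed
  show ?thesis
  proof (rule that[OF H(1-4)])
    fix f assume f: "f \<in> Hom A x y"
    have zf: "\<rho> (z f) \<in> module_hom K (fobj F t) (fobj F t)"
      using arr_linear[OF t t zc(1)[OF f]] by (simp add: \<rho>_def)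
    have Y: "(\<lambda>v. \<rho> (z f) (farr F x t i1 v)) \<in> module_hom K (fobj F x) (fobj F t)"
      using arr_linear[OF x t i(1)] V.endoD[OF zf] by (auto simp: module_hom_def Pi_iff)
    then have "degree_less ?H ?L n (q (\<lambda>v. \<rho> (z f) (farr F x t i1 v)))"
      using H(5) by (intro key) (auto simp: module_hom_def)
    then show "degree_less ?H ?L n (\<lambda>h. farr F x y (hom_add A x y f h))"
      by (subst degree_less_cong[OF G.subgroup_imp_group[OF H(1)]]) (auto simp: F_eq[OF f])
  qed
qed

section \<open>Functors of finite length\<close>

context vect_functor
begin

lemma subfunctorD:
  assumes "subfunctor K C F S"
  shows "x \<in> Obj C \<Longrightarrow> subspace K (S x) (fobj F x)"
    "\<lbrakk>x \<in> Obj C; y \<in> Obj C; f \<in> Hom C x y; v \<in> S x\<rbrakk> \<Longrightarrow> farr F x y f v \<in> S y"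
  using assms unfolding subfunctor_def by blast+

lemma arr_module_hom:
  assumes "x \<in> Obj C" "y \<in> Obj C" "f \<in> Hom C x y" "v \<in> carrier (fobj F x)"
  shows "w \<in> carrier (fobj F x) \<Longrightarrow>
      farr F x y f (v \<oplus>\<^bsub>fobj F x\<^esub> w) = farr F x y f v \<oplus>\<^bsub>fobj F y\<^esub> farr F x y f w"
    "a \<in> carrier K \<Longrightarrow> farr F x y f (a \<odot>\<^bsub>fobj F x\<^esub> v) = a \<odot>\<^bsub>fobj F y\<^esub> farr F x y f v"
  using arr_linear[OF assms(1-3)] assms(4) by (auto simp: module_hom_def)

lemma arr_zero:
  assumes "x \<in> Obj C" "y \<in> Obj C" "f \<in> Hom C x y"
  shows "farr F x y f \<zero>\<^bsub>fobj F x\<^esub> = \<zero>\<^bsub>fobj F y\<^esub>"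
proof -
  interpret Vx: vectorspace K "fobj F x" using vs assms by blast
  interpret Vy: vectorspace K "fobj F y" using vs assms by blast
  have "farr F x y f (\<zero>\<^bsub>K\<^esub> \<odot>\<^bsub>fobj F x\<^esub> \<zero>\<^bsub>fobj F x\<^esub>) = \<zero>\<^bsub>K\<^esub> \<odot>\<^bsub>fobj F y\<^esub> farr F x y f \<zero>\<^bsub>fobj F x\<^esub>"
    using assms by (intro arr_module_hom(2)) auto
  then show ?thesis using arr_closed[OF assms Vx.module.M.zero_closed] by simp
qed

text \<open>Subfunctors between \<open>S\<close> and \<open>S'\<close> correspond to subfunctors of the quotient.\<close>

lemma intermediate_subfunctor:
  assumes S: "subfunctor K C F S" and S': "subfunctor K C F S'" and T: "subfunctor K C F T"
    and ST: "\<And>x. x \<in> Obj C \<Longrightarrow> S x \<subseteq> T x" "\<And>x. x \<in> Obj C \<Longrightarrow> T x \<subseteq> S' x"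
    and simple: "simple_functor K C (quotient_functor (restrict_functor F S') S)"
  shows "(\<forall>x\<in>Obj C. T x = S x) \<or> (\<forall>x\<in>Obj C. T x = S' x)"
    and "\<exists>x\<in>Obj C. \<not> S' x \<subseteq> S x"
proof -
  define V where "V x = (fobj F x)\<lparr>carrier := S' x\<rparr>" for x
  define Q where "Q = quotient_functor (restrict_functor F S') S"
  have objQ: "fobj Q x = quotient_space (V x) (S x)" for x
    by (simp add: Q_def quotient_functor_def restrict_functor_def V_def)
  have vsV: "vectorspace K (V x)" if "x \<in> Obj C" for x
    unfolding V_def using vectorspace.subspace_is_vs[OF vs[OF that] subfunctorD(1)[OF S' that]] .
  have subV: "subspace K (S x) (V x)" and TV: "T x \<subseteq> carrier (V x)" if x: "x \<in> Obj C" for x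
  proof -
    interpret V: vectorspace K "fobj F x" by (rule vs[OF x])
    interpret W: vectorspace K "V x" by (rule vsV[OF x])
    show "subspace K (S x) (V x)"
      using V.subspaceD[OF subfunctorD(1)[OF S x]] ST[OF x]
      by (intro W.subspaceI) (auto simp: V_def)
    show "T x \<subseteq> carrier (V x)" using ST[OF x] by (simp add: V_def)
  qed
  have self: "v \<in> S x +>\<^bsub>V x\<^esub> v" if "x \<in> Obj C" "v \<in> carrier (V x)" for x v
    using abelian_subgroup.a_rcos_self[OF subspace_abelian_subgroup[OF subV]] that by blast
  have const: "S x +>\<^bsub>V x\<^esub> v = S x" if x: "x \<in> Obj C" and v: "v \<in> S x" for x v
    using abelian_subgroup.a_rcos_const[OF subspace_abelian_subgroup[OF subV[OF x]] v] .
  have coset: "S x +>\<^bsub>V x\<^esub> v \<in> a_rcosets\<^bsub>V x\<^esub> S x" if "v \<in> carrier (V x)" for x v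
    using that by (auto simp: A_RCOSETS_def')
  define U where "U x = (\<lambda>v. S x +>\<^bsub>V x\<^esub> v) ` T x" for x
  have "subfunctor K C Q U"
    unfolding subfunctor_def
  proof (intro conjI ballI)
    fix x assume x: "x \<in> Obj C"
    interpret V: vectorspace K "fobj F x" by (rule vs[OF x])
    interpret q: vectorspace K "quotient_space (V x) (S x)"
      by (rule vectorspace_quotient_space[OF subV[OF x]])
    note TD = V.subspaceD[OF subfunctorD(1)[OF T x]]
    show "subspace K (U x) (fobj Q x)"
      unfolding objQ
    proof (rule q.subspaceI)
      show "U x \<subseteq> carrier (quotient_space (V x) (S x))" using TV[OF x] coset by (auto simp: U_def)
      have "\<zero>\<^bsub>fobj F x\<^esub> \<in> S x" using V.subspaceD(2)[OF subfunctorD(1)[OF S x]] .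
      then show "\<zero>\<^bsub>quotient_space (V x) (S x)\<^esub> \<in> U x"
        using const[OF x] TD(2) by (force simp: U_def)
    next
      fix P P' assume "P \<in> U x" "P' \<in> U x"
      then obtain v w where vw: "v \<in> T x" "w \<in> T x" "P = S x +>\<^bsub>V x\<^esub> v" "P' = S x +>\<^bsub>V x\<^esub> w"
        by (auto simp: U_def)
      have "P <+>\<^bsub>V x\<^esub> P' = S x +>\<^bsub>V x\<^esub> (v \<oplus>\<^bsub>V x\<^esub> w)"
        unfolding vw using vw(1,2) TV[OF x]
        by (intro abelian_subgroup.a_rcos_sum[OF subspace_abelian_subgroup[OF subV[OF x]]]) auto
      then show "P \<oplus>\<^bsub>quotient_space (V x) (S x)\<^esub> P' \<in> U x"
        using TD(3)[OF vw(1,2)] by (auto simp: U_def V_def)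
    next
      fix a P assume a: "a \<in> carrier K" and "P \<in> U x"
      then obtain v where v: "v \<in> T x" "P = S x +>\<^bsub>V x\<^esub> v" by (auto simp: U_def)
      have "(\<Union>u\<in>S x +>\<^bsub>V x\<^esub> v. S x +>\<^bsub>V x\<^esub> (a \<odot>\<^bsub>V x\<^esub> u)) = S x +>\<^bsub>V x\<^esub> (a \<odot>\<^bsub>V x\<^esub> v)"
        using v(1) TV[OF x] by (intro quotient_space_smult[OF subV[OF x] a]) auto
      then show "a \<odot>\<^bsub>quotient_space (V x) (S x)\<^esub> P \<in> U x"
        using TD(4)[OF a v(1)] v(2) by (auto simp: U_def V_def)
    qed
  next
    fix x y f assume xy: "x \<in> Obj C" "y \<in> Obj C" "f \<in> Hom C x y"
    show "farr Q x y f ` U x \<subseteq> U y"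
    proof
      fix P' assume "P' \<in> farr Q x y f ` U x"
      then obtain v where v: "v \<in> T x" "P' = farr Q x y f (S x +>\<^bsub>V x\<^esub> v)" by (auto simp: U_def)
      have vV: "v \<in> carrier (V x)" using v TV[OF xy(1)] by auto
      let ?f = "restrict (farr F x y f) (S' x)"
      interpret V: vectorspace K "fobj F x" by (rule vs[OF xy(1)])
      note S'D = V.subspaceD[OF subfunctorD(1)[OF S' xy(1)]]
      have "(\<Union>u\<in>S x +>\<^bsub>V x\<^esub> v. S y +>\<^bsub>V y\<^esub> ?f u) = S y +>\<^bsub>V y\<^esub> ?f v"
      proof (rule rcoset_map[OF subV[OF xy(1)] subV[OF xy(2)] _ _ _ vV])
        show "?f ` S x \<subseteq> S y"
          using subfunctorD(2)[OF S xy] ST[OF xy(1)] by auto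
      qed (use subfunctorD(2)[OF S' xy] S'D xy in \<open>auto simp: V_def arr_module_hom\<close>)
      then have "P' = S y +>\<^bsub>V y\<^esub> farr F x y f v"
        using v vV coset[OF vV]
        by (simp add: Q_def quotient_functor_def restrict_functor_def V_def)
      then show "P' \<in> U y" using subfunctorD(2)[OF T xy v(1)] by (auto simp: U_def)
    qed
  qed
  moreover have sQ: "simple_functor K C Q" using simple by (simp add: Q_def)
  ultimately have "(\<forall>x\<in>Obj C. U x = {\<zero>\<^bsub>fobj Q x\<^esub>}) \<or> (\<forall>x\<in>Obj C. U x = carrier (fobj Q x))"
    using sQ[unfolded simple_functor_def, THEN conjunct2, THEN conjunct2, rule_format, of U] by simp
  then show "(\<forall>x\<in>Obj C. T x = S x) \<or> (\<forall>x\<in>Obj C. T x = S' x)"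
  proof
    assume *: "\<forall>x\<in>Obj C. U x = {\<zero>\<^bsub>fobj Q x\<^esub>}"
    have "T x \<subseteq> S x" if x: "x \<in> Obj C" for x
    proof
      fix v assume v: "v \<in> T x"
      then have "S x +>\<^bsub>V x\<^esub> v = S x" using * x by (auto simp: U_def objQ)
      then show "v \<in> S x" using self[OF x, of v] v TV[OF x] by auto
    qed
    then show ?thesis using ST by blast
  next
    assume *: "\<forall>x\<in>Obj C. U x = carrier (fobj Q x)"
    have "S' x \<subseteq> T x" if x: "x \<in> Obj C" for x
    proof
      fix v assume "v \<in> S' x"
      then have vV: "v \<in> carrier (V x)" by (simp add: V_def)
      then have "S x +>\<^bsub>V x\<^esub> v \<in> U x" using * x coset by (auto simp: objQ)
      then obtain t where t: "t \<in> T x" "S x +>\<^bsub>V x\<^esub> v = S x +>\<^bsub>V x\<^esub> t" by (auto simp: U_def)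
      then have "v \<in> S x +>\<^bsub>V x\<^esub> t" using self[OF x vV] by simp
      then obtain s where "s \<in> S x" "v = s \<oplus>\<^bsub>fobj F x\<^esub> t" by (auto simp: a_r_coset_def' V_def)
      then show "v \<in> T x"
        using t(1) ST(1)[OF x] vectorspace.subspaceD(3)[OF vs[OF x] subfunctorD(1)[OF T x]] by auto
    qed
    then show ?thesis using ST by blast
  qed
  show "\<exists>x\<in>Obj C. \<not> S' x \<subseteq> S x"
  proof -
    obtain x where x: "x \<in> Obj C" "carrier (fobj Q x) \<noteq> {\<zero>\<^bsub>fobj Q x\<^esub>}"
      using sQ[unfolded simple_functor_def, THEN conjunct2, THEN conjunct1] by (elim bexE)
    have "\<not> S' x \<subseteq> S x"
    proof
      assume "S' x \<subseteq> S x"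
      then have "S x +>\<^bsub>V x\<^esub> v = S x" if "v \<in> carrier (V x)" for v
        using const[OF x(1)] that by (auto simp: V_def)
      moreover have "\<zero>\<^bsub>V x\<^esub> \<in> carrier (V x)" using vectorspace_closed(3)[OF vsV[OF x(1)]] .
      ultimately have "a_rcosets\<^bsub>V x\<^esub> S x = {S x}" by (auto simp: A_RCOSETS_def')
      then show False using x(2) by (simp add: objQ)
    qed
    then show ?thesis using x(1) by blast
  qed
qed

end

lemma (in additive_category) ex_common_retract:
  fixes n :: nat
  assumes "\<And>i. i < n \<Longrightarrow> xs i \<in> Obj C"
  shows "\<exists>z\<in>Obj C. \<forall>i<n. \<exists>f\<in>Hom C (xs i) z. \<exists>g\<in>Hom C z (xs i). Comp C (xs i) z (xs i) g f = Id C (xs i)"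
  using assms
proof (induction n)
  case 0
  then show ?case using ex_zero_object by (auto simp: zero_object_def)
next
  case (Suc n)
  then obtain z where z: "z \<in> Obj C" "\<And>i. i < n \<Longrightarrow>
      \<exists>f\<in>Hom C (xs i) z. \<exists>g\<in>Hom C z (xs i). Comp C (xs i) z (xs i) g f = Id C (xs i)" by auto
  have n: "xs n \<in> Obj C" using Suc.prems by simp
  obtain s i j p q where bi: "biproduct C z (xs n) s i j p q" using ex_biproduct z(1) n by blast
  then have s: "s \<in> Obj C" "i \<in> Hom C z s" "j \<in> Hom C (xs n) s" "p \<in> Hom C s z" "q \<in> Hom C s (xs n)"
    "Comp C z s z p i = Id C z" "Comp C (xs n) s (xs n) q j = Id C (xs n)"
    by (auto simp: biproduct_def)
  have "\<exists>f\<in>Hom C (xs k) s. \<exists>g\<in>Hom C s (xs k). Comp C (xs k) s (xs k) g f = Id C (xs k)"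
    if "k < Suc n" for k
  proof (cases "k = n")
    case True
    then show ?thesis using s by blast
  next
    case False
    then have k: "k < n" "xs k \<in> Obj C" using that Suc.prems by auto
    obtain f g where fg: "f \<in> Hom C (xs k) z" "g \<in> Hom C z (xs k)" "Comp C (xs k) z (xs k) g f = Id C (xs k)"
      using z(2)[OF k(1)] by blast
    have pif: "Comp C (xs k) s z p (Comp C (xs k) z s i f) = f"
      using Comp_assoc[of "xs k" z s z f i p] k z(1) s fg by (simp add: Comp_Id_left)
    have "Comp C (xs k) s (xs k) (Comp C s z (xs k) g p) (Comp C (xs k) z s i f) = Id C (xs k)"
      using Comp_assoc[of "xs k" s z "xs k" "Comp C (xs k) z s i f" p g] k z(1) s fg pif
      by (simp add: Comp_closed)
    then show ?thesis using k z(1) s fg Comp_closed by blast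
  qed
  then show ?case using s(1) by blast
qed

text \<open>Choose \<open>z\<close> such that every composition factor is nonzero at \<open>z\<close>: a direct sum of objects at which
  the factors are nonzero. The composition factors of a subfunctor are among those of \<open>F\<close>, so a
  subfunctor that is zero, or everything, at \<open>z\<close> is so everywhere.\<close>

lemma (in additive_vect_functor) ex_detecting_object:
  assumes fl: "finite_length K A F"
  shows "\<exists>z\<in>Obj A. \<forall>G. subfunctor K A F G \<longrightarrow>
    (G z = carrier (fobj F z) \<longrightarrow> (\<forall>x\<in>Obj A. G x = carrier (fobj F x))) \<and>
    (G z = {\<zero>\<^bsub>fobj F z\<^esub>} \<longrightarrow> (\<forall>x\<in>Obj A. G x = {\<zero>\<^bsub>fobj F x\<^esub>}))"
proof -
  obtain n :: nat and S where *: "(\<forall>i\<le>n. subfunctor K A F (S i)) \<and>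
      (\<forall>x\<in>Obj A. S 0 x = {\<zero>\<^bsub>fobj F x\<^esub>}) \<and> (\<forall>x\<in>Obj A. S n x = carrier (fobj F x)) \<and>
      (\<forall>i<n. (\<forall>x\<in>Obj A. S i x \<subseteq> S (Suc i) x) \<and>
        simple_functor K A (quotient_functor (restrict_functor F (S (Suc i))) (S i)))"
    using fl[unfolded finite_length_def, THEN conjunct2] by (elim exE) (rule that)
  have S: "\<And>i. i \<le> n \<Longrightarrow> subfunctor K A F (S i)"
    "\<And>x. x \<in> Obj A \<Longrightarrow> S 0 x = {\<zero>\<^bsub>fobj F x\<^esub>}" "\<And>x. x \<in> Obj A \<Longrightarrow> S n x = carrier (fobj F x)"
    "\<And>i x. i < n \<Longrightarrow> x \<in> Obj A \<Longrightarrow> S i x \<subseteq> S (Suc i) x"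
    "\<And>i. i < n \<Longrightarrow> simple_functor K A (quotient_functor (restrict_functor F (S (Suc i))) (S i))"
    using * by simp_all
  have sub: "subfunctor K A F (S i)" "subfunctor K A F (S (Suc i))" if "i < n" for i
    using S(1)[of i] S(1)[of "Suc i"] that by auto
  have mid: "(\<forall>x\<in>Obj A. T x = S i x) \<or> (\<forall>x\<in>Obj A. T x = S (Suc i) x)"
    if i: "i < n" and "subfunctor K A F T" "\<And>x. x \<in> Obj A \<Longrightarrow> S i x \<subseteq> T x"
      "\<And>x. x \<in> Obj A \<Longrightarrow> T x \<subseteq> S (Suc i) x" for i T
    using intermediate_subfunctor(1)[OF sub[OF i] that(2-4) S(5)[OF i]] .
  have ne: "\<exists>x\<in>Obj A. \<not> S (Suc i) x \<subseteq> S i x" if i: "i < n" for i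
    using intermediate_subfunctor(2)[OF sub[OF i] sub(1)[OF i] _ S(4)[OF i] S(5)[OF i]] by simp
  obtain xs where xs: "\<And>i. i < n \<Longrightarrow> xs i \<in> Obj A" "\<And>i. i < n \<Longrightarrow> \<not> S (Suc i) (xs i) \<subseteq> S i (xs i)"
    using ne by metis
  obtain z where z: "z \<in> Obj A" "\<And>i. i < n \<Longrightarrow>
      \<exists>f\<in>Hom A (xs i) z. \<exists>g\<in>Hom A z (xs i). Comp A (xs i) z (xs i) g f = Id A (xs i)"
    using A.ex_common_retract[of n xs, OF xs(1)] by blast
  have zne: "S i z \<noteq> S (Suc i) z" if i: "i < n" for i
  proof
    assume eq: "S i z = S (Suc i) z"
    obtain v where v: "v \<in> S (Suc i) (xs i)" "v \<notin> S i (xs i)" using xs(2)[OF i] by blast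
    obtain f g where fg: "f \<in> Hom A (xs i) z" "g \<in> Hom A z (xs i)" "Comp A (xs i) z (xs i) g f = Id A (xs i)"
      using z(2)[OF i] by blast
    have vF: "v \<in> carrier (fobj F (xs i))"
      using v(1) vectorspace.subspaceD(7)[OF vs[OF xs(1)[OF i]] subfunctorD(1)[OF sub(2)[OF i] xs(1)[OF i]]]
      by blast
    have "farr F (xs i) z f v \<in> S i z"
      using subfunctorD(2)[OF sub(2)[OF i] xs(1)[OF i] z(1) fg(1) v(1)] eq by simp
    then have "farr F z (xs i) g (farr F (xs i) z f v) \<in> S i (xs i)"
      using subfunctorD(2)[OF sub(1)[OF i] z(1) xs(1)[OF i] fg(2)] by blast
    then have "v \<in> S i (xs i)"
      using arr_comp[OF xs(1)[OF i] z(1) xs(1)[OF i] fg(1,2) vF] arr_Id[OF xs(1)[OF i] vF] fg(3) by simp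
    then show False using v(2) by simp
  qed
  have Int: "subfunctor K A F (\<lambda>x. G x \<inter> G' x)" if "subfunctor K A F G" "subfunctor K A F G'" for G G'
    unfolding subfunctor_def
  proof (intro conjI ballI)
    fix x assume x: "x \<in> Obj A"
    show "subspace K (G x \<inter> G' x) (fobj F x)"
      by (intro vectorspace.subspace_Int[OF vs[OF x]] subfunctorD(1)[OF that(1) x] subfunctorD(1)[OF that(2) x])
  qed (use subfunctorD(2)[OF that(1)] subfunctorD(2)[OF that(2)] in blast)
  have Sum: "subfunctor K A F (\<lambda>x. {v. \<exists>s\<in>G x. \<exists>g\<in>G' x. v = s \<oplus>\<^bsub>fobj F x\<^esub> g})"
    if G: "subfunctor K A F G" and G': "subfunctor K A F G'" for G G'
    unfolding subfunctor_def
  proof (intro conjI ballI)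
    fix x assume x: "x \<in> Obj A"
    interpret V: vectorspace K "fobj F x" by (rule vs[OF x])
    note D = V.subspaceD[OF subfunctorD(1)[OF G x]] and D' = V.subspaceD[OF subfunctorD(1)[OF G' x]]
    show "subspace K {v. \<exists>s\<in>G x. \<exists>g\<in>G' x. v = s \<oplus>\<^bsub>fobj F x\<^esub> g} (fobj F x)"
    proof (rule V.subspaceI)
      show "{v. \<exists>s\<in>G x. \<exists>g\<in>G' x. v = s \<oplus>\<^bsub>fobj F x\<^esub> g} \<subseteq> carrier (fobj F x)" using D(7) D'(7) by auto
      have "\<zero>\<^bsub>fobj F x\<^esub> = \<zero>\<^bsub>fobj F x\<^esub> \<oplus>\<^bsub>fobj F x\<^esub> \<zero>\<^bsub>fobj F x\<^esub>" by simp
      then show "\<zero>\<^bsub>fobj F x\<^esub> \<in> {v. \<exists>s\<in>G x. \<exists>g\<in>G' x. v = s \<oplus>\<^bsub>fobj F x\<^esub> g}" using D(2) D'(2) by blast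
    next
      fix v w assume "v \<in> {v. \<exists>s\<in>G x. \<exists>g\<in>G' x. v = s \<oplus>\<^bsub>fobj F x\<^esub> g}" "w \<in> {v. \<exists>s\<in>G x. \<exists>g\<in>G' x. v = s \<oplus>\<^bsub>fobj F x\<^esub> g}"
      then obtain s g s' g' where *: "s \<in> G x" "g \<in> G' x" "s' \<in> G x" "g' \<in> G' x"
        "v = s \<oplus>\<^bsub>fobj F x\<^esub> g" "w = s' \<oplus>\<^bsub>fobj F x\<^esub> g'" by blast
      have "v \<oplus>\<^bsub>fobj F x\<^esub> w = (s \<oplus>\<^bsub>fobj F x\<^esub> s') \<oplus>\<^bsub>fobj F x\<^esub> (g \<oplus>\<^bsub>fobj F x\<^esub> g')"
        using * D(7) D'(7) by (simp add: V.module.M.a_ac)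
      then show "v \<oplus>\<^bsub>fobj F x\<^esub> w \<in> {v. \<exists>s\<in>G x. \<exists>g\<in>G' x. v = s \<oplus>\<^bsub>fobj F x\<^esub> g}"
        using * D(3) D'(3) by blast
    next
      fix a v assume a: "a \<in> carrier K" and "v \<in> {v. \<exists>s\<in>G x. \<exists>g\<in>G' x. v = s \<oplus>\<^bsub>fobj F x\<^esub> g}"
      then obtain s g where *: "s \<in> G x" "g \<in> G' x" "v = s \<oplus>\<^bsub>fobj F x\<^esub> g" by blast
      have "a \<odot>\<^bsub>fobj F x\<^esub> v = a \<odot>\<^bsub>fobj F x\<^esub> s \<oplus>\<^bsub>fobj F x\<^esub> a \<odot>\<^bsub>fobj F x\<^esub> g"
        using * a D(7) D'(7) by (simp add: V.module.smult_r_distr)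
      then show "a \<odot>\<^bsub>fobj F x\<^esub> v \<in> {v. \<exists>s\<in>G x. \<exists>g\<in>G' x. v = s \<oplus>\<^bsub>fobj F x\<^esub> g}"
        using * D(4)[OF a] D'(4)[OF a] by blast
    qed
  next
    fix x y f assume xy: "x \<in> Obj A" "y \<in> Obj A" "f \<in> Hom A x y"
    note D = vectorspace.subspaceD(7)[OF vs[OF xy(1)] subfunctorD(1)[OF G xy(1)]]
      and D' = vectorspace.subspaceD(7)[OF vs[OF xy(1)] subfunctorD(1)[OF G' xy(1)]]
    show "farr F x y f ` {v. \<exists>s\<in>G x. \<exists>g\<in>G' x. v = s \<oplus>\<^bsub>fobj F x\<^esub> g}
        \<subseteq> {v. \<exists>s\<in>G y. \<exists>g\<in>G' y. v = s \<oplus>\<^bsub>fobj F y\<^esub> g}"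
    proof clarify
      fix s g assume "s \<in> G x" "g \<in> G' x"
      moreover from this have "farr F x y f (s \<oplus>\<^bsub>fobj F x\<^esub> g) = farr F x y f s \<oplus>\<^bsub>fobj F y\<^esub> farr F x y f g"
        using D D' xy by (simp add: arr_module_hom)
      ultimately show "\<exists>s'\<in>G y. \<exists>g'\<in>G' y. farr F x y f (s \<oplus>\<^bsub>fobj F x\<^esub> g) = s' \<oplus>\<^bsub>fobj F y\<^esub> g'"
        using subfunctorD(2)[OF G xy] subfunctorD(2)[OF G' xy] by blast
    qed
  qed
  show ?thesis
  proof (rule bexI[OF _ z(1)], intro allI impI conjI ballI)
    fix G x assume G: "subfunctor K A F G" and Gz: "G z = carrier (fobj F z)" and x: "x \<in> Obj A"
    have "\<forall>x\<in>Obj A. S i x \<subseteq> G x" if "i \<le> n" for i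
      using that
    proof (induction i)
      case 0
      then show ?case
        using S(2) vectorspace.subspaceD(2)[OF vs subfunctorD(1)[OF G]] by simp
    next
      case (Suc i)
      then have i: "i < n" by simp
      let ?T = "\<lambda>x. G x \<inter> S (Suc i) x"
      have "(\<forall>x\<in>Obj A. ?T x = S i x) \<or> (\<forall>x\<in>Obj A. ?T x = S (Suc i) x)"
        using Suc S(4)[OF i] by (intro mid i Int G sub) auto
      moreover have "?T z = S (Suc i) z"
        using Gz vectorspace.subspaceD(1)[OF vs[OF z(1)] subfunctorD(1)[OF sub(2)[OF i] z(1)]] by auto
      ultimately show ?case using zne[OF i] z(1) by blast
    qed
    from this[of n] show "G x = carrier (fobj F x)"
      using S(3)[OF x] x vectorspace.subspaceD(1)[OF vs[OF x] subfunctorD(1)[OF G x]] by auto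
  next
    fix G x assume G: "subfunctor K A F G" and Gz: "G z = {\<zero>\<^bsub>fobj F z\<^esub>}" and x: "x \<in> Obj A"
    have "\<forall>x\<in>Obj A. G x \<inter> S i x \<subseteq> {\<zero>\<^bsub>fobj F x\<^esub>}" if "i \<le> n" for i
      using that
    proof (induction i)
      case 0
      then show ?case using S(2) by simp
    next
      case (Suc i)
      then have i: "i < n" by simp
      \<comment> \<open>the sum of \<open>S i\<close> and the part of \<open>G\<close> in \<open>S (Suc i)\<close>, which at \<open>z\<close> reduces to \<open>S i z\<close>\<close>
      define T where "T x = {v. \<exists>s\<in>S i x. \<exists>g\<in>G x \<inter> S (Suc i) x. v = s \<oplus>\<^bsub>fobj F x\<^esub> g}" for x
      have z0: "v \<oplus>\<^bsub>fobj F x\<^esub> \<zero>\<^bsub>fobj F x\<^esub> = v" "\<zero>\<^bsub>fobj F x\<^esub> \<oplus>\<^bsub>fobj F x\<^esub> v = v"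
        if "x \<in> Obj A" "v \<in> S i x \<or> v \<in> S (Suc i) x" for x v
      proof -
        interpret V: vectorspace K "fobj F x" by (rule vs[OF that(1)])
        have "v \<in> carrier (fobj F x)"
          using that V.subspaceD(7)[OF subfunctorD(1)[OF sub(1)[OF i] that(1)]]
            V.subspaceD(7)[OF subfunctorD(1)[OF sub(2)[OF i] that(1)]] by blast
        then show "v \<oplus>\<^bsub>fobj F x\<^esub> \<zero>\<^bsub>fobj F x\<^esub> = v" "\<zero>\<^bsub>fobj F x\<^esub> \<oplus>\<^bsub>fobj F x\<^esub> v = v" by simp_all
      qed
      have zin: "\<zero>\<^bsub>fobj F x\<^esub> \<in> G x" "\<zero>\<^bsub>fobj F x\<^esub> \<in> S i x" "\<zero>\<^bsub>fobj F x\<^esub> \<in> S (Suc i) x"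
        if "x \<in> Obj A" for x
        using that vectorspace.subspaceD(2)[OF vs subfunctorD(1)] G sub[OF i] by blast+
      have "(\<forall>x\<in>Obj A. T x = S i x) \<or> (\<forall>x\<in>Obj A. T x = S (Suc i) x)"
      proof (rule mid[OF i])
        show "subfunctor K A F T"
          unfolding T_def by (rule Sum[OF sub(1)[OF i] Int[OF G sub(2)[OF i]]])
        fix x assume x: "x \<in> Obj A"
        show "S i x \<subseteq> T x" unfolding T_def using z0(1)[OF x] zin[OF x] by force
        show "T x \<subseteq> S (Suc i) x"
          unfolding T_def using vectorspace.subspaceD(3)[OF vs[OF x] subfunctorD(1)[OF sub(2)[OF i] x]] S(4)[OF i x] by auto
      qed
      moreover have "T z = S i z" unfolding T_def using Gz z0(1)[OF z(1)] zin[OF z(1)] by force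
      ultimately have *: "\<forall>x\<in>Obj A. T x = S i x" using zne[OF i] z(1) by metis
      have "G x \<inter> S (Suc i) x \<subseteq> S i x" if x: "x \<in> Obj A" for x
      proof
        fix v assume v: "v \<in> G x \<inter> S (Suc i) x"
        then have "v = \<zero>\<^bsub>fobj F x\<^esub> \<oplus>\<^bsub>fobj F x\<^esub> v" using z0(2)[OF x] by simp
        then have "v \<in> T x" unfolding T_def using v zin[OF x] by blast
        then show "v \<in> S i x" using * x by blast
      qed
      then show ?case using Suc.IH i by fastforce
    qed
    from this[of n] show "G x = {\<zero>\<^bsub>fobj F x\<^esub>}"
      using S(3)[OF x] x vectorspace.subspaceD(1,2)[OF vs[OF x] subfunctorD(1)[OF G x]] by auto
  qed
qed

text \<open>The vectors on which the maps \<open>F(a) \<phi> F(c)\<close> and \<open>F(a) \<psi> F(c)\<close> agree for all \<open>a\<close> and \<open>c\<close>, and the vectors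
  annihilated by all maps into \<open>F z\<close>, form subfunctors, which are determined by their values at \<open>z\<close>.\<close>

lemma (in additive_vect_functor) ex_separating_object:
  assumes fl: "finite_length K A F"
  obtains z where "z \<in> Obj A"
    "\<And>x y \<phi> \<psi>. \<lbrakk>x \<in> Obj A; y \<in> Obj A; \<phi> \<in> Hom (Vect K) (fobj F x) (fobj F y);
      \<psi> \<in> Hom (Vect K) (fobj F x) (fobj F y);
      \<And>a b v. \<lbrakk>a \<in> Hom A y z; b \<in> Hom A z x; v \<in> carrier (fobj F z)\<rbrakk>
        \<Longrightarrow> farr F y z a (\<phi> (farr F z x b v)) = farr F y z a (\<psi> (farr F z x b v))\<rbrakk> \<Longrightarrow> \<phi> = \<psi>"
proof -
  obtain z where z: "z \<in> Obj A" and detect: "\<forall>G. subfunctor K A F G \<longrightarrow>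
    (G z = carrier (fobj F z) \<longrightarrow> (\<forall>x\<in>Obj A. G x = carrier (fobj F x))) \<and>
    (G z = {\<zero>\<^bsub>fobj F z\<^esub>} \<longrightarrow> (\<forall>x\<in>Obj A. G x = {\<zero>\<^bsub>fobj F x\<^esub>}))"
    using ex_detecting_object[OF fl] by (elim bexE) (rule that)
  have gen: "G x = carrier (fobj F x)"
    if "subfunctor K A F G" "G z = carrier (fobj F z)" "x \<in> Obj A" for G x
    using detect[rule_format, OF that(1)] that(2,3) by simp
  have cogen: "G x = {\<zero>\<^bsub>fobj F x\<^esub>}"
    if "subfunctor K A F G" "G z = {\<zero>\<^bsub>fobj F z\<^esub>}" "x \<in> Obj A" for G x
    using detect[rule_format, OF that(1)] that(2,3) by simp
  show ?thesis
  proof (rule that[OF z])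
    fix x y \<phi> \<psi> assume xy: "x \<in> Obj A" "y \<in> Obj A"
      and \<phi>: "\<phi> \<in> Hom (Vect K) (fobj F x) (fobj F y)" and \<psi>: "\<psi> \<in> Hom (Vect K) (fobj F x) (fobj F y)"
      and eq: "\<And>a b v. \<lbrakk>a \<in> Hom A y z; b \<in> Hom A z x; v \<in> carrier (fobj F z)\<rbrakk>
        \<Longrightarrow> farr F y z a (\<phi> (farr F z x b v)) = farr F y z a (\<psi> (farr F z x b v))"
    have h: "\<phi> \<in> module_hom K (fobj F x) (fobj F y)" "\<psi> \<in> module_hom K (fobj F x) (fobj F y)"
      using \<phi> \<psi> by simp_all
    note hD = h[unfolded module_hom_def]
    interpret Vx: vectorspace K "fobj F x" by (rule vs[OF xy(1)])
    interpret Vy: vectorspace K "fobj F y" by (rule vs[OF xy(2)])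
    define G1 where "G1 w = {v \<in> carrier (fobj F w). \<forall>c\<in>Hom A w x. \<forall>a\<in>Hom A y z.
      farr F y z a (\<phi> (farr F w x c v)) = farr F y z a (\<psi> (farr F w x c v))}" for w
    have G1: "subfunctor K A F G1"
      unfolding subfunctor_def
    proof (intro conjI ballI)
      fix w assume w: "w \<in> Obj A"
      interpret Vw: vectorspace K "fobj F w" by (rule vs[OF w])
      interpret p: linear_map K "fobj F x" "fobj F y" \<phi>
        using h(1) by (intro linear_map.intro mod_hom.intro mod_hom_axioms.intro Vx.module.module_axioms
            Vy.module.module_axioms Vx.vectorspace_axioms Vy.vectorspace_axioms)
      interpret q: linear_map K "fobj F x" "fobj F y" \<psi>
        using h(2) by (intro linear_map.intro mod_hom.intro mod_hom_axioms.intro Vx.module.module_axioms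
            Vy.module.module_axioms Vx.vectorspace_axioms Vy.vectorspace_axioms)
      have zero: "\<phi> \<zero>\<^bsub>fobj F x\<^esub> = \<psi> \<zero>\<^bsub>fobj F x\<^esub>" by simp
      show "subspace K (G1 w) (fobj F w)"
      proof (rule Vw.subspaceI)
        show "\<zero>\<^bsub>fobj F w\<^esub> \<in> G1 w" using w xy z by (simp add: G1_def arr_zero zero)
      qed (use w xy z hD in \<open>auto simp: G1_def arr_module_hom arr_closed Pi_iff\<close>)
    next
      fix w w' f assume w: "w \<in> Obj A" "w' \<in> Obj A" "f \<in> Hom A w w'"
      show "farr F w w' f ` G1 w \<subseteq> G1 w'"
      proof
        fix v' assume "v' \<in> farr F w w' f ` G1 w"
        then obtain v where v: "v' = farr F w w' f v" "v \<in> carrier (fobj F w)" "v \<in> G1 w"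
          by (auto simp: G1_def)
        have "farr F y z a (\<phi> (farr F w' x c v')) = farr F y z a (\<psi> (farr F w' x c v'))"
          if c: "c \<in> Hom A w' x" "a \<in> Hom A y z" for a c
        proof -
          have "farr F w' x c v' = farr F w x (Comp A w w' x c f) v"
            using w xy c v by (simp add: arr_comp)
          then show ?thesis using v(3) w xy c A.Comp_closed by (simp add: G1_def)
        qed
        then show "v' \<in> G1 w'" using v w by (simp add: G1_def arr_closed)
      qed
    qed
    have "G1 z = carrier (fobj F z)" using eq by (auto simp: G1_def)
    from gen[OF G1 this xy(1)] have eq1: "farr F y z a (\<phi> v) = farr F y z a (\<psi> v)"
      if "v \<in> carrier (fobj F x)" "a \<in> Hom A y z" for v a
      using that A.Id_closed[OF xy(1)] arr_Id[OF xy(1)] by (force simp: G1_def)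
    define G2 where "G2 w = {v \<in> carrier (fobj F w). \<forall>a\<in>Hom A w z. farr F w z a v = \<zero>\<^bsub>fobj F z\<^esub>}" for w
    interpret Vz: vectorspace K "fobj F z" by (rule vs[OF z])
    have G2: "subfunctor K A F G2"
      unfolding subfunctor_def
    proof (intro conjI ballI)
      fix w assume w: "w \<in> Obj A"
      interpret Vw: vectorspace K "fobj F w" by (rule vs[OF w])
      show "subspace K (G2 w) (fobj F w)"
        by (rule Vw.subspaceI) (use w z in \<open>auto simp: G2_def arr_module_hom arr_zero\<close>)
    next
      fix w w' f assume w: "w \<in> Obj A" "w' \<in> Obj A" "f \<in> Hom A w w'"
      show "farr F w w' f ` G2 w \<subseteq> G2 w'"
        using w z by (auto simp: G2_def arr_closed A.Comp_closed simp flip: arr_comp)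
    qed
    have "v = \<zero>\<^bsub>fobj F z\<^esub>" if "v \<in> G2 z" for v
      using that A.Id_closed[OF z] arr_Id[OF z] by (force simp: G2_def)
    then have "G2 z = {\<zero>\<^bsub>fobj F z\<^esub>}" using z by (auto simp: G2_def arr_zero)
    from cogen[OF G2 this xy(2)] have G2y: "G2 y = {\<zero>\<^bsub>fobj F y\<^esub>}" .
    show "\<phi> = \<psi>"
    proof (rule extensionalityI[of _ "carrier (fobj F x)"])
      fix v assume v: "v \<in> carrier (fobj F x)"
      have c: "\<phi> v \<in> carrier (fobj F y)" "\<psi> v \<in> carrier (fobj F y)" using hD v by auto
      have "farr F y z a (\<phi> v \<ominus>\<^bsub>fobj F y\<^esub> \<psi> v) = \<zero>\<^bsub>fobj F z\<^esub>" if a: "a \<in> Hom A y z" for a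
      proof -
        interpret a: linear_map K "fobj F y" "fobj F z" "farr F y z a"
          using arr_linear[OF xy(2) z a]
          by (intro linear_map.intro mod_hom.intro mod_hom_axioms.intro Vy.module.module_axioms
              Vz.module.module_axioms Vy.vectorspace_axioms Vz.vectorspace_axioms)
        have "farr F y z a (\<phi> v \<ominus>\<^bsub>fobj F y\<^esub> \<psi> v) = farr F y z a (\<phi> v) \<ominus>\<^bsub>fobj F z\<^esub> farr F y z a (\<psi> v)"
          using c by (rule a.T_minus)
        then show ?thesis
          using eq1[OF v a] arr_closed[OF xy(2) z a c(2)] by (simp add: Vz.module.M.minus_eq Vz.module.M.r_neg)
      qed
      then have "\<phi> v \<ominus>\<^bsub>fobj F y\<^esub> \<psi> v \<in> G2 y" using c by (simp add: G2_def)
      then have "\<phi> v \<ominus>\<^bsub>fobj F y\<^esub> \<psi> v = \<zero>\<^bsub>fobj F y\<^esub>" using G2y by simp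
      moreover have "\<phi> v = (\<phi> v \<ominus>\<^bsub>fobj F y\<^esub> \<psi> v) \<oplus>\<^bsub>fobj F y\<^esub> \<psi> v"
        using c by (simp add: Vy.module.M.minus_eq Vy.module.M.a_assoc Vy.module.M.l_neg)
      ultimately show "\<phi> v = \<psi> v" using c by simp
    qed (use \<phi> \<psi> in simp_all)
  qed
qed

section \<open>Extension of a functor to pairs of morphisms\<close>

text \<open>The behaviour of the arrow maps of a bifunctor that is polynomial in the first variable and
  antipolynomial in the second one, with both pairs of objects fixed.\<close>

definition poly_periodic ::
    "('k, 'l) ring_scheme \<Rightarrow> ('a, 'e) monoid_scheme \<Rightarrow> ('k, 'v, 'f) module_scheme
      \<Rightarrow> ('a \<Rightarrow> 'a \<Rightarrow> 'v) \<Rightarrow> bool" where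
  "poly_periodic K G M r \<longleftrightarrow> (\<forall>u\<in>carrier G. \<forall>v\<in>carrier G. r u v \<in> carrier M) \<and>
    (\<forall>v\<in>carrier G. \<exists>d. degree_less G M d (\<lambda>u. r u v)) \<and>
    (\<exists>H N. subgroup H G \<and> nat_in K N \<noteq> \<zero>\<^bsub>K\<^esub> \<and> (\<forall>v\<in>carrier G. v [^]\<^bsub>G\<^esub> (N :: nat) \<in> H) \<and>
      (\<forall>u\<in>carrier G. \<forall>v\<in>carrier G. \<forall>h\<in>H. r u (v \<otimes>\<^bsub>G\<^esub> h) = r u v))"

lemma poly_periodicI:
  assumes "\<And>u v. \<lbrakk>u \<in> carrier G; v \<in> carrier G\<rbrakk> \<Longrightarrow> r u v \<in> carrier M"
    and "\<And>v. v \<in> carrier G \<Longrightarrow> \<exists>d. degree_less G M d (\<lambda>u. r u v)"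
    and "subgroup H G" "nat_in K N \<noteq> \<zero>\<^bsub>K\<^esub>" "\<And>v. v \<in> carrier G \<Longrightarrow> v [^]\<^bsub>G\<^esub> (N :: nat) \<in> H"
    and "\<And>u v h. \<lbrakk>u \<in> carrier G; v \<in> carrier G; h \<in> H\<rbrakk> \<Longrightarrow> r u (v \<otimes>\<^bsub>G\<^esub> h) = r u v"
  shows "poly_periodic K G M r"
  unfolding poly_periodic_def
  by (intro conjI ballI assms(1,2), assumption+, rule exI[of _ H], rule exI[of _ N],
      intro conjI ballI assms(3-6))

lemma poly_periodicE:
  assumes "poly_periodic K G M r"
  obtains H N where "\<And>u v. \<lbrakk>u \<in> carrier G; v \<in> carrier G\<rbrakk> \<Longrightarrow> r u v \<in> carrier M"
    "\<And>v. v \<in> carrier G \<Longrightarrow> \<exists>d. degree_less G M d (\<lambda>u. r u v)"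
    "subgroup H G" "nat_in K N \<noteq> \<zero>\<^bsub>K\<^esub>" "\<And>v. v \<in> carrier G \<Longrightarrow> v [^]\<^bsub>G\<^esub> (N :: nat) \<in> H"
    "\<And>u v h. \<lbrakk>u \<in> carrier G; v \<in> carrier G; h \<in> H\<rbrakk> \<Longrightarrow> r u (v \<otimes>\<^bsub>G\<^esub> h) = r u v"
  using assms unfolding poly_periodic_def by (elim conjE exE) (rule that, auto)

context poly_maps
begin

text \<open>The difference vanishes on the diagonal and is periodic under the intersection of the two period
  groups.\<close>

lemma poly_periodic_unique:
  assumes r: "poly_periodic K G M r" and r': "poly_periodic K G M r'"
    and diag: "\<And>u. u \<in> carrier G \<Longrightarrow> r u u = r' u u"
    and uv: "u \<in> carrier G" "v \<in> carrier G"
  shows "r u v = r' u v"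
proof -
  obtain H N where cd: "\<And>u v. \<lbrakk>u \<in> carrier G; v \<in> carrier G\<rbrakk> \<Longrightarrow> r u v \<in> carrier M"
    "\<And>v. v \<in> carrier G \<Longrightarrow> \<exists>d. deg d (\<lambda>u. r u v)"
    and H: "subgroup H G" "nat_in K N \<noteq> \<zero>\<^bsub>K\<^esub>" "\<And>v. v \<in> carrier G \<Longrightarrow> v [^]\<^bsub>G\<^esub> (N :: nat) \<in> H"
    "\<And>u v h. \<lbrakk>u \<in> carrier G; v \<in> carrier G; h \<in> H\<rbrakk> \<Longrightarrow> r u (v \<otimes>\<^bsub>G\<^esub> h) = r u v"
    using poly_periodicE[OF r] by metis
  obtain H' N' where cd': "\<And>u v. \<lbrakk>u \<in> carrier G; v \<in> carrier G\<rbrakk> \<Longrightarrow> r' u v \<in> carrier M"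
    "\<And>v. v \<in> carrier G \<Longrightarrow> \<exists>d. deg d (\<lambda>u. r' u v)"
    and H': "subgroup H' G" "nat_in K N' \<noteq> \<zero>\<^bsub>K\<^esub>" "\<And>v. v \<in> carrier G \<Longrightarrow> v [^]\<^bsub>G\<^esub> (N' :: nat) \<in> H'"
    "\<And>u v h. \<lbrakk>u \<in> carrier G; v \<in> carrier G; h \<in> H'\<rbrakk> \<Longrightarrow> r' u (v \<otimes>\<^bsub>G\<^esub> h) = r' u v"
    using poly_periodicE[OF r'] by metis
  note c = cd(1) cd'(1) and d = cd(2) cd'(2)
  have "r u v \<ominus>\<^bsub>M\<^esub> r' u v = \<zero>\<^bsub>M\<^esub>"
  proof (rule bipoly_vanishes_if_on_diagonal[where r = "\<lambda>u v. r u v \<ominus>\<^bsub>M\<^esub> r' u v" and H = "H \<inter> H'"])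
    have "nat_in K (N * N') \<noteq> \<zero>\<^bsub>K\<^esub>"
      using H(2) H'(2) M.integral[of "nat_in K N" "nat_in K N'"] by (auto simp: M.R.nat_in_mult)
    moreover have "v [^]\<^bsub>G\<^esub> (N * N') \<in> H \<inter> H'" if v: "v \<in> carrier G" for v
      using H(3)[of "v [^]\<^bsub>G\<^esub> N'"] H'(3)[of "v [^]\<^bsub>G\<^esub> N"] v by (simp add: G.nat_pow_pow mult.commute)
    ultimately show "no_homs G M (H \<inter> H')" by (rule no_homs_pow)
    show "subgroup (H \<inter> H') G" by (rule G.subgroups_Inter_pair[OF H(1) H'(1)])
    fix v assume v: "v \<in> carrier G"
    obtain d d' where dd: "deg d (\<lambda>u. r u v)" "deg d' (\<lambda>u. r' u v)" using d(1)[OF v] d(2)[OF v] by blast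
    have "deg (max d d') (\<lambda>u. r u v)" "deg (max d d') (\<lambda>u. r' u v)"
      using c v by (auto intro: deg_mono[OF _ dd(1)] deg_mono[OF _ dd(2)])
    then have "deg (max d d') (\<lambda>u. r u v \<ominus>\<^bsub>M\<^esub> r' u v)" using c v by (intro deg_minus) auto
    then show "\<exists>d. deg d (\<lambda>u. r u v \<ominus>\<^bsub>M\<^esub> r' u v)" ..
  qed (use c uv diag H(4) H'(4) in \<open>auto simp: minus_self\<close>)
  then show ?thesis using c uv by (simp add: minus_zero_iff)
qed

lemma poly_periodic_linear:
  fixes M' :: "('k, 'w, 'g) module_scheme"
  assumes "vectorspace K M'" "L \<in> module_hom K M M'" and r: "poly_periodic K G M r"
  shows "poly_periodic K G M' (\<lambda>u v. L (r u v))"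
proof -
  obtain H N where c: "\<And>u v. \<lbrakk>u \<in> carrier G; v \<in> carrier G\<rbrakk> \<Longrightarrow> r u v \<in> carrier M"
    and d: "\<And>v. v \<in> carrier G \<Longrightarrow> \<exists>d. deg d (\<lambda>u. r u v)"
    and H: "subgroup H G" "nat_in K N \<noteq> \<zero>\<^bsub>K\<^esub>" "\<And>v. v \<in> carrier G \<Longrightarrow> v [^]\<^bsub>G\<^esub> (N :: nat) \<in> H"
    "\<And>u v h. \<lbrakk>u \<in> carrier G; v \<in> carrier G; h \<in> H\<rbrakk> \<Longrightarrow> r u (v \<otimes>\<^bsub>G\<^esub> h) = r u v"
    using poly_periodicE[OF r] by metis
  show ?thesis
  proof (rule poly_periodicI[OF _ _ H(1-3)])
    fix v assume v: "v \<in> carrier G"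
    obtain d where "deg d (\<lambda>u. r u v)" using d[OF v] by blast
    then have "degree_less G M' d (\<lambda>u. L (r u v))"
      using c v by (intro deg_linear[OF assms(1,2)]) auto
    then show "\<exists>d. degree_less G M' d (\<lambda>u. L (r u v))" by (rule exI)
  next
    fix u v assume "u \<in> carrier G" "v \<in> carrier G"
    from c[OF this] show "L (r u v) \<in> carrier M'" using assms(2) by (auto simp: module_hom_def)
  qed (simp_all add: H(4))
qed

lemma poly_periodic_hom:
  assumes G': "comm_group G'" and \<phi>: "\<phi> \<in> hom G' G" and \<psi>: "\<psi> \<in> hom G' G" and r: "poly_periodic K G M r"
  shows "poly_periodic K G' M (\<lambda>u v. r (\<phi> u) (\<psi> v))"
proof -
  interpret G': comm_group G' by fact
  have \<phi>c: "\<phi> u \<in> carrier G" "\<psi> u \<in> carrier G" if "u \<in> carrier G'" for u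
    using \<phi> \<psi> that by (auto simp: hom_def)
  interpret \<psi>: group_hom G' G \<psi>
    by (intro group_hom.intro group_hom_axioms.intro G'.is_group G.is_group \<psi>)
  obtain H N where c: "\<And>u v. \<lbrakk>u \<in> carrier G; v \<in> carrier G\<rbrakk> \<Longrightarrow> r u v \<in> carrier M"
    and d: "\<And>v. v \<in> carrier G \<Longrightarrow> \<exists>d. deg d (\<lambda>u. r u v)"
    and H: "subgroup H G" "nat_in K N \<noteq> \<zero>\<^bsub>K\<^esub>" "\<And>v. v \<in> carrier G \<Longrightarrow> v [^]\<^bsub>G\<^esub> (N :: nat) \<in> H"
    "\<And>u v h. \<lbrakk>u \<in> carrier G; v \<in> carrier G; h \<in> H\<rbrakk> \<Longrightarrow> r u (v \<otimes>\<^bsub>G\<^esub> h) = r u v"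
    using poly_periodicE[OF r] by metis
  interpret H: subgroup H G by fact
  define H' where "H' = {h \<in> carrier G'. \<psi> h \<in> H}"
  have H': "subgroup H' G'"
  proof (rule G'.subgroupI)
    show "H' \<noteq> {}" using G'.one_closed \<psi>.hom_one H.one_closed unfolding H'_def by force
  qed (auto simp: H'_def)
  show ?thesis
  proof (rule poly_periodicI[OF _ _ H' H(2)])
    fix v assume v: "v \<in> carrier G'"
    obtain d where "deg d (\<lambda>u. r u (\<psi> v))" using d[OF \<phi>c(2)[OF v]] by blast
    from degree_less_hom[OF G.is_group G'.is_group \<phi> this]
    show "\<exists>d. degree_less G' M d (\<lambda>u. r (\<phi> u) (\<psi> v))" by (rule exI)
    show "v [^]\<^bsub>G'\<^esub> N \<in> H'" using v H(3) by (simp add: H'_def \<psi>.hom_nat_pow)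
  next
    fix u v h assume "u \<in> carrier G'" "v \<in> carrier G'" "h \<in> H'"
    then show "r (\<phi> u) (\<psi> (v \<otimes>\<^bsub>G'\<^esub> h)) = r (\<phi> u) (\<psi> v)"
      using H(4) \<phi>c by (simp add: H'_def)
  qed (use c \<phi>c in blast)
qed

text \<open>The hypothesis on the maps \<open>L i\<close> is inherited by the differences of \<open>q\<close>.\<close>

lemma deg_jointly_injective:
  fixes M' :: "('k, 'w, 'g) module_scheme"
  assumes M': "vectorspace K M'" and L: "\<And>i. i \<in> I \<Longrightarrow> L i \<in> module_hom K M M'"
    and inj: "\<And>m. \<lbrakk>m \<in> carrier M; \<And>i. i \<in> I \<Longrightarrow> L i m = \<zero>\<^bsub>M'\<^esub>\<rbrakk> \<Longrightarrow> m = \<zero>\<^bsub>M\<^esub>"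
    and "q \<in> maps" "\<And>i. i \<in> I \<Longrightarrow> degree_less G M' d (\<lambda>u. L i (q u))"
  shows "deg d q"
  using assms(4,5)
proof (induction d arbitrary: q)
  case 0
  then show ?case by (auto intro!: inj)
next
  case (Suc d)
  show ?case
    unfolding degree_less.simps
  proof
    fix u assume u: "u \<in> carrier G"
    show "deg d (\<lambda>v. q (u \<otimes>\<^bsub>G\<^esub> v) \<ominus>\<^bsub>M\<^esub> q v)"
    proof (rule Suc.IH)
      fix i assume i: "i \<in> I"
      interpret L: linear_map K M M' "L i"
        using M' L[OF i] M.module.module_axioms
        by (intro linear_map.intro mod_hom.intro M.vectorspace_axioms mod_hom_axioms.intro)
          (auto simp: vectorspace_def)
      have "degree_less G M' d (\<lambda>v. L i (q (u \<otimes>\<^bsub>G\<^esub> v)) \<ominus>\<^bsub>M'\<^esub> L i (q v))"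
        using Suc.prems(2)[OF i] u by simp
      then show "degree_less G M' d (\<lambda>v. L i (q (u \<otimes>\<^bsub>G\<^esub> v) \<ominus>\<^bsub>M\<^esub> q v))"
        using Suc.prems(1) u
        by (subst degree_less_cong[OF G.is_group]) (auto simp: Pi_iff L.T_minus)
    qed (use Suc.prems(1) u in auto)
  qed
qed

end

lemma Lin_postcomp:
  assumes "vectorspace K U" "vectorspace K V" "vectorspace K W" "L \<in> Hom (Vect K) V W"
  shows "(\<lambda>\<phi>. Comp (Vect K) U V W L \<phi>) \<in> module_hom K (Lin K U V) (Lin K U W)"
proof -
  interpret C: preadditive_category "Vect K" by (rule preadditive_category_Vect)
  have O: "U \<in> Obj (Vect K)" "V \<in> Obj (Vect K)" "W \<in> Obj (Vect K)" using assms by simp_all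
  have "Comp (Vect K) U V W L (a \<odot>\<^bsub>Lin K U V\<^esub> \<phi>) = a \<odot>\<^bsub>Lin K U W\<^esub> Comp (Vect K) U V W L \<phi>"
    if "a \<in> carrier K" "\<phi> \<in> Hom (Vect K) U V" for a \<phi>
    using that assms(4) by (auto simp: Lin_simps compose_def module_hom_def fun_eq_iff Pi_iff)
  then show ?thesis
    unfolding module_hom_def[of K "Lin K U V"]
    using C.Comp_closed[OF O _ assms(4)] C.Comp_add_right[OF O _ _ assms(4)]
    by (auto simp: Lin_simps(1,3) simp del: Vect_simps)
qed

lemma Lin_precomp:
  assumes "vectorspace K U" "vectorspace K V" "vectorspace K W" "L \<in> Hom (Vect K) U V"
  shows "(\<lambda>\<phi>. Comp (Vect K) U V W \<phi> L) \<in> module_hom K (Lin K V W) (Lin K U W)"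
proof -
  interpret C: preadditive_category "Vect K" by (rule preadditive_category_Vect)
  have O: "U \<in> Obj (Vect K)" "V \<in> Obj (Vect K)" "W \<in> Obj (Vect K)" using assms by simp_all
  have "Comp (Vect K) U V W (a \<odot>\<^bsub>Lin K V W\<^esub> \<phi>) L = a \<odot>\<^bsub>Lin K U W\<^esub> Comp (Vect K) U V W \<phi> L"
    if "a \<in> carrier K" "\<phi> \<in> Hom (Vect K) V W" for a \<phi>
    using that assms(4) by (auto simp: Lin_simps compose_def module_hom_def fun_eq_iff Pi_iff)
  then show ?thesis
    unfolding module_hom_def[of K "Lin K V W"]
    using C.Comp_closed[OF O assms(4)] C.Comp_add_left[OF O assms(4)]
    by (auto simp: Lin_simps(1,3) simp del: Vect_simps)
qed

context additive_vect_functor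
begin

abbreviation LinF where "LinF x y \<equiv> Lin K (fobj F x) (fobj F y)"

lemma poly_maps_Hom:
  assumes "x \<in> Obj A" "y \<in> Obj A" "vectorspace K M"
  shows "poly_maps (hom_group A x y) K M"
  using assms A.hom_comm_group by (intro poly_maps.intro) auto

lemma vs_LinF: "\<lbrakk>x \<in> Obj A; y \<in> Obj A\<rbrakk> \<Longrightarrow> vectorspace K (LinF x y)"
  by (intro vectorspace_Lin vs)

text \<open>Besides \<open>poly_periodic\<close>, the periods have finite index and the degree in \<open>f\<close> is bounded
  independently of \<open>g\<close>.\<close>

definition is_ext where
  "is_ext x y r \<longleftrightarrow> (\<forall>f\<in>Hom A x y. \<forall>g\<in>Hom A x y. r f g \<in> Hom (Vect K) (fobj F x) (fobj F y)) \<and>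
    (\<exists>d. \<forall>g\<in>Hom A x y. degree_less (hom_group A x y) (LinF x y) d (\<lambda>f. r f g)) \<and>
    (\<exists>H N. subgroup H (hom_group A x y) \<and> finite_index (hom_group A x y) H \<and> nat_in K N \<noteq> \<zero>\<^bsub>K\<^esub> \<and>
      (\<forall>f\<in>Hom A x y. f [^]\<^bsub>hom_group A x y\<^esub> (N :: nat) \<in> H) \<and>
      (\<forall>f\<in>Hom A x y. \<forall>g\<in>Hom A x y. \<forall>h\<in>H. r f (hom_add A x y g h) = r f g)) \<and>
    (\<forall>f\<in>Hom A x y. r f f = farr F x y f)"

lemma ex_is_ext:
  assumes x: "x \<in> Obj A" and y: "y \<in> Obj A"
  shows "\<exists>r. is_ext x y r"
proof -
  interpret P: poly_maps "hom_group A x y" K "LinF x y" by (rule poly_maps_Hom[OF x y vs_LinF[OF x y]])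
  obtain H N d where H: "subgroup H (hom_group A x y)" "finite_index (hom_group A x y) H"
    "nat_in K N \<noteq> \<zero>\<^bsub>K\<^esub>" "\<And>f. f \<in> Hom A x y \<Longrightarrow> f [^]\<^bsub>hom_group A x y\<^esub> (N::nat) \<in> H"
    "\<And>f. f \<in> Hom A x y \<Longrightarrow> degree_less (hom_group A x y\<lparr>carrier := H\<rparr>)
      (LinF x y) d (\<lambda>h. farr F x y (hom_add A x y f h))"
    using polynomial_on_cosets[OF x y] by metis
  have F: "farr F x y \<in> carrier (hom_group A x y) \<rightarrow> carrier (LinF x y)"
    using arr_Lin[OF x y] by simp
  note E = P.bi_ext[of N H "farr F x y" d, unfolded hom_group_simps Lin_simps(1), OF H(3,4,1) F[unfolded hom_group_simps Lin_simps(1)] H(5)]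
  have "is_ext x y (P.bi_ext d N (farr F x y))"
    unfolding is_ext_def
  proof (intro conjI ballI)
    show "\<exists>d'. \<forall>g\<in>Hom A x y. degree_less (hom_group A x y) (LinF x y) d' (\<lambda>f. P.bi_ext d N (farr F x y) f g)"
      using E(2) by blast
    show "\<exists>H N'. subgroup H (hom_group A x y) \<and> finite_index (hom_group A x y) H \<and> nat_in K N' \<noteq> \<zero>\<^bsub>K\<^esub> \<and>
      (\<forall>f\<in>Hom A x y. f [^]\<^bsub>hom_group A x y\<^esub> (N' :: nat) \<in> H) \<and>
      (\<forall>f\<in>Hom A x y. \<forall>g\<in>Hom A x y. \<forall>h\<in>H. P.bi_ext d N (farr F x y) f (hom_add A x y g h)
        = P.bi_ext d N (farr F x y) f g)"
      using H(1-4) E(3) by (intro exI[of _ H] exI[of _ N]) blast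
  qed (use E(1,4) in blast)+
  then show ?thesis by (intro exI[of _ "P.bi_ext d N (farr F x y)"])
qed

definition ext where "ext x y = (SOME r. is_ext x y r)"

lemma is_ext_ext: "\<lbrakk>x \<in> Obj A; y \<in> Obj A\<rbrakk> \<Longrightarrow> is_ext x y (ext x y)"
  unfolding ext_def by (rule someI_ex[OF ex_is_ext])

lemma ext_closed: "\<lbrakk>x \<in> Obj A; y \<in> Obj A; f \<in> Hom A x y; g \<in> Hom A x y\<rbrakk>
    \<Longrightarrow> ext x y f g \<in> Hom (Vect K) (fobj F x) (fobj F y)"
  using is_ext_ext[of x y, unfolded is_ext_def, THEN conjunct1] by blast

lemma ext_diag: "\<lbrakk>x \<in> Obj A; y \<in> Obj A; f \<in> Hom A x y\<rbrakk> \<Longrightarrow> ext x y f f = farr F x y f"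
  using is_ext_ext[of x y, unfolded is_ext_def, THEN conjunct2, THEN conjunct2, THEN conjunct2] by blast

lemma ext_deg: "\<lbrakk>x \<in> Obj A; y \<in> Obj A\<rbrakk>
    \<Longrightarrow> \<exists>d. \<forall>g\<in>Hom A x y. degree_less (hom_group A x y) (LinF x y) d (\<lambda>f. ext x y f g)"
  using is_ext_ext[of x y, unfolded is_ext_def, THEN conjunct2, THEN conjunct1] .

lemma ext_periodic:
  assumes "x \<in> Obj A" "y \<in> Obj A"
  obtains H N where "subgroup H (hom_group A x y)" "finite_index (hom_group A x y) H" "nat_in K N \<noteq> \<zero>\<^bsub>K\<^esub>"
      "\<And>f. f \<in> Hom A x y \<Longrightarrow> f [^]\<^bsub>hom_group A x y\<^esub> (N :: nat) \<in> H"
      "\<And>f g h. \<lbrakk>f \<in> Hom A x y; g \<in> Hom A x y; h \<in> H\<rbrakk> \<Longrightarrow> ext x y f (hom_add A x y g h) = ext x y f g"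
  using is_ext_ext[OF assms, unfolded is_ext_def, THEN conjunct2, THEN conjunct2, THEN conjunct1]
  by (elim exE conjE) (rule that, auto)

lemma poly_periodic_ext:
  assumes "x \<in> Obj A" "y \<in> Obj A"
  shows "poly_periodic K (hom_group A x y) (LinF x y) (ext x y)"
proof -
  obtain H N where "subgroup H (hom_group A x y)" "nat_in K N \<noteq> \<zero>\<^bsub>K\<^esub>"
      "\<And>f. f \<in> Hom A x y \<Longrightarrow> f [^]\<^bsub>hom_group A x y\<^esub> (N :: nat) \<in> H"
      "\<And>f g h. \<lbrakk>f \<in> Hom A x y; g \<in> Hom A x y; h \<in> H\<rbrakk> \<Longrightarrow> ext x y f (hom_add A x y g h) = ext x y f g"
    using ext_periodic[OF assms] by metis
  then show ?thesis
    using ext_closed[OF assms] ext_deg[OF assms]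
    by (intro poly_periodicI[where H = H and N = N]) (simp_all add: Lin_simps(1) del: Vect_simps, blast)
qed

lemma ext_unique:
  assumes "x \<in> Obj A" "y \<in> Obj A" "poly_periodic K (hom_group A x y) (LinF x y) r"
    "\<And>f. f \<in> Hom A x y \<Longrightarrow> r f f = farr F x y f" "f \<in> Hom A x y" "g \<in> Hom A x y"
  shows "r f g = ext x y f g"
proof -
  interpret P: poly_maps "hom_group A x y" K "LinF x y"
    using assms(1,2) by (intro poly_maps_Hom vs_LinF)
  show ?thesis
    using P.poly_periodic_unique[OF poly_periodic_ext assms(3), of f g] assms ext_diag by simp
qed

text \<open>Both sides are extensions of the same function, first for \<open>f = f'\<close>, then in general.\<close>

lemma ext_comp:
  assumes O: "x \<in> Obj A" "y \<in> Obj A" "z \<in> Obj A"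
    and f: "f \<in> Hom A x y" "f' \<in> Hom A x y" and g: "g \<in> Hom A y z" "g' \<in> Hom A y z"
  shows "ext x z (Comp A x y z g f) (Comp A x y z g' f')
    = Comp (Vect K) (fobj F x) (fobj F y) (fobj F z) (ext y z g g') (ext x y f f')"
proof -
  interpret Pyz: poly_maps "hom_group A y z" K "LinF y z" using O by (intro poly_maps_Hom vs_LinF)
  interpret Pxy: poly_maps "hom_group A x y" K "LinF x y" using O by (intro poly_maps_Hom vs_LinF)
  interpret Pxz: poly_maps "hom_group A x z" K "LinF x z" using O by (intro poly_maps_Hom vs_LinF)
  interpret Qyz: poly_maps "hom_group A y z" K "LinF x z" using O by (intro poly_maps_Hom vs_LinF)
  interpret Qxy: poly_maps "hom_group A x y" K "LinF x z" using O by (intro poly_maps_Hom vs_LinF)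
  have 1: "ext x z (Comp A x y z g h) (Comp A x y z g' h)
    = Comp (Vect K) (fobj F x) (fobj F y) (fobj F z) (ext y z g g') (farr F x y h)"
    if h: "h \<in> Hom A x y" and g: "g \<in> Hom A y z" "g' \<in> Hom A y z" for h g g'
  proof (rule Qyz.poly_periodic_unique[where u = g and v = g'
        and r = "\<lambda>g g'. ext x z (Comp A x y z g h) (Comp A x y z g' h)"
        and r' = "\<lambda>g g'. Comp (Vect K) (fobj F x) (fobj F y) (fobj F z) (ext y z g g') (farr F x y h)"])
    show "poly_periodic K (hom_group A y z) (LinF x z) (\<lambda>g g'. ext x z (Comp A x y z g h) (Comp A x y z g' h))"
      by (rule Pxz.poly_periodic_hom[where \<phi> = "\<lambda>g. Comp A x y z g h" and \<psi> = "\<lambda>g. Comp A x y z g h"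
            and r = "ext x z"])
        (use O h in \<open>simp_all add: A.hom_comm_group A.precomp_hom poly_periodic_ext\<close>)
    show "poly_periodic K (hom_group A y z) (LinF x z)
        (\<lambda>g g'. Comp (Vect K) (fobj F x) (fobj F y) (fobj F z) (ext y z g g') (farr F x y h))"
    proof (rule Pyz.poly_periodic_linear[where r = "ext y z"])
      show "(\<lambda>\<phi>. Comp (Vect K) (fobj F x) (fobj F y) (fobj F z) \<phi> (farr F x y h))
          \<in> module_hom K (LinF y z) (LinF x z)"
        using O h by (intro Lin_precomp vs F.farr_closed)
    qed (use O in \<open>auto intro: vs_LinF poly_periodic_ext\<close>)
    fix g assume "g \<in> carrier (hom_group A y z)"
    then show "ext x z (Comp A x y z g h) (Comp A x y z g h)
        = Comp (Vect K) (fobj F x) (fobj F y) (fobj F z) (ext y z g g) (farr F x y h)"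
      using O h F.farr_Comp[OF O h, of g] by (simp add: ext_diag A.Comp_closed del: Vect_simps)
  qed (use g in simp_all)
  show ?thesis
  proof (rule Qxy.poly_periodic_unique[where u = f and v = f'
        and r = "\<lambda>f f'. ext x z (Comp A x y z g f) (Comp A x y z g' f')"
        and r' = "\<lambda>f f'. Comp (Vect K) (fobj F x) (fobj F y) (fobj F z) (ext y z g g') (ext x y f f')"])
    show "poly_periodic K (hom_group A x y) (LinF x z) (\<lambda>f f'. ext x z (Comp A x y z g f) (Comp A x y z g' f'))"
      by (rule Pxz.poly_periodic_hom[where \<phi> = "\<lambda>f. Comp A x y z g f" and \<psi> = "\<lambda>f. Comp A x y z g' f"
            and r = "ext x z"])
        (use O g in \<open>simp_all add: A.hom_comm_group A.postcomp_hom poly_periodic_ext\<close>)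
    show "poly_periodic K (hom_group A x y) (LinF x z)
        (\<lambda>f f'. Comp (Vect K) (fobj F x) (fobj F y) (fobj F z) (ext y z g g') (ext x y f f'))"
    proof (rule Pxy.poly_periodic_linear[where r = "ext x y"])
      show "(\<lambda>\<phi>. Comp (Vect K) (fobj F x) (fobj F y) (fobj F z) (ext y z g g') \<phi>)
          \<in> module_hom K (LinF x y) (LinF x z)"
        using O g by (intro Lin_postcomp vs ext_closed)
    qed (use O in \<open>auto intro: vs_LinF poly_periodic_ext\<close>)
    fix h assume "h \<in> carrier (hom_group A x y)"
    then show "ext x z (Comp A x y z g h) (Comp A x y z g' h)
        = Comp (Vect K) (fobj F x) (fobj F y) (fobj F z) (ext y z g g') (ext x y h h)"
      using 1 g O by (simp add: ext_diag del: Vect_simps)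
  qed (use f in simp_all)
qed

lemma ext_app:
  assumes "x \<in> Obj A" "y \<in> Obj A" "z \<in> Obj A"
    "f \<in> Hom A x y" "f' \<in> Hom A x y" "g \<in> Hom A y z" "g' \<in> Hom A y z" "v \<in> carrier (fobj F x)"
  shows "ext y z g g' (ext x y f f' v) = ext x z (Comp A x y z g f) (Comp A x y z g' f') v"
  using ext_comp[OF assms(1-7)] assms(8) by (simp add: compose_def)

lemma ext_in:
  assumes "x \<in> Obj A" "y \<in> Obj A" "f \<in> Hom A x y" "g \<in> Hom A x y" "v \<in> carrier (fobj F x)"
  shows "ext x y f g v \<in> carrier (fobj F y)"
  using ext_closed[OF assms(1-4)] assms(5) by (auto simp: module_hom_def)

end

section \<open>Functors that are periodic under an ideal\<close>

lemma isomorphic_functors_refl: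
  assumes "functor_between C D F"
  shows "isomorphic_functors C D F F"
proof -
  interpret F: functor_between C D F by fact
  show ?thesis
    unfolding isomorphic_functors_def natural_transformation_def
    by (rule exI[of _ "\<lambda>x. Id D (fobj F x)"], rule exI[of _ "\<lambda>x. Id D (fobj F x)"])
      (simp add: F.fobj_closed F.farr_closed F.D.Id_closed F.D.Comp_Id_left F.D.Comp_Id_right)
qed

text \<open>In the tensor product, \<open>a \<otimes> x = (a / N) \<otimes> N x = 0\<close>.\<close>

lemma trivial_tensor_groupI:
  assumes K: "field K" and H: "comm_group H" and N: "nat_in K N \<noteq> \<zero>\<^bsub>K\<^esub>"
    and pow: "\<And>x. x \<in> carrier H \<Longrightarrow> x [^]\<^bsub>H\<^esub> (N :: nat) = \<one>\<^bsub>H\<^esub>"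
  shows "trivial_group (tensor_group (add_monoid K) H)"
proof -
  interpret K: field K by fact
  interpret H: comm_group H by fact
  let ?S = "carrier (add_monoid K) \<times> carrier H"
  let ?M = "free_Abelian_group ?S"
  let ?R = "generate ?M (tensor_relations (add_monoid K) H)"
  interpret M: comm_group ?M by (rule abelian_free_Abelian_group)
  have rels: "tensor_relations (add_monoid K) H \<subseteq> carrier ?M"
    unfolding tensor_relations_def
    by (auto dest!: subsetD[OF keys_diff] subsetD[OF keys_add] split: if_splits)
  have sub: "subgroup ?R ?M" by (rule M.generate_is_subgroup[OF rels])
  have add: "x + y \<in> ?R" if "x \<in> ?R" "y \<in> ?R" for x y
    using subgroup.m_closed[OF sub that] by simp
  have neg: "- x \<in> ?R" if "x \<in> ?R" for x
  proof -
    have "Poly_Mapping.keys x \<subseteq> ?S" using subgroup.mem_carrier[OF sub that] by simp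
    then show ?thesis using subgroup.m_inv_closed[OF sub that] by simp
  qed
  have diff: "x - y \<in> ?R" if "x \<in> ?R" "y \<in> ?R" for x y
    using add[OF that(1) neg[OF that(2)]] by simp
  have zero: "0 \<in> ?R" using subgroup.one_closed[OF sub] by simp
  have r1: "frag_of (a \<oplus>\<^bsub>K\<^esub> a', x) - (frag_of (a, x) + frag_of (a', x)) \<in> ?R"
    if "a \<in> carrier K" "a' \<in> carrier K" "x \<in> carrier H" for a a' x
    using that by (intro generate.incl) (auto simp: tensor_relations_def)
  have r2: "frag_of (a, x \<otimes>\<^bsub>H\<^esub> y) - (frag_of (a, x) + frag_of (a, y)) \<in> ?R"
    if "a \<in> carrier K" "x \<in> carrier H" "y \<in> carrier H" for a x y
    using that by (intro generate.incl) (auto simp: tensor_relations_def)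
  have a0: "frag_of (\<zero>\<^bsub>K\<^esub>, x) \<in> ?R" if "x \<in> carrier H" for x
    using neg[OF r1[of "\<zero>\<^bsub>K\<^esub>" "\<zero>\<^bsub>K\<^esub>" x]] that by simp
  have x0: "frag_of (a, \<one>\<^bsub>H\<^esub>) \<in> ?R" if "a \<in> carrier K" for a
    using neg[OF r2[of a "\<one>\<^bsub>H\<^esub>" "\<one>\<^bsub>H\<^esub>"]] that by simp
  have swap: "frag_of (nat_in K n \<otimes>\<^bsub>K\<^esub> a, x) - frag_of (a, x [^]\<^bsub>H\<^esub> n) \<in> ?R"
    if a: "a \<in> carrier K" and x: "x \<in> carrier H" for a x n
  proof (induction n)
    case 0
    show ?case using diff[OF a0[OF x] x0[OF a]] a x by simp
  next
    case (Suc n)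
    let ?u = "frag_of (nat_in K n \<otimes>\<^bsub>K\<^esub> a, x)" and ?v = "frag_of (a, x [^]\<^bsub>H\<^esub> n)" and ?w = "frag_of (a, x)"
    have e: "nat_in K (Suc n) \<otimes>\<^bsub>K\<^esub> a = a \<oplus>\<^bsub>K\<^esub> nat_in K n \<otimes>\<^bsub>K\<^esub> a" using a by (simp add: K.l_distr)
    have 1: "frag_of (nat_in K (Suc n) \<otimes>\<^bsub>K\<^esub> a, x) - (?w + ?u) \<in> ?R"
      unfolding e using a x by (intro r1) auto
    have 2: "frag_of (a, x [^]\<^bsub>H\<^esub> Suc n) - (?v + ?w) \<in> ?R"
      using r2[of a "x [^]\<^bsub>H\<^esub> n" x] a x by simp
    have "(frag_of (nat_in K (Suc n) \<otimes>\<^bsub>K\<^esub> a, x) - (?w + ?u))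
        - (frag_of (a, x [^]\<^bsub>H\<^esub> Suc n) - (?v + ?w)) + (?u - ?v) \<in> ?R"
      by (rule add[OF diff[OF 1 2] Suc])
    then show ?case by (simp add: algebra_simps)
  qed
  have "carrier ?M \<subseteq> ?R"
  proof
    fix y assume "y \<in> carrier ?M"
    then have "Poly_Mapping.keys y \<subseteq> ?S" by simp
    then show "y \<in> ?R"
    proof (rule free_Abelian_group_induct[where P = "\<lambda>x. x \<in> ?R"])
      fix p assume "p \<in> ?S"
      then obtain a x where p: "p = (a, x)" "a \<in> carrier K" "x \<in> carrier H" by auto
      let ?b = "inv\<^bsub>K\<^esub> (nat_in K N) \<otimes>\<^bsub>K\<^esub> a"
      have i: "nat_in K N \<in> Units K" using N K.field_Units by simp
      then have b: "?b \<in> carrier K" "nat_in K N \<otimes>\<^bsub>K\<^esub> ?b = a"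
        using p(2) by (simp_all add: K.m_assoc[symmetric])
      have "frag_of (a, x) - frag_of (?b, \<one>\<^bsub>H\<^esub>) \<in> ?R"
        using swap[OF b(1) p(3), of N] pow[OF p(3)] by (simp only: b(2))
      from add[OF this x0[OF b(1)]] show "frag_of p \<in> ?R" by (simp add: p(1))
    qed (use zero diff in auto)
  qed
  moreover have "group (add_monoid K)" by (rule K.a_group)
  ultimately show ?thesis using trivial_tensor_group_iff H.is_group by blast
qed

locale ideal_quotient = A: additive_category A
  for A :: "('o, 'm, 'e) preadditive_data_scheme" +
  fixes I :: "'o \<Rightarrow> 'o \<Rightarrow> 'm set"
  assumes subgroup_I: "\<lbrakk>x \<in> Obj A; y \<in> Obj A\<rbrakk> \<Longrightarrow> subgroup (I x y) (hom_group A x y)"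
    and I_left: "\<lbrakk>x \<in> Obj A; y \<in> Obj A; z \<in> Obj A; f \<in> I x y; g \<in> Hom A y z\<rbrakk> \<Longrightarrow> Comp A x y z g f \<in> I x z"
    and I_right: "\<lbrakk>x \<in> Obj A; y \<in> Obj A; z \<in> Obj A; f \<in> Hom A x y; g \<in> I y z\<rbrakk> \<Longrightarrow> Comp A x y z g f \<in> I x z"
begin

definition cls where "cls x y f = {g \<in> Hom A x y. \<exists>h\<in>I x y. g = hom_add A x y f h}"
definition rep where "rep W = (SOME f. f \<in> W)"

definition quot :: "('o, 'm set) preadditive_data" where
  "quot = \<lparr>Obj = Obj A, Hom = (\<lambda>x y. cls x y ` Hom A x y), Id = (\<lambda>x. cls x x (Id A x)),
    Comp = (\<lambda>x y z g f. cls x z (Comp A x y z (rep g) (rep f))),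
    hom_add = (\<lambda>x y f g. cls x y (hom_add A x y (rep f) (rep g))),
    hom_zero = (\<lambda>x y. cls x y (hom_zero A x y))\<rparr>"

lemma I_Hom: "\<lbrakk>x \<in> Obj A; y \<in> Obj A; h \<in> I x y\<rbrakk> \<Longrightarrow> h \<in> Hom A x y"
  using subgroup.subset[OF subgroup_I] by fastforce

lemma cls_eqI:
  assumes xy: "x \<in> Obj A" "y \<in> Obj A" and f: "f \<in> Hom A x y" and h: "h \<in> I x y"
  shows "cls x y (hom_add A x y f h) = cls x y f"
proof -
  interpret G: comm_group "hom_group A x y" by (rule A.hom_comm_group[OF xy])
  interpret I: subgroup "I x y" "hom_group A x y" by (rule subgroup_I[OF xy])
  have hH: "h \<in> Hom A x y" using I_Hom xy h by blast
  show ?thesis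
  proof (intro equalityI subsetI)
    fix g assume "g \<in> cls x y (hom_add A x y f h)"
    then obtain k where k: "k \<in> I x y" "g = hom_add A x y (hom_add A x y f h) k" "g \<in> Hom A x y"
      by (auto simp: cls_def)
    then have "g = hom_add A x y f (hom_add A x y h k)"
      using xy f hH I_Hom by (simp add: A.add_assoc)
    moreover have "hom_add A x y h k \<in> I x y" using I.m_closed[OF h k(1)] by simp
    ultimately show "g \<in> cls x y f" using k(3) by (auto simp: cls_def)
  next
    fix g assume "g \<in> cls x y f"
    then obtain k where k: "k \<in> I x y" "g = hom_add A x y f k" "g \<in> Hom A x y" by (auto simp: cls_def)
    let ?k = "hom_add A x y (inv\<^bsub>hom_group A x y\<^esub> h) k"
    have "?k \<in> I x y" using I.m_closed[OF I.m_inv_closed[OF h] k(1)] by simp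
    moreover have "g = hom_add A x y (hom_add A x y f h) ?k"
      using G.m_assoc[of "hom_add A x y f h" "inv\<^bsub>hom_group A x y\<^esub> h" k] G.m_assoc[of f h "inv\<^bsub>hom_group A x y\<^esub> h"]
        xy f hH I_Hom[OF xy k(1)] k(2) by simp
    ultimately show "g \<in> cls x y (hom_add A x y f h)" using k(3) by (auto simp: cls_def)
  qed
qed

lemma rep_cls:
  assumes "x \<in> Obj A" "y \<in> Obj A" "f \<in> Hom A x y"
  obtains h where "h \<in> I x y" "rep (cls x y f) = hom_add A x y f h" "rep (cls x y f) \<in> Hom A x y"
proof -
  have "hom_zero A x y \<in> I x y" using subgroup.one_closed[OF subgroup_I] assms by simp
  then have "f \<in> cls x y f" using assms by (auto simp: cls_def intro!: bexI[of _ "hom_zero A x y"])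
  then have "rep (cls x y f) \<in> cls x y f" unfolding rep_def by (rule someI)
  then show ?thesis using that by (auto simp: cls_def)
qed

lemma quot_Comp:
  assumes O: "x \<in> Obj A" "y \<in> Obj A" "z \<in> Obj A" and f: "f \<in> Hom A x y" and g: "g \<in> Hom A y z"
  shows "Comp quot x y z (cls y z g) (cls x y f) = cls x z (Comp A x y z g f)"
proof -
  obtain h where h: "h \<in> I x y" "rep (cls x y f) = hom_add A x y f h" "rep (cls x y f) \<in> Hom A x y"
    using rep_cls[OF O(1,2) f] .
  obtain k where k: "k \<in> I y z" "rep (cls y z g) = hom_add A y z g k" "rep (cls y z g) \<in> Hom A y z"
    using rep_cls[OF O(2,3) g] .
  have H: "h \<in> Hom A x y" "k \<in> Hom A y z" using I_Hom O h(1) k(1) by blast+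
  have "Comp A x y z (rep (cls y z g)) (rep (cls x y f))
      = hom_add A x z (Comp A x y z (hom_add A y z g k) f) (Comp A x y z (hom_add A y z g k) h)"
    unfolding h(2) k(2) using O f g H by (simp add: A.Comp_add_right)
  also have "Comp A x y z (hom_add A y z g k) f = hom_add A x z (Comp A x y z g f) (Comp A x y z k f)"
    using O f g H by (simp add: A.Comp_add_left)
  finally show ?thesis
    using O f g H I_left[OF O h(1), of "hom_add A y z g k"] I_right[OF O f k(1)]
    by (simp add: quot_def cls_eqI A.Comp_closed)
qed

lemma quot_add:
  assumes O: "x \<in> Obj A" "y \<in> Obj A" and f: "f \<in> Hom A x y" and g: "g \<in> Hom A x y"
  shows "hom_add quot x y (cls x y f) (cls x y g) = cls x y (hom_add A x y f g)"
proof -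
  obtain h where h: "h \<in> I x y" "rep (cls x y f) = hom_add A x y f h" "rep (cls x y f) \<in> Hom A x y"
    using rep_cls[OF O f] .
  obtain k where k: "k \<in> I x y" "rep (cls x y g) = hom_add A x y g k" "rep (cls x y g) \<in> Hom A x y"
    using rep_cls[OF O g] .
  have H: "h \<in> Hom A x y" "k \<in> Hom A x y" using I_Hom O h(1) k(1) by blast+
  have "hom_add A x y (rep (cls x y f)) (rep (cls x y g))
      = hom_add A x y (hom_add A x y (hom_add A x y f g) h) k"
    unfolding h(2) k(2) using O f g H by (simp add: A.add_assoc A.add_left_comm A.add_comm)
  then show ?thesis
    using O f g H h(1) k(1) by (simp add: quot_def cls_eqI)
qed

lemma quot_simps [simp]:
  "Obj quot = Obj A" "Hom quot x y = cls x y ` Hom A x y" "Id quot x = cls x x (Id A x)"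
  "hom_zero quot x y = cls x y (hom_zero A x y)"
  by (simp_all add: quot_def)

lemma additive_quot: "additive_category quot"
proof -
  have cat: "category quot"
    by standard (auto simp: quot_Comp A.Id_closed A.Comp_closed A.Comp_Id_left A.Comp_Id_right A.Comp_assoc)
  have grp: "comm_group (hom_group quot x y)" if xy: "x \<in> Obj A" "y \<in> Obj A" for x y
  proof (rule comm_groupI)
    fix W assume "W \<in> carrier (hom_group quot x y)"
    then obtain f where f: "f \<in> Hom A x y" "W = cls x y f" by auto
    have "hom_add A x y (inv\<^bsub>hom_group A x y\<^esub> f) f = hom_zero A x y"
      using A.add_comm[OF xy A.neg_closed[OF xy f(1)] f(1)] A.add_neg[OF xy f(1)] by simp
    then show "\<exists>Y\<in>carrier (hom_group quot x y).
        Y \<otimes>\<^bsub>hom_group quot x y\<^esub> W = \<one>\<^bsub>hom_group quot x y\<^esub>"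
      using xy f by (intro bexI[of _ "cls x y (inv\<^bsub>hom_group A x y\<^esub> f)"]) (simp_all add: quot_add)
  next
    fix U V assume "U \<in> carrier (hom_group quot x y)" "V \<in> carrier (hom_group quot x y)"
    then obtain f g where "f \<in> Hom A x y" "U = cls x y f" "g \<in> Hom A x y" "V = cls x y g" by auto
    then show "U \<otimes>\<^bsub>hom_group quot x y\<^esub> V = V \<otimes>\<^bsub>hom_group quot x y\<^esub> U"
      using xy A.add_comm[of x y f g] by (simp add: quot_add)
  qed (use xy in \<open>auto simp: quot_add A.add_assoc\<close>)
  have pre: "preadditive_category quot"
    by (intro preadditive_category.intro cat preadditive_category_axioms.intro)
      (auto simp: grp quot_Comp quot_add A.Comp_closed A.Comp_add_left A.Comp_add_right)
  show ?thesis
  proof (intro additive_category.intro pre additive_category_axioms.intro)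
    obtain w where w: "zero_object A w" using A.ex_zero_object by blast
    have img: "\<exists>!f. f \<in> c ` S" if S: "\<exists>!f. f \<in> S" for c :: "'m \<Rightarrow> 'm set" and S
    proof -
      obtain f where f: "f \<in> S \<and> (\<forall>g. g \<in> S \<longrightarrow> g = f)"
        using S unfolding Ex1_def by (rule exE)
      then have "c g = c f" if "g \<in> S" for g
        using that by metis
      with f show ?thesis by (intro ex1I[of _ "c f"]) (blast elim!: imageE)+
    qed
    have "zero_object quot w"
      using w unfolding zero_object_def quot_simps by (simp add: img)
    then show "\<exists>w. zero_object quot w" ..
  next
    fix x y assume "x \<in> Obj quot" "y \<in> Obj quot"
    then have xy: "x \<in> Obj A" "y \<in> Obj A" by simp_all
    then obtain s i j p q where bi: "biproduct A x y s i j p q" using A.ex_biproduct by blast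
    then have "biproduct quot x y s (cls x s i) (cls y s j) (cls s x p) (cls s y q)"
      using xy unfolding biproduct_def by (simp add: quot_Comp quot_add A.Comp_closed)
    then show "\<exists>s i j p q. biproduct quot x y s i j p q" by blast
  qed
qed

text \<open>The functor factors through the quotient category.\<close>

lemma antipolynomial_if_periodic:
  fixes K :: "'k ring" and E :: "('o, 'm, 'k, 'v) vfunctor"
  assumes K: "field K" and E: "functor_between A (Vect K) E"
    and per: "\<And>x y f h. \<lbrakk>x \<in> Obj A; y \<in> Obj A; f \<in> Hom A x y; h \<in> I x y\<rbrakk>
      \<Longrightarrow> farr E x y (hom_add A x y f h) = farr E x y f"
    and fin: "\<And>x y. \<lbrakk>x \<in> Obj A; y \<in> Obj A\<rbrakk> \<Longrightarrow> finite_index (hom_group A x y) (I x y)"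
    and pow: "\<And>x y. \<lbrakk>x \<in> Obj A; y \<in> Obj A\<rbrakk> \<Longrightarrow> \<exists>N. nat_in K N \<noteq> \<zero>\<^bsub>K\<^esub> \<and>
      (\<forall>f\<in>Hom A x y. f [^]\<^bsub>hom_group A x y\<^esub> (N::nat) \<in> I x y)"
  shows "antipolynomial_functor K A E"
proof -
  interpret E: functor_between A "Vect K" E by fact
  interpret Q: additive_category quot by (rule additive_quot)
  define \<pi> :: "('o, 'm, 'o, 'm set) functor_data" where "\<pi> = \<lparr>fobj = (\<lambda>x. x), farr = cls\<rparr>"
  define G :: "('o, 'm set, 'k, 'v) vfunctor" where
    "G = \<lparr>fobj = fobj E, farr = (\<lambda>x y W. farr E x y (rep W))\<rparr>"
  have E_rep: "farr E x y (rep (cls x y f)) = farr E x y f"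
    if "x \<in> Obj A" "y \<in> Obj A" "f \<in> Hom A x y" for x y f
    using rep_cls[OF that] per[OF that] by metis
  have triv: "K_trivial K quot"
    unfolding K_trivial_def quot_simps(1)
  proof (intro conjI ballI additive_quot)
    fix x y assume xy: "x \<in> Obj A" "y \<in> Obj A"
    interpret G: comm_group "hom_group A x y" by (rule A.hom_comm_group[OF xy])
    obtain \<kappa> :: "'m \<Rightarrow> nat" where \<kappa>: "finite (\<kappa> ` Hom A x y)"
      "\<And>f g. \<lbrakk>f \<in> Hom A x y; g \<in> Hom A x y; \<kappa> f = \<kappa> g\<rbrakk>
        \<Longrightarrow> hom_add A x y f (inv\<^bsub>hom_group A x y\<^esub> g) \<in> I x y"
      using fin[OF xy] unfolding finite_index_def by auto
    have eq: "cls x y f = cls x y g" if fg: "f \<in> Hom A x y" "g \<in> Hom A x y" "\<kappa> f = \<kappa> g" for f g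
    proof -
      have "hom_add A x y g (hom_add A x y f (inv\<^bsub>hom_group A x y\<^esub> g)) = f"
        using xy fg(1,2) by (simp add: A.add_left_comm[of x y g f])
      then show ?thesis using cls_eqI[OF xy fg(2) \<kappa>(2)[OF fg]] by simp
    qed
    have "cls x y f = cls x y (inv_into (Hom A x y) \<kappa> (\<kappa> f))" if f: "f \<in> Hom A x y" for f
    proof (rule eq[OF f])
      show "inv_into (Hom A x y) \<kappa> (\<kappa> f) \<in> Hom A x y" by (rule inv_into_into) (use f in blast)
      show "\<kappa> f = \<kappa> (inv_into (Hom A x y) \<kappa> (\<kappa> f))" using f_inv_into_f[of "\<kappa> f" \<kappa> "Hom A x y"] f by (metis imageI)
    qed
    then have "cls x y ` Hom A x y \<subseteq> (\<lambda>k. cls x y (inv_into (Hom A x y) \<kappa> k)) ` \<kappa> ` Hom A x y" by blast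
    then show "finite (Hom quot x y)"
      unfolding quot_simps by (rule finite_subset) (rule finite_imageI[OF \<kappa>(1)])
    obtain N :: nat where N: "nat_in K N \<noteq> \<zero>\<^bsub>K\<^esub>" "\<And>f. f \<in> Hom A x y \<Longrightarrow> f [^]\<^bsub>hom_group A x y\<^esub> N \<in> I x y"
      using pow[OF xy] by blast
    show "trivial_group (tensor_group (add_monoid K) (hom_group quot x y))"
    proof (rule trivial_tensor_groupI[OF K _ N(1)])
      show "comm_group (hom_group quot x y)" using Q.hom_comm_group xy by simp
      fix W assume "W \<in> carrier (hom_group quot x y)"
      then obtain f where f: "f \<in> Hom A x y" "W = cls x y f" by auto
      have pc: "f [^]\<^bsub>hom_group A x y\<^esub> n \<in> Hom A x y" for n :: nat using G.nat_pow_closed[of f n] f by simp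
      have "W [^]\<^bsub>hom_group quot x y\<^esub> n = cls x y (f [^]\<^bsub>hom_group A x y\<^esub> n)" for n :: nat
        by (induction n) (use xy f pc in \<open>simp_all add: quot_add\<close>)
      moreover have "cls x y (f [^]\<^bsub>hom_group A x y\<^esub> N) = cls x y (hom_zero A x y)"
        using cls_eqI[OF xy _ N(2)[OF f(1)], of "hom_zero A x y"] xy pc by simp
      ultimately show "W [^]\<^bsub>hom_group quot x y\<^esub> N = \<one>\<^bsub>hom_group quot x y\<^esub>" by simp
    qed
  qed
  have \<pi>f: "functor_between A quot \<pi>"
    by (intro functor_between.intro A.category_axioms Q.category_axioms functor_between_axioms.intro)
      (auto simp: \<pi>_def quot_Comp)
  have \<pi>: "additive_functor A quot \<pi>"
    by (intro additive_functor.intro \<pi>f additive_functor_axioms.intro)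
      (auto simp: \<pi>_def hom_into_hom_group quot_add)
  have G: "functor_between quot (Vect K) G"
    by (intro functor_between.intro Q.category_axioms E.D.category_axioms functor_between_axioms.intro)
      (auto simp: G_def E_rep A.Id_closed A.Comp_closed quot_Comp E.fobj_closed E.farr_closed
        E.farr_Id E.farr_Comp simp del: Vect_simps)
  have "isomorphic_functors A (Vect K) E (comp_functor G \<pi>)"
    by (rule isomorphic_functors_cong[OF isomorphic_functors_refl[OF E] A.category_axioms])
      (simp_all add: comp_functor_def G_def \<pi>_def E_rep)
  then show ?thesis
    by (intro antipolynomial_functorI[OF A.additive_category_axioms K E triv \<pi> G])
qed

end

section \<open>The periods of the extended functor\<close>

lemma finite_index_reps:
  assumes "finite_index G H"
  obtains R where "finite R" "R \<subseteq> carrier G"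
    "\<And>u. u \<in> carrier G \<Longrightarrow> \<exists>r\<in>R. u \<otimes>\<^bsub>G\<^esub> inv\<^bsub>G\<^esub> r \<in> H"
proof -
  obtain \<kappa> :: "'a \<Rightarrow> nat" where \<kappa>: "finite (\<kappa> ` carrier G)"
    "\<And>u v. \<lbrakk>u \<in> carrier G; v \<in> carrier G; \<kappa> u = \<kappa> v\<rbrakk> \<Longrightarrow> u \<otimes>\<^bsub>G\<^esub> inv\<^bsub>G\<^esub> v \<in> H"
    using assms unfolding finite_index_def by metis
  show ?thesis
  proof (rule that[of "inv_into (carrier G) \<kappa> ` \<kappa> ` carrier G"])
    show "finite (inv_into (carrier G) \<kappa> ` \<kappa> ` carrier G)" by (rule finite_imageI[OF \<kappa>(1)])
    show "inv_into (carrier G) \<kappa> ` \<kappa> ` carrier G \<subseteq> carrier G" by (auto intro: inv_into_into)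
    fix u assume u: "u \<in> carrier G"
    then have "inv_into (carrier G) \<kappa> (\<kappa> u) \<in> carrier G" "\<kappa> (inv_into (carrier G) \<kappa> (\<kappa> u)) = \<kappa> u"
      by (auto intro: inv_into_into f_inv_into_f)
    then show "\<exists>r\<in>inv_into (carrier G) \<kappa> ` \<kappa> ` carrier G. u \<otimes>\<^bsub>G\<^esub> inv\<^bsub>G\<^esub> r \<in> H"
      using \<kappa>(2)[OF u, of "inv_into (carrier G) \<kappa> (\<kappa> u)"] u by (intro bexI[of _ "inv_into (carrier G) \<kappa> (\<kappa> u)"]) auto
  qed
qed

lemma finite_index_vimages:
  fixes G' :: "('b, 'e) monoid_scheme"
  assumes G: "group G" "group G'" and H: "finite_index G' H" and T: "finite T"
    and \<phi>: "\<And>t. t \<in> T \<Longrightarrow> \<phi> t \<in> hom G G'"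
  shows "finite_index G {u \<in> carrier G. \<forall>t\<in>T. \<phi> t u \<in> H}"
proof -
  interpret G: group G by fact
  interpret G': group G' by fact
  obtain \<kappa> :: "'b \<Rightarrow> nat" where \<kappa>: "finite (\<kappa> ` carrier G')"
    "\<And>u v. \<lbrakk>u \<in> carrier G'; v \<in> carrier G'; \<kappa> u = \<kappa> v\<rbrakk> \<Longrightarrow> u \<otimes>\<^bsub>G'\<^esub> inv\<^bsub>G'\<^esub> v \<in> H"
    using H unfolding finite_index_def by metis
  have cl: "\<phi> t u \<in> carrier G'" if "t \<in> T" "u \<in> carrier G" for t u
    using hom_in_carrier[OF \<phi>[OF that(1)] that(2)] .
  show ?thesis
  proof (rule finite_indexI[where \<kappa> = "\<lambda>u. \<lambda>t\<in>T. \<kappa> (\<phi> t u)"])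
    show "finite ((\<lambda>u. \<lambda>t\<in>T. \<kappa> (\<phi> t u)) ` carrier G)"
      by (rule finite_subset[OF _ finite_PiE[OF T, of "\<lambda>_. \<kappa> ` carrier G'"]]) (use cl \<kappa>(1) in auto)
    fix u v assume uv: "u \<in> carrier G" "v \<in> carrier G" and eq: "(\<lambda>t\<in>T. \<kappa> (\<phi> t u)) = (\<lambda>t\<in>T. \<kappa> (\<phi> t v))"
    have "\<phi> t (u \<otimes>\<^bsub>G\<^esub> inv\<^bsub>G\<^esub> v) \<in> H" if t: "t \<in> T" for t
    proof -
      interpret h: group_hom G G' "\<phi> t"
        by (intro group_hom.intro group_hom_axioms.intro G \<phi> t)
      have "\<kappa> (\<phi> t u) = \<kappa> (\<phi> t v)" using fun_cong[OF eq, of t] t by simp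
      then show ?thesis using \<kappa>(2)[OF cl[OF t uv(1)] cl[OF t uv(2)]] uv by simp
    qed
    then show "u \<otimes>\<^bsub>G\<^esub> inv\<^bsub>G\<^esub> v \<in> {u \<in> carrier G. \<forall>t\<in>T. \<phi> t u \<in> H}" using uv by simp
  qed
qed

lemma module_hom_comp: "\<lbrakk>f \<in> module_hom K U V; g \<in> module_hom K V W\<rbrakk> \<Longrightarrow> (\<lambda>x. g (f x)) \<in> module_hom K U W"
  by (auto simp: module_hom_def Pi_iff)

locale detected_functor = additive_vect_functor A K F
  for A :: "('o, 'm, 'e) preadditive_data_scheme" and K :: "'k ring" and F :: "('o, 'm, 'k, 'v) vfunctor" +
  fixes z :: 'o
  assumes z: "z \<in> Obj A"
    and detect: "\<lbrakk>x \<in> Obj A; y \<in> Obj A; \<phi> \<in> Hom (Vect K) (fobj F x) (fobj F y);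
      \<psi> \<in> Hom (Vect K) (fobj F x) (fobj F y);
      \<And>a b v. \<lbrakk>a \<in> Hom A y z; b \<in> Hom A z x; v \<in> carrier (fobj F z)\<rbrakk>
        \<Longrightarrow> farr F y z a (\<phi> (farr F z x b v)) = farr F y z a (\<psi> (farr F z x b v))\<rbrakk> \<Longrightarrow> \<phi> = \<psi>"
begin

definition compress where "compress x y a b f = Comp A z x z (Comp A x y z a f) b"

lemma compress_hom:
  assumes "x \<in> Obj A" "y \<in> Obj A" "a \<in> Hom A y z" "b \<in> Hom A z x"
  shows "compress x y a b \<in> hom (hom_group A x y) (hom_group A z z)"
  using assms z by (simp add: hom_into_hom_group compress_def A.Comp_closed A.Comp_add_left A.Comp_add_right)

lemma compress_closed:
  "\<lbrakk>x \<in> Obj A; y \<in> Obj A; a \<in> Hom A y z; b \<in> Hom A z x; f \<in> Hom A x y\<rbrakk> \<Longrightarrow> compress x y a b f \<in> Hom A z z"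
  using z by (simp add: compress_def A.Comp_closed)

lemma ext_compress:
  assumes O: "x \<in> Obj A" "y \<in> Obj A" and ab: "a \<in> Hom A y z" "b \<in> Hom A z x"
    and fg: "f \<in> Hom A x y" "g \<in> Hom A x y" and v: "v \<in> carrier (fobj F z)"
  shows "farr F y z a (ext x y f g (farr F z x b v)) = ext z z (compress x y a b f) (compress x y a b g) v"
proof -
  note [simp] = A.Comp_closed
  have "farr F y z a (ext x y f g (farr F z x b v))
      = ext y z a a (ext x y f g (ext z x b b v))"
    using O ab z by (simp add: ext_diag)
  also have "\<dots> = ext z z (Comp A z y z a (Comp A z x y f b)) (Comp A z y z a (Comp A z x y g b)) v"
    using O ab fg z v by (simp add: ext_app)
  also have "\<dots> = ext z z (compress x y a b f) (compress x y a b g) v"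
    using O ab fg z by (simp add: compress_def A.Comp_assoc)
  finally show ?thesis .
qed

text \<open>The compressions \<open>F(a) ext(f, g) F(b) = ext(a f b, a g b)\<close> jointly detect linear maps, so a bound for
  the degree on \<open>Hom z z\<close> is valid for all pairs of objects.\<close>

lemma ext_deg_uniform:
  "\<exists>d. \<forall>x\<in>Obj A. \<forall>y\<in>Obj A. \<forall>g\<in>Hom A x y.
    degree_less (hom_group A x y) (LinF x y) d (\<lambda>f. ext x y f g)"
proof -
  obtain d where d: "\<forall>g\<in>Hom A z z. degree_less (hom_group A z z) (LinF z z) d (\<lambda>f. ext z z f g)"
    using ext_deg[OF z z] by blast
  show ?thesis
  proof (intro exI[of _ d] ballI)
    fix x y g assume O: "x \<in> Obj A" "y \<in> Obj A" and g: "g \<in> Hom A x y"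
    interpret P: poly_maps "hom_group A x y" K "LinF x y" by (rule poly_maps_Hom[OF O vs_LinF[OF O]])
    interpret Z: comm_group "hom_group A z z" by (rule A.hom_comm_group[OF z z])
    define L where "L i \<phi> = Comp (Vect K) (fobj F z) (fobj F x) (fobj F z)
      (Comp (Vect K) (fobj F x) (fobj F y) (fobj F z) (farr F y z (fst i)) \<phi>) (farr F z x (snd i))" for i \<phi>
    have Lv: "L (a, b) \<phi> = (\<lambda>v\<in>carrier (fobj F z). farr F y z a (\<phi> (farr F z x b v)))"
      if "b \<in> Hom A z x" for a b \<phi>
      using that O z by (auto simp: L_def compose_def fun_eq_iff arr_closed)
    show "degree_less (hom_group A x y) (LinF x y) d (\<lambda>f. ext x y f g)"
    proof (rule P.deg_jointly_injective[where I = "Hom A y z \<times> Hom A z x" and L = L and M' = "LinF z z"])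
      show "vectorspace K (LinF z z)" by (rule vs_LinF[OF z z])
      fix i assume "i \<in> Hom A y z \<times> Hom A z x"
      then obtain a b where i: "i = (a, b)" "a \<in> Hom A y z" "b \<in> Hom A z x" by auto
      show "L i \<in> module_hom K (LinF x y) (LinF z z)"
        unfolding L_def i(1) fst_conv snd_conv
        by (rule module_hom_comp[OF Lin_postcomp Lin_precomp]) (use O z i in \<open>auto intro: vs F.farr_closed simp del: Vect_simps\<close>)
      show "degree_less (hom_group A x y) (LinF z z) d (\<lambda>f. L i (ext x y f g))"
      proof (subst degree_less_cong[OF P.G.is_group])
        show "degree_less (hom_group A x y) (LinF z z) d (\<lambda>f. ext z z (compress x y a b f) (compress x y a b g))"
          by (rule degree_less_hom[where \<phi> = "compress x y a b" and q = "\<lambda>f. ext z z f (compress x y a b g)",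
                OF Z.is_group P.G.is_group compress_hom[OF O i(2,3)]])
            (use d compress_closed[OF O i(2,3) g] in blast)
        fix f assume f: "f \<in> carrier (hom_group A x y)"
        have "ext z z (compress x y a b f) (compress x y a b g) \<in> extensional (carrier (fobj F z))"
          using ext_closed[OF z z compress_closed compress_closed] O i f g by simp
        then show "L i (ext x y f g) = ext z z (compress x y a b f) (compress x y a b g)"
          unfolding i(1) Lv[OF i(3)]
          using ext_compress[OF O i(2,3) _ g] f by (auto simp: extensional_def fun_eq_iff)
      qed
    next
      fix m assume m: "m \<in> carrier (LinF x y)"
        and eq: "\<And>i. i \<in> Hom A y z \<times> Hom A z x \<Longrightarrow> L i m = \<zero>\<^bsub>LinF z z\<^esub>"
      show "m = \<zero>\<^bsub>LinF x y\<^esub>"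
      proof (rule detect[OF O])
        show "m \<in> Hom (Vect K) (fobj F x) (fobj F y)" using m by (simp add: Lin_simps)
        show "\<zero>\<^bsub>LinF x y\<^esub> \<in> Hom (Vect K) (fobj F x) (fobj F y)"
          using P.M.module.M.zero_closed by (simp only: Lin_simps(1))
        fix a b v assume ab: "a \<in> Hom A y z" "b \<in> Hom A z x" and v: "v \<in> carrier (fobj F z)"
        have "farr F y z a (m (farr F z x b v)) = \<zero>\<^bsub>fobj F z\<^esub>"
          using fun_cong[OF eq[of "(a, b)"], of v] ab v Lv[OF ab(2)] by (simp add: Lin_simps)
        then show "farr F y z a (m (farr F z x b v)) = farr F y z a (\<zero>\<^bsub>LinF x y\<^esub> (farr F z x b v))"
          using O z ab v by (simp add: Lin_simps arr_closed arr_zero)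
      qed
    next
      show "(\<lambda>f. ext x y f g) \<in> carrier (hom_group A x y) \<rightarrow> carrier (LinF x y)"
        using O g ext_closed by (simp add: Lin_simps(1) del: Vect_simps)
    qed
  qed
qed

definition periods where
  "periods = {h \<in> Hom A z z. \<forall>e\<in>Hom A z z. \<forall>g\<in>Hom A z z. ext z z e (hom_add A z z g h) = ext z z e g}"

lemma subgroup_periods: "subgroup periods (hom_group A z z)"
proof -
  interpret Z: comm_group "hom_group A z z" by (rule A.hom_comm_group[OF z z])
  show ?thesis
  proof (rule Z.subgroupI)
    have "hom_zero A z z \<in> periods" using z by (simp add: periods_def)
    then show "periods \<noteq> {}" by blast
    fix h assume "h \<in> periods"
    then have h: "h \<in> Hom A z z" "\<And>e g. \<lbrakk>e \<in> Hom A z z; g \<in> Hom A z z\<rbrakk> \<Longrightarrow> ext z z e (hom_add A z z g h) = ext z z e g"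
      by (auto simp: periods_def)
    have "ext z z e (hom_add A z z g (inv\<^bsub>hom_group A z z\<^esub> h)) = ext z z e g"
      if eg: "e \<in> Hom A z z" "g \<in> Hom A z z" for e g
    proof -
      have "hom_add A z z (hom_add A z z g (inv\<^bsub>hom_group A z z\<^esub> h)) h = g"
        using Z.m_assoc[of g "inv\<^bsub>hom_group A z z\<^esub> h" h] Z.l_inv[of h] eg h(1) z by simp
      then show ?thesis using h(2)[OF eg(1), of "hom_add A z z g (inv\<^bsub>hom_group A z z\<^esub> h)"] eg h(1) z by simp
    qed
    then show "inv\<^bsub>hom_group A z z\<^esub> h \<in> periods" using h(1) z by (simp add: periods_def)
  next
    fix h k assume "h \<in> periods" "k \<in> periods"
    then show "h \<otimes>\<^bsub>hom_group A z z\<^esub> k \<in> periods"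
      using z by (auto simp: periods_def simp flip: A.add_assoc)
  qed (auto simp: periods_def)
qed

lemma periods_finite_index: "finite_index (hom_group A z z) periods"
  and periods_pow: "\<exists>N. nat_in K N \<noteq> \<zero>\<^bsub>K\<^esub> \<and> (\<forall>f\<in>Hom A z z. f [^]\<^bsub>hom_group A z z\<^esub> (N :: nat) \<in> periods)"
proof -
  obtain H N where H: "subgroup H (hom_group A z z)" "finite_index (hom_group A z z) H" "nat_in K N \<noteq> \<zero>\<^bsub>K\<^esub>"
      "\<And>f. f \<in> Hom A z z \<Longrightarrow> f [^]\<^bsub>hom_group A z z\<^esub> (N :: nat) \<in> H"
      "\<And>f g h. \<lbrakk>f \<in> Hom A z z; g \<in> Hom A z z; h \<in> H\<rbrakk> \<Longrightarrow> ext z z f (hom_add A z z g h) = ext z z f g"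
    using ext_periodic[OF z z] by metis
  have sub: "H \<subseteq> periods" using H(5) subgroup.subset[OF H(1)] by (auto simp: periods_def)
  then show "finite_index (hom_group A z z) periods"
    using H(2) unfolding finite_index_def by blast
  show "\<exists>N. nat_in K N \<noteq> \<zero>\<^bsub>K\<^esub> \<and> (\<forall>f\<in>Hom A z z. f [^]\<^bsub>hom_group A z z\<^esub> (N :: nat) \<in> periods)"
    using H(3,4) sub by blast
qed

text \<open>Factor \<open>g + c f\<close> as \<open>(g, c) \<circ> (1, f)\<close> through \<open>z \<oplus> y\<close>. If \<open>(0, c)\<close> is a period of the extension on
  morphisms \<open>z \<oplus> y \<rightarrow> z\<close>, then \<open>c f\<close> is a period whatever \<open>f\<close> is.\<close>

lemma comp_periods_left:
  assumes y: "y \<in> Obj A"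
  obtains H where "finite_index (hom_group A y z) H"
    "\<And>c f. \<lbrakk>c \<in> Hom A y z; c \<in> H; f \<in> Hom A z y\<rbrakk> \<Longrightarrow> Comp A z y z c f \<in> periods"
proof -
  note [simp] = A.Comp_closed A.Id_closed
  obtain s i j p q where bi: "biproduct A z y s i j p q" using A.ex_biproduct[OF z y] by blast
  then have s: "s \<in> Obj A" and ij: "i \<in> Hom A z s" "j \<in> Hom A y s" "p \<in> Hom A s z" "q \<in> Hom A s y"
    and pi: "Comp A z s z p i = Id A z" "Comp A y s y q j = Id A y" "Comp A y s z p j = hom_zero A y z"
      "Comp A z s y q i = hom_zero A z y"
    by (auto simp: biproduct_def)
  obtain H N where H: "subgroup H (hom_group A s z)" "finite_index (hom_group A s z) H"
      "\<And>f g h. \<lbrakk>f \<in> Hom A s z; g \<in> Hom A s z; h \<in> H\<rbrakk> \<Longrightarrow> ext s z f (hom_add A s z g h) = ext s z f g"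
    using ext_periodic[OF s z] by metis
  have grp: "group (hom_group A y z)" "group (hom_group A s z)"
    using A.hom_comm_group[OF y z] A.hom_comm_group[OF s z] by (simp_all add: comm_group_def)
  show ?thesis
  proof (rule that)
    show "finite_index (hom_group A y z) {c \<in> carrier (hom_group A y z). \<forall>t\<in>{()}. Comp A s y z c q \<in> H}"
      by (rule finite_index_vimages[OF grp H(2), of "{()}" "\<lambda>_ c. Comp A s y z c q"])
        (use A.precomp_hom[OF s y z ij(4)] in auto)
    fix c f assume c: "c \<in> Hom A y z" "c \<in> {c \<in> carrier (hom_group A y z). \<forall>t\<in>{()}. Comp A s y z c q \<in> H}"
      and f: "f \<in> Hom A z y"
    then have cH: "Comp A s y z c q \<in> H" by simp
    define u where "u = hom_add A z s i (Comp A z y s j f)"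
    have u: "u \<in> Hom A z s" using ij f s y z by (simp add: u_def)
    have left: "Comp A z s w h u = hom_add A z w (Comp A z s w h i) (Comp A z y w (Comp A y s w h j) f)"
      if "w \<in> Obj A" "h \<in> Hom A s w" for w h
      using that ij f s y z by (simp add: u_def A.Comp_add_right A.Comp_assoc)
    have pu: "Comp A z s z p u = Id A z" "Comp A z s y q u = f"
      using left[OF z ij(3)] left[OF y ij(4)] pi f y z by (simp_all add: A.Comp_Id_left)
    have eu: "Comp A z s z (Comp A s z z e p) u = e" if "e \<in> Hom A z z" for e
      using A.Comp_assoc[OF z s z z u ij(3) that] pu that z by (simp add: A.Comp_Id_right)
    have cu: "Comp A z s z (Comp A s y z c q) u = Comp A z y z c f"
      using A.Comp_assoc[OF z s y z u ij(4) c(1)] pu by simp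
    have "ext z z e (hom_add A z z g (Comp A z y z c f)) = ext z z e g"
      if eg: "e \<in> Hom A z z" "g \<in> Hom A z z" for e g
    proof -
      define e' where "e' = Comp A s z z e p"
      define g' where "g' = Comp A s z z g p"
      have cl: "e' \<in> Hom A s z" "g' \<in> Hom A s z" "Comp A s y z c q \<in> Hom A s z"
        using eg ij c(1) s y z by (simp_all add: e'_def g'_def)
      have "ext z z e (hom_add A z z g (Comp A z y z c f))
          = Comp (Vect K) (fobj F z) (fobj F s) (fobj F z)
            (ext s z e' (hom_add A s z g' (Comp A s y z c q))) (ext z s u u)"
        using ext_comp[OF z s z u u cl(1), of "hom_add A s z g' (Comp A s y z c q)"] cl eg eu cu u s z
        by (simp add: A.Comp_add_left e'_def g'_def del: Vect_simps)
      also have "\<dots> = Comp (Vect K) (fobj F z) (fobj F s) (fobj F z) (ext s z e' g') (ext z s u u)"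
        using H(3)[OF cl(1,2) cH] by simp
      also have "\<dots> = ext z z e g"
        using ext_comp[OF z s z u u cl(1,2)] eg eu by (simp add: e'_def g'_def del: Vect_simps)
      finally show ?thesis .
    qed
    then show "Comp A z y z c f \<in> periods" using c f y z by (simp add: periods_def)
  qed
qed

text \<open>Dually, factor \<open>g + f c\<close> through \<open>z \<oplus> x\<close>.\<close>

lemma comp_periods_right:
  assumes x: "x \<in> Obj A"
  obtains H where "finite_index (hom_group A z x) H"
    "\<And>c f. \<lbrakk>c \<in> Hom A z x; c \<in> H; f \<in> Hom A x z\<rbrakk> \<Longrightarrow> Comp A z x z f c \<in> periods"
proof -
  note [simp] = A.Comp_closed A.Id_closed
  obtain s i j p q where bi: "biproduct A z x s i j p q" using A.ex_biproduct[OF z x] by blast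
  then have s: "s \<in> Obj A" and ij: "i \<in> Hom A z s" "j \<in> Hom A x s" "p \<in> Hom A s z" "q \<in> Hom A s x"
    and pi: "Comp A z s z p i = Id A z" "Comp A x s x q j = Id A x" "Comp A x s z p j = hom_zero A x z"
      "Comp A z s x q i = hom_zero A z x"
    by (auto simp: biproduct_def)
  obtain H N where H: "subgroup H (hom_group A z s)" "finite_index (hom_group A z s) H"
      "\<And>f g h. \<lbrakk>f \<in> Hom A z s; g \<in> Hom A z s; h \<in> H\<rbrakk> \<Longrightarrow> ext z s f (hom_add A z s g h) = ext z s f g"
    using ext_periodic[OF z s] by metis
  have grp: "group (hom_group A z x)" "group (hom_group A z s)"
    using A.hom_comm_group[OF z x] A.hom_comm_group[OF z s] by (simp_all add: comm_group_def)
  show ?thesis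
  proof (rule that)
    show "finite_index (hom_group A z x) {c \<in> carrier (hom_group A z x). \<forall>t\<in>{()}. Comp A z x s j c \<in> H}"
      by (rule finite_index_vimages[OF grp H(2), of "{()}" "\<lambda>_ c. Comp A z x s j c"])
        (use A.postcomp_hom[OF z x s ij(2)] in auto)
    fix c f assume c: "c \<in> Hom A z x" "c \<in> {c \<in> carrier (hom_group A z x). \<forall>t\<in>{()}. Comp A z x s j c \<in> H}"
      and f: "f \<in> Hom A x z"
    then have cH: "Comp A z x s j c \<in> H" by simp
    define u where "u = hom_add A s z p (Comp A s x z f q)"
    have u: "u \<in> Hom A s z" using ij f s x z by (simp add: u_def)
    have left: "Comp A w s z u h = hom_add A w z (Comp A w s z p h) (Comp A w x z f (Comp A w s x q h))"
      if "w \<in> Obj A" "h \<in> Hom A w s" for w h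
      using that ij f s x z by (simp add: u_def A.Comp_add_left A.Comp_assoc)
    have ui: "Comp A z s z u i = Id A z" "Comp A x s z u j = f"
      using left[OF z ij(1)] left[OF x ij(2)] pi f x z by (simp_all add: A.Comp_Id_right)
    have ue: "Comp A z s z u (Comp A z z s i e) = e" if "e \<in> Hom A z z" for e
      using A.Comp_assoc[OF z z s z that ij(1) u] ui that z by (simp add: A.Comp_Id_left)
    have uc: "Comp A z s z u (Comp A z x s j c) = Comp A z x z f c"
      using A.Comp_assoc[OF z x s z c(1) ij(2) u] ui by simp
    have "ext z z e (hom_add A z z g (Comp A z x z f c)) = ext z z e g"
      if eg: "e \<in> Hom A z z" "g \<in> Hom A z z" for e g
    proof -
      define e' where "e' = Comp A z z s i e"
      define g' where "g' = Comp A z z s i g"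
      have cl: "e' \<in> Hom A z s" "g' \<in> Hom A z s" "Comp A z x s j c \<in> Hom A z s"
        using eg ij c(1) s x z by (simp_all add: e'_def g'_def)
      have "ext z z e (hom_add A z z g (Comp A z x z f c))
          = Comp (Vect K) (fobj F z) (fobj F s) (fobj F z) (ext s z u u)
            (ext z s e' (hom_add A z s g' (Comp A z x s j c)))"
        using ext_comp[OF z s z cl(1) _ u u, of "hom_add A z s g' (Comp A z x s j c)"] cl eg ue uc u s z
        by (simp add: A.Comp_add_right e'_def g'_def del: Vect_simps)
      also have "\<dots> = Comp (Vect K) (fobj F z) (fobj F s) (fobj F z) (ext s z u u) (ext z s e' g')"
        using H(3)[OF cl(1,2) cH] by simp
      also have "\<dots> = ext z z e g"
        using ext_comp[OF z s z cl(1,2) u u] eg ue by (simp add: e'_def g'_def del: Vect_simps)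
      finally show ?thesis .
    qed
    then show "Comp A z x z f c \<in> periods" using c f x z by (simp add: periods_def)
  qed
qed

text \<open>The largest ideal whose members in \<open>Hom z z\<close> are periods.\<close>

definition I where "I x y = {f \<in> Hom A x y. \<forall>a\<in>Hom A y z. \<forall>b\<in>Hom A z x. compress x y a b f \<in> periods}"

sublocale ideal_quotient A I
proof (intro ideal_quotient.intro ideal_quotient_axioms.intro A.additive_category_axioms)
  fix x y assume O: "x \<in> Obj A" "y \<in> Obj A"
  interpret G: comm_group "hom_group A x y" by (rule A.hom_comm_group[OF O])
  interpret Z: comm_group "hom_group A z z" by (rule A.hom_comm_group[OF z z])
  interpret S: subgroup periods "hom_group A z z" by (rule subgroup_periods)
  have hom: "group_hom (hom_group A x y) (hom_group A z z) (compress x y a b)"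
    if "a \<in> Hom A y z" "b \<in> Hom A z x" for a b
    by (intro group_hom.intro group_hom_axioms.intro compress_hom O that G.is_group Z.is_group)
  show "subgroup (I x y) (hom_group A x y)"
  proof (rule G.subgroupI)
    have "hom_zero A x y \<in> I x y"
      using group_hom.hom_one[OF hom] S.one_closed O by (simp add: I_def)
    then show "I x y \<noteq> {}" by blast
    fix f assume "f \<in> I x y"
    then show "inv\<^bsub>hom_group A x y\<^esub> f \<in> I x y"
      using group_hom.hom_inv[OF hom] S.m_inv_closed O by (simp add: I_def)
  next
    fix f g assume "f \<in> I x y" "g \<in> I x y"
    then show "f \<otimes>\<^bsub>hom_group A x y\<^esub> g \<in> I x y"
      using group_hom.hom_mult[OF hom] S.m_closed O by (simp add: I_def)
  qed (auto simp: I_def)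
next
  fix x y w f g assume "x \<in> Obj A" "y \<in> Obj A" "w \<in> Obj A" "f \<in> I x y" "g \<in> Hom A y w"
  moreover have "compress x w a b (Comp A x y w g f) = compress x y (Comp A y w z a g) b f"
    if "x \<in> Obj A" "y \<in> Obj A" "w \<in> Obj A" "f \<in> Hom A x y" "g \<in> Hom A y w" "a \<in> Hom A w z" "b \<in> Hom A z x" for a b
    using that z by (simp add: compress_def A.Comp_assoc A.Comp_closed)
  ultimately show "Comp A x y w g f \<in> I x w" using z by (auto simp: I_def A.Comp_closed)
next
  fix x y w f g assume "x \<in> Obj A" "y \<in> Obj A" "w \<in> Obj A" "f \<in> Hom A x y" "g \<in> I y w"
  moreover have "compress x w a b (Comp A x y w g f) = compress y w a (Comp A z x y f b) g"
    if "x \<in> Obj A" "y \<in> Obj A" "w \<in> Obj A" "f \<in> Hom A x y" "g \<in> Hom A y w" "a \<in> Hom A w z" "b \<in> Hom A z x" for a b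
    using that z by (simp add: compress_def A.Comp_assoc A.Comp_closed)
  ultimately show "Comp A x y w g f \<in> I x w" using z by (auto simp: I_def A.Comp_closed)
qed

lemma ext_I:
  assumes O: "x \<in> Obj A" "y \<in> Obj A" and fg: "f \<in> Hom A x y" "g \<in> Hom A x y" and h: "h \<in> I x y"
  shows "ext x y f (hom_add A x y g h) = ext x y f g"
proof (rule detect[OF O])
  have hH: "h \<in> Hom A x y" using h by (simp add: I_def)
  show "ext x y f (hom_add A x y g h) \<in> Hom (Vect K) (fobj F x) (fobj F y)"
    by (rule ext_closed[OF O fg(1)]) (use O fg hH in simp)
  show "ext x y f g \<in> Hom (Vect K) (fobj F x) (fobj F y)" by (rule ext_closed[OF O fg])
  fix a b v assume ab: "a \<in> Hom A y z" "b \<in> Hom A z x" and v: "v \<in> carrier (fobj F z)"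
  have "compress x y a b (hom_add A x y g h) = hom_add A z z (compress x y a b g) (compress x y a b h)"
    using compress_hom[OF O ab] fg hH by (simp add: hom_into_hom_group)
  moreover have "compress x y a b h \<in> periods" using h ab by (simp add: I_def)
  ultimately have "ext z z (compress x y a b f) (compress x y a b (hom_add A x y g h)) = ext z z (compress x y a b f) (compress x y a b g)"
    using compress_closed[OF O ab] fg by (simp add: periods_def)
  then show "farr F y z a (ext x y f (hom_add A x y g h) (farr F z x b v)) = farr F y z a (ext x y f g (farr F z x b v))"
    using ext_compress[OF O ab fg(1) _ v] fg(2) hH O by simp
qed

lemma I_pow:
  assumes O: "x \<in> Obj A" "y \<in> Obj A"
  shows "\<exists>N. nat_in K N \<noteq> \<zero>\<^bsub>K\<^esub> \<and> (\<forall>f\<in>Hom A x y. f [^]\<^bsub>hom_group A x y\<^esub> (N :: nat) \<in> I x y)"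
proof -
  obtain N :: nat where N: "nat_in K N \<noteq> \<zero>\<^bsub>K\<^esub>" "\<And>f. f \<in> Hom A z z \<Longrightarrow> f [^]\<^bsub>hom_group A z z\<^esub> N \<in> periods"
    using periods_pow by blast
  interpret G: comm_group "hom_group A x y" by (rule A.hom_comm_group[OF O])
  interpret Z: comm_group "hom_group A z z" by (rule A.hom_comm_group[OF z z])
  have "f [^]\<^bsub>hom_group A x y\<^esub> N \<in> I x y" if f: "f \<in> Hom A x y" for f
  proof -
    have "compress x y a b (f [^]\<^bsub>hom_group A x y\<^esub> N) \<in> periods" if ab: "a \<in> Hom A y z" "b \<in> Hom A z x" for a b
    proof -
      interpret h: group_hom "hom_group A x y" "hom_group A z z" "compress x y a b"
        by (intro group_hom.intro group_hom_axioms.intro compress_hom O ab G.is_group Z.is_group)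
      show ?thesis using h.hom_nat_pow[of f N] N(2)[OF compress_closed[OF O ab f]] f by simp
    qed
    then show ?thesis using G.nat_pow_closed[of f N] f by (simp add: I_def)
  qed
  then show ?thesis using N(1) by blast
qed

text \<open>Modulo periods, the compression \<open>a f b\<close> is additive in \<open>a\<close> and \<open>b\<close> and depends only on the classes of
  \<open>a\<close> and \<open>b\<close> modulo subgroups of finite index. So finitely many conditions on \<open>f\<close> define the ideal.\<close>

lemma I_finite_index:
  assumes O: "x \<in> Obj A" "y \<in> Obj A"
  shows "finite_index (hom_group A x y) (I x y)"
proof -
  note [simp] = A.Comp_closed
  obtain H where H: "finite_index (hom_group A y z) H"
    "\<And>c f. \<lbrakk>c \<in> Hom A y z; c \<in> H; f \<in> Hom A z y\<rbrakk> \<Longrightarrow> Comp A z y z c f \<in> periods"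
    using comp_periods_left[OF O(2)] by metis
  obtain H' where H': "finite_index (hom_group A z x) H'"
    "\<And>c f. \<lbrakk>c \<in> Hom A z x; c \<in> H'; f \<in> Hom A x z\<rbrakk> \<Longrightarrow> Comp A z x z f c \<in> periods"
    using comp_periods_right[OF O(1)] by metis
  obtain R where R: "finite R" "R \<subseteq> Hom A y z"
    "\<And>a. a \<in> Hom A y z \<Longrightarrow> \<exists>r\<in>R. hom_add A y z a (inv\<^bsub>hom_group A y z\<^esub> r) \<in> H"
    using finite_index_reps[OF H(1)] unfolding hom_group_simps by metis
  obtain R' where R': "finite R'" "R' \<subseteq> Hom A z x"
    "\<And>b. b \<in> Hom A z x \<Longrightarrow> \<exists>r\<in>R'. hom_add A z x b (inv\<^bsub>hom_group A z x\<^esub> r) \<in> H'"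
    using finite_index_reps[OF H'(1)] unfolding hom_group_simps by metis
  have grp: "group (hom_group A x y)" "group (hom_group A z z)"
    using A.hom_comm_group[OF O] A.hom_comm_group[OF z z] by (simp_all add: comm_group_def)
  interpret S: subgroup periods "hom_group A z z" by (rule subgroup_periods)
  have split: "\<exists>r\<in>R. \<exists>c\<in>Hom A y z. c \<in> H \<and> a = hom_add A y z r c" if a: "a \<in> Hom A y z" for a
  proof -
    obtain r where r: "r \<in> R" "hom_add A y z a (inv\<^bsub>hom_group A y z\<^esub> r) \<in> H" using R(3)[OF a] by blast
    moreover have "a = hom_add A y z r (hom_add A y z a (inv\<^bsub>hom_group A y z\<^esub> r))"
      using r a R(2) O z A.add_left_comm[of y z r a "inv\<^bsub>hom_group A y z\<^esub> r"] by auto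
    ultimately show ?thesis using a R(2) O z
      by (intro bexI[of _ r] bexI[of _ "hom_add A y z a (inv\<^bsub>hom_group A y z\<^esub> r)"]) auto
  qed
  have split': "\<exists>r\<in>R'. \<exists>c\<in>Hom A z x. c \<in> H' \<and> a = hom_add A z x r c" if a: "a \<in> Hom A z x" for a
  proof -
    obtain r where r: "r \<in> R'" "hom_add A z x a (inv\<^bsub>hom_group A z x\<^esub> r) \<in> H'" using R'(3)[OF a] by blast
    moreover have "a = hom_add A z x r (hom_add A z x a (inv\<^bsub>hom_group A z x\<^esub> r))"
      using r a R'(2) O z A.add_left_comm[of z x r a "inv\<^bsub>hom_group A z x\<^esub> r"] by auto
    ultimately show ?thesis using a R'(2) O z
      by (intro bexI[of _ r] bexI[of _ "hom_add A z x a (inv\<^bsub>hom_group A z x\<^esub> r)"]) auto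
  qed
  let ?J = "{f \<in> carrier (hom_group A x y). \<forall>t\<in>R \<times> R'. compress x y (fst t) (snd t) f \<in> periods}"
  have "?J \<subseteq> I x y"
  proof
    fix f assume f: "f \<in> ?J"
    then have fH: "f \<in> Hom A x y" by simp
    have "compress x y a b f \<in> periods" if ab: "a \<in> Hom A y z" "b \<in> Hom A z x" for a b
    proof -
      obtain r c where r: "r \<in> R" "c \<in> Hom A y z" "c \<in> H" "a = hom_add A y z r c" using split[OF ab(1)] by blast
      obtain r' c' where r': "r' \<in> R'" "c' \<in> Hom A z x" "c' \<in> H'" "b = hom_add A z x r' c'" using split'[OF ab(2)] by blast
      have rc: "r \<in> Hom A y z" "r' \<in> Hom A z x" using r r' R R' by auto
      have "compress x y a b f = hom_add A z z (compress x y r b f) (Comp A z y z c (Comp A z x y f b))"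
        using r rc ab fH O z by (simp add: compress_def A.Comp_add_left A.Comp_assoc)
      moreover have "compress x y r b f = hom_add A z z (compress x y r r' f) (Comp A z x z (Comp A x y z r f) c')"
        using r' rc ab fH O z by (simp add: compress_def A.Comp_add_right)
      moreover have "Comp A z y z c (Comp A z x y f b) \<in> periods" using r ab fH O z by (intro H(2)) simp_all
      moreover have "Comp A z x z (Comp A x y z r f) c' \<in> periods" using r' rc fH O z by (intro H'(2)) simp_all
      moreover have "compress x y r r' f \<in> periods" using f r(1) r'(1) by auto
      ultimately show ?thesis using S.m_closed by simp
    qed
    then show "f \<in> I x y" using fH by (simp add: I_def)
  qed
  moreover have "finite_index (hom_group A x y) ?J"
    by (rule finite_index_vimages[OF grp periods_finite_index])
      (use R R' compress_hom[OF O] in \<open>auto simp: subset_iff\<close>)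
  ultimately show ?thesis unfolding finite_index_def by blast
qed

end

section \<open>Construction of the bifunctor\<close>

lemma prod_category_simps [simp]:
  "Obj (prod_category C D) = Obj C \<times> Obj D"
  "Hom (prod_category C D) a b = Hom C (fst a) (fst b) \<times> Hom D (snd a) (snd b)"
  "Id (prod_category C D) a = (Id C (fst a), Id D (snd a))"
  "Comp (prod_category C D) a b c g f = (Comp C (fst a) (fst b) (fst c) (fst g) (fst f),
    Comp D (snd a) (snd b) (snd c) (snd g) (snd f))"
  by (simp_all add: prod_category_def)

lemma functor_fix_second:
  assumes "category C" "category D" "functor_between (prod_category C D) E B" "y \<in> Obj D"
  shows "functor_between C E (fix_second D B y)"
proof -
  interpret C: category C by fact
  interpret D: category D by fact
  interpret B: functor_between "prod_category C D" E B by fact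
  show ?thesis
  proof (intro functor_between.intro C.category_axioms B.D.category_axioms functor_between_axioms.intro)
    fix x x' x'' f g assume *: "x \<in> Obj C" "x' \<in> Obj C" "x'' \<in> Obj C" "f \<in> Hom C x x'" "g \<in> Hom C x' x''"
    show "farr (fix_second D B y) x x'' (Comp C x x' x'' g f)
        = Comp E (fobj (fix_second D B y) x) (fobj (fix_second D B y) x') (fobj (fix_second D B y) x'')
          (farr (fix_second D B y) x' x'' g) (farr (fix_second D B y) x x' f)"
      using * assms(4) B.farr_Comp[of "(x, y)" "(x', y)" "(x'', y)" "(f, Id D y)" "(g, Id D y)"]
      by (simp add: fix_second_def D.Id_closed D.Comp_Id_left)
  next
    fix x assume "x \<in> Obj C"
    then show "farr (fix_second D B y) x x (Id C x) = Id E (fobj (fix_second D B y) x)"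
      using assms(4) B.farr_Id[of "(x, y)"] by (simp add: fix_second_def)
  qed (use assms(4) B.fobj_closed B.farr_closed in \<open>auto simp: fix_second_def D.Id_closed\<close>)
qed

lemma functor_fix_first:
  assumes "category C" "category D" "functor_between (prod_category C D) E B" "x \<in> Obj C"
  shows "functor_between D E (fix_first C B x)"
proof -
  interpret C: category C by fact
  interpret D: category D by fact
  interpret B: functor_between "prod_category C D" E B by fact
  show ?thesis
  proof (intro functor_between.intro D.category_axioms B.D.category_axioms functor_between_axioms.intro)
    fix y y' y'' f g assume *: "y \<in> Obj D" "y' \<in> Obj D" "y'' \<in> Obj D" "f \<in> Hom D y y'" "g \<in> Hom D y' y''"
    show "farr (fix_first C B x) y y'' (Comp D y y' y'' g f)
        = Comp E (fobj (fix_first C B x) y) (fobj (fix_first C B x) y') (fobj (fix_first C B x) y'')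
          (farr (fix_first C B x) y' y'' g) (farr (fix_first C B x) y y' f)"
      using * assms(4) B.farr_Comp[of "(x, y)" "(x, y')" "(x, y'')" "(Id C x, f)" "(Id C x, g)"]
      by (simp add: fix_first_def C.Id_closed C.Comp_Id_left)
  next
    fix y assume "y \<in> Obj D"
    then show "farr (fix_first C B x) y y (Id D y) = Id E (fobj (fix_first C B x) y)"
      using assms(4) B.farr_Id[of "(x, y)"] by (simp add: fix_first_def)
  qed (use assms(4) B.fobj_closed B.farr_closed in \<open>auto simp: fix_first_def C.Id_closed\<close>)
qed

context category
begin

lemma retract_cancel:
  assumes "w \<in> Obj C" "x \<in> Obj C" "s \<in> Obj C" "i \<in> Hom C x s" "p \<in> Hom C s x"
    and "Comp C x s x p i = Id C x" "h \<in> Hom C w x"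
  shows "Comp C w s x p (Comp C w x s i h) = h"
  using assms Comp_assoc[of w x s x h i p] by (simp add: Comp_Id_left)

lemma retract_cancel_right:
  assumes "x \<in> Obj C" "x' \<in> Obj C" "s \<in> Obj C" "i \<in> Hom C x s" "p \<in> Hom C s x"
    and "Comp C x s x p i = Id C x" "f \<in> Hom C x x'"
  shows "Comp C x s x' (Comp C s x x' f p) i = f"
  using assms Comp_assoc[of x s x x' i p f] by (simp add: Comp_Id_right)

end

locale split_functor = detected_functor A K F z
  for A :: "('o, 'm, 'e) preadditive_data_scheme" and K :: "'k ring" and F :: "('o, 'm, 'k, 'v) vfunctor" and z +
  fixes s :: "'o \<times> 'o \<Rightarrow> 'o" and i j p q :: "'o \<times> 'o \<Rightarrow> 'm"
  assumes bi: "a \<in> Obj A \<times> Obj A \<Longrightarrow> biproduct A (fst a) (snd a) (s a) (i a) (j a) (p a) (q a)"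
begin

abbreviation "PP \<equiv> prod_category A A"

lemma O1 [simp]: "a \<in> Obj A \<times> Obj A \<Longrightarrow> fst a \<in> Obj A"
  and O2 [simp]: "a \<in> Obj A \<times> Obj A \<Longrightarrow> snd a \<in> Obj A"
  and s [simp]: "a \<in> Obj A \<times> Obj A \<Longrightarrow> s a \<in> Obj A"
  and i [simp]: "a \<in> Obj A \<times> Obj A \<Longrightarrow> i a \<in> Hom A (fst a) (s a)"
  and j [simp]: "a \<in> Obj A \<times> Obj A \<Longrightarrow> j a \<in> Hom A (snd a) (s a)"
  and p [simp]: "a \<in> Obj A \<times> Obj A \<Longrightarrow> p a \<in> Hom A (s a) (fst a)"
  and q [simp]: "a \<in> Obj A \<times> Obj A \<Longrightarrow> q a \<in> Hom A (s a) (snd a)"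
  and p_i: "a \<in> Obj A \<times> Obj A \<Longrightarrow> Comp A (fst a) (s a) (fst a) (p a) (i a) = Id A (fst a)"
  and q_j: "a \<in> Obj A \<times> Obj A \<Longrightarrow> Comp A (snd a) (s a) (snd a) (q a) (j a) = Id A (snd a)"
  using bi[of a] by (auto simp: biproduct_def)

definition lift1 where
  "lift1 a b f = Comp A (s a) (fst b) (s b) (i b) (Comp A (s a) (fst a) (fst b) f (p a))"

definition lift2 where
  "lift2 a b g = Comp A (s a) (snd b) (s b) (j b) (Comp A (s a) (snd a) (snd b) g (q a))"

lemma lift_closed:
  assumes "a \<in> Obj A \<times> Obj A" "b \<in> Obj A \<times> Obj A"
  shows "f \<in> Hom A (fst a) (fst b) \<Longrightarrow> lift1 a b f \<in> Hom A (s a) (s b)"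
    and "g \<in> Hom A (snd a) (snd b) \<Longrightarrow> lift2 a b g \<in> Hom A (s a) (s b)"
  using assms by (simp_all add: lift1_def lift2_def A.Comp_closed)

lemma lift_hom:
  assumes "a \<in> Obj A \<times> Obj A" "b \<in> Obj A \<times> Obj A"
  shows "lift1 a b \<in> hom (hom_group A (fst a) (fst b)) (hom_group A (s a) (s b))"
    and "lift2 a b \<in> hom (hom_group A (snd a) (snd b)) (hom_group A (s a) (s b))"
  using assms
  by (simp_all add: hom_into_hom_group lift1_def lift2_def A.Comp_closed A.Comp_add_left A.Comp_add_right)

lemma lift_comp:
  assumes a: "a \<in> Obj A \<times> Obj A" and b: "b \<in> Obj A \<times> Obj A" and c: "c \<in> Obj A \<times> Obj A"
  shows "\<lbrakk>f \<in> Hom A (fst a) (fst b); f' \<in> Hom A (fst b) (fst c)\<rbrakk>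
      \<Longrightarrow> Comp A (s a) (s b) (s c) (lift1 b c f') (lift1 a b f) = lift1 a c (Comp A (fst a) (fst b) (fst c) f' f)"
    and "\<lbrakk>g \<in> Hom A (snd a) (snd b); g' \<in> Hom A (snd b) (snd c)\<rbrakk>
      \<Longrightarrow> Comp A (s a) (s b) (s c) (lift2 b c g') (lift2 a b g) = lift2 a c (Comp A (snd a) (snd b) (snd c) g' g)"
proof -
  note [simp] = A.Comp_closed
  assume f: "f \<in> Hom A (fst a) (fst b)" "f' \<in> Hom A (fst b) (fst c)"
  have "Comp A (s a) (s b) (fst b) (p b) (Comp A (s a) (fst b) (s b) (i b) (Comp A (s a) (fst a) (fst b) f (p a)))
      = Comp A (s a) (fst a) (fst b) f (p a)"
    using a b f by (intro A.retract_cancel) (simp_all add: p_i)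
  then show "Comp A (s a) (s b) (s c) (lift1 b c f') (lift1 a b f) = lift1 a c (Comp A (fst a) (fst b) (fst c) f' f)"
    using a b c f by (simp add: lift1_def flip: A.Comp_assoc)
next
  note [simp] = A.Comp_closed
  assume g: "g \<in> Hom A (snd a) (snd b)" "g' \<in> Hom A (snd b) (snd c)"
  have "Comp A (s a) (s b) (snd b) (q b) (Comp A (s a) (snd b) (s b) (j b) (Comp A (s a) (snd a) (snd b) g (q a)))
      = Comp A (s a) (snd a) (snd b) g (q a)"
    using a b g by (intro A.retract_cancel) (simp_all add: q_j)
  then show "Comp A (s a) (s b) (s c) (lift2 b c g') (lift2 a b g) = lift2 a c (Comp A (snd a) (snd b) (snd c) g' g)"
    using a b c g by (simp add: lift2_def flip: A.Comp_assoc)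
qed

lemma lift_inj:
  assumes a: "a \<in> Obj A \<times> Obj A" and b: "b \<in> Obj A \<times> Obj A"
  shows "f \<in> Hom A (fst a) (fst b) \<Longrightarrow> Comp A (fst a) (s a) (s b) (lift1 a b f) (i a) = Comp A (fst a) (fst b) (s b) (i b) f"
    and "g \<in> Hom A (snd a) (snd b) \<Longrightarrow> Comp A (snd a) (s a) (s b) (lift2 a b g) (j a) = Comp A (snd a) (snd b) (s b) (j b) g"
proof -
  note [simp] = A.Comp_closed
  assume f: "f \<in> Hom A (fst a) (fst b)"
  have "Comp A (fst a) (s a) (fst b) (Comp A (s a) (fst a) (fst b) f (p a)) (i a) = f"
    using a b f by (intro A.retract_cancel_right) (simp_all add: p_i)
  then show "Comp A (fst a) (s a) (s b) (lift1 a b f) (i a) = Comp A (fst a) (fst b) (s b) (i b) f"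
    using a b f A.Comp_assoc[of "fst a" "s a" "fst b" "s b" "i a" "Comp A (s a) (fst a) (fst b) f (p a)" "i b"]
    by (simp add: lift1_def)
next
  note [simp] = A.Comp_closed
  assume g: "g \<in> Hom A (snd a) (snd b)"
  have "Comp A (snd a) (s a) (snd b) (Comp A (s a) (snd a) (snd b) g (q a)) (j a) = g"
    using a b g by (intro A.retract_cancel_right) (simp_all add: q_j)
  then show "Comp A (snd a) (s a) (s b) (lift2 a b g) (j a) = Comp A (snd a) (snd b) (s b) (j b) g"
    using a b g A.Comp_assoc[of "snd a" "s a" "snd b" "s b" "j a" "Comp A (s a) (snd a) (snd b) g (q a)" "j b"]
    by (simp add: lift2_def)
qed

text \<open>The endomorphism \<open>pr a\<close> below is the extension of \<open>F\<close> evaluated at the two projectors of \<open>x \<oplus> y\<close>. If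
  \<open>F = B \<circ> \<Delta>\<close>, it is \<open>B(i p, j q)\<close>, whose image is the value \<open>B(x, y)\<close> inside \<open>B(x \<oplus> y, x \<oplus> y)\<close>.\<close>

definition mid where "mid a b h = ext (s a) (s b) (lift1 a b (fst h)) (lift2 a b (snd h))"

abbreviation pr where "pr a \<equiv> mid a a (Id PP a)"

definition B_carrier where "B_carrier a = pr a ` carrier (fobj F (s a))"

definition B :: "('o \<times> 'o, 'm \<times> 'm, 'k, 'v) vfunctor" where
  "B = \<lparr>fobj = (\<lambda>a. (fobj F (s a))\<lparr>carrier := B_carrier a\<rparr>), farr = (\<lambda>a b h. restrict (mid a b h) (B_carrier a))\<rparr>"

lemma Id_PP: "a \<in> Obj PP \<Longrightarrow> Id PP a \<in> Hom PP a a"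
  by (auto simp: A.Id_closed)

lemma mid_closed:
  assumes "a \<in> Obj PP" "b \<in> Obj PP" "h \<in> Hom PP a b"
  shows "mid a b h \<in> module_hom K (fobj F (s a)) (fobj F (s b))"
    and "mid a b h \<in> Hom (Vect K) (fobj F (s a)) (fobj F (s b))"
    and "v \<in> carrier (fobj F (s a)) \<Longrightarrow> mid a b h v \<in> carrier (fobj F (s b))"
proof -
  show *: "mid a b h \<in> Hom (Vect K) (fobj F (s a)) (fobj F (s b))"
    using assms unfolding mid_def by (intro ext_closed lift_closed) auto
  then show "mid a b h \<in> module_hom K (fobj F (s a)) (fobj F (s b))"
    "v \<in> carrier (fobj F (s a)) \<Longrightarrow> mid a b h v \<in> carrier (fobj F (s b))"
    by (auto simp: module_hom_def)
qed

lemma mid_mid: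
  assumes "a \<in> Obj PP" "b \<in> Obj PP" "c \<in> Obj PP" "h \<in> Hom PP a b" "k \<in> Hom PP b c"
    and "v \<in> carrier (fobj F (s a))"
  shows "mid b c k (mid a b h v) = mid a c (Comp PP a b c k h) v"
proof -
  have *: "a \<in> Obj A \<times> Obj A" "b \<in> Obj A \<times> Obj A" "c \<in> Obj A \<times> Obj A"
    "fst h \<in> Hom A (fst a) (fst b)" "snd h \<in> Hom A (snd a) (snd b)"
    "fst k \<in> Hom A (fst b) (fst c)" "snd k \<in> Hom A (snd b) (snd c)" using assms by auto
  show ?thesis
    using * assms(6) unfolding mid_def
    by (subst ext_app) (simp_all add: lift_closed lift_comp)
qed

lemma mid_pr:
  assumes "a \<in> Obj PP" "b \<in> Obj PP" "h \<in> Hom PP a b" "v \<in> carrier (fobj F (s a))"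
  shows "mid a b h (pr a v) = mid a b h v" "pr b (mid a b h v) = mid a b h v"
proof -
  have e: "Comp PP a a b h (Id PP a) = h" "Comp PP a b b (Id PP b) h = h"
    using assms by (auto simp: A.Comp_Id_left A.Comp_Id_right)
  show "mid a b h (pr a v) = mid a b h v"
    using mid_mid[OF assms(1,1,2) Id_PP[OF assms(1)] assms(3,4)] unfolding e .
  show "pr b (mid a b h v) = mid a b h v"
    using mid_mid[OF assms(1,2,2,3) Id_PP[OF assms(2)] assms(4)] unfolding e .
qed

lemma B_carrierD:
  assumes "a \<in> Obj PP" "v \<in> B_carrier a"
  shows "v \<in> carrier (fobj F (s a))" "pr a v = v"
proof -
  obtain w where w: "w \<in> carrier (fobj F (s a))" "v = pr a w" using assms(2) by (auto simp: B_carrier_def)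
  show "v \<in> carrier (fobj F (s a))" using mid_closed(3)[OF assms(1,1) Id_PP[OF assms(1)] w(1)] w(2) by simp
  show "pr a v = v" using mid_pr(1)[OF assms(1,1) Id_PP[OF assms(1)] w(1)] unfolding w(2) .
qed

lemma B_carrier_iff: "a \<in> Obj PP \<Longrightarrow> v \<in> B_carrier a \<longleftrightarrow> v \<in> carrier (fobj F (s a)) \<and> pr a v = v"
  using B_carrierD[of a v] by (metis B_carrier_def imageI)

lemma mid_in_B: "\<lbrakk>a \<in> Obj PP; b \<in> Obj PP; h \<in> Hom PP a b; v \<in> carrier (fobj F (s a))\<rbrakk> \<Longrightarrow> mid a b h v \<in> B_carrier b"
  using mid_pr(2) mid_closed(3) by (simp only: B_carrier_iff)

lemma vs_s: "a \<in> Obj PP \<Longrightarrow> vectorspace K (fobj F (s a))"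
  by (rule vs) simp

lemma linear_pr: "a \<in> Obj PP \<Longrightarrow> linear_map K (fobj F (s a)) (fobj F (s a)) (pr a)"
  using vs_s[of a] mid_closed(1)[OF _ _ Id_PP, of a]
  by (intro linear_map.intro mod_hom.intro mod_hom_axioms.intro) (simp_all add: vectorspace_def)

lemma subspace_B:
  assumes a: "a \<in> Obj PP"
  shows "subspace K (B_carrier a) (fobj F (s a))"
proof -
  interpret l: linear_map K "fobj F (s a)" "fobj F (s a)" "pr a" by (rule linear_pr[OF a])
  show ?thesis using l.imT_is_subspace unfolding l.im_def B_carrier_def .
qed

lemma fobj_B: "fobj B a = (fobj F (s a))\<lparr>carrier := B_carrier a\<rparr>"
  and farr_B: "farr B a b h = restrict (mid a b h) (B_carrier a)"
  by (simp_all add: B_def)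

lemma vs_B: "a \<in> Obj PP \<Longrightarrow> vectorspace K (fobj B a)"
  unfolding fobj_B by (rule vectorspace.subspace_is_vs[OF vs_s subspace_B])

lemma pr_B:
  assumes a: "a \<in> Obj PP"
  shows "restrict (pr a) (carrier (fobj F (s a))) \<in> Hom (Vect K) (fobj F (s a)) (fobj B a)"
proof -
  interpret V: vectorspace K "fobj F (s a)" by (rule vs_s[OF a])
  show ?thesis
    using mid_closed(1)[OF a a Id_PP[OF a]] mid_in_B[OF a a Id_PP[OF a]]
    by (auto simp: fobj_B module_hom_def simp del: prod_category_simps)
qed

lemma incl_B:
  assumes a: "a \<in> Obj PP"
  shows "restrict (\<lambda>v. v) (B_carrier a) \<in> Hom (Vect K) (fobj B a) (fobj F (s a))"
  using vectorspace.subspaceD(3,4,7)[OF vs_s[OF a] subspace_B[OF a]]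
  by (auto simp: fobj_B module_hom_def simp del: prod_category_simps)

lemma fin_dim_B:
  assumes a: "a \<in> Obj PP"
  shows "vectorspace.fin_dim K (fobj B a)"
proof -
  have O: "s a \<in> Obj A" using a by simp
  have "linear_map K (fobj F (s a)) (fobj B a) (restrict (pr a) (carrier (fobj F (s a))))"
    using vs_s[OF a] vs_B[OF a] pr_B[OF a]
    by (intro linear_map.intro mod_hom.intro mod_hom_axioms.intro) (simp_all add: vectorspace_def)
  moreover have "restrict (pr a) (carrier (fobj F (s a))) ` carrier (fobj F (s a)) = carrier (fobj B a)"
    by (simp add: fobj_B B_carrier_def del: prod_category_simps)
  ultimately show ?thesis
    using linear_map.rank_nullity_main(2)[OF _ fin_dim] O by blast
qed

lemma functor_B: "functor_between PP (Vect K) B"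
proof (intro functor_between.intro functor_between_axioms.intro category_prod_category
    A.category_axioms category_Vect F.D.category_axioms)
  fix a assume a: "a \<in> Obj PP"
  show "fobj B a \<in> Obj (Vect K)" using vs_B[OF a] by simp
  show "farr B a a (Id PP a) = Id (Vect K) (fobj B a)"
    using B_carrierD(2)[OF a] by (auto simp: fobj_B farr_B fun_eq_iff simp del: prod_category_simps)
next
  fix a b h assume *: "a \<in> Obj PP" "b \<in> Obj PP" "h \<in> Hom PP a b"
  note D = vectorspace.subspaceD[OF vs_s[OF *(1)] subspace_B[OF *(1)]]
  show "farr B a b h \<in> Hom (Vect K) (fobj B a) (fobj B b)"
    using mid_closed(1)[OF *] mid_in_B[OF *] D B_carrierD(1)[OF *(1)]
    by (auto simp: fobj_B farr_B module_hom_def simp del: prod_category_simps)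
next
  fix a b c h k assume *: "a \<in> Obj PP" "b \<in> Obj PP" "c \<in> Obj PP" "h \<in> Hom PP a b" "k \<in> Hom PP b c"
  show "farr B a c (Comp PP a b c k h)
      = Comp (Vect K) (fobj B a) (fobj B b) (fobj B c) (farr B b c k) (farr B a b h)"
    using mid_mid[OF *] mid_in_B[OF *(1,2,4)] B_carrierD(1)[OF *(1)]
    by (auto simp: fobj_B farr_B compose_def fun_eq_iff simp del: prod_category_simps)
qed

lemma df_B: "df_functor K PP B"
  using functor_B fin_dim_B by (simp add: df_functor_def)

text \<open>The arrows of \<open>B(-, y)\<close> arise from those of \<open>ext\<close> by an additive substitution in the first argument
  and a linear map on the values.\<close>

lemma polynomial_B:
  assumes y: "y \<in> Obj A"
  shows "polynomial_functor K A (fix_second A B y)"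
  unfolding polynomial_functor_def
proof (intro conjI functor_fix_second[OF A.category_axioms A.category_axioms functor_B y])
  obtain d where d: "\<forall>x\<in>Obj A. \<forall>y\<in>Obj A. \<forall>g\<in>Hom A x y.
      degree_less (hom_group A x y) (LinF x y) d (\<lambda>f. ext x y f g)"
    using ext_deg_uniform by blast
  show "\<exists>d. \<forall>x\<in>Obj A. \<forall>x'\<in>Obj A. polynomial_map (hom_group A x x')
      (hom_group (Vect K) (fobj (fix_second A B y) x) (fobj (fix_second A B y) x')) d (farr (fix_second A B y) x x')"
  proof (intro exI[of _ d] ballI)
    fix x x' assume x: "x \<in> Obj A" "x' \<in> Obj A"
    define a where "a = (x, y)"
    define b where "b = (x', y)"
    have ab: "a \<in> Obj PP" "b \<in> Obj PP" using x y by (simp_all add: a_def b_def)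
    have O: "s a \<in> Obj A" "s b \<in> Obj A" using ab by simp_all
    let ?G = "hom_group A x x'" and ?W = "hom_group (Vect K) (fobj B a) (fobj B b)"
    let ?M = "Lin K (fobj B a) (fobj B b)"
    interpret P: poly_maps ?G K ?M
      by (rule poly_maps_Hom[OF x vectorspace_Lin[OF vs_B[OF ab(1)] vs_B[OF ab(2)]]])
    interpret Q: poly_maps ?G K "LinF (s a) (s b)" by (rule poly_maps_Hom[OF x vs_LinF[OF O]])
    interpret S: comm_group "hom_group A (s a) (s b)" by (rule A.hom_comm_group[OF O])
    define L where "L \<phi> = Comp (Vect K) (fobj B a) (fobj F (s b)) (fobj B b)
      (restrict (pr b) (carrier (fobj F (s b))))
      (Comp (Vect K) (fobj B a) (fobj F (s a)) (fobj F (s b)) \<phi> (restrict (\<lambda>v. v) (B_carrier a)))" for \<phi>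
    define c where "c f = farr B a b (f, Id A y)" for f
    let ?e = "\<lambda>f. ext (s a) (s b) (lift1 a b f) (lift2 a b (Id A y))"
    have h: "(f, Id A y) \<in> Hom PP a b" if "f \<in> Hom A x x'" for f
      using that y by (simp add: a_def b_def A.Id_closed)
    have l1: "lift1 a b \<in> hom ?G (hom_group A (s a) (s b))"
      using lift_hom(1)[of a b] ab by (simp add: a_def b_def)
    have l2: "lift2 a b (Id A y) \<in> Hom A (s a) (s b)"
      using lift_closed(2)[of a b "Id A y"] ab y by (simp add: a_def b_def A.Id_closed)
    have cL: "c f = L (?e f)" if f: "f \<in> Hom A x x'" for f
    proof -
      have m: "?e f = mid a b (f, Id A y)" by (simp add: mid_def)
      show ?thesis
        unfolding m L_def c_def farr_B
        using mid_pr(2)[OF ab h[OF f]] B_carrierD(1)[OF ab(1)] mid_closed(3)[OF ab h[OF f]]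
        by (auto simp: compose_def fobj_B fun_eq_iff simp del: prod_category_simps)
    qed
    have "L \<in> module_hom K (LinF (s a) (s b)) ?M"
      unfolding L_def
      by (rule module_hom_comp[OF Lin_precomp Lin_postcomp]) (intro vs_s vs_B ab incl_B pr_B)+
    moreover have "Q.deg d ?e"
      using degree_less_hom[OF S.is_group P.G.is_group l1, of "LinF (s a) (s b)" d
          "\<lambda>f. ext (s a) (s b) f (lift2 a b (Id A y))"] d O l2 by blast
    moreover have e: "?e \<in> Q.maps"
      using ext_closed[OF O _ l2] l1 by (auto simp: Lin_simps hom_into_hom_group simp del: Vect_simps)
    ultimately have "P.deg d (\<lambda>f. L (?e f))"
      by (intro Q.deg_linear[OF P.M.vectorspace_axioms])
    then have "P.deg d c" using cL by (subst degree_less_cong[OF P.G.is_group, where q' = "\<lambda>f. L (?e f)"]) simp_all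
    moreover have c: "c \<in> P.maps"
      using functor_between.farr_closed[OF functor_B ab h] by (simp add: c_def Lin_simps del: Vect_simps)
    ultimately have "P.deg (Suc d) c" by (intro P.deg_Suc) auto
    moreover have "comm_group ?W"
      using preadditive_category.hom_comm_group[OF preadditive_category_Vect] vs_B[OF ab(1)] vs_B[OF ab(2)] by simp
    ultimately have "polynomial_map ?G ?W d c"
      by (subst P.polynomial_map_iff_deg[OF _ _ _ _ c]) (simp_all add: Lin_simps Lin_def hom_group_def del: Vect_simps)
    then show "polynomial_map ?G (hom_group (Vect K) (fobj (fix_second A B y) x) (fobj (fix_second A B y) x')) d
        (farr (fix_second A B y) x x')"
      by (simp add: fix_second_def a_def b_def c_def[abs_def])
  qed
qed

lemma antipolynomial_B:
  assumes x: "x \<in> Obj A"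
  shows "antipolynomial_functor K A (fix_first A B x)"
proof (rule antipolynomial_if_periodic)
  show "field K" by (rule alg.field_axioms)
  show "functor_between A (Vect K) (fix_first A B x)"
    by (rule functor_fix_first[OF A.category_axioms A.category_axioms functor_B x])
  fix y y' assume y: "y \<in> Obj A" "y' \<in> Obj A"
  show "finite_index (hom_group A y y') (I y y')" by (rule I_finite_index[OF y])
  show "\<exists>N. nat_in K N \<noteq> \<zero>\<^bsub>K\<^esub> \<and> (\<forall>f\<in>Hom A y y'. f [^]\<^bsub>hom_group A y y'\<^esub> (N::nat) \<in> I y y')"
    by (rule I_pow[OF y])
  fix g h assume g: "g \<in> Hom A y y'" and h: "h \<in> I y y'"
  define a where "a = (x, y)"
  define b where "b = (x, y')"
  have ab: "a \<in> Obj A \<times> Obj A" "b \<in> Obj A \<times> Obj A" using x y by (simp_all add: a_def b_def)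
  have hH: "h \<in> Hom A y y'" by (rule I_Hom[OF y h])
  have "lift2 a b (hom_add A y y' g h) = hom_add A (s a) (s b) (lift2 a b g) (lift2 a b h)"
    using lift_hom(2)[OF ab] g hH by (simp add: hom_into_hom_group a_def b_def)
  moreover have "lift2 a b h \<in> I (s a) (s b)"
    unfolding lift2_def
    using h
    by (intro I_left[OF s[OF ab(1)] O2[OF ab(2)] s[OF ab(2)] I_right[OF s[OF ab(1)] O2[OF ab(1)] O2[OF ab(2)] q[OF ab(1)]] j[OF ab(2)]])
      (simp add: a_def b_def)
  ultimately have "mid a b (Id A x, hom_add A y y' g h) = mid a b (Id A x, g)"
    using ext_I[of "s a" "s b" "lift1 a b (Id A x)" "lift2 a b g" "lift2 a b h"] ab g
      lift_closed(1)[OF ab, of "Id A x"] lift_closed(2)[OF ab, of g] x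
    by (simp add: mid_def a_def b_def A.Id_closed)
  then show "farr (fix_first A B x) y y' (hom_add A y y' g h) = farr (fix_first A B x) y y' g"
    by (simp add: fix_first_def farr_B a_def b_def)
qed

lemma pr_def': "a \<in> Obj PP \<Longrightarrow> pr a = ext (s a) (s a) (Comp A (s a) (fst a) (s a) (i a) (p a))
    (Comp A (s a) (snd a) (s a) (j a) (q a))"
  by (simp add: mid_def lift1_def lift2_def A.Comp_Id_left)

text \<open>The isomorphism is \<open>ext i j : F x \<rightarrow> F (x \<oplus> x)\<close>, with inverse \<open>ext p q\<close>, since \<open>p i = q j = 1\<close>.\<close>

lemma diagonal_B: "isomorphic_functors A (Vect K) F (comp_functor B diagonal_functor)"
proof -
  note [simp] = A.Comp_closed A.Id_closed
  let ?D = "\<lambda>x. (x, x)"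
  define \<eta> where "\<eta> x = ext x (s (x, x)) (i (x, x)) (j (x, x))" for x
  define \<theta> where "\<theta> x = restrict (ext (s (x, x)) x (p (x, x)) (q (x, x))) (B_carrier (x, x))" for x
  have cl: "(x, x) \<in> Obj A \<times> Obj A" "s (x, x) \<in> Obj A" "i (x, x) \<in> Hom A x (s (x, x))" "j (x, x) \<in> Hom A x (s (x, x))"
    "p (x, x) \<in> Hom A (s (x, x)) x" "q (x, x) \<in> Hom A (s (x, x)) x"
    "Comp A x (s (x, x)) x (p (x, x)) (i (x, x)) = Id A x"
    "Comp A x (s (x, x)) x (q (x, x)) (j (x, x)) = Id A x" if "x \<in> Obj A" for x
    using i[of "(x, x)"] j[of "(x, x)"] p[of "(x, x)"] q[of "(x, x)"] p_i[of "(x, x)"] q_j[of "(x, x)"] that by simp_all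
  have PP: "(x, x) \<in> Obj PP" if "x \<in> Obj A" for x using that by simp
  have \<eta>1: "\<eta> x v \<in> B_carrier (x, x)" if x: "x \<in> Obj A" and v: "v \<in> carrier (fobj F x)" for x v
  proof -
    have in1: "\<eta> x v \<in> carrier (fobj F (s (x, x)))" using ext_in[OF x cl(2,3,4)] x v by (simp add: \<eta>_def)
    moreover have "pr (x, x) (\<eta> x v) = \<eta> x v"
      unfolding pr_def'[OF PP[OF x]] \<eta>_def
      using x v cl[OF x] A.retract_cancel_right[of x "s (x, x)" "s (x, x)" "i (x, x)" "p (x, x)" "i (x, x)"]
         A.retract_cancel_right[of x "s (x, x)" "s (x, x)" "j (x, x)" "q (x, x)" "j (x, x)"]
      by (simp add: ext_app)
    ultimately show ?thesis using B_carrier_iff[OF PP[OF x]] by blast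
  qed
  have \<eta>D: "\<eta> x \<in> Hom (Vect K) (fobj F x) (fobj F (s (x, x)))" if "x \<in> Obj A" for x
    unfolding \<eta>_def using that cl by (intro ext_closed) auto
  have \<theta>D: "ext (s (x, x)) x (p (x, x)) (q (x, x)) \<in> Hom (Vect K) (fobj F (s (x, x))) (fobj F x)" if "x \<in> Obj A" for x
    using that cl by (intro ext_closed) auto
  have \<theta>\<eta>: "\<theta> x (\<eta> x v) = v" if x: "x \<in> Obj A" and v: "v \<in> carrier (fobj F x)" for x v
  proof -
    have "\<theta> x (\<eta> x v) = ext x x (Id A x) (Id A x) v"
      using \<eta>1[OF x v] x v cl[OF x] unfolding \<theta>_def by (simp add: \<eta>_def ext_app)
    then show ?thesis using x v by (simp add: ext_diag arr_Id)
  qed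
  have \<eta>\<theta>: "\<eta> x (\<theta> x v) = v" if x: "x \<in> Obj A" and v: "v \<in> B_carrier (x, x)" for x v
  proof -
    have c: "v \<in> carrier (fobj F (s (x, x)))" using B_carrierD(1)[OF PP[OF x] v] .
    have "\<eta> x (\<theta> x v) = pr (x, x) v"
      unfolding pr_def'[OF PP[OF x]]
      using x v c cl[OF x] by (simp add: \<eta>_def \<theta>_def ext_app)
    then show ?thesis using B_carrierD(2)[OF PP[OF x] v] by simp
  qed
  have nat: "\<eta> y (farr F x y f v) = mid (x, x) (y, y) (f, f) (\<eta> x v)"
    if xy: "x \<in> Obj A" "y \<in> Obj A" and f: "f \<in> Hom A x y" and v: "v \<in> carrier (fobj F x)" for x y f v
  proof -
    have "\<eta> y (farr F x y f v) = \<eta> y (ext x y f f v)" using xy f by (simp add: ext_diag)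
    also have "\<dots> = ext x (s (y, y)) (Comp A x y (s (y, y)) (i (y, y)) f) (Comp A x y (s (y, y)) (j (y, y)) f) v"
      using xy f v cl[OF xy(2)] by (simp add: \<eta>_def ext_app)
    also have "\<dots> = mid (x, x) (y, y) (f, f) (\<eta> x v)"
      using xy f v cl[OF xy(1)] cl[OF xy(2)] lift_closed[OF cl(1)[OF xy(1)] cl(1)[OF xy(2)]]
        lift_inj[OF cl(1)[OF xy(1)] cl(1)[OF xy(2)]]
      by (simp add: mid_def \<eta>_def ext_app)
    finally show ?thesis .
  qed
  have nat': "\<theta> y (mid (x, x) (y, y) (f, f) v) = farr F x y f (\<theta> x v)"
    if xy: "x \<in> Obj A" "y \<in> Obj A" and f: "f \<in> Hom A x y" and v: "v \<in> B_carrier (x, x)" for x y f v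
  proof -
    have c: "v \<in> carrier (fobj F (s (x, x)))" using B_carrierD(1)[OF PP[OF xy(1)] v] .
    have m: "mid (x, x) (y, y) (f, f) v \<in> B_carrier (y, y)" using xy f c by (intro mid_in_B) simp_all
    have "\<theta> x v \<in> carrier (fobj F x)" using ext_in[OF cl(2) _ cl(5,6)] xy v c by (simp add: \<theta>_def)
    then have "\<eta> y (farr F x y f (\<theta> x v)) = mid (x, x) (y, y) (f, f) v"
      using nat[OF xy f] \<eta>\<theta>[OF xy(1) v] by simp
    then have "\<theta> y (mid (x, x) (y, y) (f, f) v) = \<theta> y (\<eta> y (farr F x y f (\<theta> x v)))" by simp
    also have "\<dots> = farr F x y f (\<theta> x v)"
      using \<theta>\<eta>[OF xy(2)] arr_closed[OF xy f \<open>\<theta> x v \<in> carrier (fobj F x)\<close>] by simp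
    finally show ?thesis .
  qed
  have comp: "fobj (comp_functor B diagonal_functor) x = fobj B (x, x)"
    "farr (comp_functor B diagonal_functor) x y f = farr B (x, x) (y, y) (f, f)" for x y f
    by (simp_all add: comp_functor_def diagonal_functor_def)
  show ?thesis
    unfolding isomorphic_functors_def natural_transformation_def comp
  proof (rule exI[of _ \<eta>], rule exI[of _ \<theta>], intro conjI ballI)
    fix x assume x: "x \<in> Obj A"
    note D = vectorspace.subspaceD[OF vs_s[OF PP[OF x]] subspace_B[OF PP[OF x]]]
    show "\<eta> x \<in> Hom (Vect K) (fobj F x) (fobj B (x, x))"
      using \<eta>D[OF x] \<eta>1[OF x] by (auto simp: module_hom_def fobj_B)
    show "\<theta> x \<in> Hom (Vect K) (fobj B (x, x)) (fobj F x)"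
      using \<theta>D[OF x] D by (auto simp: module_hom_def fobj_B \<theta>_def)
    show "Comp (Vect K) (fobj F x) (fobj B (x, x)) (fobj F x) (\<theta> x) (\<eta> x) = Id (Vect K) (fobj F x)"
      using \<theta>\<eta>[OF x] by (auto simp: compose_def fun_eq_iff)
    show "Comp (Vect K) (fobj B (x, x)) (fobj F x) (fobj B (x, x)) (\<eta> x) (\<theta> x) = Id (Vect K) (fobj B (x, x))"
      using \<eta>\<theta>[OF x] by (auto simp: compose_def fun_eq_iff fobj_B)
  next
    fix x y f assume xy: "x \<in> Obj A" "y \<in> Obj A" and f: "f \<in> Hom A x y"
    show "Comp (Vect K) (fobj F x) (fobj F y) (fobj B (y, y)) (\<eta> y) (farr F x y f)
        = Comp (Vect K) (fobj F x) (fobj B (x, x)) (fobj B (y, y)) (farr B (x, x) (y, y) (f, f)) (\<eta> x)"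
      using nat[OF xy f] \<eta>1[OF xy(1)] by (auto simp: compose_def fun_eq_iff farr_B)
    show "Comp (Vect K) (fobj B (x, x)) (fobj B (y, y)) (fobj F y) (\<theta> y) (farr B (x, x) (y, y) (f, f))
        = Comp (Vect K) (fobj B (x, x)) (fobj F x) (fobj F y) (farr F x y f) (\<theta> x)"
      using nat'[OF xy f] by (auto simp: compose_def fun_eq_iff farr_B fobj_B)
  qed
qed

lemma decomposition_B: "bifunctor_decomposition K A F B"
  unfolding bifunctor_decomposition_def
  using df_B polynomial_B antipolynomial_B diagonal_B by blast

end

section \<open>Periodicity of antipolynomial functors\<close>

text \<open>The additive map \<open>k \<otimes> x \<mapsto> k \<phi>(x)\<close> on the tensor product is zero.\<close>

lemma trivial_tensor_no_characters:
  assumes K: "field K" and H: "comm_group H" and triv: "trivial_group (tensor_group (add_monoid K) H)"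
    and \<phi>: "\<phi> \<in> hom H (add_monoid K)" and x: "x \<in> carrier H"
  shows "\<phi> x = \<zero>\<^bsub>K\<^esub>"
proof -
  interpret K: field K by fact
  interpret H: comm_group H by fact
  let ?S = "carrier (add_monoid K) \<times> carrier H"
  let ?M = "free_Abelian_group ?S"
  interpret M: comm_group ?M by (rule abelian_free_Abelian_group)
  have \<phi>c: "\<phi> y \<in> carrier K" if "y \<in> carrier H" for y using \<phi> that by (auto simp: hom_def)
  have \<phi>m: "\<phi> (y \<otimes>\<^bsub>H\<^esub> w) = \<phi> y \<oplus>\<^bsub>K\<^esub> \<phi> w" if "y \<in> carrier H" "w \<in> carrier H" for y w
    using \<phi> that by (auto simp: hom_def)
  have f: "(\<lambda>(k, y). k \<otimes>\<^bsub>K\<^esub> \<phi> y) ` ?S \<subseteq> carrier (add_monoid K)" using \<phi>c by auto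
  obtain h where h: "h \<in> hom ?M (add_monoid K)" and hf: "\<And>t. t \<in> ?S \<Longrightarrow> h (frag_of t) = (\<lambda>(k, y). k \<otimes>\<^bsub>K\<^esub> \<phi> y) t"
    using comm_group.free_Abelian_group_universal[OF K.a_comm_group f] by metis
  interpret h: group_hom ?M "add_monoid K" h
    by (intro group_hom.intro group_hom_axioms.intro M.is_group K.a_group h)
  have hd: "h (u - v) = h u \<ominus>\<^bsub>K\<^esub> h v" if "u \<in> carrier ?M" "v \<in> carrier ?M" for u v
  proof -
    have "u - v \<in> carrier ?M" using that by (auto dest!: subsetD[OF keys_diff])
    then have "h (u - v) \<in> carrier K" using h.hom_closed by fastforce
    moreover have "h u = h (u - v) \<oplus>\<^bsub>K\<^esub> h v"
      using h.hom_mult[of "u - v" v] that \<open>u - v \<in> carrier ?M\<close> by simp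
    moreover have "h v \<in> carrier K" using h.hom_closed[OF that(2)] by simp
    ultimately show ?thesis by (simp add: K.minus_eq K.a_assoc K.r_neg)
  qed
  have ha: "h (u + v) = h u \<oplus>\<^bsub>K\<^esub> h v" if "u \<in> carrier ?M" "v \<in> carrier ?M" for u v
    using h.hom_mult[OF that] by simp
  have fr: "frag_of (a, b) \<in> carrier ?M" and hf': "h (frag_of (a, b)) = a \<otimes>\<^bsub>K\<^esub> \<phi> b"
    if "a \<in> carrier K" "b \<in> carrier H" for a b using that hf[of "(a, b)"] by simp_all
  have ac: "u + v \<in> carrier ?M" if "u \<in> carrier ?M" "v \<in> carrier ?M" for u v
    using M.m_closed[OF that] by simp
  have "tensor_relations (add_monoid K) H \<subseteq> kernel ?M (add_monoid K) h"
  proof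
    fix t assume "t \<in> tensor_relations (add_monoid K) H"
    then consider (l) a a' b where "a \<in> carrier K" "a' \<in> carrier K" "b \<in> carrier H"
        "t = frag_of (a \<oplus>\<^bsub>K\<^esub> a', b) - (frag_of (a, b) + frag_of (a', b))"
      | (r) a b b' where "a \<in> carrier K" "b \<in> carrier H" "b' \<in> carrier H"
        "t = frag_of (a, b \<otimes>\<^bsub>H\<^esub> b') - (frag_of (a, b) + frag_of (a, b'))"
      unfolding tensor_relations_def by auto
    then show "t \<in> kernel ?M (add_monoid K) h"
    proof cases
      case l
      have t: "t \<in> carrier ?M" using l by (auto dest!: subsetD[OF keys_diff] subsetD[OF keys_add] split: if_splits)
      have "h t = \<zero>\<^bsub>K\<^esub>"
        unfolding l(4) using l(1-3)
        by (simp only: hd ha ac fr hf' K.a_closed) (simp add: \<phi>c K.l_distr K.minus_eq K.r_neg)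
      with t show ?thesis by (simp add: kernel_def)
    next
      case r
      have t: "t \<in> carrier ?M" using r by (auto dest!: subsetD[OF keys_diff] subsetD[OF keys_add] split: if_splits)
      have "h t = \<zero>\<^bsub>K\<^esub>"
        unfolding r(4) using r(1-3)
        by (simp only: hd ha ac fr hf' H.m_closed) (simp add: \<phi>c \<phi>m K.r_distr K.minus_eq K.r_neg)
      with t show ?thesis by (simp add: kernel_def)
    qed
  qed
  then have "generate ?M (tensor_relations (add_monoid K) H) \<subseteq> kernel ?M (add_monoid K) h"
    by (rule M.generate_subgroup_incl[OF _ h.subgroup_kernel])
  moreover have "carrier ?M \<subseteq> generate ?M (tensor_relations (add_monoid K) H)"
    using triv trivial_tensor_group_iff[OF K.a_group H.is_group] by simp
  moreover have "frag_of (\<one>\<^bsub>K\<^esub>, x) \<in> carrier ?M" using x by simp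
  ultimately have "frag_of (\<one>\<^bsub>K\<^esub>, x) \<in> kernel ?M (add_monoid K) h" by blast
  then have "h (frag_of (\<one>\<^bsub>K\<^esub>, x)) = \<zero>\<^bsub>K\<^esub>" by (simp add: kernel_def)
  then show ?thesis using hf[of "(\<one>\<^bsub>K\<^esub>, x)"] x \<phi>c[OF x] by simp
qed

text \<open>Here \<open>p\<close> is the characteristic of \<open>K\<close>. Let \<open>M\<close> be a maximal proper subgroup containing the \<open>p\<close>-th powers
  and \<open>g\<close> an element outside. Then every element is of the form \<open>m g^k\<close>, and \<open>k\<close> is determined modulo
  \<open>p\<close>, so that mapping it to the image of \<open>k\<close> in \<open>K\<close> is a character.\<close>

lemma (in comm_group) ex_character:
  assumes K: "field K" and fin: "finite (carrier G)"
    and p: "0 < p" "nat_in K p = \<zero>\<^bsub>K\<^esub>" "\<And>n. \<lbrakk>0 < n; n < p\<rbrakk> \<Longrightarrow> nat_in K n \<noteq> \<zero>\<^bsub>K\<^esub>"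
    and nsurj: "(\<lambda>x. x [^] (p :: nat)) ` carrier G \<noteq> carrier G"
  shows "\<exists>\<phi>\<in>hom G (add_monoid K). \<exists>x\<in>carrier G. \<phi> x \<noteq> \<zero>\<^bsub>K\<^esub>"
proof -
  interpret K: field K by fact
  define P where "P = (\<lambda>x. x [^] p) ` carrier G"
  have "subgroup P G"
  proof (rule subgroupI)
    show "P \<noteq> {}" unfolding P_def using one_closed by blast
  next
    fix a assume "a \<in> P"
    then obtain x where x: "x \<in> carrier G" "a = x [^] p" by (auto simp: P_def)
    then have "inv a = inv x [^] p" by (simp add: nat_pow_inv)
    then show "inv a \<in> P" using x(1) by (auto simp: P_def)
  next
    fix a b assume "a \<in> P" "b \<in> P"
    then obtain x y where x: "x \<in> carrier G" "a = x [^] p" "y \<in> carrier G" "b = y [^] p" by (auto simp: P_def)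
    then have "a \<otimes> b = (x \<otimes> y) [^] p" by (simp add: nat_pow_distrib)
    then show "a \<otimes> b \<in> P" using x by (auto simp: P_def)
  qed (auto simp: P_def)
  define \<M> where "\<M> = {M. subgroup M G \<and> P \<subseteq> M \<and> M \<noteq> carrier G}"
  have "\<M> \<subseteq> Pow (carrier G)" by (auto simp: \<M>_def dest: subgroup.subset)
  then have "finite \<M>" by (rule finite_subset) (simp add: fin)
  moreover have "P \<in> \<M>" using \<open>subgroup P G\<close> nsurj by (simp add: \<M>_def P_def)
  ultimately obtain M where M\<M>: "M \<in> \<M>" and max: "\<And>M'. \<lbrakk>M' \<in> \<M>; M \<subseteq> M'\<rbrakk> \<Longrightarrow> M = M'"
    using finite_has_maximal[of \<M>] by blast
  interpret M: subgroup M G using M\<M> by (simp add: \<M>_def)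
  have PM: "P \<subseteq> M" using M\<M> by (simp add: \<M>_def)
  obtain g where g: "g \<in> carrier G" "g \<notin> M" using M\<M> M.subset by (auto simp: \<M>_def)
  define D where "D = {x. \<exists>m\<in>M. \<exists>k::nat. x = m \<otimes> g [^] k}"
  have gord: "g [^] order G = \<one>" by (rule pow_order_eq_1[OF g(1)])
  have opos: "0 < order G" using fin by (simp add: order_gt_0_iff_finite)
  have "subgroup D G"
  proof (rule subgroupI)
    show "D \<subseteq> carrier G" using g(1) by (auto simp: D_def)
    show "D \<noteq> {}" unfolding D_def using M.one_closed by blast
  next
    fix x assume "x \<in> D"
    then obtain m k where x: "m \<in> M" "x = m \<otimes> g [^] (k::nat)" by (auto simp: D_def)
    have "g [^] k \<otimes> g [^] ((order G - 1) * k) = g [^] (order G * k)"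
      using g(1) opos by (cases "order G") (simp_all add: nat_pow_mult algebra_simps)
    also have "\<dots> = \<one>" using g(1) gord nat_pow_pow[OF g(1), of "order G" k] by simp
    finally have "inv (g [^] k) = g [^] ((order G - 1) * k)" using g(1) by (intro inv_equality) (simp_all add: m_comm)
    then have "inv x = inv m \<otimes> g [^] ((order G - 1) * k)" using x g(1) by (simp add: inv_mult)
    then show "inv x \<in> D" using x(1) by (auto simp: D_def)
  next
    fix x y assume "x \<in> D" "y \<in> D"
    then obtain m k m' k' where x: "m \<in> M" "x = m \<otimes> g [^] (k::nat)" "m' \<in> M" "y = m' \<otimes> g [^] (k'::nat)"
      by (auto simp: D_def)
    have "x \<otimes> y = (m \<otimes> m') \<otimes> g [^] (k + k')"
      using x g(1) M.mem_carrier by (simp add: m_ac flip: nat_pow_mult)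
    then show "x \<otimes> y \<in> D" using x by (auto simp: D_def)
  qed
  moreover have "M \<subseteq> D"
  proof
    fix m assume "m \<in> M"
    then show "m \<in> D" unfolding D_def by (intro CollectI bexI[of _ m] exI[of _ "0::nat"]) simp_all
  qed
  moreover have "g \<in> D"
    unfolding D_def using g(1) by (intro CollectI bexI[of _ \<one>] exI[of _ "1::nat"]) simp_all
  ultimately have D: "D = carrier G" using max[of D] PM g(2) by (auto simp: \<M>_def)
  have gp: "g [^] p \<in> M" using PM g(1) by (auto simp: P_def)
  define n0 where "n0 = (LEAST n. 0 < n \<and> g [^] (n::nat) \<in> M)"
  have n0: "0 < n0" "g [^] n0 \<in> M"
    using LeastI[of "\<lambda>n. 0 < n \<and> g [^] n \<in> M" p] p(1) gp by (simp_all add: n0_def)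
  have n0_min: "\<not> (0 < n \<and> g [^] n \<in> M)" if "n < n0" for n
    using not_less_Least[of n "\<lambda>n. 0 < n \<and> g [^] n \<in> M"] that by (simp add: n0_def)
  have cancel: "y \<in> M" if "x \<otimes> y \<in> M" "x \<in> M" "y \<in> carrier G" for x y
  proof -
    have "y = inv x \<otimes> (x \<otimes> y)" using that by (simp flip: m_assoc)
    then show ?thesis using M.m_closed[OF M.m_inv_closed[OF that(2)] that(1)] by simp
  qed
  have n0_dvd: "n0 dvd n" if n: "g [^] (n::nat) \<in> M" for n
  proof -
    have "(g [^] n0) [^] (k :: nat) \<in> M" for k using n0(2) by (induction k) simp_all
    then have "g [^] (n0 * (n div n0)) \<in> M" using nat_pow_pow[OF g(1), of n0 "n div n0"] by metis
    moreover have "g [^] (n0 * (n div n0)) \<otimes> g [^] (n mod n0) = g [^] n"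
      using g(1) by (simp add: nat_pow_mult)
    ultimately have "g [^] (n mod n0) \<in> M" using cancel[of "g [^] (n0 * (n div n0))" "g [^] (n mod n0)"] n g(1) by simp
    then have "n mod n0 = 0" using n0_min[of "n mod n0"] n0(1) by simp
    then show ?thesis by blast
  qed
  have nat0: "nat_in K n0 = \<zero>\<^bsub>K\<^esub>"
  proof -
    obtain r where r: "p = n0 * r" using n0_dvd[OF gp] by blast
    have "n0 \<noteq> 1" using n0(2) g by auto
    then have "0 < r" "r < p" using r p(1) n0(1) by auto
    then have "nat_in K r \<noteq> \<zero>\<^bsub>K\<^esub>" using p(3) by blast
    then show ?thesis using p(2) K.nat_in_mult[of n0 r] K.integral[of "nat_in K n0" "nat_in K r"] by (simp add: r)
  qed
  have natM: "nat_in K n = \<zero>\<^bsub>K\<^esub>" if "g [^] (n::nat) \<in> M" for n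
    using n0_dvd[OF that] nat0 by (auto simp: K.nat_in_mult elim!: dvdE)
  have wd: "nat_in K k = nat_in K k'"
    if "m \<in> M" "m' \<in> M" "m \<otimes> g [^] k = m' \<otimes> g [^] k'" "k' \<le> k" for m m' and k k' :: nat
  proof -
    have "m \<otimes> g [^] (k - k') \<otimes> g [^] k' = m' \<otimes> g [^] k'"
      using that g(1) by (simp add: m_assoc nat_pow_mult)
    then have "m \<otimes> g [^] (k - k') = m'" using that g(1) by simp
    then have "g [^] (k - k') \<in> M" using cancel[of m "g [^] (k - k')"] that(1,2) g(1) by simp
    then have "nat_in K (k - k') = \<zero>\<^bsub>K\<^esub>" by (rule natM)
    then show ?thesis using K.nat_in_add[of "k - k'" k'] that(4) by simp
  qed
  define \<phi> where "\<phi> x = nat_in K (SOME k. \<exists>m\<in>M. x = m \<otimes> g [^] (k::nat))" for x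
  have \<phi>: "\<phi> (m \<otimes> g [^] k) = nat_in K k" if m: "m \<in> M" for m and k :: nat
  proof -
    define k' where "k' = (SOME k'. \<exists>m'\<in>M. m \<otimes> g [^] k = m' \<otimes> g [^] (k'::nat))"
    have "\<exists>m'\<in>M. m \<otimes> g [^] k = m' \<otimes> g [^] k'" unfolding k'_def by (rule someI_ex) (use m in blast)
    then obtain m' where m': "m' \<in> M" "m \<otimes> g [^] k = m' \<otimes> g [^] k'" by blast
    have "nat_in K k = nat_in K k'"
      using wd[OF m m'] wd[OF m'(1) m m'(2)[symmetric]] by (cases "k' \<le> k") auto
    then show ?thesis by (simp add: \<phi>_def k'_def)
  qed
  have "\<phi> \<in> hom G (add_monoid K)"
  proof (rule homI)
    fix x assume "x \<in> carrier G"
    show "\<phi> x \<in> carrier (add_monoid K)" by (simp add: \<phi>_def)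
  next
    fix x y assume "x \<in> carrier G" "y \<in> carrier G"
    then have "x \<in> D" "y \<in> D" by (simp_all only: D)
    then obtain m k m' k' where x: "m \<in> M" "x = m \<otimes> g [^] (k::nat)" "m' \<in> M" "y = m' \<otimes> g [^] (k'::nat)"
      by (auto simp: D_def)
    have "x \<otimes> y = (m \<otimes> m') \<otimes> g [^] (k + k')"
      using x g(1) M.mem_carrier by (simp add: m_ac flip: nat_pow_mult)
    then show "\<phi> (x \<otimes> y) = \<phi> x \<otimes>\<^bsub>add_monoid K\<^esub> \<phi> y"
      using x \<phi> by (simp add: K.nat_in_add)
  qed
  moreover have "\<phi> g \<noteq> \<zero>\<^bsub>K\<^esub>" using \<phi>[OF M.one_closed, of 1] g(1) by simp
  ultimately show ?thesis using g(1) by blast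
qed

text \<open>The exponent will do. If it vanishes in \<open>K\<close>, it is divisible by the characteristic \<open>p\<close>. By the
  absence of characters the \<open>p\<close>-th power map is surjective, hence injective as the group is finite,
  so the exponent divided by \<open>p\<close> kills the group as well.\<close>

lemma trivial_tensor_exponent:
  assumes K: "field K" and H: "comm_group H" and fin: "finite (carrier H)"
    and triv: "trivial_group (tensor_group (add_monoid K) H)"
  shows "\<exists>N. nat_in K N \<noteq> \<zero>\<^bsub>K\<^esub> \<and> (\<forall>x\<in>carrier H. x [^]\<^bsub>H\<^esub> (N :: nat) = \<one>\<^bsub>H\<^esub>)"
proof -
  interpret K: field K by fact
  interpret H: comm_group H by fact
  define N where "N = (LEAST n. 0 < n \<and> (\<forall>x\<in>carrier H. x [^]\<^bsub>H\<^esub> (n::nat) = \<one>\<^bsub>H\<^esub>))"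
  have "0 < order H \<and> (\<forall>x\<in>carrier H. x [^]\<^bsub>H\<^esub> order H = \<one>\<^bsub>H\<^esub>)"
    using fin by (simp add: H.order_gt_0_iff_finite H.pow_order_eq_1)
  then have N: "0 < N" "\<And>x. x \<in> carrier H \<Longrightarrow> x [^]\<^bsub>H\<^esub> N = \<one>\<^bsub>H\<^esub>"
    unfolding N_def using LeastI[of "\<lambda>n. 0 < n \<and> (\<forall>x\<in>carrier H. x [^]\<^bsub>H\<^esub> (n::nat) = \<one>\<^bsub>H\<^esub>)" "order H"] by simp_all
  have N_min: "\<not> (0 < n \<and> (\<forall>x\<in>carrier H. x [^]\<^bsub>H\<^esub> n = \<one>\<^bsub>H\<^esub>))" if "n < N" for n
    using not_less_Least[of n "\<lambda>n. 0 < n \<and> (\<forall>x\<in>carrier H. x [^]\<^bsub>H\<^esub> (n::nat) = \<one>\<^bsub>H\<^esub>)"] that by (simp only: N_def not_False_eq_True)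
  have "nat_in K N \<noteq> \<zero>\<^bsub>K\<^esub>"
  proof
    assume N0: "nat_in K N = \<zero>\<^bsub>K\<^esub>"
    define p where "p = (LEAST n. 0 < n \<and> nat_in K n = \<zero>\<^bsub>K\<^esub>)"
    have p: "0 < p" "nat_in K p = \<zero>\<^bsub>K\<^esub>"
      using LeastI[of "\<lambda>n. 0 < n \<and> nat_in K n = \<zero>\<^bsub>K\<^esub>" N] N(1) N0 by (simp_all add: p_def)
    have p_min: "nat_in K n \<noteq> \<zero>\<^bsub>K\<^esub>" if "0 < n" "n < p" for n
      using not_less_Least[of n "\<lambda>n. 0 < n \<and> nat_in K n = \<zero>\<^bsub>K\<^esub>"] that by (simp add: p_def)
    have "nat_in K N = nat_in K p \<otimes>\<^bsub>K\<^esub> nat_in K (N div p) \<oplus>\<^bsub>K\<^esub> nat_in K (N mod p)"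
      using K.nat_in_add[of "p * (N div p)" "N mod p"] K.nat_in_mult[of p "N div p"] by simp
    then have "nat_in K (N mod p) = \<zero>\<^bsub>K\<^esub>" using N0 p(2) by simp
    then have "N mod p = 0" using p_min[of "N mod p"] p(1) by auto
    then obtain m where m: "N = p * m" by blast
    have "p \<noteq> 1" using p(2) by auto
    then have m1: "0 < m" "m < N" using m N(1) p(1) by auto
    have "(\<lambda>x. x [^]\<^bsub>H\<^esub> p) ` carrier H = carrier H"
    proof (rule ccontr)
      assume "(\<lambda>x. x [^]\<^bsub>H\<^esub> p) ` carrier H \<noteq> carrier H"
      then show False
        using H.ex_character[OF K fin p p_min] trivial_tensor_no_characters[OF K H triv] by blast
    qed
    then have inj: "inj_on (\<lambda>x. x [^]\<^bsub>H\<^esub> p) (carrier H)" using fin by (intro eq_card_imp_inj_on) simp_all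
    have "x [^]\<^bsub>H\<^esub> m = \<one>\<^bsub>H\<^esub>" if x: "x \<in> carrier H" for x
    proof (rule inj_onD[OF inj])
      show "(x [^]\<^bsub>H\<^esub> m) [^]\<^bsub>H\<^esub> p = \<one>\<^bsub>H\<^esub> [^]\<^bsub>H\<^esub> p"
        using N(2)[OF x] x by (simp add: H.nat_pow_pow m mult.commute)
    qed (use x in simp_all)
    then show False using N_min[OF m1(2)] m1(1) by blast
  qed
  then show ?thesis using N(2) by blast
qed

text \<open>The periods are the kernel of the additive functor through which \<open>E\<close> factors.\<close>

lemma antipolynomial_periodic:
  fixes K :: "'k ring" and E :: "('o, 'm, 'k, 'v) vfunctor"
  assumes K: "field K" and A: "additive_category A" and E: "antipolynomial_functor K A E" and O: "y \<in> Obj A" "y' \<in> Obj A"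
  obtains H N where "subgroup H (hom_group A y y')" "nat_in K N \<noteq> \<zero>\<^bsub>K\<^esub>"
    "\<And>g. g \<in> Hom A y y' \<Longrightarrow> g [^]\<^bsub>hom_group A y y'\<^esub> (N :: nat) \<in> H"
    "\<And>g h. \<lbrakk>g \<in> Hom A y y'; h \<in> H\<rbrakk> \<Longrightarrow> farr E y y' (hom_add A y y' g h) = farr E y y' g"
proof -
  interpret A: additive_category A by (rule A)
  obtain C :: "('o, nat) preadditive_data" and \<pi> and G :: "('o, nat, 'k, 'v) vfunctor"
    where C: "K_trivial K C" and \<pi>: "additive_functor A C \<pi>" and G: "functor_between C (Vect K) G"
      and iso: "isomorphic_functors A (Vect K) E (comp_functor G \<pi>)"
    using E unfolding antipolynomial_functor_def by (elim conjE exE) (rule that)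
  have EF: "functor_between A (Vect K) E" using E by (simp add: antipolynomial_functor_def)
  interpret E: functor_between A "Vect K" E by (rule EF)
  interpret \<pi>: additive_functor A C \<pi> by (rule \<pi>)
  interpret G: functor_between C "Vect K" G by (rule G)
  interpret C: additive_category C using C by (simp add: K_trivial_def)
  let ?G = "hom_group A y y'" and ?C = "hom_group C (fobj \<pi> y) (fobj \<pi> y')"
  let ?V = "fobj G (fobj \<pi> y)" and ?V' = "fobj G (fobj \<pi> y')"
  have PO: "fobj \<pi> y \<in> Obj C" "fobj \<pi> y' \<in> Obj C" using O by (simp_all add: \<pi>.fobj_closed)
  interpret AG: comm_group ?G by (rule A.hom_comm_group[OF O])
  interpret CG: comm_group ?C by (rule C.hom_comm_group[OF PO])
  interpret h: group_hom ?G ?C "farr \<pi> y y'"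
    by (intro group_hom.intro group_hom_axioms.intro AG.is_group CG.is_group \<pi>.farr_hom[OF O])
  obtain \<alpha> \<beta> where \<alpha>: "natural_transformation A (Vect K) E (comp_functor G \<pi>) \<alpha>"
    and \<beta>: "natural_transformation A (Vect K) (comp_functor G \<pi>) E \<beta>"
    and inv: "\<forall>x\<in>Obj A. Comp (Vect K) (fobj E x) (fobj (comp_functor G \<pi>) x) (fobj E x) (\<beta> x) (\<alpha> x) = Id (Vect K) (fobj E x)"
    using iso unfolding isomorphic_functors_def by blast
  have c: "\<alpha> y \<in> Hom (Vect K) (fobj E y) ?V" "\<alpha> y' \<in> Hom (Vect K) (fobj E y') ?V'"
    "\<beta> y' \<in> Hom (Vect K) ?V' (fobj E y')"
    "Comp (Vect K) (fobj E y') ?V' (fobj E y') (\<beta> y') (\<alpha> y') = Id (Vect K) (fobj E y')"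
    using \<alpha> \<beta> inv O by (simp_all add: natural_transformation_def comp_functor_def del: Vect_simps)
  note VO = E.fobj_closed[OF O(1)] E.fobj_closed[OF O(2)] G.fobj_closed[OF PO(1)] G.fobj_closed[OF PO(2)]
  have eq: "farr E y y' g = Comp (Vect K) (fobj E y) ?V' (fobj E y') (\<beta> y')
      (Comp (Vect K) (fobj E y) ?V ?V' (farr G (fobj \<pi> y) (fobj \<pi> y') (farr \<pi> y y' g)) (\<alpha> y))"
    if g: "g \<in> Hom A y y'" for g
  proof -
    have "Comp (Vect K) (fobj E y) (fobj E y') ?V' (\<alpha> y') (farr E y y' g)
        = Comp (Vect K) (fobj E y) ?V ?V' (farr G (fobj \<pi> y) (fobj \<pi> y') (farr \<pi> y y' g)) (\<alpha> y)"
      using \<alpha> O g by (simp add: natural_transformation_def comp_functor_def del: Vect_simps)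
    moreover have "farr E y y' g = Comp (Vect K) (fobj E y) ?V' (fobj E y') (\<beta> y')
      (Comp (Vect K) (fobj E y) (fobj E y') ?V' (\<alpha> y') (farr E y y' g))"
      using E.D.Comp_assoc[OF VO(1,2,4,2) E.farr_closed[OF O g] c(2,3)] c(4)
        E.D.Comp_Id_left[OF VO(1,2) E.farr_closed[OF O g]] by (simp del: Vect_simps)
    ultimately show ?thesis by (simp del: Vect_simps)
  qed
  obtain N :: nat where N: "nat_in K N \<noteq> \<zero>\<^bsub>K\<^esub>" "\<And>x. x \<in> carrier ?C \<Longrightarrow> x [^]\<^bsub>?C\<^esub> N = \<one>\<^bsub>?C\<^esub>"
    using trivial_tensor_exponent[OF K C.hom_comm_group[OF PO]] C PO by (auto simp: K_trivial_def)
  show ?thesis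
  proof (rule that[of "kernel ?G ?C (farr \<pi> y y')" N])
    show "subgroup (kernel ?G ?C (farr \<pi> y y')) ?G" by (rule h.subgroup_kernel)
    show "nat_in K N \<noteq> \<zero>\<^bsub>K\<^esub>" by (rule N(1))
    fix g assume g: "g \<in> Hom A y y'"
    show "g [^]\<^bsub>?G\<^esub> N \<in> kernel ?G ?C (farr \<pi> y y')"
      using h.hom_nat_pow[of g N] N(2)[OF h.hom_closed] AG.nat_pow_closed[of g N] g by (simp add: kernel_def)
    fix h assume h: "h \<in> kernel ?G ?C (farr \<pi> y y')"
    then have hH: "h \<in> Hom A y y'" "farr \<pi> y y' h = hom_zero C (fobj \<pi> y) (fobj \<pi> y')" by (simp_all add: kernel_def)
    have "farr \<pi> y y' (hom_add A y y' g h) = farr \<pi> y y' g"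
      using h.hom_mult[of g h] h.hom_closed[of g] g hH PO by simp
    then show "farr E y y' (hom_add A y y' g h) = farr E y y' g"
      using eq[OF g] eq[of "hom_add A y y' g h"] g hH O by simp
  qed
qed

section \<open>Uniqueness\<close>

lemma module_hom_closed: "\<lbrakk>\<phi> \<in> Hom (Vect K) V W; v \<in> carrier V\<rbrakk> \<Longrightarrow> \<phi> v \<in> carrier W"
  by (auto simp: module_hom_def)

context split_functor
begin

context
  fixes B' :: "('o \<times> 'o, 'm \<times> 'm, 'k, 'v) vfunctor"
  assumes B': "bifunctor_decomposition K A F B'"
begin

lemma functor_B': "functor_between PP (Vect K) B'"
  using B' by (simp add: bifunctor_decomposition_def df_functor_def)

interpretation B': vect_functor PP K B'
  by (intro vect_functor.intro vect_functor_axioms.intro category_prod_category A.category_axioms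
      alg.field_axioms functor_B')

lemma arr_pair_comp:
  assumes "a \<in> Obj A \<times> Obj A" "b \<in> Obj A \<times> Obj A" "c \<in> Obj A \<times> Obj A"
    "f \<in> Hom A (fst a) (fst b)" "g \<in> Hom A (snd a) (snd b)" "f' \<in> Hom A (fst b) (fst c)" "g' \<in> Hom A (snd b) (snd c)"
    "v \<in> carrier (fobj B' a)"
  shows "farr B' b c (f', g') (farr B' a b (f, g) v)
    = farr B' a c (Comp A (fst a) (fst b) (fst c) f' f, Comp A (snd a) (snd b) (snd c) g' g) v"
  using assms B'.arr_comp[of a b c "(f, g)" "(f', g')" v] by simp

text \<open>Factor \<open>(f, g)\<close> as \<open>(1, g) (f, 1)\<close> for the degree, and as \<open>(f, 1) (1, g)\<close> for the periods.\<close>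

lemma poly_periodic_B':
  assumes x: "x \<in> Obj A" and y: "y \<in> Obj A"
  shows "poly_periodic K (hom_group A x y) (Lin K (fobj B' (x, x)) (fobj B' (y, y)))
    (\<lambda>f g. farr B' (x, x) (y, y) (f, g))"
proof -
  let ?G = "hom_group A x y" and ?X = "fobj B' (x, x)" and ?Y = "fobj B' (y, y)" and ?Z = "fobj B' (y, x)"
  have vsB: "vectorspace K (fobj B' (w, w'))" if "w \<in> Obj A" "w' \<in> Obj A" for w w'
    using that by (intro B'.vs) simp
  interpret G: comm_group ?G by (rule A.hom_comm_group[OF x y])
  have Bcl: "farr B' (w, w') (u, u') (f, g) \<in> Hom (Vect K) (fobj B' (w, w')) (fobj B' (u, u'))"
    if "w \<in> Obj A" "w' \<in> Obj A" "u \<in> Obj A" "u' \<in> Obj A" "f \<in> Hom A w u" "g \<in> Hom A w' u'" for w w' u u' f g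
    using that by (intro B'.F.farr_closed) simp_all
  have Bcomp: "farr B' (w, w') (t, t') (Comp A w u t f' f, Comp A w' u' t' g' g)
      = Comp (Vect K) (fobj B' (w, w')) (fobj B' (u, u')) (fobj B' (t, t'))
        (farr B' (u, u') (t, t') (f', g')) (farr B' (w, w') (u, u') (f, g))"
    if "w \<in> Obj A" "w' \<in> Obj A" "u \<in> Obj A" "u' \<in> Obj A" "t \<in> Obj A" "t' \<in> Obj A"
      "f \<in> Hom A w u" "g \<in> Hom A w' u'" "f' \<in> Hom A u t" "g' \<in> Hom A u' t'" for w w' u u' t t' f g f' g'
    using that B'.F.farr_Comp[of "(w, w')" "(u, u')" "(t, t')" "(f, g)" "(f', g')"] by simp
  have polyd: "\<exists>d. degree_less ?G (Lin K ?X ?Y) d (\<lambda>f. farr B' (x, x) (y, y) (f, g))" if g: "g \<in> Hom A x y" for g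
  proof -
    interpret P: poly_maps ?G K "Lin K ?X ?Z"
      by (rule poly_maps_Hom[OF x y vectorspace_Lin[OF vsB[OF x x] vsB[OF y x]]])
    have "polynomial_functor K A (fix_second A B' x)" using B' x by (simp add: bifunctor_decomposition_def)
    then obtain d where "\<forall>w\<in>Obj A. \<forall>w'\<in>Obj A. polynomial_map (hom_group A w w')
      (hom_group (Vect K) (fobj (fix_second A B' x) w) (fobj (fix_second A B' x) w')) d (farr (fix_second A B' x) w w')"
      unfolding polynomial_functor_def by (elim conjE exE) (rule that)
    from bspec[OF bspec[OF this x] y]
    have d: "polynomial_map ?G (hom_group (Vect K) ?X ?Z) d (\<lambda>f. farr B' (x, x) (y, x) (f, Id A x))"
      by (simp add: fix_second_def)
    have W: "comm_group (hom_group (Vect K) ?X ?Z)"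
      using preadditive_category.hom_comm_group[OF preadditive_category_Vect] vsB[OF x x] vsB[OF y x] by simp
    have m: "(\<lambda>f. farr B' (x, x) (y, x) (f, Id A x)) \<in> P.maps"
      using Bcl[OF x x y x _ A.Id_closed[OF x]] by (simp add: Lin_simps(1) del: Vect_simps)
    have "P.deg (Suc d) (\<lambda>f. farr B' (x, x) (y, x) (f, Id A x))"
      using d P.polynomial_map_iff_deg[OF W _ _ _ m, of d] by (simp add: Lin_simps Lin_def hom_group_def del: Vect_simps)
    then have "degree_less ?G (Lin K ?X ?Y) (Suc d)
        (\<lambda>f. Comp (Vect K) ?X ?Z ?Y (farr B' (y, x) (y, y) (Id A y, g)) (farr B' (x, x) (y, x) (f, Id A x)))"
      by (rule P.deg_linear[OF vectorspace_Lin[OF vsB[OF x x] vsB[OF y y]]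
            Lin_postcomp[OF vsB[OF x x] vsB[OF y x] vsB[OF y y] Bcl[OF y x y y A.Id_closed[OF y] g]] m])
    moreover have "Comp (Vect K) ?X ?Z ?Y (farr B' (y, x) (y, y) (Id A y, g)) (farr B' (x, x) (y, x) (f, Id A x))
        = farr B' (x, x) (y, y) (f, g)" if f: "f \<in> Hom A x y" for f
      using Bcomp[OF x x y x y y f A.Id_closed[OF x] A.Id_closed[OF y] g]
        A.Comp_Id_left[OF x y f] A.Comp_Id_right[OF x y g] by (simp del: Vect_simps)
    ultimately have "degree_less ?G (Lin K ?X ?Y) (Suc d) (\<lambda>f. farr B' (x, x) (y, y) (f, g))"
      by (subst degree_less_cong[OF G.is_group, where q' = "\<lambda>f. Comp (Vect K) ?X ?Z ?Y
        (farr B' (y, x) (y, y) (Id A y, g)) (farr B' (x, x) (y, x) (f, Id A x))"]) (simp_all del: Vect_simps)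
    then show ?thesis by (rule exI)
  qed
  have "antipolynomial_functor K A (fix_first A B' x)" using B' x by (simp add: bifunctor_decomposition_def)
  then obtain H N where H: "subgroup H ?G" "nat_in K N \<noteq> \<zero>\<^bsub>K\<^esub>" "\<And>g. g \<in> Hom A x y \<Longrightarrow> g [^]\<^bsub>?G\<^esub> (N::nat) \<in> H"
    "\<And>g h. \<lbrakk>g \<in> Hom A x y; h \<in> H\<rbrakk> \<Longrightarrow> farr (fix_first A B' x) x y (hom_add A x y g h) = farr (fix_first A B' x) x y g"
    using antipolynomial_periodic[OF alg.field_axioms A.additive_category_axioms _ x y, of "fix_first A B' x"] by metis
  have per: "farr B' (x, x) (y, y) (f, hom_add A x y g h) = farr B' (x, x) (y, y) (f, g)"
    if f: "f \<in> Hom A x y" and g: "g \<in> Hom A x y" and h: "h \<in> H" for f g h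
  proof -
    have hH: "h \<in> Hom A x y" using subgroup.mem_carrier[OF H(1) h] by simp
    have eq: "farr B' (x, x) (y, y) (f, k) = Comp (Vect K) ?X (fobj B' (x, y)) ?Y
        (farr B' (x, y) (y, y) (f, Id A y)) (farr (fix_first A B' x) x y k)" if k: "k \<in> Hom A x y" for k
      using Bcomp[OF x x x y y y A.Id_closed[OF x] k f A.Id_closed[OF y]]
        A.Comp_Id_left[OF x y k] A.Comp_Id_right[OF x y f] by (simp add: fix_first_def del: Vect_simps)
    show ?thesis using eq[OF g] eq[of "hom_add A x y g h"] H(4)[OF g h] g hH x y by (simp del: Vect_simps)
  qed
  show ?thesis
    by (rule poly_periodicI[OF _ _ H(1-2)]) (use polyd per H(3) Bcl x y in \<open>simp_all add: Lin_simps(1) del: Vect_simps\<close>)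
qed

context
  fixes \<eta> \<theta> :: "'o \<Rightarrow> 'v \<Rightarrow> 'v"
  assumes \<eta>: "natural_transformation A (Vect K) F (comp_functor B' diagonal_functor) \<eta>"
    and \<theta>: "natural_transformation A (Vect K) (comp_functor B' diagonal_functor) F \<theta>"
    and inv: "\<forall>x\<in>Obj A.
      Comp (Vect K) (fobj F x) (fobj (comp_functor B' diagonal_functor) x) (fobj F x) (\<theta> x) (\<eta> x) = Id (Vect K) (fobj F x) \<and>
      Comp (Vect K) (fobj (comp_functor B' diagonal_functor) x) (fobj F x) (fobj (comp_functor B' diagonal_functor) x) (\<eta> x) (\<theta> x)
        = Id (Vect K) (fobj (comp_functor B' diagonal_functor) x)"
begin

lemma diag_simps: "fobj (comp_functor B' diagonal_functor) x = fobj B' (x, x)"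
  "farr (comp_functor B' diagonal_functor) x y f = farr B' (x, x) (y, y) (f, f)"
  by (simp_all add: comp_functor_def diagonal_functor_def)

lemma \<eta>_hom: "x \<in> Obj A \<Longrightarrow> \<eta> x \<in> Hom (Vect K) (fobj F x) (fobj B' (x, x))"
  and \<theta>_hom: "x \<in> Obj A \<Longrightarrow> \<theta> x \<in> Hom (Vect K) (fobj B' (x, x)) (fobj F x)"
  using \<eta> \<theta> by (simp_all add: natural_transformation_def diag_simps del: Vect_simps)

lemma \<eta>_in: "\<lbrakk>x \<in> Obj A; v \<in> carrier (fobj F x)\<rbrakk> \<Longrightarrow> \<eta> x v \<in> carrier (fobj B' (x, x))"
  by (rule module_hom_closed[OF \<eta>_hom])

lemma \<theta>_in: "\<lbrakk>x \<in> Obj A; u \<in> carrier (fobj B' (x, x))\<rbrakk> \<Longrightarrow> \<theta> x u \<in> carrier (fobj F x)"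
  by (rule module_hom_closed[OF \<theta>_hom])

lemma \<theta>_\<eta>: assumes "x \<in> Obj A" "v \<in> carrier (fobj F x)" shows "\<theta> x (\<eta> x v) = v"
  using fun_cong[OF conjunct1[OF bspec[OF inv assms(1)]], of v] assms(2) by (simp add: compose_def)

lemma \<eta>_\<theta>: assumes "x \<in> Obj A" "u \<in> carrier (fobj B' (x, x))" shows "\<eta> x (\<theta> x u) = u"
  using fun_cong[OF conjunct2[OF bspec[OF inv assms(1)]], of u] assms(2) by (simp add: compose_def diag_simps)

lemma \<eta>_natural:
  assumes "x \<in> Obj A" "y \<in> Obj A" "f \<in> Hom A x y" "v \<in> carrier (fobj F x)"
  shows "farr B' (x, x) (y, y) (f, f) (\<eta> x v) = \<eta> y (farr F x y f v)"
proof -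
  have "Comp (Vect K) (fobj F x) (fobj F y) (fobj B' (y, y)) (\<eta> y) (farr F x y f)
      = Comp (Vect K) (fobj F x) (fobj B' (x, x)) (fobj B' (y, y)) (farr B' (x, x) (y, y) (f, f)) (\<eta> x)"
    using \<eta> assms(1-3) by (simp add: natural_transformation_def diag_simps del: Vect_simps)
  from fun_cong[OF this, of v] show ?thesis using assms(4) by (simp add: compose_def)
qed

text \<open>Transported to \<open>F\<close>, the values of \<open>B'\<close> on the pairs \<open>(f, g)\<close> between diagonal objects
  extend the values of \<open>F\<close>, so they are determined by \<open>F\<close>.\<close>

lemma ext_eq:
  assumes x: "x \<in> Obj A" and y: "y \<in> Obj A" and fg: "f \<in> Hom A x y" "g \<in> Hom A x y"
    and v: "v \<in> carrier (fobj F x)"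
  shows "\<theta> y (farr B' (x, x) (y, y) (f, g) (\<eta> x v)) = ext x y f g v"
proof -
  let ?L = "\<lambda>\<phi>. Comp (Vect K) (fobj F x) (fobj B' (y, y)) (fobj F y) (\<theta> y)
    (Comp (Vect K) (fobj F x) (fobj B' (x, x)) (fobj B' (y, y)) \<phi> (\<eta> x))"
  have vsB: "vectorspace K (fobj B' (x, x))" "vectorspace K (fobj B' (y, y))" using x y by (auto intro: B'.vs)
  interpret P: poly_maps "hom_group A x y" K "Lin K (fobj B' (x, x)) (fobj B' (y, y))"
    by (rule poly_maps_Hom[OF x y vectorspace_Lin[OF vsB]])
  have w: "poly_periodic K (hom_group A x y) (LinF x y) (\<lambda>f g. ?L (farr B' (x, x) (y, y) (f, g)))"
  proof (rule P.poly_periodic_linear[where r = "\<lambda>f g. farr B' (x, x) (y, y) (f, g)" and L = ?L])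
    show "?L \<in> module_hom K (Lin K (fobj B' (x, x)) (fobj B' (y, y))) (LinF x y)"
      by (rule module_hom_comp[OF Lin_precomp Lin_postcomp]) (intro vs vsB x y \<eta>_hom \<theta>_hom)+
  qed (use x y in \<open>auto intro: vs_LinF poly_periodic_B'\<close>)
  have "?L (farr B' (x, x) (y, y) (h, h)) = farr F x y h" if h: "h \<in> Hom A x y" for h
  proof (rule extensionalityI[of _ "carrier (fobj F x)"])
    show "farr F x y h \<in> extensional (carrier (fobj F x))" using F.farr_closed[OF x y h] by simp
    fix v assume v: "v \<in> carrier (fobj F x)"
    then show "?L (farr B' (x, x) (y, y) (h, h)) v = farr F x y h v"
      using \<eta>_natural[OF x y h v] \<theta>_\<eta>[OF y arr_closed[OF x y h v]] by (simp add: compose_def)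
  qed (simp add: compose_def)
  from ext_unique[OF x y w this fg]
  have "?L (farr B' (x, x) (y, y) (f, g)) = ext x y f g" .
  from fun_cong[OF this, of v] show ?thesis using v by (simp add: compose_def)
qed

lemma ext_\<theta>:
  assumes "x \<in> Obj A" "y \<in> Obj A" "f \<in> Hom A x y" "g \<in> Hom A x y" "u \<in> carrier (fobj B' (x, x))"
  shows "ext x y f g (\<theta> x u) = \<theta> y (farr B' (x, x) (y, y) (f, g) u)"
  using ext_eq[OF assms(1-4) \<theta>_in[OF assms(1,5)]] \<eta>_\<theta>[OF assms(1,5)] by simp

abbreviation dg where "dg a \<equiv> (s a, s a)"

text \<open>The value \<open>B' a\<close> is a direct summand of \<open>B' (dg a)\<close>, which \<open>\<theta>\<close> identifies with \<open>F (s a)\<close>.\<close>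

definition \<Phi> where "\<Phi> a = (\<lambda>v\<in>carrier (fobj B' a). \<theta> (s a) (farr B' a (dg a) (i a, j a) v))"
definition \<Psi> where "\<Psi> a = (\<lambda>w\<in>B_carrier a. farr B' (dg a) a (p a, q a) (\<eta> (s a) w))"

lemma
  assumes a: "a \<in> Obj PP"
  shows \<Phi>_B_carrier: "v \<in> carrier (fobj B' a) \<Longrightarrow> \<Phi> a v \<in> B_carrier a"
    and \<Phi>_hom: "\<Phi> a \<in> Hom (Vect K) (fobj B' a) (fobj B a)"
    and \<Psi>_in: "w \<in> B_carrier a \<Longrightarrow> \<Psi> a w \<in> carrier (fobj B' a)"
    and \<Psi>_hom: "\<Psi> a \<in> Hom (Vect K) (fobj B a) (fobj B' a)"
    and \<Psi>_\<Phi>: "v \<in> carrier (fobj B' a) \<Longrightarrow> \<Psi> a (\<Phi> a v) = v"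
    and \<Phi>_\<Psi>: "w \<in> B_carrier a \<Longrightarrow> \<Phi> a (\<Psi> a w) = w"
proof -
  note [simp] = A.Comp_closed
  have aO [simp]: "a \<in> Obj A \<times> Obj A" using a by simp
  have sO [simp]: "s a \<in> Obj A" "dg a \<in> Obj A \<times> Obj A" by simp_all
  have ij: "(i a, j a) \<in> Hom PP a (dg a)" "(p a, q a) \<in> Hom PP (dg a) a" by simp_all
  have O: "a \<in> Obj PP" "dg a \<in> Obj PP" by simp_all
  have iL: "Comp A (fst a) (s a) (s a) (Comp A (s a) (fst a) (s a) (i a) (p a)) (i a) = i a"
    by (rule A.retract_cancel_right) (simp_all add: p_i)
  have jL: "Comp A (snd a) (s a) (s a) (Comp A (s a) (snd a) (s a) (j a) (q a)) (j a) = j a"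
    by (rule A.retract_cancel_right) (simp_all add: q_j)
  have inc: "farr B' a (dg a) (i a, j a) v \<in> carrier (fobj B' (dg a))" if "v \<in> carrier (fobj B' a)" for v
    by (rule B'.arr_closed[OF O(1,2) ij(1) that])
  show B1: "\<Phi> a v \<in> B_carrier a" if v: "v \<in> carrier (fobj B' a)" for v
  proof -
    have 1: "\<Phi> a v \<in> carrier (fobj F (s a))" using \<theta>_in[OF sO(1) inc[OF v]] v by (simp add: \<Phi>_def)
    have "pr a (\<Phi> a v) = \<theta> (s a) (farr B' (dg a) (dg a)
        (Comp A (s a) (fst a) (s a) (i a) (p a), Comp A (s a) (snd a) (s a) (j a) (q a)) (farr B' a (dg a) (i a, j a) v))"
      unfolding pr_def'[OF a] using ext_\<theta>[OF sO(1) sO(1) _ _ inc[OF v]] v by (simp add: \<Phi>_def)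
    also have "\<dots> = \<Phi> a v"
      using v by (subst arr_pair_comp) (simp_all add: iL jL \<Phi>_def)
    finally show ?thesis using 1 B_carrier_iff[OF a] by blast
  qed
  have Fh: "\<theta> (s a) \<in> module_hom K (fobj B' (dg a)) (fobj F (s a))" "\<eta> (s a) \<in> module_hom K (fobj F (s a)) (fobj B' (dg a))"
    using \<theta>_hom[OF sO(1)] \<eta>_hom[OF sO(1)] by simp_all
  interpret V: vectorspace K "fobj B' a" by (rule B'.vs[OF O(1)])
  have "(\<lambda>v. \<theta> (s a) (farr B' a (dg a) (i a, j a) v)) \<in> module_hom K (fobj B' a) (fobj F (s a))"
    by (rule module_hom_comp[OF B'.arr_linear[OF O(1,2) ij(1)] Fh(1)])
  then show "\<Phi> a \<in> Hom (Vect K) (fobj B' a) (fobj B a)"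
    using B1 by (auto simp: \<Phi>_def module_hom_def fobj_B simp del: prod_category_simps)
  have wc: "w \<in> carrier (fobj F (s a))" "pr a w = w" if "w \<in> B_carrier a" for w using B_carrierD[OF a that] .
  show P1: "\<Psi> a w \<in> carrier (fobj B' a)" if w: "w \<in> B_carrier a" for w
    using w B'.arr_closed[OF O(2,1) ij(2) \<eta>_in[OF sO(1) wc(1)[OF w]]] by (simp add: \<Psi>_def)
  have "(\<lambda>w. farr B' (dg a) a (p a, q a) (\<eta> (s a) w)) \<in> module_hom K (fobj F (s a)) (fobj B' a)"
    by (rule module_hom_comp[OF Fh(2) B'.arr_linear[OF O(2,1) ij(2)]])
  then show "\<Psi> a \<in> Hom (Vect K) (fobj B a) (fobj B' a)"
    using P1 wc vectorspace.subspaceD(3,4)[OF vs_s[OF a] subspace_B[OF a]]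
    by (auto simp: \<Psi>_def module_hom_def fobj_B simp del: prod_category_simps)
  show "\<Psi> a (\<Phi> a v) = v" if v: "v \<in> carrier (fobj B' a)" for v
  proof -
    have "\<Psi> a (\<Phi> a v) = farr B' (dg a) a (p a, q a) (farr B' a (dg a) (i a, j a) v)"
      using B1[OF v] v \<eta>_\<theta>[OF sO(1) inc[OF v]] by (simp add: \<Psi>_def \<Phi>_def)
    also have "\<dots> = farr B' a a (Id PP a) v"
      using v by (subst arr_pair_comp) (simp_all add: p_i q_j)
    also have "\<dots> = v" by (rule B'.arr_Id[OF O(1) v])
    finally show ?thesis .
  qed
  show "\<Phi> a (\<Psi> a w) = w" if w: "w \<in> B_carrier a" for w
  proof -
    have "\<Phi> a (\<Psi> a w) = \<theta> (s a) (farr B' a (dg a) (i a, j a) (farr B' (dg a) a (p a, q a) (\<eta> (s a) w)))"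
      using P1[OF w] w by (simp add: \<Phi>_def \<Psi>_def)
    also have "\<dots> = \<theta> (s a) (farr B' (dg a) (dg a)
        (Comp A (s a) (fst a) (s a) (i a) (p a), Comp A (s a) (snd a) (s a) (j a) (q a)) (\<eta> (s a) w))"
      using \<eta>_in[OF sO(1) wc(1)[OF w]] by (subst arr_pair_comp) simp_all
    also have "\<dots> = pr a w"
      unfolding pr_def'[OF a] using wc(1)[OF w] by (intro ext_eq) simp_all
    finally show ?thesis using wc(2)[OF w] by simp
  qed
qed

lemma \<Phi>_natural:
  assumes ab: "a \<in> Obj PP" "b \<in> Obj PP" and h: "h \<in> Hom PP a b" and v: "v \<in> carrier (fobj B' a)"
  shows "\<Phi> b (farr B' a b h v) = farr B a b h (\<Phi> a v)"
proof -
  note [simp] = A.Comp_closed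
  obtain f g where hfg: "h = (f, g)" and f [simp]: "f \<in> Hom A (fst a) (fst b)" and g [simp]: "g \<in> Hom A (snd a) (snd b)"
    using h by (cases h) auto
  have [simp]: "a \<in> Obj A \<times> Obj A" "b \<in> Obj A \<times> Obj A" using ab by simp_all
  have [simp]: "s a \<in> Obj A" "s b \<in> Obj A" "dg a \<in> Obj A \<times> Obj A" "dg b \<in> Obj A \<times> Obj A" by simp_all
  have inc: "farr B' a (dg a) (i a, j a) v \<in> carrier (fobj B' (dg a))"
    by (rule B'.arr_closed[OF _ _ _ v]) simp_all
  note L = lift_closed(1)[OF _ _ f] lift_closed(2)[OF _ _ g]
  have "farr B a b h (\<Phi> a v) = ext (s a) (s b) (lift1 a b f) (lift2 a b g) (\<theta> (s a) (farr B' a (dg a) (i a, j a) v))"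
    using \<Phi>_B_carrier[OF ab(1) v] v by (simp add: farr_B mid_def hfg \<Phi>_def)
  also have "\<dots> = \<theta> (s b) (farr B' (dg a) (dg b) (lift1 a b f, lift2 a b g) (farr B' a (dg a) (i a, j a) v))"
    using L by (intro ext_\<theta> inc) simp_all
  also have "\<dots> = \<theta> (s b) (farr B' a (dg b) (Comp A (fst a) (fst b) (s b) (i b) f, Comp A (snd a) (snd b) (s b) (j b) g) v)"
    using L v lift_inj(1)[OF _ _ f] lift_inj(2)[OF _ _ g] by (subst arr_pair_comp) simp_all
  also have "\<dots> = \<theta> (s b) (farr B' b (dg b) (i b, j b) (farr B' a b (f, g) v))"
    using v by (subst arr_pair_comp) simp_all
  also have "\<dots> = \<Phi> b (farr B' a b h v)"
    using B'.arr_closed[OF ab h v] by (simp add: \<Phi>_def hfg)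
  finally show ?thesis by simp
qed

lemma isomorphic_B'_B: "isomorphic_functors PP (Vect K) B' B"
  unfolding isomorphic_functors_def natural_transformation_def
proof (rule exI[of _ \<Phi>], rule exI[of _ \<Psi>], intro conjI ballI)
  fix a assume a: "a \<in> Obj PP"
  show "\<Phi> a \<in> Hom (Vect K) (fobj B' a) (fobj B a)" by (rule \<Phi>_hom[OF a])
  show "\<Psi> a \<in> Hom (Vect K) (fobj B a) (fobj B' a)" by (rule \<Psi>_hom[OF a])
  show "Comp (Vect K) (fobj B' a) (fobj B a) (fobj B' a) (\<Psi> a) (\<Phi> a) = Id (Vect K) (fobj B' a)"
    using \<Psi>_\<Phi>[OF a] by (auto simp: compose_def fun_eq_iff)
  show "Comp (Vect K) (fobj B a) (fobj B' a) (fobj B a) (\<Phi> a) (\<Psi> a) = Id (Vect K) (fobj B a)"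
    using \<Phi>_\<Psi>[OF a] by (auto simp: compose_def fun_eq_iff fobj_B)
next
  fix a b h assume *: "a \<in> Obj PP" "b \<in> Obj PP" "h \<in> Hom PP a b"
  show "Comp (Vect K) (fobj B' a) (fobj B' b) (fobj B b) (\<Phi> b) (farr B' a b h)
      = Comp (Vect K) (fobj B' a) (fobj B a) (fobj B b) (farr B a b h) (\<Phi> a)"
    using \<Phi>_natural[OF *] by (auto simp: compose_def fun_eq_iff)
  have "\<Psi> b (farr B a b h w) = farr B' a b h (\<Psi> a w)" if w: "w \<in> B_carrier a" for w
  proof -
    have "\<Phi> b (farr B' a b h (\<Psi> a w)) = farr B a b h w"
      using \<Phi>_natural[OF * \<Psi>_in[OF *(1) w]] \<Phi>_\<Psi>[OF *(1) w] by simp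
    then show ?thesis using \<Psi>_\<Phi>[OF *(2) B'.arr_closed[OF * \<Psi>_in[OF *(1) w]]] by simp
  qed
  then show "Comp (Vect K) (fobj B a) (fobj B b) (fobj B' b) (\<Psi> b) (farr B a b h)
      = Comp (Vect K) (fobj B a) (fobj B' a) (fobj B' b) (farr B' a b h) (\<Psi> a)"
    by (auto simp: compose_def fun_eq_iff fobj_B)
qed

end

lemma unique_B: "isomorphic_functors PP (Vect K) B' B"
proof -
  have "isomorphic_functors A (Vect K) F (comp_functor B' diagonal_functor)"
    using B' by (simp add: bifunctor_decomposition_def)
  then obtain \<eta> \<theta> where "natural_transformation A (Vect K) F (comp_functor B' diagonal_functor) \<eta>"
    "natural_transformation A (Vect K) (comp_functor B' diagonal_functor) F \<theta>"
    "\<forall>x\<in>Obj A.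
      Comp (Vect K) (fobj F x) (fobj (comp_functor B' diagonal_functor) x) (fobj F x) (\<theta> x) (\<eta> x) = Id (Vect K) (fobj F x) \<and>
      Comp (Vect K) (fobj (comp_functor B' diagonal_functor) x) (fobj F x) (fobj (comp_functor B' diagonal_functor) x) (\<eta> x) (\<theta> x)
        = Id (Vect K) (fobj (comp_functor B' diagonal_functor) x)"
    unfolding isomorphic_functors_def by (elim exE conjE)
  then show ?thesis by (rule isomorphic_B'_B)
qed

end

end

theorem mainTheorem1:
  fixes A :: "('o, 'm) preadditive_data"
    and K :: "'k ring"
    and F :: "('o, 'm, 'k, 'v) vfunctor"
  assumes "additive_category A"
    and "algebraically_closed K"
    and "df_functor K A F"
    and "finite_length K A F"
  shows "\<exists>B :: ('o \<times> 'o, 'm \<times> 'm, 'k, 'v) vfunctor.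
    bifunctor_decomposition K A F B \<and>
    (\<forall>B'. bifunctor_decomposition K A F B' \<longrightarrow>
      isomorphic_functors (prod_category A A) (Vect K) B' B)"
proof -
  interpret A: additive_category A by fact
  have K: "field K" using assms(2) by (rule algebraically_closed.axioms(1))
  have F: "functor_between A (Vect K) F" and fd: "\<And>x. x \<in> Obj A \<Longrightarrow> vectorspace.fin_dim K (fobj F x)"
    using assms(3) by (simp_all add: df_functor_def)
  interpret F: additive_vect_functor A K F
    by (intro additive_vect_functor.intro vect_functor.intro vect_functor_axioms.intro additive_vect_functor_axioms.intro
        assms(1,2) A.category_axioms K F fd)
  have "\<forall>a. \<exists>t. a \<in> Obj A \<times> Obj A \<longrightarrow> biproduct A (fst a) (snd a) (fst t)
      (fst (snd t)) (fst (snd (snd t))) (fst (snd (snd (snd t)))) (snd (snd (snd (snd t))))"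
    using A.ex_biproduct by (auto simp: split_paired_Ex)
  then obtain t where t: "\<And>a. a \<in> Obj A \<times> Obj A \<Longrightarrow> biproduct A (fst a) (snd a) (fst (t a))
      (fst (snd (t a))) (fst (snd (snd (t a)))) (fst (snd (snd (snd (t a))))) (snd (snd (snd (snd (t a)))))"
    by metis
  show ?thesis
  proof (rule F.ex_separating_object[OF assms(4)])
    fix z assume z: "z \<in> Obj A" and detect: "\<And>x y \<phi> \<psi>. \<lbrakk>x \<in> Obj A; y \<in> Obj A;
      \<phi> \<in> Hom (Vect K) (fobj F x) (fobj F y); \<psi> \<in> Hom (Vect K) (fobj F x) (fobj F y);
      \<And>a b v. \<lbrakk>a \<in> Hom A y z; b \<in> Hom A z x; v \<in> carrier (fobj F z)\<rbrakk>
        \<Longrightarrow> farr F y z a (\<phi> (farr F z x b v)) = farr F y z a (\<psi> (farr F z x b v))\<rbrakk> \<Longrightarrow> \<phi> = \<psi>"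
    have D: "detected_functor A K F z"
      by (intro detected_functor.intro F.additive_vect_functor_axioms detected_functor_axioms.intro z) (rule detect)
    interpret S: split_functor A K F z "\<lambda>a. fst (t a)" "\<lambda>a. fst (snd (t a))" "\<lambda>a. fst (snd (snd (t a)))"
      "\<lambda>a. fst (snd (snd (snd (t a))))" "\<lambda>a. snd (snd (snd (snd (t a))))"
      by (intro split_functor.intro D split_functor_axioms.intro t)
    show ?thesis using S.decomposition_B S.unique_B by blast
  qed
qed

end
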